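(* Consider the dynamics on $\mathbb{R}^{2d}$ $$\mathrm{d}q_t=M^{-1}p_t\,\mathrm{d}t-\mu J_1\nabla V(q_t)\,\mathrm{d}t,$$ $$\mathrm{d}p_t=-\nabla V(q_t)\,\mathrm{d}t-\mu J_2M^{-1}p_t\,\mathrm{d}t-\Gamma M^{-1}p_t\,\mathrm{d}t+\sqrt{2\Gamma}\,\mathrm{d}W_t,$$ with $V(q)=\frac12q\cdot Sq$, $M=S$, $\Gamma=\gamma S$ with $\gamma>\sqrt2$, and $SJ_1S=J_2$. Let $\Pi$ denote the orthogonal projection in $L^2(\pi)$ onto $\ker(J_1Sq\cdot\nabla)$. Then for every $f\in L^2(\pi)$ $$\lim_{\mu\to\infty}\sigma_f^2(\mu)=\sigma_{\Pi f}^2(0)\le\sigma_f^2(0).$$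
   Context: $S\in\mathbb{R}^{d\times d}$ is symmetric positive definite, $J_1,J_2\in\mathbb{R}^{d\times d}$ are skew-symmetric, $\mu\in\mathbb{R}$, $W$ is a standard $d$-dimensional Brownian motion. The dynamics is ergodic with invariant measure $\widehat\pi=\pi\otimes\mathcal{N}(0,M)$, where $\pi=\mathcal{N}(0,S^{-1})$. Let $\mathcal{L}$ be the generator of its Markov semigroup on $L^2(\widehat\pi)$. For $f\in L^2(\pi)$, regarded as a function of $(q,p)$ depending on $q$ only, the asymptotic variance is $\sigma_f^2(\mu)=\langle\chi,f-\pi(f)\rangle_{L^2(\widehat\pi)}$, where $\chi\in\mathcal{D}(\mathcal{L})$ is the unique solution of $-\mathcal{L}\chi=f-\pi(f)$, $\widehat\pi(\chi)=0$. The operator $J_1Sq\cdot\nabla$ (first-order operator $\phi\mapsto(J_1Sq)\cdot\nabla\phi(q)$) is understood as the smallest closed extension in $L^2(\pi)$ of its action on $C_c^\infty(\mathbb{R}^d)$. *)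

theory Defs
  imports "HOL-Probability.Probability"
begin

definition skew_symmetric :: "real^'n^'n \<Rightarrow> bool" where
  "skew_symmetric A \<longleftrightarrow> transpose A = - A"

definition sym_pos_def :: "real^'n^'n \<Rightarrow> bool" where
  "sym_pos_def A \<longleftrightarrow> transpose A = A \<and> (\<forall>x. x \<noteq> 0 \<longrightarrow> x \<bullet> (A *v x) > 0)"

definition sym_pos_semidef :: "real^'n^'n \<Rightarrow> bool" where
  "sym_pos_semidef A \<longleftrightarrow> transpose A = A \<and> (\<forall>x. x \<bullet> (A *v x) \<ge> 0)"

text \<open>The principal square root; meaningful for symmetric positive semidefinite arguments.\<close>

definition matrix_sqrt :: "real^'n^'n \<Rightarrow> real^'n^'n" where
  "matrix_sqrt A = (THE R. sym_pos_semidef R \<and> R ** R = A)"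

text \<open>The centred nondegenerate Gaussian with covariance matrix \<open>C\<close>.\<close>

definition gaussian_measure :: "real^'n^'n \<Rightarrow> (real^'n) measure" where
  "gaussian_measure C = density lborel (\<lambda>x.
     ennreal (exp (- (x \<bullet> (matrix_inv C *v x)) / 2) / sqrt ((2 * pi) ^ CARD('n) * det C)))"

text \<open>Elements of \<open>L\<^sup>2\<close> are represented by functions; equality is meant
  up to null sets.\<close>

definition L2 :: "'a measure \<Rightarrow> ('a \<Rightarrow> real) set" where
  "L2 m = {f \<in> borel_measurable m. integrable m (\<lambda>x. (f x)\<^sup>2)}"

definition L2_inner :: "'a measure \<Rightarrow> ('a \<Rightarrow> real) \<Rightarrow> ('a \<Rightarrow> real) \<Rightarrow> real" where
  "L2_inner m f g = (\<integral>x. f x * g x \<partial>m)"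

definition L2_norm :: "'a measure \<Rightarrow> ('a \<Rightarrow> real) \<Rightarrow> real" where
  "L2_norm m f = sqrt (L2_inner m f f)"

definition L2_tendsto ::
  "'a measure \<Rightarrow> ('b \<Rightarrow> 'a \<Rightarrow> real) \<Rightarrow> ('a \<Rightarrow> real) \<Rightarrow> 'b filter \<Rightarrow> bool" where
  "L2_tendsto m u g F \<longleftrightarrow>
     g \<in> L2 m \<and> (\<forall>\<^sub>F n in F. u n \<in> L2 m) \<and> ((\<lambda>n. L2_norm m (\<lambda>x. u n x - g x)) \<longlongrightarrow> 0) F"

text \<open>Orthogonal projection onto a closed subspace \<open>K\<close>; the result is a representative, unique
  up to null sets.\<close>

definition L2_projection :: "'a measure \<Rightarrow> ('a \<Rightarrow> real) set \<Rightarrow> ('a \<Rightarrow> real) \<Rightarrow> 'a \<Rightarrow> real" where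
  "L2_projection m K f = (SOME g. g \<in> K \<and> (\<forall>h\<in>K. L2_inner m (\<lambda>x. f x - g x) h = 0))"

definition grad :: "('a::real_inner \<Rightarrow> real) \<Rightarrow> 'a \<Rightarrow> 'a" where
  "grad f x = (THE D. GDERIV f x :> D)"

fun Ck :: "nat \<Rightarrow> (real^'n \<Rightarrow> real) \<Rightarrow> bool" where
  "Ck 0 f \<longleftrightarrow> continuous_on UNIV f"
| "Ck (Suc k) f \<longleftrightarrow> (\<forall>x. f differentiable (at x)) \<and> (\<forall>i. Ck k (\<lambda>x. grad f x $ i))"

definition Cc_infinity :: "(real^'n \<Rightarrow> real) set" where
  "Cc_infinity = {f. (\<forall>k. Ck k f) \<and> compact (closure {x. f x \<noteq> 0})}"

text \<open>For an operator \<open>A\<close> that is closable on \<open>C\<^sub>c\<^sup>\<infinity>\<close>, the graph of its smallest closed extension in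
  \<open>L\<^sup>2(m)\<close> is the closure of its graph: \<open>closure_maps m A f g\<close> says that \<open>f\<close> is in the domain of
  this extension and is mapped to \<open>g\<close>.\<close>

definition closure_maps ::
  "(real^'n) measure \<Rightarrow> ((real^'n \<Rightarrow> real) \<Rightarrow> real^'n \<Rightarrow> real) \<Rightarrow>
     (real^'n \<Rightarrow> real) \<Rightarrow> (real^'n \<Rightarrow> real) \<Rightarrow> bool" where
  "closure_maps m A f g \<longleftrightarrow> (\<exists>u :: nat \<Rightarrow> real^'n \<Rightarrow> real.
     (\<forall>n. u n \<in> Cc_infinity) \<and>
     L2_tendsto m u f sequentially \<and> L2_tendsto m (\<lambda>n. A (u n)) g sequentially)"

definition closure_kernel ::
  "(real^'n) measure \<Rightarrow> ((real^'n \<Rightarrow> real) \<Rightarrow> real^'n \<Rightarrow> real) \<Rightarrow> (real^'n \<Rightarrow> real) set" where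
  "closure_kernel m A = {f. closure_maps m A f (\<lambda>x. 0)}"

definition first_order_op ::
  "(real^'n \<Rightarrow> real^'n) \<Rightarrow> (real^'n \<Rightarrow> real) \<Rightarrow> real^'n \<Rightarrow> real" where
  "first_order_op b \<phi> = (\<lambda>q. b q \<bullet> grad \<phi> q)"

definition standard_brownian_motion ::
  "'w measure \<Rightarrow> (real \<Rightarrow> 'w \<Rightarrow> real^'n) \<Rightarrow> bool" where
  "standard_brownian_motion P W \<longleftrightarrow>
     prob_space P \<and>
     (\<forall>t\<ge>0. W t \<in> borel_measurable P) \<and>
     (AE \<omega> in P. W 0 \<omega> = 0 \<and> continuous_on {0..} (\<lambda>t. W t \<omega>)) \<and>
     (\<forall>s t. 0 \<le> s \<and> s < t \<longrightarrow>
        distr P borel (\<lambda>\<omega>. W t \<omega> - W s \<omega>) = gaussian_measure ((t - s) *\<^sub>R mat 1)) \<and>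
     (\<forall>(n::nat) \<tau>. 0 \<le> \<tau> 0 \<and> (\<forall>i<n. \<tau> i < \<tau> (Suc i)) \<longrightarrow>
        prob_space.indep_vars P (\<lambda>_. borel) (\<lambda>i \<omega>. W (\<tau> (Suc i)) \<omega> - W (\<tau> i) \<omega>) {..<n})"

text \<open>\<open>X\<close> solves \<open>dX = b(X) dt + \<sigma> dW\<close>, \<open>X\<^sub>0 = x\<close>. As the noise is additive, the stochastic
  integral is just \<open>\<sigma> W\<^sub>t\<close> and the equation can be read pathwise; for Lipschitz \<open>b\<close> it determines
  \<open>X\<close> up to indistinguishability, so that adaptedness need not be required.\<close>

definition additive_sde_solution ::
  "'w measure \<Rightarrow> (real \<Rightarrow> 'w \<Rightarrow> 'b) \<Rightarrow> ('a::euclidean_space \<Rightarrow> 'a) \<Rightarrow> ('b \<Rightarrow> 'a) \<Rightarrow> 'a \<Rightarrow>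
     (real \<Rightarrow> 'w \<Rightarrow> 'a) \<Rightarrow> bool" where
  "additive_sde_solution P W b \<sigma> x X \<longleftrightarrow>
     (\<forall>t\<ge>0. X t \<in> borel_measurable P) \<and>
     (AE \<omega> in P. continuous_on {0..} (\<lambda>t. X t \<omega>) \<and>
        (\<forall>t\<ge>0. X t \<omega> = x + integral {0..t} (\<lambda>s. b (X s \<omega>)) + \<sigma> (W t \<omega>)))"

definition langevin_drift ::
  "real^'d^'d \<Rightarrow> real^'d^'d \<Rightarrow> real^'d^'d \<Rightarrow> real^'d^'d \<Rightarrow> (real^'d \<Rightarrow> real) \<Rightarrow> real \<Rightarrow>
     (real^'d) \<times> (real^'d) \<Rightarrow> (real^'d) \<times> (real^'d)" where
  "langevin_drift M \<Gamma> J\<^sub>1 J\<^sub>2 V \<mu> = (\<lambda>(q, p).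
     (matrix_inv M *v p - \<mu> *\<^sub>R (J\<^sub>1 *v grad V q),
      - grad V q - \<mu> *\<^sub>R (J\<^sub>2 *v (matrix_inv M *v p)) - \<Gamma> *v (matrix_inv M *v p)))"

definition langevin_noise ::
  "real^'d^'d \<Rightarrow> real^'d \<Rightarrow> (real^'d) \<times> (real^'d)" where
  "langevin_noise \<Gamma> w = (0, matrix_sqrt (2 *\<^sub>R \<Gamma>) *v w)"

text \<open>Here \<open>X x\<close> is the process started in \<open>x\<close>.\<close>

definition markov_semigroup ::
  "'w measure \<Rightarrow> ('a \<Rightarrow> real \<Rightarrow> 'w \<Rightarrow> 'a) \<Rightarrow> real \<Rightarrow> ('a \<Rightarrow> real) \<Rightarrow> 'a \<Rightarrow> real" where
  "markov_semigroup P X t \<phi> x = (\<integral>\<omega>. \<phi> (X x t \<omega>) \<partial>P)"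

text \<open>\<open>generator_maps m T \<phi> \<psi>\<close>: \<open>\<phi>\<close> is in the domain of the \<open>L\<^sup>2(m)\<close>-generator \<open>L\<close> of the semigroup
  \<open>T\<close>, and \<open>L \<phi> = \<psi>\<close>.\<close>

definition generator_maps ::
  "'a measure \<Rightarrow> (real \<Rightarrow> ('a \<Rightarrow> real) \<Rightarrow> 'a \<Rightarrow> real) \<Rightarrow> ('a \<Rightarrow> real) \<Rightarrow> ('a \<Rightarrow> real) \<Rightarrow> bool" where
  "generator_maps m T \<phi> \<psi> \<longleftrightarrow>
     \<phi> \<in> L2 m \<and> L2_tendsto m (\<lambda>t x. (T t \<phi> x - \<phi> x) / t) \<psi> (at_right 0)"

definition centred :: "'a measure \<Rightarrow> ('a \<Rightarrow> real) \<Rightarrow> 'a \<Rightarrow> real" where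
  "centred m f = (\<lambda>x. f x - (\<integral>y. f y \<partial>m))"

text \<open>\<open>u\<close> solves the Poisson equation \<open>-L u = f - \<pi>(f)\<close> with mean zero, for an observable \<open>f\<close> of
  the position only, where the phase space carries \<open>\<pi> \<otimes> \<kappa>\<close>.\<close>

definition poisson_solution ::
  "'q measure \<Rightarrow> 'p measure \<Rightarrow> (real \<Rightarrow> ('q \<times> 'p \<Rightarrow> real) \<Rightarrow> 'q \<times> 'p \<Rightarrow> real) \<Rightarrow>
     ('q \<Rightarrow> real) \<Rightarrow> ('q \<times> 'p \<Rightarrow> real) \<Rightarrow> bool" where
  "poisson_solution \<pi> \<kappa> T f u \<longleftrightarrow>
     generator_maps (\<pi> \<Otimes>\<^sub>M \<kappa>) T u (\<lambda>(q, p). - centred \<pi> f q) \<and>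
     (\<integral>z. u z \<partial>(\<pi> \<Otimes>\<^sub>M \<kappa>)) = 0"

text \<open>The solution of the Poisson equation is unique up to null sets only, hence the description of
  the value rather than of \<open>u\<close>.\<close>

definition asymptotic_variance ::
  "'q measure \<Rightarrow> 'p measure \<Rightarrow> (real \<Rightarrow> ('q \<times> 'p \<Rightarrow> real) \<Rightarrow> 'q \<times> 'p \<Rightarrow> real) \<Rightarrow>
     ('q \<Rightarrow> real) \<Rightarrow> real" where
  "asymptotic_variance \<pi> \<kappa> T f = (THE v. \<exists>u. poisson_solution \<pi> \<kappa> T f u \<and>
     v = L2_inner (\<pi> \<Otimes>\<^sub>M \<kappa>) u (\<lambda>(q, p). centred \<pi> f q))"

end

theory Submission
  imports Defs "HOL-Computational_Algebra.Polynomial"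
begin

text \<open>
  Let \<open>Q = S\<^sup>1\<^sup>/\<^sup>2\<close> and \<open>A = Q J\<^sub>1 Q\<close>, a skew matrix. In the coordinates \<open>(Q q, Q\<^sup>-\<^sup>1 p)\<close> the invariant
  measure is the standard Gaussian and the drift becomes \<open>B + \<mu> C\<close> with \<open>B (q, p) = (p, - q - \<gamma> p)\<close> and
  \<open>C = - (A, A)\<close>. Since \<open>B\<close> and \<open>C\<close> commute and \<open>C\<close> is skew, the Markov semigroup factorises as
  \<open>U (\<mu> t) \<circ> T t\<close>, where \<open>U\<close> is the unitary group of composition with the rotations \<open>exp (s C)\<close> and \<open>T\<close> is
  the Ornstein--Uhlenbeck semigroup for \<open>\<mu> = 0\<close>. The latter is given by Mehler's formula and is a strict
  contraction on mean-zero functions after a fixed time, so that the Poisson equation has a solution operator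
  \<open>R \<mu>\<close> bounded uniformly in \<open>\<mu>\<close>. By von Neumann's decomposition \<open>f = y + z\<close> with \<open>y = \<Pi> f\<close> fixed by \<open>U\<close> and
  \<open>z\<close> in the closed span of the coboundaries \<open>U s w - w\<close>. On fixed vectors \<open>R \<mu> = R 0\<close>, on coboundaries
  \<open>R \<mu>\<close> tends to \<open>0\<close>, and the mixed terms vanish; the inequality is \<open>\<langle>R 0 z, z\<rangle> \<ge> 0\<close>.
  Mehler operators are compared on the functions \<open>cos (\<xi> \<bullet> x)\<close> and \<open>sin (\<xi> \<bullet> x)\<close>, which are total in
  \<open>L\<^sup>2\<close> and are mapped to multiples of functions of the same kind.
\<close>

subsection \<open>Linear flows\<close>

text \<open>The hypothesis \<open>SJS\<close> is what makes both blocks of the twist equal to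
  \<open>- A\<close>: scaling positions by \<open>Q\<close> and momenta by its inverse sends the two
  skew drifts to the same matrix, hence the commutation. An orthogonal twist leaves the noise
  covariance alone, so one family of noise laws serves every \<mu>. The process is given only as
  some solution of the equation; additive noise lets its one-time law be computed pathwise by parts,
  without stochastic integrals. The noise acts on momenta only, so the dissipation is degenerate;
  strict contraction is obtained at a late time, when the Hilbert--Schmidt norm of the flow is below
  one. There the Gram matrices of trigonometric functions replace a Hermite expansion: their entries
  are weighted power series in the inner products of frequencies, and the constant term of the
  series is the contribution of the mean. The kernel of the first-order operator is matched with the
  fixed vectors of the rotation group by averaging along orbits, so no spectral theorem
  enters.\<close>

typedef (overloaded) 'a endo = "UNIV :: ('a::euclidean_space \<Rightarrow>\<^sub>L 'a) set" ..

setup_lifting type_definition_endo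

text \<open>\<open>exp\<close> and its derivative rules need a Banach algebra, so the bounded
  endomorphisms are copied into a type whose product is composition.\<close>

instantiation endo :: (euclidean_space) real_normed_algebra_1
begin

lift_definition zero_endo :: "'a endo" is 0 .
lift_definition one_endo :: "'a endo" is id_blinfun .
lift_definition plus_endo :: "'a endo \<Rightarrow> 'a endo \<Rightarrow> 'a endo" is "(+)" .
lift_definition minus_endo :: "'a endo \<Rightarrow> 'a endo \<Rightarrow> 'a endo" is "(-)" .
lift_definition uminus_endo :: "'a endo \<Rightarrow> 'a endo" is uminus .
lift_definition times_endo :: "'a endo \<Rightarrow> 'a endo \<Rightarrow> 'a endo" is "(o\<^sub>L)" .
lift_definition scaleR_endo :: "real \<Rightarrow> 'a endo \<Rightarrow> 'a endo" is scaleR .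
lift_definition norm_endo :: "'a endo \<Rightarrow> real" is norm .
definition dist_endo :: "'a endo \<Rightarrow> 'a endo \<Rightarrow> real" where "dist_endo a b = norm (a - b)"
definition sgn_endo :: "'a endo \<Rightarrow> 'a endo" where "sgn_endo x = inverse (norm x) *\<^sub>R x"
definition uniformity_endo :: "('a endo \<times> 'a endo) filter" where
  "uniformity_endo = (INF e\<in>{0<..}. principal {(x, y). dist x y < e})"
definition open_endo :: "'a endo set \<Rightarrow> bool" where
  "open_endo S = (\<forall>x\<in>S. \<forall>\<^sub>F (x', y) in uniformity. x' = x \<longrightarrow> y \<in> S)"

instance
proof
  fix a b c :: "'a endo" and r s :: real
  show "a + b + c = a + (b + c)" by transfer simp
  show "a + b = b + a" by transfer simp
  show "0 + a = a" by transfer simp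
  show "- a + a = 0" by transfer simp
  show "a - b = a + - b" by transfer simp
  show "r *\<^sub>R (a + b) = r *\<^sub>R a + r *\<^sub>R b" by transfer (simp add: scaleR_add_right)
  show "(r + s) *\<^sub>R a = r *\<^sub>R a + s *\<^sub>R a" by transfer (simp add: scaleR_add_left)
  show "r *\<^sub>R s *\<^sub>R a = (r * s) *\<^sub>R a" by transfer simp
  show "1 *\<^sub>R a = a" by transfer simp
  show "a * b * c = a * (b * c)" by transfer (simp add: blinfun_eqI)
  show "(a + b) * c = a * c + b * c" by transfer (simp add: blinfun_eqI blinfun.add_left)
  show "a * (b + c) = a * b + a * c"
    by transfer (simp add: blinfun_eqI blinfun.add_left blinfun.add_right)
  show "r *\<^sub>R a * b = r *\<^sub>R (a * b)" by transfer (simp add: blinfun_eqI blinfun.scaleR_left)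
  show "a * r *\<^sub>R b = r *\<^sub>R (a * b)"
    by transfer (simp add: blinfun_eqI blinfun.scaleR_left blinfun.scaleR_right)
  show "1 * a = a" by transfer (simp add: blinfun_eqI)
  show "a * 1 = a" by transfer (simp add: blinfun_eqI)
  show "(0::'a endo) \<noteq> 1"
    by transfer (metis norm_blinfun_id norm_zero zero_neq_one)
  show "dist a b = norm (a - b)" by (rule dist_endo_def)
  show "sgn a = inverse (norm a) *\<^sub>R a" by (rule sgn_endo_def)
  show "(uniformity :: ('a endo \<times> 'a endo) filter) = (INF e\<in>{0<..}. principal {(x, y). dist x y < e})"
    by (rule uniformity_endo_def)
  show "open U \<longleftrightarrow> (\<forall>x\<in>U. \<forall>\<^sub>F (x', y) in uniformity. x' = x \<longrightarrow> y \<in> U)" for U :: "'a endo set"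
    by (rule open_endo_def)
  show "norm a = 0 \<longleftrightarrow> a = 0" by transfer simp
  show "norm (a + b) \<le> norm a + norm b" by transfer (rule norm_triangle_ineq)
  show "norm (r *\<^sub>R a) = \<bar>r\<bar> * norm a" by transfer simp
  show "norm (a * b) \<le> norm a * norm b" by transfer (rule norm_blinfun_compose)
  show "norm (1::'a endo) = 1" by transfer simp
qed

end

instance endo :: (euclidean_space) banach
proof
  fix X :: "nat \<Rightarrow> 'a endo" assume "Cauchy X"
  then have "Cauchy (\<lambda>n. Rep_endo (X n))"
    unfolding Cauchy_def dist_norm by transfer (simp add: dist_norm)
  then obtain l where "(\<lambda>n. Rep_endo (X n)) \<longlonglongrightarrow> l"
    using convergent_def Cauchy_convergent by blast
  then have "X \<longlonglongrightarrow> Abs_endo l"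
    unfolding tendsto_iff dist_norm by (simp add: norm_endo.rep_eq minus_endo.rep_eq Abs_endo_inverse)
  then show "convergent X" by (auto simp: convergent_def)
qed

lift_definition endo_apply :: "'a::euclidean_space endo \<Rightarrow> 'a \<Rightarrow> 'a" is blinfun_apply .

lift_definition endo_of :: "('a::euclidean_space \<Rightarrow> 'a) \<Rightarrow> 'a endo" is Blinfun .

lemma bounded_bilinear_endo_apply: "bounded_bilinear endo_apply"
proof
  show "\<exists>K. \<forall>a b. norm (endo_apply a b :: 'a) \<le> norm a * norm b * K"
    by (rule exI[of _ 1]) (transfer, simp add: norm_blinfun)
qed (transfer, simp add: blinfun.add_left blinfun.add_right blinfun.scaleR_left blinfun.scaleR_right)+

lemma endo_apply_times: "endo_apply (a * b) x = endo_apply a (endo_apply b x)"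
  by transfer simp

lemma endo_apply_one: "endo_apply 1 x = x"
  by transfer simp

lemma endo_apply_endo_of: "linear f \<Longrightarrow> endo_apply (endo_of f) x = f x"
  by transfer (simp add: bounded_linear_Blinfun_apply linear_conv_bounded_linear)

definition flow :: "('a::euclidean_space \<Rightarrow> 'a) \<Rightarrow> real \<Rightarrow> 'a \<Rightarrow> 'a" where
  "flow L t = endo_apply (exp (t *\<^sub>R endo_of L))"

lemma linear_flow: "linear (flow L t)"
  unfolding flow_def
  by (rule bounded_linear.linear[OF bounded_bilinear.bounded_linear_right[OF bounded_bilinear_endo_apply]])

lemma flow_0 [simp]: "flow L 0 x = x"
  by (simp add: flow_def endo_apply_one)

lemma flow_add: "flow L (s + t) x = flow L s (flow L t x)"
  by (simp add: flow_def scaleR_add_left exp_add_commuting endo_apply_times)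

lemma flow_flow_minus [simp]: "flow L t (flow L (- t) x) = x" "flow L (- t) (flow L t x) = x"
  using flow_add[of L t "- t" x] flow_add[of L "- t" t x] by simp_all

lemma flow_generator_commute:
  assumes "linear L"
  shows "flow L t (L x) = L (flow L t x)"
proof -
  have "exp (t *\<^sub>R endo_of L) * endo_of L = endo_of L * exp (t *\<^sub>R endo_of L)"
    using exp_times_scaleR_commute[of t "endo_of L"] by simp
  then have "endo_apply (exp (t *\<^sub>R endo_of L)) (endo_apply (endo_of L) x)
      = endo_apply (endo_of L) (endo_apply (exp (t *\<^sub>R endo_of L)) x)"
    by (simp only: endo_apply_times[symmetric])
  then show ?thesis by (simp add: flow_def endo_apply_endo_of assms)
qed

lemma flow_has_vector_derivative:
  assumes "linear L"
  shows "((\<lambda>t. flow L t x) has_vector_derivative L (flow L t x)) (at t within T)"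
proof -
  have "((\<lambda>t. endo_apply (exp (t *\<^sub>R endo_of L)) x) has_vector_derivative
      endo_apply (exp (t *\<^sub>R endo_of L) * endo_of L) x) (at t within T)"
    by (rule bounded_linear.has_vector_derivative[OF
          bounded_bilinear.bounded_linear_left[OF bounded_bilinear_endo_apply]
          exp_scaleR_has_vector_derivative_right])
  then show ?thesis
    by (simp add: flow_def[symmetric] endo_apply_times endo_apply_endo_of assms flow_generator_commute)
qed

lemma flow_has_vector_derivative_comp:
  assumes "linear L" "(h has_real_derivative h') (at t within T)"
  shows "((\<lambda>t. flow L (h t) x) has_vector_derivative h' *\<^sub>R L (flow L (h t) x)) (at t within T)"
  using vector_diff_chain_within[OF assms(2)[unfolded has_real_derivative_iff_has_vector_derivative]
      flow_has_vector_derivative[OF assms(1)]]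
  by (simp add: o_def)

text \<open>Product rule for a flow applied to a moving vector. With \<open>h s = - s\<close> the
  two terms cancel along solutions; with \<open>h s = s\<close> they produce the generator of a
  product of commuting flows.\<close>

lemma bounded_bilinear_flow_step:
  assumes L: "linear L"
    and h: "(h has_real_derivative h') (at t within T)"
    and y: "(y has_vector_derivative y') (at t within T)"
  shows "((\<lambda>t. flow L (h t) (y t)) has_vector_derivative
           h' *\<^sub>R flow L (h t) (L (y t)) + flow L (h t) y') (at t within T)"
proof -
  have e: "((\<lambda>t. exp (h t *\<^sub>R endo_of L)) has_vector_derivative
      h' *\<^sub>R (exp (h t *\<^sub>R endo_of L) * endo_of L)) (at t within T)"
    using vector_diff_chain_within[OF h[unfolded has_real_derivative_iff_has_vector_derivative]
        exp_scaleR_has_vector_derivative_right] by (simp add: o_def)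
  have "((\<lambda>t. endo_apply (exp (h t *\<^sub>R endo_of L)) (y t)) has_vector_derivative
      endo_apply (exp (h t *\<^sub>R endo_of L)) y'
      + endo_apply (h' *\<^sub>R (exp (h t *\<^sub>R endo_of L) * endo_of L)) (y t)) (at t within T)"
    by (rule bounded_bilinear.has_vector_derivative[OF bounded_bilinear_endo_apply e y])
  then show ?thesis
    by (simp add: flow_def endo_apply_times endo_apply_endo_of L add.commute
        bounded_bilinear.scaleR_left[OF bounded_bilinear_endo_apply])
qed

lemma continuous_on_flow [continuous_intros]:
  assumes h: "continuous_on T h" and y: "continuous_on T y"
  shows "continuous_on T (\<lambda>t. flow L (h t) (y t))"
proof -
  have "continuous_on UNIV (\<lambda>t. exp (t *\<^sub>R endo_of L))"
    by (auto intro!: continuous_at_imp_continuous_on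
        has_vector_derivative_continuous[OF exp_scaleR_has_vector_derivative_right])
  from continuous_on_compose2[OF this h] show ?thesis
    unfolding flow_def
    by (intro bounded_bilinear.continuous_on[OF bounded_bilinear_endo_apply] y) auto
qed

text \<open>The integrating factor \<open>flow L (- s)\<close> turns any solution into a
  constant.\<close>

lemma flow_unique:
  assumes L: "linear L" and "0 \<le> t"
    and y: "\<And>s. s \<in> {0..t} \<Longrightarrow> (y has_vector_derivative L (y s)) (at s within {0..t})"
  shows "y t = flow L t (y 0)"
proof -
  have "\<exists>c. \<forall>s\<in>{0..t}. flow L (- s) (y s) = c"
  proof (rule has_vector_derivative_zero_constant)
    fix s assume s: "s \<in> {0..t}"
    have "((\<lambda>s. flow L (- s) (y s)) has_vector_derivative
        (- 1) *\<^sub>R flow L (- s) (L (y s)) + flow L (- s) (L (y s))) (at s within {0..t})"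
      by (rule bounded_bilinear_flow_step[OF L _ y[OF s]]) (auto intro!: derivative_eq_intros)
    then show "((\<lambda>s. flow L (- s) (y s)) has_vector_derivative 0) (at s within {0..t})" by simp
  qed auto
  then have "flow L (- t) (y t) = y 0" using \<open>0 \<le> t\<close> by force
  then show ?thesis by (metis flow_flow_minus(1))
qed

lemma flow_negate: "linear L \<Longrightarrow> flow L (- t) x = flow (\<lambda>x. - L x) t x"
proof -
  assume L: "linear L"
  then have "endo_of (\<lambda>x. - L x) = - endo_of L"
    by (transfer) (auto intro!: blinfun_eqI simp: bounded_linear_Blinfun_apply
         linear_conv_bounded_linear bounded_linear_minus blinfun.minus_left)
  then show ?thesis by (simp add: flow_def)
qed

text \<open>The pairing of \<open>flow L s x\<close> with \<open>flow L' (t - s) y\<close> does not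
  depend on \<open>s\<close>; its values at \<open>s = t\<close> and \<open>s = 0\<close> are the
  two sides.\<close>

lemma flow_adjoint:
  assumes L: "linear L" and L': "linear L'" and adj: "\<And>x y. L x \<bullet> y = x \<bullet> L' y"
  shows "flow L t x \<bullet> y = x \<bullet> flow L' t y"
proof -
  have "\<exists>c. \<forall>s\<in>UNIV. flow L s x \<bullet> flow L' (t - s) y = c"
  proof (rule has_vector_derivative_zero_constant)
    fix s :: real
    have "((\<lambda>s. flow L s x \<bullet> flow L' (t - s) y) has_vector_derivative
        flow L s x \<bullet> ((-1) *\<^sub>R L' (flow L' (t - s) y)) + L (flow L s x) \<bullet> flow L' (t - s) y) (at s within UNIV)"
      by (intro bounded_bilinear.has_vector_derivative[OF bounded_bilinear_inner]
            flow_has_vector_derivative flow_has_vector_derivative_comp L L') (auto intro!: derivative_eq_intros)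
    then show "((\<lambda>s. flow L s x \<bullet> flow L' (t - s) y) has_vector_derivative 0) (at s within UNIV)"
      by (simp add: adj)
  qed auto
  then obtain c where "\<And>s. flow L s x \<bullet> flow L' (t - s) y = c" by auto
  from this[of t] this[of 0] show ?thesis by simp
qed

subsection \<open>Gaussian measures and characteristic functions\<close>

text \<open>Available on every Euclidean space, since phase space is a product type while
  \<open>gaussian_measure\<close> lives on \<open>real^'n\<close>. The product over
  \<open>Basis\<close> lets integrals factor into one-dimensional ones.\<close>

definition gauss :: "'a::euclidean_space measure" where
  "gauss = density lborel (\<lambda>x. ennreal (\<Prod>b\<in>Basis. std_normal_density (x \<bullet> b)))"

definition cf :: "'a::euclidean_space measure \<Rightarrow> 'a \<Rightarrow> complex" where
  "cf M \<xi> = (CLINT x|M. iexp (\<xi> \<bullet> x))"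

lemma sets_gauss [simp, measurable_cong]: "sets gauss = sets borel"
  and space_gauss [simp]: "space gauss = UNIV"
  by (simp_all add: gauss_def)

lemma gauss_density:
  "(\<Prod>b\<in>Basis. std_normal_density (x \<bullet> b)) = exp (- (x \<bullet> x) / 2) / sqrt (2 * pi) ^ DIM('a)"
  for x :: "'a::euclidean_space"
proof -
  have "(\<Prod>b\<in>Basis. std_normal_density (x \<bullet> b))
      = (\<Prod>b\<in>(Basis :: 'a set). 1 / sqrt (2 * pi)) * (\<Prod>b\<in>(Basis :: 'a set). exp (- ((x \<bullet> b)\<^sup>2 / 2)))"
  proof -
    have "std_normal_density (x \<bullet> b) = 1 / sqrt (2 * pi) * exp (- ((x \<bullet> b)\<^sup>2 / 2))" for b
      by (simp add: normal_density_def)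
    then show ?thesis by (simp only: prod.distrib)
  qed
  also have "(\<Prod>b\<in>(Basis :: 'a set). exp (- ((x \<bullet> b)\<^sup>2 / 2))) = exp (\<Sum>b\<in>(Basis :: 'a set). - ((x \<bullet> b)\<^sup>2 / 2))"
    by (simp add: exp_sum)
  also have "(\<Sum>b\<in>(Basis :: 'a set). - ((x \<bullet> b)\<^sup>2 / 2)) = - (x \<bullet> x) / 2"
    by (subst euclidean_inner[of x x]) (simp add: sum_negf sum_divide_distrib power2_eq_square)
  finally show ?thesis by (simp add: power_one_over)
qed

lemma measurable_gauss_density [measurable]:
  "(\<lambda>x::'a::euclidean_space. \<Prod>b\<in>Basis. std_normal_density (x \<bullet> b)) \<in> borel_measurable borel"
  by measurable

lemma prob_space_gauss: "prob_space (gauss :: 'a::euclidean_space measure)"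
proof
  interpret std: prob_space "density lborel std_normal_density"
    by (rule prob_space_normal_density) simp
  have one: "(\<integral>\<^sup>+x. ennreal (std_normal_density x) \<partial>lborel) = 1"
    using std.emeasure_space_1 by (simp add: emeasure_density)
  have "emeasure (gauss :: 'a measure) (space gauss)
      = (\<integral>\<^sup>+x. (\<Prod>b\<in>Basis. ennreal (std_normal_density ((x :: 'a) \<bullet> b))) \<partial>lborel)"
    by (simp add: gauss_def emeasure_density prod_ennreal)
  also have "\<dots> = (\<Prod>b\<in>(Basis::'a set). \<integral>\<^sup>+x. ennreal (std_normal_density x) \<partial>lborel)"
    by (rule nn_integral_lborel_prod) auto
  finally show "emeasure (gauss :: 'a measure) (space gauss) = 1" by (simp add: one)
qed

lemma emeasure_gauss_UNIV [simp]: "emeasure gauss UNIV = 1"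
  using prob_space.emeasure_space_1[OF prob_space_gauss] by simp

text \<open>Both the density and the exponential factor over \<open>Basis\<close>, and
  \<open>lborel\<close> is a product measure, so the one-dimensional formula applies in each
  coordinate.\<close>

lemma cf_gauss: "cf gauss \<xi> = of_real (exp (- (\<xi> \<bullet> \<xi>) / 2))" for \<xi> :: "'a::euclidean_space"
proof -
  interpret product_sigma_finite "\<lambda>_::'a. lborel :: real measure" ..
  let ?h = "\<lambda>b x. of_real (std_normal_density x) * iexp ((\<xi> \<bullet> b) * x)"
  have int: "integrable lborel (?h b)" for b
  proof (rule Bochner_Integration.integrable_bound[where f="std_normal_density"])
    show "integrable lborel std_normal_density" by simp
  qed (auto simp: norm_mult)
  have val: "(\<integral>x. ?h b x \<partial>lborel) = of_real (exp (- ((\<xi> \<bullet> b)\<^sup>2) / 2))" for b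
    using char_std_normal_distribution
    by (simp add: fun_eq_iff char_def integral_density scaleR_conv_of_real)
  have "cf gauss \<xi> = (\<integral>x. of_real (\<Prod>b\<in>Basis. std_normal_density (x \<bullet> b)) * iexp (\<xi> \<bullet> x) \<partial>lborel)"
    unfolding cf_def gauss_def
    by (subst integral_density) (auto simp: scaleR_conv_of_real intro!: prod_nonneg)
  also have "\<dots> = (\<integral>x. (\<Prod>b\<in>Basis. ?h b (x \<bullet> b)) \<partial>lborel)"
  proof -
    have "iexp (\<xi> \<bullet> x) = (\<Prod>b\<in>Basis. iexp ((\<xi> \<bullet> b) * (x \<bullet> b)))" for x
      by (subst euclidean_inner) (simp add: exp_sum[symmetric] sum_distrib_left)
    then show ?thesis by (simp add: prod.distrib)
  qed
  also have "\<dots> = (\<integral>f. (\<Prod>b\<in>Basis. ?h b (f b)) \<partial>(\<Pi>\<^sub>M b\<in>(Basis::'a set). lborel))"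
    by (subst lborel_eq, subst integral_distr) simp_all
  also have "\<dots> = (\<Prod>b\<in>(Basis::'a set). \<integral>x. ?h b x \<partial>lborel)"
    by (rule product_integral_prod) (use int in auto)
  also have "\<dots> = of_real (exp (- (\<xi> \<bullet> \<xi>) / 2))"
    unfolding val
    by (subst euclidean_inner[of \<xi> \<xi>]) (simp add: exp_sum[symmetric] sum_negf sum_divide_distrib power2_eq_square
        flip: of_real_prod)
  finally show ?thesis .
qed

section \<open>Fourier uniqueness for finite measures\<close>

lemma measurable_iexp_inner [measurable]:
  "f \<in> borel_measurable M \<Longrightarrow> g \<in> borel_measurable M \<Longrightarrow> (\<lambda>x. iexp (f x \<bullet> g x)) \<in> borel_measurable M"
  for f g :: "_ \<Rightarrow> 'a::euclidean_space"
  by measurable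

lemma integrable_iexp:
  assumes "finite_measure M" and [measurable]: "f \<in> borel_measurable M"
  shows "integrable M (\<lambda>x. iexp (f x))"
  by (rule finite_measure.integrable_const_bound[OF assms(1), where B=1]) auto

text \<open>The Gaussian kernel is itself a characteristic function, that of \<open>gauss\<close>.
  Writing it so and exchanging the integrals leaves \<open>M\<close> visible only through
  \<open>cf M\<close>.\<close>

lemma smoothed_measure_eq:
  fixes M N :: "'a::euclidean_space measure"
  assumes "finite_measure M" and M [measurable_cong]: "sets M = sets borel" and "0 < a"
  shows "of_real (\<integral>x. exp (- ((norm (x - y) / a)\<^sup>2) / 2) \<partial>M)
       = (CLINT z|gauss. iexp (- (z \<bullet> y) / a) * cf M (z /\<^sub>R a))"
proof -
  interpret M: finite_measure M by fact
  interpret G: prob_space "gauss :: 'a measure" by (rule prob_space_gauss)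
  interpret MG: pair_sigma_finite M "gauss :: 'a measure" ..
  interpret MGf: finite_measure "M \<Otimes>\<^sub>M (gauss :: 'a measure)"
    by (rule finite_measure_pair_measure) unfold_locales
  have "of_real (\<integral>x. exp (- ((norm (x - y) / a)\<^sup>2) / 2) \<partial>M)
      = (CLINT x|M. cf gauss ((x - y) /\<^sub>R a))"
  proof -
    have "((x - y) /\<^sub>R a) \<bullet> ((x - y) /\<^sub>R a) = (norm (x - y) / a)\<^sup>2" for x
      by (simp add: power_mult_distrib power2_norm_eq_inner power2_eq_square[of "inverse a"] divide_inverse)
    then show ?thesis by (simp add: cf_gauss)
  qed
  also have "\<dots> = (CLINT x|M. CLINT z|gauss. iexp (((x - y) /\<^sub>R a) \<bullet> z))"
    by (simp add: cf_def)
  also have "\<dots> = (CLINT z|gauss. CLINT x|M. iexp (((x - y) /\<^sub>R a) \<bullet> z))"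
    by (rule MG.Fubini_integral[symmetric])
       (use integrable_iexp[OF MGf.finite_measure_axioms, of "\<lambda>(x, z). ((x - y) /\<^sub>R a) \<bullet> z"] in
         \<open>simp add: split_beta' M\<close>)
  also have "\<dots> = (CLINT z|gauss. CLINT x|M. iexp (- (z \<bullet> y) / a) * iexp ((z /\<^sub>R a) \<bullet> x))"
    by (intro Bochner_Integration.integral_cong refl)
       (auto simp: exp_add[symmetric] inner_commute inner_diff_left inner_diff_right divide_inverse algebra_simps)
  also have "\<dots> = (CLINT z|gauss. iexp (- (z \<bullet> y) / a) * cf M (z /\<^sub>R a))"
    by (simp add: cf_def)
  finally show ?thesis .
qed

lemma nn_integral_lborel_affine:
  fixes f :: "'a::euclidean_space \<Rightarrow> ennreal"
  assumes [measurable]: "f \<in> borel_measurable borel" and "0 < c"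
  shows "(\<integral>\<^sup>+x. f x \<partial>lborel) = ennreal (c ^ DIM('a)) * (\<integral>\<^sup>+x. f (t + c *\<^sub>R x) \<partial>lborel)"
  using \<open>0 < c\<close>
  by (subst lborel_affine[of c t]) (simp_all add: nn_integral_density nn_integral_distr nn_integral_cmult)

text \<open>Up to the normalising factor on the right, the smoothed kernel is the density of the
  convolution of \<open>M\<close> with a centred Gaussian of standard deviation \<open>a\<close>;
  the substitution \<open>y = x + a *\<^sub>R z\<close> rewrites testing against it.\<close>

lemma smoothed_nn_integral:
  fixes M :: "'a::euclidean_space measure" and g :: "'a \<Rightarrow> ennreal"
  assumes "finite_measure M" and M [measurable_cong]: "sets M = sets borel" and "0 < a"
    and [measurable]: "g \<in> borel_measurable borel"
  shows "(\<integral>\<^sup>+y. g y * ennreal (\<integral>x. exp (- ((norm (x - y) / a)\<^sup>2) / 2) \<partial>M) \<partial>lborel)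
       = ennreal ((a * sqrt (2 * pi)) ^ DIM('a)) * (\<integral>\<^sup>+x. \<integral>\<^sup>+z. g (x + a *\<^sub>R z) \<partial>gauss \<partial>M)"
proof -
  interpret M: finite_measure M by fact
  interpret P: pair_sigma_finite M "lborel :: 'a measure" ..
  let ?e = "\<lambda>x y. exp (- ((norm (x - y :: 'a) / a)\<^sup>2) / 2)"
  have "ennreal (\<integral>x. ?e x y \<partial>M) = (\<integral>\<^sup>+x. ennreal (?e x y) \<partial>M)" for y
    by (rule nn_integral_eq_integral[symmetric])
       (auto intro!: M.integrable_const_bound[where B=1])
  then have "(\<integral>\<^sup>+y. g y * ennreal (\<integral>x. ?e x y \<partial>M) \<partial>lborel)
      = (\<integral>\<^sup>+y. \<integral>\<^sup>+x. g y * ennreal (?e x y) \<partial>M \<partial>lborel)"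
    by (simp add: nn_integral_cmult)
  also have "\<dots> = (\<integral>\<^sup>+x. \<integral>\<^sup>+y. g y * ennreal (?e x y) \<partial>lborel \<partial>M)"
    by (rule P.Fubini') measurable
  also have "\<dots> = (\<integral>\<^sup>+x. ennreal ((a * sqrt (2 * pi)) ^ DIM('a)) * (\<integral>\<^sup>+z. g (x + a *\<^sub>R z) \<partial>gauss) \<partial>M)"
  proof (intro nn_integral_cong)
    fix x
    have "(\<integral>\<^sup>+y. g y * ennreal (?e x y) \<partial>lborel)
        = ennreal (a ^ DIM('a)) * (\<integral>\<^sup>+z. g (x + a *\<^sub>R z) * ennreal (exp (- (z \<bullet> z) / 2)) \<partial>lborel)"
      using \<open>0 < a\<close> by (subst nn_integral_lborel_affine[where c=a and t=x])
        (auto simp: power2_norm_eq_inner[symmetric])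
    also have "(\<integral>\<^sup>+z. g (x + a *\<^sub>R z) * ennreal (exp (- (z \<bullet> z) / 2)) \<partial>lborel)
        = (\<integral>\<^sup>+z. ennreal (sqrt (2 * pi) ^ DIM('a))
            * (ennreal (exp (- (z \<bullet> z) / 2) / sqrt (2 * pi) ^ DIM('a)) * g (x + a *\<^sub>R z)) \<partial>lborel)"
    proof (intro nn_integral_cong)
      fix z :: 'a
      have "ennreal (exp (- (z \<bullet> z) / 2))
          = ennreal (sqrt (2 * pi) ^ DIM('a)) * ennreal (exp (- (z \<bullet> z) / 2) / sqrt (2 * pi) ^ DIM('a))"
        by (subst ennreal_mult[symmetric]) auto
      then show "g (x + a *\<^sub>R z) * ennreal (exp (- (z \<bullet> z) / 2)) = ennreal (sqrt (2 * pi) ^ DIM('a))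
            * (ennreal (exp (- (z \<bullet> z) / 2) / sqrt (2 * pi) ^ DIM('a)) * g (x + a *\<^sub>R z))"
        by (simp only: mult_ac)
    qed
    also have "\<dots> = ennreal (sqrt (2 * pi) ^ DIM('a)) * (\<integral>\<^sup>+z. g (x + a *\<^sub>R z) \<partial>gauss)"
      by (simp add: nn_integral_cmult gauss_def nn_integral_density gauss_density)
    finally show "(\<integral>\<^sup>+y. g y * ennreal (?e x y) \<partial>lborel)
        = ennreal ((a * sqrt (2 * pi)) ^ DIM('a)) * (\<integral>\<^sup>+z. g (x + a *\<^sub>R z) \<partial>gauss)"
      using \<open>0 < a\<close> by (simp add: mult.assoc[symmetric] ennreal_mult'[symmetric] power_mult_distrib)
  qed
  also have "\<dots> = ennreal ((a * sqrt (2 * pi)) ^ DIM('a)) * (\<integral>\<^sup>+x. \<integral>\<^sup>+z. g (x + a *\<^sub>R z) \<partial>gauss \<partial>M)"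
  proof -
    interpret G: prob_space "gauss :: 'a measure" by (rule prob_space_gauss)
    show ?thesis by (rule nn_integral_cmult) measurable
  qed
  finally show ?thesis .
qed

lemma smoothed_nn_integral_tendsto:
  fixes M :: "'a::euclidean_space measure" and g :: "'a \<Rightarrow> real"
  assumes "finite_measure M" and M [measurable_cong]: "sets M = sets borel"
    and g: "continuous_on UNIV g" "\<And>x. 0 \<le> g x" "\<And>x. g x \<le> 1"
  shows "(\<lambda>n. \<integral>\<^sup>+x. \<integral>\<^sup>+z. ennreal (g (x + (1 / real (Suc n)) *\<^sub>R z)) \<partial>gauss \<partial>M)
     \<longlonglongrightarrow> (\<integral>\<^sup>+x. ennreal (g x) \<partial>M)"
proof -
  interpret M: finite_measure M by fact
  interpret G: prob_space "gauss :: 'a measure" by (rule prob_space_gauss)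
  have [measurable]: "g \<in> borel_measurable borel"
    using g(1) by (rule borel_measurable_continuous_onI)
  have lim: "(\<lambda>n. ennreal (g (x + (1 / real (Suc n)) *\<^sub>R z))) \<longlonglongrightarrow> ennreal (g x)" for x z
  proof -
    have "(\<lambda>n. x + (1 / real (Suc n)) *\<^sub>R z) \<longlonglongrightarrow> x + 0 *\<^sub>R z"
      by (intro tendsto_intros LIMSEQ_Suc lim_1_over_n)
    with g(1) have "(\<lambda>n. g (x + (1 / real (Suc n)) *\<^sub>R z)) \<longlonglongrightarrow> g x"
      by (intro isCont_tendsto_compose[of x g]) (simp_all add: continuous_on_eq_continuous_at)
    then show ?thesis by (rule tendsto_ennrealI)
  qed
  have inner: "(\<lambda>n. \<integral>\<^sup>+z. ennreal (g (x + (1 / real (Suc n)) *\<^sub>R z)) \<partial>gauss) \<longlonglongrightarrow> (\<integral>\<^sup>+z. ennreal (g x) \<partial>(gauss :: 'a measure))" for x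
    by (rule nn_integral_dominated_convergence[where w="\<lambda>_. 1"])
       (use g lim in auto)
  show ?thesis
  proof (rule nn_integral_dominated_convergence[where w="\<lambda>_. 1"])
    fix j
    have "(\<integral>\<^sup>+z. ennreal (g (x + (1 / real (Suc j)) *\<^sub>R z)) \<partial>gauss) \<le> (\<integral>\<^sup>+z. 1 \<partial>(gauss :: 'a measure))" for x
      using g by (intro nn_integral_mono) auto
    then show "AE x in M. (\<integral>\<^sup>+z. ennreal (g (x + (1 / real (Suc j)) *\<^sub>R z)) \<partial>gauss) \<le> 1"
      by (simp add: G.emeasure_space_1)
  qed (use inner in \<open>auto simp: G.emeasure_space_1 M.emeasure_eq_measure less_top[symmetric]\<close>)
qed

text \<open>Convolutions of \<open>M\<close> and \<open>N\<close> with the same small Gaussian agree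
  because they depend on the characteristic function only. Letting the width
  \<open>1 / Suc n\<close> tend to zero gives equal integrals of continuous functions with values in
  the unit interval, and these determine the measure of open sets.\<close>

theorem measure_eqI_cf:
  fixes M N :: "'a::euclidean_space measure"
  assumes fin: "finite_measure M" "finite_measure N"
    and sets: "sets M = sets borel" "sets N = sets borel" and cf: "\<And>\<xi>. cf M \<xi> = cf N \<xi>"
  shows "M = N"
proof -
  note [measurable_cong] = sets
  interpret M: finite_measure M by fact
  interpret N: finite_measure N by fact
  have cont: "(\<integral>\<^sup>+x. ennreal (g x) \<partial>M) = (\<integral>\<^sup>+x. ennreal (g x) \<partial>N)"
    if g: "continuous_on UNIV g" "\<And>x. 0 \<le> g x" "\<And>x. g x \<le> 1" for g :: "'a \<Rightarrow> real"
  proof (rule LIMSEQ_unique[OF smoothed_nn_integral_tendsto[OF fin(1) sets(1) g]])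
    have [measurable]: "g \<in> borel_measurable borel"
      using g(1) by (rule borel_measurable_continuous_onI)
    have "(\<integral>\<^sup>+x. \<integral>\<^sup>+z. ennreal (g (x + a *\<^sub>R z)) \<partial>gauss \<partial>M) = (\<integral>\<^sup>+x. \<integral>\<^sup>+z. ennreal (g (x + a *\<^sub>R z)) \<partial>gauss \<partial>N)"
      if "0 < a" for a
    proof -
      have "(\<integral>x. exp (- ((norm (x - y) / a)\<^sup>2) / 2) \<partial>M) = (\<integral>x. exp (- ((norm (x - y) / a)\<^sup>2) / 2) \<partial>N)" for y
        using smoothed_measure_eq[OF fin(1) sets(1) that, of y] smoothed_measure_eq[OF fin(2) sets(2) that, of y]
        by (simp add: cf flip: of_real_eq_iff[where 'a=complex])
      then have "ennreal ((a * sqrt (2 * pi)) ^ DIM('a)) * (\<integral>\<^sup>+x. \<integral>\<^sup>+z. ennreal (g (x + a *\<^sub>R z)) \<partial>gauss \<partial>M)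
          = ennreal ((a * sqrt (2 * pi)) ^ DIM('a)) * (\<integral>\<^sup>+x. \<integral>\<^sup>+z. ennreal (g (x + a *\<^sub>R z)) \<partial>gauss \<partial>N)"
        using smoothed_nn_integral[OF fin(1) sets(1) that, of g] smoothed_nn_integral[OF fin(2) sets(2) that, of g]
        by simp
      moreover have "0 < (a * sqrt (2 * pi)) ^ DIM('a)" using that by simp
      ultimately show ?thesis
        by (subst (asm) ennreal_mult_cancel_left) (use that in \<open>auto simp: power_eq_0_iff\<close>)
    qed
    then show "(\<lambda>n. \<integral>\<^sup>+x. \<integral>\<^sup>+z. ennreal (g (x + (1 / real (Suc n)) *\<^sub>R z)) \<partial>gauss \<partial>M) \<longlonglongrightarrow> (\<integral>\<^sup>+x. ennreal (g x) \<partial>N)"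
      using smoothed_nn_integral_tendsto[OF fin(2) sets(2) g] by simp
  qed
  have UNIV: "emeasure M UNIV = emeasure N UNIV"
    using cont[of "\<lambda>_. 1"] sets_eq_imp_space_eq[OF sets(1)] sets_eq_imp_space_eq[OF sets(2)] by simp
  have "emeasure M U = emeasure N U" if U: "open U" for U
  proof (cases "U = UNIV")
    case False
    \<comment> \<open>Continuous functions that increase to the indicator of \<open>U\<close>: the
      distance to the complement is positive exactly on the open set.\<close>
    define g where "g n x = min 1 (real n * infdist x (- U))" for n x
    have g: "continuous_on UNIV (g n)" "0 \<le> g n x" "g n x \<le> 1" for n x
      unfolding g_def by (auto intro!: continuous_intros simp: infdist_nonneg)
    have lim: "(\<lambda>n. ennreal (g n x)) \<longlonglongrightarrow> indicator U x" for x
    proof (cases "x \<in> U")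
      case True
      have "0 < infdist x (- U)"
        using U True False by (intro infdist_pos_not_in_closed) auto
      then obtain m where m: "1 \<le> real m * infdist x (- U)"
        by (metis ex_less_of_nat_mult less_imp_le)
      have "g n x = 1" if "n \<ge> m" for n
        using m that order_trans[OF m mult_right_mono[of "real m" "real n"]] infdist_nonneg[of x "- U"]
        by (auto simp: g_def)
      then have "\<forall>\<^sub>F n in sequentially. ennreal (g n x) = indicator U x"
        using True by (auto simp: eventually_sequentially)
      then show ?thesis by (rule tendsto_eventually)
    qed (simp add: g_def)
    have lim': "(\<lambda>n. \<integral>\<^sup>+x. ennreal (g n x) \<partial>K) \<longlonglongrightarrow> (\<integral>\<^sup>+x. indicator U x \<partial>K)"
      if K: "finite_measure K" "sets K = sets borel" for K
    proof (rule nn_integral_dominated_convergence[where w="\<lambda>_. 1"])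
      note [measurable_cong] = K(2)
      interpret finite_measure K by fact
      show "(\<lambda>x. ennreal (g n x)) \<in> borel_measurable K" for n
        using borel_measurable_continuous_onI[OF g(1)] by measurable
      show "(\<lambda>x. indicator U x :: ennreal) \<in> borel_measurable K"
        using U K(2) by (intro borel_measurable_indicator) auto
    qed (use g lim K in \<open>auto simp: less_top[symmetric] finite_measure.emeasure_finite\<close>)
    have "(\<integral>\<^sup>+x. indicator U x \<partial>M) = (\<integral>\<^sup>+x. indicator U x \<partial>N)"
      using LIMSEQ_unique[OF lim'[OF fin(1) sets(1)]] lim'[OF fin(2) sets(2)] cont[OF g] by simp
    then show ?thesis using U by (simp add: sets)
  qed (simp add: UNIV)
  then show ?thesis
    by (intro measure_eqI_generator_eq[where E="{U. open U}" and \<Omega>=UNIV and A="\<lambda>_. UNIV"])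
       (auto simp: Int_stable_def sets borel_def)
qed

lemma cf_distr:
  assumes [measurable]: "f \<in> M \<rightarrow>\<^sub>M borel"
  shows "cf (distr M borel f) \<xi> = (CLINT x|M. iexp (\<xi> \<bullet> f x))"
  unfolding cf_def by (subst integral_distr) auto

text \<open>The change-of-variables theorems of HOL-Analysis demand a well-ordered index type; this copy
  of a finite type provides one.\<close>

typedef 'a idx = "UNIV :: 'a set" ..

instance idx :: (finite) finite
proof
  have "(UNIV :: 'a idx set) = range Abs_idx" by (metis Abs_idx_cases surj_def)
  then show "finite (UNIV :: 'a idx set)" by (metis finite finite_imageI)
qed

instantiation idx :: (finite) wellorder
begin

definition less_eq_idx :: "'a idx \<Rightarrow> 'a idx \<Rightarrow> bool" where
  "x \<le> y \<longleftrightarrow> to_nat (Rep_idx x) \<le> to_nat (Rep_idx y)"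
definition less_idx :: "'a idx \<Rightarrow> 'a idx \<Rightarrow> bool" where
  "x < y \<longleftrightarrow> to_nat (Rep_idx x) < to_nat (Rep_idx y)"

instance
proof
  fix P :: "'a idx \<Rightarrow> bool" and a
  assume *: "\<And>x. (\<And>y. y < x \<Longrightarrow> P y) \<Longrightarrow> P x"
  show "P a"
    by (rule measure_induct_rule[of "\<lambda>x. to_nat (Rep_idx x)" P a]) (rule *, simp add: less_idx_def)
qed (auto simp: less_eq_idx_def less_idx_def Rep_idx_inject)

end

text \<open>Conjugation by a bijection turns a product of transpositions into a product of equally
  many transpositions.\<close>

lemma sign_conjugate:
  fixes g :: "'m::finite \<Rightarrow> 'n::finite"
  assumes g: "bij g" and p: "p permutes UNIV"
  shows "sign (g \<circ> p \<circ> inv g) = sign p"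
proof -
  have conj: "swapidseq n (g \<circ> p \<circ> inv g)" if "swapidseq n p" for n and p :: "'m \<Rightarrow> 'm"
    using that
  proof induction
    case id
    have "g \<circ> id \<circ> inv g = id" using g by (auto simp: fun_eq_iff bij_is_surj surj_f_inv_f)
    then show ?case by (metis swapidseq.id)
  next
    case (comp_Suc n p a b)
    have eq: "g \<circ> (Transposition.transpose a b \<circ> p) \<circ> inv g = Transposition.transpose (g a) (g b) \<circ> (g \<circ> p \<circ> inv g)"
      using bij_is_inj[OF g] by (auto simp: fun_eq_iff Transposition.transpose_def dest: injD)
    show ?case
      unfolding eq using comp_Suc.hyps bij_is_inj[OF g]
      by (intro swapidseq.comp_Suc comp_Suc.IH) (auto dest: injD)
  qed
  obtain n where n: "swapidseq n p"
    using permutes_imp_permutation[OF finite p] by (auto simp: permutation_def)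
  show ?thesis
    by (simp only: sign_def evenperm_unique[OF n refl] evenperm_unique[OF conj[OF n] refl])
qed

text \<open>In the Leibniz formula, conjugation with \<open>g\<close> matches the permutations of
  the two index types and keeps their signs.\<close>

lemma det_reindex:
  fixes A :: "real^'n^'n" and g :: "'m::finite \<Rightarrow> 'n"
  assumes g: "bij g"
  shows "det (\<chi> i j. A $ g i $ g j) = det A"
  unfolding det_def
proof (rule sum.reindex_bij_witness[where j="\<lambda>p. g \<circ> p \<circ> inv g" and i="\<lambda>p. inv g \<circ> p \<circ> g"])
  have gi: "inv g (g x) = x" "g (inv g y) = y" for x y
    using g by (simp_all add: bij_is_inj bij_is_surj surj_f_inv_f)
  fix p :: "'m \<Rightarrow> 'm" assume "p \<in> {p. p permutes UNIV}"
  then have p: "p permutes UNIV" by simp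
  then show "g \<circ> p \<circ> inv g \<in> {p. p permutes UNIV}"
    using g by (auto intro!: bij_imp_permutes bij_comp bij_imp_bij_inv permutes_bij)
  show "inv g \<circ> (g \<circ> p \<circ> inv g) \<circ> g = p" by (simp add: fun_eq_iff gi)
  have "(\<Prod>i\<in>UNIV. A $ i $ (g \<circ> p \<circ> inv g) i) = (\<Prod>i\<in>UNIV. A $ g i $ g (p i))"
    using prod.reindex_bij_betw[of g UNIV UNIV "\<lambda>i. A $ i $ (g \<circ> p \<circ> inv g) i"] g by (simp add: gi)
  then show "of_int (sign (g \<circ> p \<circ> inv g)) * (\<Prod>i\<in>UNIV. A $ i $ (g \<circ> p \<circ> inv g) i)
      = of_int (sign p) * (\<Prod>i\<in>UNIV. (\<chi> i j. A $ g i $ g j) $ i $ p i)"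
    by (simp add: sign_conjugate[OF g p])
next
  have gi: "inv g (g x) = x" "g (inv g y) = y" for x y
    using g by (simp_all add: bij_is_inj bij_is_surj surj_f_inv_f)
  fix p :: "'n \<Rightarrow> 'n" assume "p \<in> {p. p permutes UNIV}"
  then show "inv g \<circ> p \<circ> g \<in> {p. p permutes UNIV}" "g \<circ> (inv g \<circ> p \<circ> g) \<circ> inv g = p"
    using g by (auto intro!: bij_imp_permutes bij_comp bij_imp_bij_inv permutes_bij simp: fun_eq_iff gi)
qed

section \<open>Lebesgue and Gaussian measures under invertible matrices\<close>

lemma borel_measurable_matrix_vector [measurable]: "(*v) A \<in> borel_measurable borel"
  for A :: "real^'n^'m"
  by (intro borel_measurable_continuous_onI linear_continuous_on matrix_vector_mul_bounded_linear)

text \<open>It is enough to test on boxes: the preimage of a box under \<open>A\<close> is its image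
  under the inverse \<open>B\<close>, whose volume carries the factor
  \<open>\<bar>det B\<bar>\<close>, and the two determinants multiply to one in absolute
  value.\<close>

lemma lborel_matrix_wellorder:
  fixes A :: "real^'n::{finite,wellorder}^'n::_"
  assumes A: "det A \<noteq> 0"
  shows "lborel = density (distr lborel borel ((*v) A)) (\<lambda>_. ennreal \<bar>det A\<bar>)"
proof (rule lborel_eqI)
  obtain B where B: "A ** B = mat 1" "B ** A = mat 1"
    using A invertible_det_nz[of A] by (auto simp: invertible_def)
  fix l u :: "real^'n::{finite,wellorder}" assume lu: "\<And>b. b \<in> Basis \<Longrightarrow> l \<bullet> b \<le> u \<bullet> b"
  have pre: "(*v) A -` box l u = (*v) B ` box l u"
  proof (intro set_eqI iffI)
    fix x assume "x \<in> (*v) A -` box l u"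
    moreover have "x = B *v (A *v x)" by (simp add: matrix_vector_mul_assoc B)
    ultimately show "x \<in> (*v) B ` box l u" by blast
  qed (auto simp: matrix_vector_mul_assoc B)
  have "(*v) B ` box l u \<in> lmeasurable"
    by (rule measurable_linear_image) auto
  then have "emeasure lebesgue ((*v) B ` box l u) = ennreal (\<bar>det B\<bar> * measure lebesgue (box l u))"
    by (simp add: emeasure_eq_measure2 measure_linear_image)
  moreover have "emeasure lebesgue ((*v) B ` box l u) = emeasure lborel ((*v) A -` box l u)"
  proof -
    have "(*v) A -` box l u \<in> sets borel"
      using measurable_sets[of "(*v) A" borel borel "box l u"] by simp
    then show ?thesis by (simp add: pre)
  qed
  moreover have "\<bar>det A\<bar> * \<bar>det B\<bar> = 1"
    using B(1) by (metis abs_mult abs_one det_I det_mul)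
  ultimately show "emeasure (density (distr lborel borel ((*v) A)) (\<lambda>_. ennreal \<bar>det A\<bar>)) (box l u)
      = (\<Prod>b\<in>Basis. (u - l) \<bullet> b)"
    using lu
    by (simp add: emeasure_density nn_integral_cmult_indicator emeasure_distr
        ennreal_mult'[symmetric] mult.assoc[symmetric] measure_lborel_box_eq)
qed simp

text \<open>The well-ordered case is carried over along the relabelling of coordinates
  \<open>P\<close> with inverse \<open>Q\<close>: \<open>Q\<close> preserves Lebesgue measure and
  intertwines \<open>A'\<close> with \<open>A\<close>, and the determinants agree.\<close>

lemma lborel_matrix:
  fixes A :: "real^'n^'n"
  assumes A: "det A \<noteq> 0"
  shows "lborel = density (distr lborel borel ((*v) A)) (\<lambda>_. ennreal \<bar>det A\<bar>)"
proof -
  define P :: "real^'n \<Rightarrow> real^'n idx" where "P x = (\<chi> i. x $ Rep_idx i)" for x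
  define Q :: "real^'n idx \<Rightarrow> real^'n" where "Q y = (\<chi> i. y $ Abs_idx i)" for y
  define A' :: "real^'n idx^'n idx" where "A' = (\<chi> i j. A $ Rep_idx i $ Rep_idx j)"
  have bij: "bij (Rep_idx :: 'n idx \<Rightarrow> 'n)"
    by (metis Abs_idx_inverse Rep_idx_inject UNIV_I bijI' )
  have PQ: "P (Q y) = y" "Q (P x) = x" for x y
    by (simp_all add: P_def Q_def vec_eq_iff Abs_idx_inverse Rep_idx_inverse)
  have [measurable]: "P \<in> borel_measurable borel" "Q \<in> borel_measurable borel"
    unfolding P_def Q_def by (auto intro!: borel_measurable_continuous_onI continuous_intros)
  have A'P: "A' *v P x = P (A *v x)" for x
    unfolding P_def A'_def matrix_vector_mult_def
    using sum.reindex_bij_betw[OF bij, of "\<lambda>j. A $ Rep_idx i $ j * x $ j" for i]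
    by (simp add: vec_eq_iff)
  have QA': "Q (A' *v y) = A *v Q y" for y
    by (metis A'P PQ)
  have prod: "(\<Prod>b\<in>Basis. (u - l) \<bullet> b) = (\<Prod>i\<in>UNIV. (u - l) $ i)" for u l :: "real^'m::finite"
    by (simp add: Basis_vec_def inner_axis UNION_singleton_eq_range prod.reindex inj_on_def axis_eq_axis)
  have Qlb: "distr lborel borel Q = lborel"
  proof (rule lborel_eqI[symmetric])
    fix l u :: "real^'n" assume lu: "\<And>b. b \<in> Basis \<Longrightarrow> l \<bullet> b \<le> u \<bullet> b"
    have "Q -` box l u = box (P l) (P u)"
      by (auto simp: mem_box_cart P_def Q_def) (metis Rep_idx_inverse Abs_idx_inverse UNIV_I)+
    moreover have "P l \<bullet> b \<le> P u \<bullet> b" if "b \<in> Basis" for b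
      using that lu by (force simp: Basis_vec_def inner_axis P_def)
    moreover have "(\<Prod>i\<in>UNIV. (P u - P l) $ i) = (\<Prod>i\<in>UNIV. (u - l) $ i)"
      using prod.reindex_bij_betw[OF bij, of "\<lambda>i. (u - l) $ i"] by (simp add: P_def)
    ultimately show "emeasure (distr lborel borel Q) (box l u) = (\<Prod>b\<in>Basis. (u - l) \<bullet> b)"
      by (simp add: emeasure_distr prod)
  qed simp
  have det: "det A' = det A" unfolding A'_def by (rule det_reindex[OF bij])
  have "(lborel :: (real^'n) measure) = distr (density (distr lborel borel ((*v) A')) (\<lambda>_. ennreal \<bar>det A\<bar>)) borel Q"
    using lborel_matrix_wellorder[of A'] A det Qlb by simp
  also have "\<dots> = density (distr lborel borel ((*v) A)) (\<lambda>_. ennreal \<bar>det A\<bar>)"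
    (is "?L = ?R")
  proof (rule measure_eqI)
    fix X assume "X \<in> sets ?L"
    then have [measurable]: "X \<in> sets borel" by simp
    have [measurable]: "Q -` X \<in> sets borel" "(*v) A -` X \<in> sets borel"
      by (rule measurable_sets_borel; measurable)+
    have "emeasure ?L X = ennreal \<bar>det A\<bar> * emeasure lborel ((*v) A' -` (Q -` X))"
      by (simp add: emeasure_distr emeasure_density nn_integral_cmult_indicator measurable_sets_borel)
    also have "(*v) A' -` (Q -` X) = Q -` ((*v) A -` X)" by (auto simp: QA')
    also have "emeasure lborel (Q -` ((*v) A -` X)) = emeasure (distr lborel borel Q) ((*v) A -` X)"
      by (simp add: emeasure_distr measurable_sets_borel)
    also have "ennreal \<bar>det A\<bar> * emeasure (distr lborel borel Q) ((*v) A -` X) = emeasure ?R X"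
      unfolding Qlb
      by (simp add: emeasure_distr emeasure_density nn_integral_cmult_indicator measurable_sets_borel)
    finally show "emeasure ?L X = emeasure ?R X" .
  qed simp
  finally show ?thesis .
qed

lemma matrix_inv_eqI:
  fixes A B :: "real^'n^'n"
  assumes "A ** B = mat 1" "B ** A = mat 1"
  shows "matrix_inv A = B"
proof -
  have "A ** matrix_inv A = mat 1"
    using assms unfolding matrix_inv_def by (metis (mono_tags, lifting) someI_ex)
  then show ?thesis by (metis assms(2) matrix_mul_assoc matrix_mul_lid matrix_mul_rid)
qed

text \<open>Substituting \<open>L *v x\<close> turns the quadratic form of the inverse covariance
  into \<open>x \<bullet> x\<close>, while the root of the determinant of the covariance is
  \<open>\<bar>det L\<bar>\<close> and cancels the Jacobian.\<close>

lemma gaussian_measure_matrix: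
  fixes L :: "real^'n^'n"
  assumes "invertible L"
  shows "gaussian_measure (L ** transpose L) = distr gauss borel ((*v) L)"
proof (rule measure_eqI)
  fix X assume "X \<in> sets (gaussian_measure (L ** transpose L))"
  then have [measurable]: "X \<in> sets borel" by (simp add: gaussian_measure_def)
  obtain K where K: "L ** K = mat 1" "K ** L = mat 1"
    using assms by (auto simp: invertible_def)
  have det: "det L \<noteq> 0" using assms invertible_det_nz by blast
  let ?C = "L ** transpose L"
  have inv: "matrix_inv ?C = transpose K ** K"
  proof (rule matrix_inv_eqI)
    show "?C ** (transpose K ** K) = mat 1"
      by (metis K matrix_mul_assoc matrix_mul_rid matrix_transpose_mul transpose_mat)
    show "transpose K ** K ** ?C = mat 1"
      by (metis K matrix_mul_assoc matrix_mul_rid matrix_transpose_mul transpose_mat)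
  qed
  have quad: "(L *v x) \<bullet> (matrix_inv ?C *v (L *v x)) = x \<bullet> x" for x
  proof -
    have "(L *v x) \<bullet> (matrix_inv ?C *v (L *v x)) = (L *v x) \<bullet> (transpose K *v (K *v (L *v x)))"
      by (simp only: inv matrix_vector_mul_assoc matrix_mul_assoc)
    also have "\<dots> = (K *v (L *v x)) \<bullet> (K *v (L *v x))"
      by (simp only: dot_lmul_matrix transpose_matrix_vector inner_commute[of "L *v x"])
    finally show ?thesis by (simp add: matrix_vector_mul_assoc K)
  qed
  define h where "h x = exp (- (x \<bullet> (matrix_inv ?C *v x)) / 2) / sqrt ((2 * pi) ^ CARD('n) * det ?C)" for x
  have [measurable]: "(*v) L -` X \<in> sets borel"
    by (rule measurable_sets_borel) measurable
  have [measurable]: "h \<in> borel_measurable borel"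
    unfolding h_def by (intro borel_measurable_continuous_onI continuous_intros) (auto simp: det det_mul)
  have h: "\<bar>det L\<bar> * h (L *v x) = exp (- (x \<bullet> x) / 2) / sqrt (2 * pi) ^ CARD('n)" for x
  proof -
    have "sqrt ((2 * pi) ^ CARD('n) * (det L * det L)) = sqrt (2 * pi) ^ CARD('n) * \<bar>det L\<bar>"
      by (simp only: real_sqrt_mult[of _ "det L * det L"] real_sqrt_power real_sqrt_abs2)
    then show ?thesis using det by (simp add: h_def quad det_mul)
  qed
  have "emeasure (gaussian_measure ?C) X = (\<integral>\<^sup>+x. ennreal (h x) * indicator X x \<partial>lborel)"
    unfolding gaussian_measure_def h_def[symmetric] by (simp add: emeasure_density)
  also have "\<dots> = (\<integral>\<^sup>+x. ennreal \<bar>det L\<bar> * (ennreal (h (L *v x)) * indicator X (L *v x)) \<partial>lborel)"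
    by (subst lborel_matrix[OF det]) (simp add: nn_integral_density nn_integral_distr)
  also have "\<dots> = (\<integral>\<^sup>+x. ennreal (exp (- (x \<bullet> x) / 2) / sqrt (2 * pi) ^ CARD('n)) * indicator ((*v) L -` X) x \<partial>lborel)"
    by (intro nn_integral_cong)
       (simp add: mult.assoc[symmetric] ennreal_mult'[symmetric] h split: split_indicator)
  also have "\<dots> = emeasure (distr gauss borel ((*v) L)) X"
    by (simp add: emeasure_distr gauss_def emeasure_density gauss_density measurable_sets_borel)
  finally show "emeasure (gaussian_measure ?C) X = emeasure (distr gauss borel ((*v) L)) X" .
qed (simp add: gaussian_measure_def)

subsection \<open>The Hilbert space of square-integrable functions of a Gaussian\<close>

lemma finite_measure_gauss [simp]: "finite_measure gauss"
  by (rule prob_space.axioms(1)[OF prob_space_gauss])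

lemma L2_measurable: "f \<in> L2 m \<Longrightarrow> f \<in> borel_measurable m"
  and L2_integrable_square: "f \<in> L2 m \<Longrightarrow> integrable m (\<lambda>x. (f x)\<^sup>2)"
  by (simp_all add: L2_def)

lemma L2_mult_integrable:
  assumes "f \<in> L2 m" "g \<in> L2 m"
  shows "integrable m (\<lambda>x. f x * g x)"
proof (rule Bochner_Integration.integrable_bound)
  show "integrable m (\<lambda>x. (f x)\<^sup>2 + (g x)\<^sup>2)"
    using assms by (simp add: L2_def)
  show "(\<lambda>x. f x * g x) \<in> borel_measurable m"
    using assms by (auto simp: L2_def)
  have "\<bar>a * b\<bar> \<le> a\<^sup>2 + b\<^sup>2" for a b :: real
  proof -
    have "2 * (\<bar>a\<bar> * \<bar>b\<bar>) \<le> \<bar>a\<bar>\<^sup>2 + \<bar>b\<bar>\<^sup>2" using sum_squares_bound[of "\<bar>a\<bar>" "\<bar>b\<bar>"] by simp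
    moreover have "0 \<le> \<bar>a\<bar> * \<bar>b\<bar>" by simp
    ultimately show ?thesis unfolding abs_mult power2_abs by linarith
  qed
  then show "AE x in m. norm (f x * g x) \<le> norm ((f x)\<^sup>2 + (g x)\<^sup>2)"
    by (intro AE_I2) (metis abs_of_nonneg add_nonneg_nonneg real_norm_def zero_le_power2)
qed

lemma L2_zero: "(\<lambda>x. 0) \<in> L2 m"
  by (simp add: L2_def)

lemma L2_add: "f \<in> L2 m \<Longrightarrow> g \<in> L2 m \<Longrightarrow> (\<lambda>x. f x + g x) \<in> L2 m"
  using L2_mult_integrable[of f m g]
  by (auto simp: L2_def power2_sum mult.assoc)

lemma L2_scale: "f \<in> L2 m \<Longrightarrow> (\<lambda>x. c * f x) \<in> L2 m"
  by (auto simp: L2_def power_mult_distrib)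

lemma L2_minus: "f \<in> L2 m \<Longrightarrow> (\<lambda>x. - f x) \<in> L2 m"
  by (auto simp: L2_def)

lemma L2_diff: "f \<in> L2 m \<Longrightarrow> g \<in> L2 m \<Longrightarrow> (\<lambda>x. f x - g x) \<in> L2 m"
  using L2_add[of f m "\<lambda>x. - g x"] L2_minus[of g m] by simp

lemma L2_const: "finite_measure m \<Longrightarrow> (\<lambda>x. c) \<in> L2 m"
  by (simp add: L2_def finite_measure.integrable_const)

lemma L2_bounded:
  assumes "finite_measure m" "f \<in> borel_measurable m" "\<And>x. \<bar>f x\<bar> \<le> B"
  shows "f \<in> L2 m"
proof -
  have "(f x)\<^sup>2 \<le> B\<^sup>2" for x
    using power_mono[OF assms(3) abs_ge_zero, of x 2] by simp
  then show ?thesis using assms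
    by (auto simp: L2_def intro!: finite_measure.integrable_const_bound[where B="B\<^sup>2"])
qed

lemma L2_integrable: "finite_measure m \<Longrightarrow> f \<in> L2 m \<Longrightarrow> integrable m f"
  using L2_mult_integrable[of f m "\<lambda>x. 1"] L2_const[of m 1] by simp

section \<open>The space \<open>L2 gauss\<close> modulo null sets as a Hilbert space type\<close>

definition l2_rel :: "('a::euclidean_space \<Rightarrow> real) \<Rightarrow> ('a \<Rightarrow> real) \<Rightarrow> bool" where
  "l2_rel f g \<longleftrightarrow> f \<in> L2 gauss \<and> g \<in> L2 gauss \<and> (AE x in gauss. f x = g x)"

\<comment> \<open>The relation is partial because only square-integrable functions are to have
  classes. As a type of its own the quotient can be an instance of \<open>real_inner\<close> and
  \<open>banach\<close>, which lets the semigroup argument be carried out abstractly.\<close>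
quotient_type (overloaded) 'a l2 = "'a::euclidean_space \<Rightarrow> real" / partial: l2_rel
proof (rule part_equivpI)
  show "\<exists>f. l2_rel f f" by (rule exI[of _ "\<lambda>x. 0"]) (simp add: l2_rel_def L2_zero)
  show "symp l2_rel" by (rule sympI) (auto simp: l2_rel_def)
  show "transp l2_rel" by (rule transpI) (auto simp: l2_rel_def)
qed

instantiation l2 :: (euclidean_space) real_inner
begin

lift_definition zero_l2 :: "'a l2" is "\<lambda>x. 0" by (simp add: l2_rel_def L2_zero)
lift_definition plus_l2 :: "'a l2 \<Rightarrow> 'a l2 \<Rightarrow> 'a l2" is "\<lambda>f g x. f x + g x"
  by (auto simp: l2_rel_def L2_add)
lift_definition minus_l2 :: "'a l2 \<Rightarrow> 'a l2 \<Rightarrow> 'a l2" is "\<lambda>f g x. f x - g x"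
  by (auto simp: l2_rel_def L2_diff)
lift_definition uminus_l2 :: "'a l2 \<Rightarrow> 'a l2" is "\<lambda>f x. - f x"
  by (auto simp: l2_rel_def L2_minus)
lift_definition scaleR_l2 :: "real \<Rightarrow> 'a l2 \<Rightarrow> 'a l2" is "\<lambda>c f x. c * f x"
  by (auto simp: l2_rel_def L2_scale)
lift_definition inner_l2 :: "'a l2 \<Rightarrow> 'a l2 \<Rightarrow> real" is "\<lambda>f g. \<integral>x. f x * g x \<partial>gauss"
  by (auto simp: l2_rel_def L2_def intro!: integral_cong_AE)
definition norm_l2 :: "'a l2 \<Rightarrow> real" where "norm_l2 x = sqrt (inner x x)"
definition dist_l2 :: "'a l2 \<Rightarrow> 'a l2 \<Rightarrow> real" where "dist_l2 x y = norm (x - y)"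
definition sgn_l2 :: "'a l2 \<Rightarrow> 'a l2" where "sgn_l2 x = inverse (norm x) *\<^sub>R x"
definition uniformity_l2 :: "('a l2 \<times> 'a l2) filter" where
  "uniformity_l2 = (INF e\<in>{0<..}. principal {(x, y). dist x y < e})"
definition open_l2 :: "'a l2 set \<Rightarrow> bool" where
  "open_l2 S = (\<forall>x\<in>S. \<forall>\<^sub>F (x', y) in uniformity. x' = x \<longrightarrow> y \<in> S)"

instance
proof
  fix x y z :: "'a l2" and r s :: real
  show "x + y + z = x + (y + z)" by transfer (auto simp: l2_rel_def L2_add add.assoc)
  show "x + y = y + x" by transfer (auto simp: l2_rel_def L2_add add.commute)
  show "0 + x = x" by transfer (auto simp: l2_rel_def L2_add L2_zero)
  show "- x + x = 0" by transfer (auto simp: l2_rel_def L2_add L2_minus L2_zero)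
  show "x - y = x + - y"
    by transfer (auto simp: l2_rel_def L2_diff intro!: L2_add[OF _ L2_minus, simplified])
  show "r *\<^sub>R (x + y) = r *\<^sub>R x + r *\<^sub>R y"
    by transfer (auto simp: l2_rel_def L2_scale L2_add algebra_simps intro!: L2_add[OF L2_scale L2_scale])
  show "(r + s) *\<^sub>R x = r *\<^sub>R x + s *\<^sub>R x"
    by transfer (auto simp: l2_rel_def L2_scale algebra_simps intro!: L2_add[OF L2_scale L2_scale])
  show "r *\<^sub>R s *\<^sub>R x = (r * s) *\<^sub>R x" by transfer (auto simp: l2_rel_def L2_scale algebra_simps)
  show "1 *\<^sub>R x = x" by transfer (auto simp: l2_rel_def)
  show "dist x y = norm (x - y)" by (rule dist_l2_def)
  show "sgn x = inverse (norm x) *\<^sub>R x" by (rule sgn_l2_def)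
  show "(uniformity :: ('a l2 \<times> 'a l2) filter) = (INF e\<in>{0<..}. principal {(x, y). dist x y < e})"
    by (rule uniformity_l2_def)
  show "open U \<longleftrightarrow> (\<forall>x\<in>U. \<forall>\<^sub>F (x', y) in uniformity. x' = x \<longrightarrow> y \<in> U)" for U :: "'a l2 set"
    by (rule open_l2_def)
  show "inner x y = inner y x" by transfer (simp add: mult.commute)
  show "inner (x + y) z = inner x z + inner y z"
    by transfer (auto simp: l2_rel_def distrib_right L2_mult_integrable)
  show "inner (r *\<^sub>R x) y = r * inner x y"
    by transfer (simp add: mult.assoc)
  show "0 \<le> inner x x" by transfer simp
  show "inner x x = 0 \<longleftrightarrow> x = 0"
  proof transfer
    fix f :: "'a \<Rightarrow> real" assume "l2_rel f f"
    then have f: "f \<in> L2 gauss" by (simp add: l2_rel_def)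
    then show "(\<integral>x. f x * f x \<partial>gauss) = 0 \<longleftrightarrow> l2_rel f (\<lambda>x. 0)"
      using integral_nonneg_eq_0_iff_AE[of gauss "\<lambda>x. f x * f x"] L2_mult_integrable[OF f f]
      by (simp add: l2_rel_def L2_zero)
  qed
  show "norm x = sqrt (inner x x)" by (rule norm_l2_def)
qed

end

text \<open>\<open>cls\<close> is meaningful on \<open>L2 gauss\<close> only; \<open>rpr\<close>
  picks some representative, so statements about its values hold almost everywhere.\<close>

definition cls :: "('a::euclidean_space \<Rightarrow> real) \<Rightarrow> 'a l2" where
  "cls f = abs_l2 f"

definition rpr :: "'a::euclidean_space l2 \<Rightarrow> 'a \<Rightarrow> real" where
  "rpr x = rep_l2 x"

lemma rpr_L2: "rpr x \<in> L2 gauss"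
  using Quotient3_rep_reflp[OF Quotient3_l2, of x] by (simp add: rpr_def l2_rel_def)

lemma cls_rpr [simp]: "cls (rpr x) = x"
  by (simp add: cls_def rpr_def Quotient3_abs_rep[OF Quotient3_l2])

lemma cls_eq_iff:
  "f \<in> L2 gauss \<Longrightarrow> g \<in> L2 gauss \<Longrightarrow> cls f = cls g \<longleftrightarrow> (AE x in gauss. f x = g x)"
  unfolding cls_def
  using Quotient3_rel[OF Quotient3_l2, of f g] by (simp add: l2_rel_def)

lemma rpr_cls: "f \<in> L2 gauss \<Longrightarrow> AE x in gauss. rpr (cls f) x = f x"
  using cls_eq_iff[OF rpr_L2, of f "cls f"] by simp

lemma cls_cases: obtains f where "f \<in> L2 gauss" "x = cls f"
  using rpr_L2[of x] cls_rpr[of x] by metis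

lemma cls_add: "f \<in> L2 gauss \<Longrightarrow> g \<in> L2 gauss \<Longrightarrow> cls f + cls g = cls (\<lambda>x. f x + g x)"
  and cls_diff: "f \<in> L2 gauss \<Longrightarrow> g \<in> L2 gauss \<Longrightarrow> cls f - cls g = cls (\<lambda>x. f x - g x)"
  and cls_minus: "f \<in> L2 gauss \<Longrightarrow> - cls f = cls (\<lambda>x. - f x)"
  and cls_scale: "f \<in> L2 gauss \<Longrightarrow> c *\<^sub>R cls f = cls (\<lambda>x. c * f x)"
  and cls_inner: "f \<in> L2 gauss \<Longrightarrow> g \<in> L2 gauss \<Longrightarrow> inner (cls f) (cls g) = (\<integral>x. f x * g x \<partial>gauss)"
  by (simp_all add: cls_def plus_l2.abs_eq minus_l2.abs_eq uminus_l2.abs_eq scaleR_l2.abs_eq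
      inner_l2.abs_eq l2_rel_def)

lemma cls_zero: "cls (\<lambda>x. 0) = 0"
  by (simp add: cls_def zero_l2.abs_eq)

lemma cls_norm: "f \<in> L2 gauss \<Longrightarrow> (norm (cls f))\<^sup>2 = (\<integral>x. (f x)\<^sup>2 \<partial>gauss)"
  by (simp add: power2_norm_eq_inner cls_inner power2_eq_square[of "f _"])

lemma cls_sum:
  "finite I \<Longrightarrow> (\<And>i. i \<in> I \<Longrightarrow> f i \<in> L2 gauss) \<Longrightarrow>
     (\<lambda>x. \<Sum>i\<in>I. f i x) \<in> L2 gauss \<and> cls (\<lambda>x. \<Sum>i\<in>I. f i x) = (\<Sum>i\<in>I. cls (f i))"
  by (induction I rule: finite_induct) (auto simp: L2_zero cls_zero L2_add cls_add[symmetric])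

section \<open>Completeness\<close>

lemma L1_le_norm_l2:
  fixes f :: "'a::euclidean_space \<Rightarrow> real"
  assumes f: "f \<in> L2 gauss"
  shows "(\<integral>x. \<bar>f x\<bar> \<partial>gauss) \<le> norm (cls f)"
proof -
  interpret prob_space gauss by (rule prob_space_gauss)
  have g: "(\<lambda>x. \<bar>f x\<bar>) \<in> L2 gauss" using f by (auto simp: L2_def)
  have "inner (cls (\<lambda>x. \<bar>f x\<bar>)) (cls (\<lambda>x. 1)) \<le> norm (cls (\<lambda>x. \<bar>f x\<bar>)) * norm (cls (\<lambda>x::'a. 1))"
    by (rule norm_cauchy_schwarz)
  moreover have "norm (cls (\<lambda>x::'a. 1)) = 1"
    using prob_space by (simp add: norm_l2_def cls_inner L2_const)
  moreover have "norm (cls (\<lambda>x. \<bar>f x\<bar>)) = norm (cls f)"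
    by (rule power2_eq_imp_eq) (simp_all add: cls_norm f g)
  ultimately show ?thesis
    using cls_inner[OF g L2_const[OF finite_measure_axioms]] by simp
qed

text \<open>Integrability is part of the conclusion: the bound is checked for the extended integral,
  the form in which Fatou's lemma and the averaging inequality for Mehler operators deliver
  it.\<close>

lemma norm_cls_le_sqrtI:
  assumes f: "f \<in> borel_measurable gauss" and "0 \<le> B"
    and le: "(\<integral>\<^sup>+x. ennreal ((f x)\<^sup>2) \<partial>gauss) \<le> ennreal (B\<^sup>2)"
  shows "f \<in> L2 gauss" "norm (cls f) \<le> B"
proof -
  have "integrable gauss (\<lambda>x. (f x)\<^sup>2)"
    using f le by (intro integrableI_bounded) (auto simp: le_less_trans[OF le])
  then show fL2: "f \<in> L2 gauss" using f by (simp add: L2_def)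
  have "ennreal ((norm (cls f))\<^sup>2) \<le> ennreal (B\<^sup>2)"
    using le nn_integral_eq_integral[OF L2_integrable_square[OF fL2]] by (simp add: cls_norm fL2)
  then show "norm (cls f) \<le> B" using \<open>0 \<le> B\<close> by (simp add: power_mono_iff)
qed

lemma nn_integral_norm_cls:
  assumes "f \<in> L2 gauss"
  shows "(\<integral>\<^sup>+x. ennreal ((f x)\<^sup>2) \<partial>gauss) = ennreal ((norm (cls f))\<^sup>2)"
  using nn_integral_eq_integral[OF L2_integrable_square[OF assms]] by (simp add: cls_norm assms)

text \<open>Riesz--Fischer: along a subsequence with geometrically small steps the increments are
  almost everywhere absolutely summable, which gives a pointwise limit \<open>F\<close>. Fatou's
  lemma then bounds the distance of \<open>F\<close> to the subsequence in norm.\<close>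

instance l2 :: (euclidean_space) complete_space
proof
  fix X :: "nat \<Rightarrow> 'a l2" assume X: "Cauchy X"
  have "\<exists>r. strict_mono r \<and> (\<forall>n. norm (X (r (Suc n)) - X (r n)) < (1/2) ^ n)"
  proof -
    have "\<exists>N. \<forall>m\<ge>N. \<forall>n\<ge>N. norm (X m - X n) < (1/2) ^ k" for k :: nat
      using X CauchyD by (metis zero_less_divide_1_iff zero_less_numeral zero_less_power)
    then obtain N where N: "\<And>k m n. m \<ge> N k \<Longrightarrow> n \<ge> N k \<Longrightarrow> norm (X m - X n) < (1/2) ^ k"
      by metis
    \<comment> \<open>The summand \<open>k\<close> makes \<open>r\<close> strictly increasing, and
      the sum makes it dominate every threshold \<open>N k\<close>.\<close>
    define r where "r k = k + (\<Sum>i\<le>k. N i)" for k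
    have "strict_mono r" by (rule strict_monoI_Suc) (simp add: r_def)
    moreover have "N k \<le> r k" for k
      using member_le_sum[of k "{..k}" N] by (simp add: r_def trans_le_add2)
    ultimately show ?thesis
      by (intro exI[of _ r]) (meson N lessI less_imp_le order_trans strict_mono_less_eq)
  qed
  then obtain r where r: "strict_mono r" "\<And>n. norm (X (r (Suc n)) - X (r n)) < (1/2) ^ n" by blast
  define f where "f n = rpr (X (r n))" for n
  have f: "f n \<in> L2 gauss" "cls (f n) = X (r n)" for n by (simp_all add: f_def rpr_L2)
  note [measurable] = L2_measurable[OF f(1)]
  have "(\<integral>\<^sup>+x. (\<Sum>n. ennreal \<bar>f (Suc n) x - f n x\<bar>) \<partial>gauss)
      = (\<Sum>n. \<integral>\<^sup>+x. ennreal \<bar>f (Suc n) x - f n x\<bar> \<partial>gauss)"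
    by (rule nn_integral_suminf) measurable
  also have "\<dots> \<le> (\<Sum>n. ennreal ((1/2) ^ n))"
  proof (rule suminf_le)
    fix n
    have d: "(\<lambda>x. f (Suc n) x - f n x) \<in> L2 gauss" by (intro L2_diff f)
    have "(\<integral>\<^sup>+x. ennreal \<bar>f (Suc n) x - f n x\<bar> \<partial>gauss) = ennreal (\<integral>x. \<bar>f (Suc n) x - f n x\<bar> \<partial>gauss)"
      using L2_integrable[OF finite_measure_gauss d] by (intro nn_integral_eq_integral) auto
    also have "\<dots> \<le> ennreal (norm (X (r (Suc n)) - X (r n)))"
      using L1_le_norm_l2[OF d] by (intro ennreal_leI) (simp add: cls_diff[symmetric] f)
    finally show "(\<integral>\<^sup>+x. ennreal \<bar>f (Suc n) x - f n x\<bar> \<partial>gauss) \<le> ennreal ((1/2) ^ n)"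
      using r(2)[of n] by (meson ennreal_leI less_imp_le order_trans)
  qed auto
  also have "\<dots> < \<infinity>"
    by (subst suminf_ennreal2) auto
  finally have "(\<integral>\<^sup>+x. (\<Sum>n. ennreal \<bar>f (Suc n) x - f n x\<bar>) \<partial>gauss) \<noteq> \<infinity>" by simp
  then have "AE x in gauss. (\<Sum>n. ennreal \<bar>f (Suc n) x - f n x\<bar>) \<noteq> \<infinity>"
    by (intro nn_integral_PInf_AE) auto
  then have conv: "AE x in gauss. convergent (\<lambda>n. f n x)"
  proof eventually_elim
    fix x assume "(\<Sum>n. ennreal \<bar>f (Suc n) x - f n x\<bar>) \<noteq> \<infinity>"
    then have "summable (\<lambda>n. \<bar>f (Suc n) x - f n x\<bar>)"
      by (intro summable_suminf_not_top) auto
    then have "summable (\<lambda>n. f (Suc n) x - f n x)" by (rule summable_rabs_cancel)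
    then show "convergent (\<lambda>n. f n x)"
      using sum_lessThan_telescope[of "\<lambda>n. f n x"]
      by (simp only: summable_iff_convergent convergent_diff_const_right_iff)
  qed
  define F where "F x = lim (\<lambda>n. f n x)" for x
  have F_meas [measurable]: "F \<in> borel_measurable gauss"
    unfolding F_def by (rule borel_measurable_lim_metric) measurable
  have lim: "AE x in gauss. (\<lambda>n. f n x) \<longlonglongrightarrow> F x"
    using conv by eventually_elim (simp add: F_def convergent_LIMSEQ_iff)
  have bound: "\<exists>N. \<forall>n\<ge>N. (\<lambda>x. F x - f n x) \<in> L2 gauss \<and> norm (cls (\<lambda>x. F x - f n x)) \<le> e" if "0 < e" for e
  proof -
    obtain N where N: "\<And>m n. m \<ge> N \<Longrightarrow> n \<ge> N \<Longrightarrow> norm (X m - X n) < e"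
      using CauchyD[OF X \<open>0 < e\<close>] by blast
    have "(\<lambda>x. F x - f n x) \<in> L2 gauss \<and> norm (cls (\<lambda>x. F x - f n x)) \<le> e" if "n \<ge> N" for n
    proof -
      have "(\<integral>\<^sup>+x. ennreal ((F x - f n x)\<^sup>2) \<partial>gauss)
          = (\<integral>\<^sup>+x. liminf (\<lambda>m. ennreal ((f m x - f n x)\<^sup>2)) \<partial>gauss)"
      proof (rule nn_integral_cong_AE)
        show "AE x in gauss. ennreal ((F x - f n x)\<^sup>2) = liminf (\<lambda>m. ennreal ((f m x - f n x)\<^sup>2))"
          using lim
        proof eventually_elim
          fix x assume "(\<lambda>n. f n x) \<longlonglongrightarrow> F x"
          then have "(\<lambda>m. ennreal ((f m x - f n x)\<^sup>2)) \<longlonglongrightarrow> ennreal ((F x - f n x)\<^sup>2)"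
            by (intro tendsto_intros)
          then show "ennreal ((F x - f n x)\<^sup>2) = liminf (\<lambda>m. ennreal ((f m x - f n x)\<^sup>2))"
            using lim_imp_Liminf[OF trivial_limit_sequentially] by metis
        qed
      qed
      also have "\<dots> \<le> liminf (\<lambda>m. \<integral>\<^sup>+x. ennreal ((f m x - f n x)\<^sup>2) \<partial>gauss)"
        by (rule nn_integral_liminf) measurable
      also have "\<dots> \<le> liminf (\<lambda>m. ennreal (e\<^sup>2))"
      proof (rule Liminf_mono, rule eventually_sequentiallyI)
        fix m assume "N \<le> m"
        then have "norm (X (r m) - X (r n)) < e"
          using N \<open>n \<ge> N\<close> seq_suble[OF r(1)] by (meson order_trans)
        then have "(norm (cls (\<lambda>x. f m x - f n x)))\<^sup>2 \<le> e\<^sup>2"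
          by (intro power_mono) (auto simp: cls_diff[symmetric] f)
        then show "(\<integral>\<^sup>+x. ennreal ((f m x - f n x)\<^sup>2) \<partial>gauss) \<le> ennreal (e\<^sup>2)"
          using nn_integral_norm_cls[OF L2_diff[OF f(1) f(1)], of m n] by (simp add: ennreal_leI)
      qed
      also have "\<dots> = ennreal (e\<^sup>2)" by (simp add: Liminf_const)
      finally have le: "(\<integral>\<^sup>+x. ennreal ((F x - f n x)\<^sup>2) \<partial>gauss) \<le> ennreal (e\<^sup>2)" .
      have "(\<lambda>x. F x - f n x) \<in> borel_measurable gauss" by measurable
      from norm_cls_le_sqrtI[OF this _ le] \<open>0 < e\<close> show ?thesis by simp
    qed
    then show ?thesis by blast
  qed
  obtain n where "(\<lambda>x. F x - f n x) \<in> L2 gauss" using bound[of 1] by auto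
  from L2_add[OF this f(1)[of n]] have F: "F \<in> L2 gauss" by simp
  have "(X \<circ> r) \<longlonglongrightarrow> cls F"
  proof (rule LIMSEQ_I)
    fix e :: real assume "0 < e"
    then obtain N where N: "\<And>n. n \<ge> N \<Longrightarrow> norm (cls (\<lambda>x. F x - f n x)) \<le> e / 2"
      using bound[of "e / 2"] by auto
    have "norm ((X \<circ> r) n - cls F) < e" if "n \<ge> N" for n
      using N[OF that] \<open>0 < e\<close> by (simp add: cls_diff[symmetric] F f norm_minus_commute)
    then show "\<exists>no. \<forall>n\<ge>no. norm ((X \<circ> r) n - cls F) < e" by blast
  qed
  then have "X \<longlonglongrightarrow> cls F"
    using Cauchy_converges_subseq[OF X r(1)] by simp
  then show "convergent X" by (auto simp: convergent_def)
qed

subsection \<open>Contraction semigroups twisted by a fast unitary group\<close>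

text \<open>The parallelogram law for \<open>v - x\<close> and \<open>v - y\<close>. If both
  distances to \<open>v\<close> are nearly minimal, \<open>x\<close> and \<open>y\<close> are close,
  since the midpoint cannot be nearer than the minimum.\<close>

lemma norm_power2_minimizing_midpoint:
  fixes x y v :: "'h::real_inner"
  shows "(norm (x - y))\<^sup>2 = 2 * (norm (v - x))\<^sup>2 + 2 * (norm (v - y))\<^sup>2 - 4 * (norm (v - (1/2) *\<^sub>R (x + y)))\<^sup>2"
  by (simp add: power2_norm_eq_inner inner_diff_left inner_diff_right inner_add_left inner_add_right
      inner_commute algebra_simps)

lemma closed_subspace_projection:
  fixes K :: "'h::{real_inner, banach} set"
  assumes K: "subspace K" "closed K"
  obtains p where "p \<in> K" "\<And>k. k \<in> K \<Longrightarrow> inner (v - p) k = 0"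
proof -
  let ?D = "(\<lambda>k. norm (v - k)) ` K"
  define d where "d = Inf ?D"
  have K0: "0 \<in> K" using K(1) by (rule subspace_0)
  have bdd: "bdd_below ?D" by (rule bdd_belowI[of _ 0]) auto
  have d_le: "d \<le> norm (v - k)" if "k \<in> K" for k
    unfolding d_def using bdd that by (intro cInf_lower) auto
  have d0: "0 \<le> d" unfolding d_def using K0 by (intro cInf_greatest) auto
  have "\<exists>k\<in>K. norm (v - k) < d + 1 / real (Suc n)" for n
    using cInf_lessD[of ?D "d + 1 / real (Suc n)"] K0 by (auto simp: d_def)
  then obtain x where x: "\<And>n. x n \<in> K" "\<And>n. norm (v - x n) < d + 1 / real (Suc n)" by metis
  have mid: "d \<le> norm (v - (1/2) *\<^sub>R (x m + x n))" for m n
    using x(1) K(1) by (intro d_le) (simp add: subspace_add subspace_scale)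
  have sq: "(\<lambda>n. (norm (v - x n))\<^sup>2) \<longlonglongrightarrow> d\<^sup>2"
  proof (rule tendsto_power, rule tendsto_sandwich[of "\<lambda>_. d" _ _ "\<lambda>n. d + 1 / real (Suc n)"])
    show "(\<lambda>n. d + 1 / real (Suc n)) \<longlonglongrightarrow> d"
      using tendsto_add[OF tendsto_const LIMSEQ_Suc[OF lim_1_over_n], of d] by simp
    show "\<forall>\<^sub>F n in sequentially. norm (v - x n) \<le> d + 1 / real (Suc n)"
      using x(2) by (intro always_eventually allI less_imp_le)
  qed (use d_le x(1) in auto)
  have "Cauchy x"
  proof (rule CauchyI)
    fix e :: real assume "0 < e"
    then have "\<forall>\<^sub>F n in sequentially. (norm (v - x n))\<^sup>2 < d\<^sup>2 + e\<^sup>2 / 4"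
      using order_tendstoD(2)[OF sq, of "d\<^sup>2 + e\<^sup>2 / 4"] by simp
    then obtain N where N: "\<And>n. n \<ge> N \<Longrightarrow> (norm (v - x n))\<^sup>2 < d\<^sup>2 + e\<^sup>2 / 4"
      by (auto simp: eventually_sequentially)
    have "norm (x m - x n) < e" if "m \<ge> N" "n \<ge> N" for m n
    proof -
      have "(norm (x m - x n))\<^sup>2 < e\<^sup>2"
        using norm_power2_minimizing_midpoint[of "x m" "x n" v] N[OF that(1)] N[OF that(2)]
          power_mono[OF mid[of m n] d0, of 2] by linarith
      then show ?thesis using \<open>0 < e\<close> by (meson less_imp_le power_less_imp_less_base)
    qed
    then show "\<exists>M. \<forall>m\<ge>M. \<forall>n\<ge>M. norm (x m - x n) < e" by blast
  qed
  then obtain p where p: "x \<longlonglongrightarrow> p" using Cauchy_convergent convergentD by blast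
  have pK: "p \<in> K" using closed_sequentially[OF K(2) _ p] x(1) by blast
  have "(\<lambda>n. (norm (v - x n))\<^sup>2) \<longlonglongrightarrow> (norm (v - p))\<^sup>2"
    by (intro tendsto_intros p)
  then have np: "(norm (v - p))\<^sup>2 = d\<^sup>2" using LIMSEQ_unique sq by blast
  have orth: "inner (v - p) k = 0" if k: "k \<in> K" for k
  proof (rule ccontr)
    assume nz: "inner (v - p) k \<noteq> 0"
    then have kk: "0 < inner k k" by (auto simp: less_le)
    \<comment> \<open>The minimiser of the distance from \<open>v\<close> to
      \<open>p + s *\<^sub>R k\<close> over real \<open>s\<close>; a nonzero inner product would
      make this distance smaller than the infimum.\<close>
    define s where "s = inner (v - p) k / inner k k"
    have "p + s *\<^sub>R k \<in> K" using pK k K(1) by (simp add: subspace_add subspace_scale)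
    then have "d\<^sup>2 \<le> (norm (v - (p + s *\<^sub>R k)))\<^sup>2" using d_le d0 by (intro power_mono) auto
    also have "\<dots> = (norm (v - p))\<^sup>2 - (inner (v - p) k)\<^sup>2 / inner k k"
    proof -
      have "(norm (v - (p + s *\<^sub>R k)))\<^sup>2 = (norm (v - p))\<^sup>2 - 2 * s * inner (v - p) k + s\<^sup>2 * inner k k"
        unfolding power2_norm_eq_inner
        by (simp add: inner_diff_left inner_diff_right inner_add_left inner_add_right inner_commute
            power2_eq_square algebra_simps)
      then show ?thesis using kk by (simp add: s_def power2_eq_square field_simps)
    qed
    also have "\<dots> < d\<^sup>2" using np nz kk by simp
    finally show False by simp
  qed
  show ?thesis by (rule that[OF pK orth])
qed

lemma subspace_closure:
  fixes S :: "'h::real_normed_vector set"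
  assumes S: "subspace S"
  shows "subspace (closure S)"
proof (rule subspaceI)
  show "0 \<in> closure S" using subspace_0[OF S] closure_subset by blast
  fix x y assume "x \<in> closure S" "y \<in> closure S"
  then obtain u v where u: "\<And>n. u n \<in> S" "u \<longlonglongrightarrow> x" and v: "\<And>n. v n \<in> S" "v \<longlonglongrightarrow> y"
    unfolding closure_sequential by blast
  then show "x + y \<in> closure S"
    unfolding closure_sequential
    by (intro exI[of _ "\<lambda>n. u n + v n"]) (auto intro!: tendsto_add subspace_add[OF S])
next
  fix c x assume "x \<in> closure S"
  then obtain u where "\<And>n. u n \<in> S" "u \<longlonglongrightarrow> x"
    unfolding closure_sequential by blast
  then show "c *\<^sub>R x \<in> closure S"
    unfolding closure_sequential
    by (intro exI[of _ "\<lambda>n. c *\<^sub>R u n"]) (auto intro!: tendsto_intros subspace_scale[OF S])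
qed

text \<open>The residual of the projection onto the closed span is orthogonal to \<open>B\<close>,
  hence zero.\<close>

lemma dense_subspaceI:
  fixes B :: "'h::{real_inner, banach} set"
  assumes "\<And>m. (\<And>b. b \<in> B \<Longrightarrow> inner m b = 0) \<Longrightarrow> m = 0"
  shows "closure (span B) = UNIV"
proof -
  have "v \<in> closure (span B)" for v
  proof -
    obtain p where p: "p \<in> closure (span B)" "\<And>k. k \<in> closure (span B) \<Longrightarrow> inner (v - p) k = 0"
      using closed_subspace_projection[of "closure (span B)" v] subspace_closure[OF subspace_span] closed_closure
      by blast
    have "v - p = 0"
      by (rule assms) (use p closure_subset span_base in blast)
    then show ?thesis using p by simp
  qed
  then show ?thesis by auto
qed

locale unitary_group =
  fixes U :: "real \<Rightarrow> 'h::{real_inner, banach} \<Rightarrow> 'h"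
  assumes U_linear: "linear (U s)"
    and U_inner: "inner (U s x) (U s y) = inner x y"
    and U_0: "U 0 x = x"
    and U_add: "U (s + t) x = U s (U t x)"
begin

lemma U_norm: "norm (U s x) = norm x"
  by (simp add: norm_eq_sqrt_inner U_inner)

lemma U_inverse: "U (- s) (U s x) = x" "U s (U (- s) x) = x"
  using U_add[of "- s" s x] U_add[of s "- s" x] by (simp_all add: U_0)

lemma U_adjoint: "inner (U s x) y = inner x (U (- s) y)"
  using U_inner[of s x "U (- s) y"] by (simp add: U_inverse)

definition Fix :: "'h set" where "Fix = {x. \<forall>s. U s x = x}"

definition cobound :: "'h set" where "cobound = {U s x - x | s x. True}"

lemma subspace_Fix: "subspace Fix"
  by (auto simp: Fix_def subspace_def linear_0[OF U_linear] linear_add[OF U_linear] linear_scale[OF U_linear])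

lemma isCont_U: "isCont (U s) x"
proof -
  have "bounded_linear (U s)"
    using U_linear by (auto intro!: bounded_linear_intro[where K=1] simp: U_norm linear_add linear_scale)
  then show ?thesis by (rule linear_continuous_at)
qed

lemma closed_Fix: "closed Fix"
proof -
  have "closed {x. U s x = x}" for s
    using isCont_U by (intro closed_Collect_eq continuous_at_imp_continuous_on) auto
  then have "closed (\<Inter>s. {x. U s x = x})" by auto
  moreover have "Fix = (\<Inter>s. {x. U s x = x})" by (auto simp: Fix_def)
  ultimately show ?thesis by simp
qed

text \<open>With \<open>U s\<close> moved to the other side, a coboundary paired with
  \<open>x\<close> becomes \<open>w\<close> paired with \<open>U (- s) x - x\<close>, which
  vanishes.\<close>

lemma Fix_orthogonal_cobound:
  assumes "x \<in> Fix" "y \<in> closure (span cobound)"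
  shows "inner x y = 0"
proof -
  have "inner x z = 0" if "z \<in> cobound" for z
  proof -
    obtain s w where z: "z = U s w - w" using \<open>z \<in> cobound\<close> by (auto simp: cobound_def)
    have "inner x (U s w) = inner (U (- s) x) w" by (simp add: U_adjoint)
    then show ?thesis using assms(1) by (simp add: z inner_diff_right Fix_def)
  qed
  then have "span cobound \<subseteq> {z. inner x z = 0}"
    by (intro span_minimal) (auto simp: subspace_def inner_add_right)
  then have "closure (span cobound) \<subseteq> {z. inner x z = 0}"
    by (intro closure_minimal closed_Collect_eq continuous_intros)
  with assms(2) show ?thesis by auto
qed

text \<open>Half of the mean ergodic decomposition. The residual \<open>y - p\<close> of the
  projection onto the closed span of the coboundaries is orthogonal to all coboundaries, hence
  invariant by adjointness, hence orthogonal to \<open>y\<close> by assumption and to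
  \<open>p\<close> by construction, hence zero.\<close>

lemma orthogonal_Fix_cobound:
  assumes "\<And>x. x \<in> Fix \<Longrightarrow> inner y x = 0"
  shows "y \<in> closure (span cobound)"
proof -
  obtain p where p: "p \<in> closure (span cobound)"
      "\<And>k. k \<in> closure (span cobound) \<Longrightarrow> inner (y - p) k = 0"
    using closed_subspace_projection[of "closure (span cobound)" y] subspace_closure[OF subspace_span] closed_closure
    by blast
  have "U s (y - p) = y - p" for s
  proof -
    have "inner (U s (y - p) - (y - p)) z = 0" for z
    proof -
      have "U (- s) z - z \<in> closure (span cobound)"
        by (intro set_mp[OF closure_subset] span_base) (auto simp: cobound_def)
      from p(2)[OF this] show ?thesis
        by (simp add: inner_diff_left inner_diff_right U_adjoint)
    qed
    from this[of "U s (y - p) - (y - p)"] show ?thesis by simp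
  qed
  then have m: "y - p \<in> Fix" by (simp add: Fix_def)
  have "inner y (y - p) = 0" using assms[OF m] .
  moreover have "inner p (y - p) = 0" using p by (simp add: inner_commute)
  ultimately have "inner (y - p) (y - p) = 0" by (subst inner_diff_left) simp
  then show ?thesis using p by simp
qed

end

text \<open>\<open>G \<mu> t = U (\<mu> t) \<circ> T t\<close>. The Poisson equation is solved through the fixed-point equation
  \<open>u = \<integral>\<^sub>0\<^sup>t\<^sub>0 G \<mu> t x dt + G \<mu> t\<^sub>0 u\<close>, which is contractive uniformly in \<open>\<mu>\<close>.\<close>

locale twisted_semigroup = unitary_group U
  for U :: "real \<Rightarrow> 'h::{real_inner, banach} \<Rightarrow> 'h" +
  fixes T :: "real \<Rightarrow> 'h \<Rightarrow> 'h" and e :: 'h and t0 \<theta> :: real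
  assumes T_linear: "0 \<le> t \<Longrightarrow> linear (T t)"
    and T_contraction: "0 \<le> t \<Longrightarrow> norm (T t x) \<le> norm x"
    and T_0: "T 0 x = x"
    and T_add: "0 \<le> s \<Longrightarrow> 0 \<le> t \<Longrightarrow> T (s + t) x = T s (T t x)"
    and TU: "0 \<le> t \<Longrightarrow> T t (U s x) = U s (T t x)"
    and G_continuous: "continuous_on {0..} (\<lambda>t. U (\<mu> * t) (T t x))"
    and T_e: "0 \<le> t \<Longrightarrow> inner (T t x) e = inner x e"
    and T_fix_e: "0 \<le> t \<Longrightarrow> T t e = e"
    and U_e: "inner (U s x) e = inner x e"
    and norm_e: "norm e = 1"
    and t0: "0 < t0" and \<theta>: "0 \<le> \<theta>" "\<theta> < 1"
    and decay: "inner x e = 0 \<Longrightarrow> norm (T t0 x) \<le> \<theta> * norm x"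
begin

definition G :: "real \<Rightarrow> real \<Rightarrow> 'h \<Rightarrow> 'h" where "G \<mu> t x = U (\<mu> * t) (T t x)"

lemma G_linear: "0 \<le> t \<Longrightarrow> linear (G \<mu> t)"
  unfolding G_def using linear_compose[OF T_linear U_linear] by (simp add: o_def)

lemmas G_simps = linear_0[OF G_linear] linear_add[OF G_linear] linear_diff[OF G_linear]
  linear_scale[OF G_linear]

lemma G_contraction: "0 \<le> t \<Longrightarrow> norm (G \<mu> t x) \<le> norm x"
  by (simp add: G_def U_norm T_contraction)

lemma G_bounded_linear: "0 \<le> t \<Longrightarrow> bounded_linear (G \<mu> t)"
  by (rule bounded_linear_intro[where K=1]) (simp_all add: G_simps G_contraction)

lemma G_0: "G \<mu> 0 x = x"
  by (simp add: G_def U_0 T_0)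

lemma G_add: "0 \<le> s \<Longrightarrow> 0 \<le> t \<Longrightarrow> G \<mu> (s + t) x = G \<mu> s (G \<mu> t x)"
  by (simp add: G_def T_add distrib_left U_add TU)

lemma GU: "0 \<le> t \<Longrightarrow> G \<mu> t (U s x) = U s (G \<mu> t x)"
  by (simp add: G_def TU) (simp add: U_add[symmetric] add.commute)

lemma G_e: "0 \<le> t \<Longrightarrow> inner (G \<mu> t x) e = inner x e"
  by (simp add: G_def U_e T_e)

lemma G_cont: "A \<subseteq> {0..} \<Longrightarrow> continuous_on A (\<lambda>t. G \<mu> t x)"
  using G_continuous continuous_on_subset unfolding G_def by blast

lemma G_integrable: "0 \<le> a \<Longrightarrow> (\<lambda>t. G \<mu> t x) integrable_on {a..b}"
  by (intro integrable_continuous_real G_cont) auto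

lemma integral_G_diff:
  assumes "0 \<le> r" "0 \<le> t"
  shows "G \<mu> r (integral {0..t} (\<lambda>s. G \<mu> s x)) = integral {r..r + t} (\<lambda>s. G \<mu> s x)"
proof -
  have "G \<mu> r (integral {0..t} (\<lambda>s. G \<mu> s x)) = integral {0..t} (\<lambda>s. G \<mu> r (G \<mu> s x))"
    using integral_linear[OF G_integrable G_bounded_linear[OF assms(1)], of 0] by (simp add: o_def)
  also have "\<dots> = integral {0..t} (\<lambda>s. G \<mu> (s + r) x)"
    by (intro integral_cong) (simp add: assms G_add[symmetric] add.commute)
  also have "\<dots> = integral {r..r + t} (\<lambda>s. G \<mu> s x)"
    using integral_shift_real_ivl[of r r "r + t" "\<lambda>s. G \<mu> s x"] by simp
  finally show ?thesis .
qed

section \<open>The solution operator of the Poisson equation\<close>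

definition P0 :: "'h \<Rightarrow> 'h" where "P0 x = x - inner x e *\<^sub>R e"

definition I :: "real \<Rightarrow> real \<Rightarrow> 'h \<Rightarrow> 'h" where "I \<mu> t x = integral {0..t} (\<lambda>s. G \<mu> s x)"

text \<open>The inverse of minus the generator, preceded by centring. Integrating the derivative of
  \<open>G \<mu> t u\<close> from \<open>0\<close> to \<open>t0\<close> shows that a solution of the
  Poisson equation satisfies this equation; asking for it at the single time \<open>t0\<close>
  avoids the unbounded generator.\<close>

definition R :: "real \<Rightarrow> 'h \<Rightarrow> 'h" where
  "R \<mu> x = (THE u. inner u e = 0 \<and> u = I \<mu> t0 (P0 x) + G \<mu> t0 u)"

lemma P0_e: "inner (P0 x) e = 0"
  using norm_e by (simp add: P0_def inner_diff_left norm_eq_1)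

lemma P0_id: "inner x e = 0 \<Longrightarrow> P0 x = x"
  by (simp add: P0_def)

lemma norm_P0: "norm (P0 x) \<le> norm x"
proof -
  have "(norm (P0 x))\<^sup>2 = (norm x)\<^sup>2 - (inner x e)\<^sup>2"
    using norm_e unfolding power2_norm_eq_inner norm_eq_1
    by (simp add: P0_def inner_diff_left inner_diff_right inner_commute power2_eq_square)
  then have "(norm (P0 x))\<^sup>2 \<le> (norm x)\<^sup>2" by simp
  from power2_le_imp_le[OF this norm_ge_zero] show ?thesis .
qed

lemma U_fix_e: "U s e = e"
proof -
  have "inner (U s e - e) z = 0" for z
    using U_e[of "- s" z] by (simp only: inner_diff_left U_adjoint inner_commute[of e])
  from this[of "U s e - e"] show ?thesis by simp
qed

lemma P0_U: "P0 (U s x) = U s (P0 x)"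
  by (simp add: P0_def U_e linear_diff[OF U_linear] linear_scale[OF U_linear] U_fix_e)

lemma I_e: "inner x e = 0 \<Longrightarrow> inner (I \<mu> t x) e = 0"
proof -
  assume x: "inner x e = 0"
  have "inner (I \<mu> t x) e = integral {0..t} (\<lambda>s. inner (G \<mu> s x) e)"
    unfolding I_def
    by (rule integral_linear[OF G_integrable bounded_linear_inner_left, unfolded o_def, symmetric]) simp
  also have "\<dots> = integral {0..t} (\<lambda>s. 0)"
    by (intro integral_cong) (simp add: G_e x)
  finally show ?thesis by simp
qed

lemma I_norm: "0 \<le> t \<Longrightarrow> norm (I \<mu> t x) \<le> t * norm x"
  unfolding I_def using integral_bound[of 0 t "\<lambda>s. G \<mu> s x" "norm x"] G_cont[of "{0..t}" \<mu> x]
  by (auto simp: G_contraction mult.commute)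

lemma I_linear: "linear (I \<mu> t)"
proof
  show "I \<mu> t (x + y) = I \<mu> t x + I \<mu> t y" for x y
  proof -
    have "I \<mu> t (x + y) = integral {0..t} (\<lambda>s. G \<mu> s x + G \<mu> s y)"
      unfolding I_def by (intro integral_cong) (simp add: G_simps)
    then show ?thesis by (simp add: I_def integral_add G_integrable)
  qed
  show "I \<mu> t (c *\<^sub>R x) = c *\<^sub>R I \<mu> t x" for c x
  proof -
    have "I \<mu> t (c *\<^sub>R x) = integral {0..t} (\<lambda>s. c *\<^sub>R G \<mu> s x)"
      unfolding I_def by (intro integral_cong) (simp add: G_simps)
    then show ?thesis by (simp add: I_def)
  qed
qed

lemma I_commute:
  assumes A: "bounded_linear A" and AG: "\<And>s x. 0 \<le> s \<Longrightarrow> A (G \<mu> s x) = G \<mu> s (A x)"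
  shows "I \<mu> t (A x) = A (I \<mu> t x)"
proof -
  have "I \<mu> t (A x) = integral {0..t} (\<lambda>s. A (G \<mu> s x))"
    unfolding I_def by (intro integral_cong) (simp add: AG)
  also have "\<dots> = A (I \<mu> t x)"
    unfolding I_def by (rule integral_linear[OF G_integrable A, unfolded o_def]) simp
  finally show ?thesis .
qed

lemma G_decay: "inner x e = 0 \<Longrightarrow> norm (G \<mu> t0 x) \<le> \<theta> * norm x"
  by (simp add: G_def U_norm decay)

lemma G_fixed_zero: "inner x e = 0 \<Longrightarrow> G \<mu> t0 x = x \<Longrightarrow> x = 0"
proof -
  assume "inner x e = 0" "G \<mu> t0 x = x"
  then have "norm x \<le> \<theta> * norm x" using G_decay[of x \<mu>] by simp
  then have "(1 - \<theta>) * norm x \<le> 0" by (simp add: algebra_simps)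
  then show "x = 0" using \<theta> by (simp add: mult_le_0_iff)
qed

text \<open>Banach's fixed point theorem on the hyperplane orthogonal to \<open>e\<close>, where
  \<open>G \<mu> t0\<close> contracts by \<theta> for every \<mu>.\<close>

lemma R_ex1: "\<exists>!u. inner u e = 0 \<and> u = I \<mu> t0 (P0 x) + G \<mu> t0 u"
proof -
  have "\<exists>!u\<in>{u. inner u e = 0}. I \<mu> t0 (P0 x) + G \<mu> t0 u = u"
  proof (rule Banach_fix[where c=\<theta>])
    have "closed {u. inner u e = 0}" by (intro closed_Collect_eq continuous_intros)
    then show "uniform_space_class.complete {u. inner u e = 0}" by (simp only: complete_eq_closed)
    show "{u. inner u e = 0} \<noteq> {}" using inner_zero_left by blast
    show "(\<lambda>u. I \<mu> t0 (P0 x) + G \<mu> t0 u) ` {u. inner u e = 0} \<subseteq> {u. inner u e = 0}"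
      using t0 by (auto simp: inner_add_left I_e P0_e G_e)
    show "dist (I \<mu> t0 (P0 x) + G \<mu> t0 u) (I \<mu> t0 (P0 x) + G \<mu> t0 v) \<le> \<theta> * dist u v"
      if "u \<in> {u. inner u e = 0}" "v \<in> {u. inner u e = 0}" for u v
      using that G_decay[of "u - v" \<mu>] t0 by (simp add: dist_norm inner_diff_left G_simps)
  qed (use \<theta> in auto)
  moreover have "(u = I \<mu> t0 (P0 x) + G \<mu> t0 u) = (I \<mu> t0 (P0 x) + G \<mu> t0 u = u)" for u
    by auto
  ultimately show ?thesis by simp
qed

lemma R_e: "inner (R \<mu> x) e = 0"
  and R_eq: "R \<mu> x = I \<mu> t0 (P0 x) + G \<mu> t0 (R \<mu> x)"
  using theI'[OF R_ex1[of \<mu> x]] unfolding R_def[symmetric] by blast+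

lemma R_unique: "inner u e = 0 \<Longrightarrow> u = I \<mu> t0 (P0 x) + G \<mu> t0 u \<Longrightarrow> u = R \<mu> x"
  using R_ex1[of \<mu> x] R_e R_eq by blast

lemma R_norm: "norm (R \<mu> x) \<le> t0 / (1 - \<theta>) * norm x"
proof -
  have "norm (R \<mu> x) \<le> norm (I \<mu> t0 (P0 x)) + norm (G \<mu> t0 (R \<mu> x))"
    by (subst R_eq) (rule norm_triangle_ineq)
  also have "\<dots> \<le> t0 * norm x + \<theta> * norm (R \<mu> x)"
    using I_norm[of t0 \<mu> "P0 x"] t0 mult_left_mono[OF norm_P0, of t0 x] G_decay[OF R_e, of \<mu> \<mu> x]
    by linarith
  finally have "(1 - \<theta>) * norm (R \<mu> x) \<le> t0 * norm x" by (simp add: algebra_simps)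
  then show ?thesis using \<theta> by (simp add: field_simps)
qed

lemma P0_linear: "linear P0"
  by (rule linearI) (simp_all add: P0_def inner_add_left algebra_simps)

lemma R_linear: "linear (R \<mu>)"
proof
  show "R \<mu> (x + y) = R \<mu> x + R \<mu> y" for x y
  proof (rule R_unique[symmetric])
    have "R \<mu> x + R \<mu> y = (I \<mu> t0 (P0 x) + G \<mu> t0 (R \<mu> x)) + (I \<mu> t0 (P0 y) + G \<mu> t0 (R \<mu> y))"
      by (rule arg_cong2[where f="(+)", OF R_eq R_eq])
    also have "\<dots> = I \<mu> t0 (P0 (x + y)) + G \<mu> t0 (R \<mu> x + R \<mu> y)"
      using t0 by (simp add: G_simps linear_add[OF P0_linear] linear_add[OF I_linear])
    finally show "R \<mu> x + R \<mu> y = I \<mu> t0 (P0 (x + y)) + G \<mu> t0 (R \<mu> x + R \<mu> y)" .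
  qed (simp add: inner_add_left R_e)
  show "R \<mu> (c *\<^sub>R x) = c *\<^sub>R R \<mu> x" for c x
  proof (rule R_unique[symmetric])
    have "c *\<^sub>R R \<mu> x = c *\<^sub>R (I \<mu> t0 (P0 x) + G \<mu> t0 (R \<mu> x))"
      by (rule arg_cong[where f="(*\<^sub>R) c", OF R_eq])
    also have "\<dots> = I \<mu> t0 (P0 (c *\<^sub>R x)) + G \<mu> t0 (c *\<^sub>R R \<mu> x)"
      using t0 by (simp add: G_simps linear_scale[OF P0_linear] linear_scale[OF I_linear] scaleR_add_right)
    finally show "c *\<^sub>R R \<mu> x = I \<mu> t0 (P0 (c *\<^sub>R x)) + G \<mu> t0 (c *\<^sub>R R \<mu> x)" .
  qed (simp add: R_e)
qed

text \<open>An operator that commutes with the semigroup and respects the mean sends the fixed point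
  for \<open>x\<close> to a fixed point for \<open>A x\<close>; uniqueness does the rest.\<close>

lemma R_commute:
  assumes A: "bounded_linear A" and AG: "\<And>s x. 0 \<le> s \<Longrightarrow> A (G \<mu> s x) = G \<mu> s (A x)"
    and Ae: "\<And>x. inner (A x) e = inner x e" and AP: "P0 (A x) = A (P0 x)"
  shows "R \<mu> (A x) = A (R \<mu> x)"
proof (rule R_unique[symmetric])
  have "A (R \<mu> x) = A (I \<mu> t0 (P0 x) + G \<mu> t0 (R \<mu> x))"
    by (rule arg_cong[where f=A, OF R_eq])
  also have "\<dots> = I \<mu> t0 (P0 (A x)) + G \<mu> t0 (A (R \<mu> x))"
    using t0 by (simp add: linear_add[OF bounded_linear.linear[OF A]] AG I_commute[OF A AG] AP)
  finally show "A (R \<mu> x) = I \<mu> t0 (P0 (A x)) + G \<mu> t0 (A (R \<mu> x))" .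
qed (simp add: Ae R_e)

lemma bounded_linear_U: "bounded_linear (U s)"
  using U_linear by (auto intro!: bounded_linear_intro[where K=1] simp: U_norm linear_add linear_scale)

lemma R_U: "R \<mu> (U s x) = U s (R \<mu> x)"
  by (rule R_commute) (simp_all add: bounded_linear_U GU U_e P0_U)

lemma G_zero_T: "G 0 t x = T t x"
  by (simp add: G_def U_0)

lemma T_G: "0 \<le> t \<Longrightarrow> 0 \<le> s \<Longrightarrow> T t (G \<mu> s x) = G \<mu> s (T t x)"
  by (simp add: G_def TU T_add[symmetric] add.commute)

lemma R_T:
  assumes t: "0 \<le> t"
  shows "R \<mu> (x - T t x) = R \<mu> x - T t (R \<mu> x)"
proof -
  have "G 0 t = T t" by (rule ext) (rule G_zero_T)
  then have "bounded_linear (T t)" using G_bounded_linear[OF t, of 0] by simp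
  then have "R \<mu> (T t x) = T t (R \<mu> x)"
    using t by (intro R_commute)
       (simp_all add: G_zero_T T_G T_e P0_def linear_diff[OF T_linear] linear_scale[OF T_linear] T_fix_e)
  then show ?thesis by (simp add: linear_diff[OF R_linear])
qed

text \<open>The defining equation concerns the time \<open>t0\<close> only. The defect
  \<open>w\<close> at another time \<open>d\<close> is invariant under \<open>G \<mu> t0\<close> and
  has mean zero, so the contraction forces it to vanish.\<close>

lemma R_resolvent:
  assumes d: "0 \<le> d"
  shows "R \<mu> x - G \<mu> d (R \<mu> x) = I \<mu> d (P0 x)"
proof -
  define u where "u = R \<mu> x"
  define y where "y = P0 x"
  have t0': "0 \<le> t0" using t0 by simp
  define w where "w = u - G \<mu> d u - I \<mu> d y"
  have we: "inner w e = 0"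
    by (simp add: w_def inner_diff_left u_def R_e G_e d I_e y_def P0_e)
  have u: "u = I \<mu> t0 y + G \<mu> t0 u" unfolding u_def y_def by (rule R_eq)
  have comb: "I \<mu> a y + G \<mu> a (I \<mu> b y) = I \<mu> (a + b) y" if "0 \<le> a" "0 \<le> b" for a b
    unfolding I_def using that
    by (simp add: integral_G_diff Henstock_Kurzweil_Integration.integral_combine G_integrable)
  \<comment> \<open>Both sides are the integral over the interval from \<open>0\<close> to
    \<open>t0 + d\<close>.\<close>
  have sw: "I \<mu> t0 y + G \<mu> t0 (I \<mu> d y) = I \<mu> d y + G \<mu> d (I \<mu> t0 y)"
    using comb[OF t0' d] comb[OF d t0'] by (simp add: add.commute)
  have a: "G \<mu> t0 u = u - I \<mu> t0 y" by (metis add_diff_cancel_left' u)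
  have "G \<mu> t0 (G \<mu> d u) = G \<mu> d (G \<mu> t0 u)"
    by (simp add: d t0' G_add[symmetric] add.commute)
  then have b: "G \<mu> t0 (G \<mu> d u) = G \<mu> d u - G \<mu> d (I \<mu> t0 y)"
    by (simp add: a G_simps d)
  have c: "G \<mu> t0 (I \<mu> d y) = I \<mu> d y + G \<mu> d (I \<mu> t0 y) - I \<mu> t0 y"
    by (metis add_diff_cancel_left' sw)
  have "G \<mu> t0 w = w"
    by (simp add: w_def G_simps t0' a b c)
  from G_fixed_zero[OF we this] show ?thesis by (simp add: w_def u_def y_def)
qed

lemma I_derivative: "((\<lambda>d. (1 / d) *\<^sub>R I \<mu> d x) \<longlongrightarrow> x) (at_right 0)"
proof -
  have "((\<lambda>d. I \<mu> d x) has_vector_derivative G \<mu> 0 x) (at 0 within {0..1})"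
    unfolding I_def by (rule integral_has_vector_derivative[OF G_cont]) auto
  then have "((\<lambda>d. norm (I \<mu> d x - d *\<^sub>R x) / \<bar>d\<bar>) \<longlongrightarrow> 0) (at_right 0)"
    unfolding has_vector_derivative_def has_derivative_iff_norm
    by (simp add: I_def G_0 at_within_Icc_at_right)
  moreover have "\<forall>\<^sub>F d in at_right 0. norm (I \<mu> d x - d *\<^sub>R x) / \<bar>d\<bar> = norm ((1 / d) *\<^sub>R I \<mu> d x - x)"
    unfolding eventually_at_right_field
  proof (rule exI[of _ 1], intro conjI allI impI)
    fix d :: real assume "0 < d"
    then have "(1 / d) *\<^sub>R I \<mu> d x - x = (1 / d) *\<^sub>R (I \<mu> d x - d *\<^sub>R x)"
      by (simp add: scaleR_diff_right)
    then show "norm (I \<mu> d x - d *\<^sub>R x) / \<bar>d\<bar> = norm ((1 / d) *\<^sub>R I \<mu> d x - x)" by simp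
  qed simp
  ultimately have "((\<lambda>d. norm ((1 / d) *\<^sub>R I \<mu> d x - x)) \<longlongrightarrow> 0) (at_right 0)"
    by (rule Lim_transform_eventually)
  then show ?thesis by (metis LIM_zero_cancel tendsto_norm_zero_cancel)
qed

lemma R_generator: "((\<lambda>d. (1 / d) *\<^sub>R (G \<mu> d (R \<mu> x) - R \<mu> x)) \<longlongrightarrow> - P0 x) (at_right 0)"
proof (rule Lim_transform_eventually)
  show "((\<lambda>d. - ((1 / d) *\<^sub>R I \<mu> d (P0 x))) \<longlongrightarrow> - P0 x) (at_right 0)"
    by (intro tendsto_minus I_derivative)
  show "\<forall>\<^sub>F d in at_right 0. - ((1 / d) *\<^sub>R I \<mu> d (P0 x)) = (1 / d) *\<^sub>R (G \<mu> d (R \<mu> x) - R \<mu> x)"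
    unfolding eventually_at_right_field
    by (rule exI[of _ 1]) (simp add: R_resolvent[symmetric] scaleR_diff_right)
qed

lemma G_diff_le: "0 \<le> h \<Longrightarrow> norm (G \<mu> (real n * h) z - z) \<le> real n * norm (G \<mu> h z - z)"
proof (induction n)
  case (Suc n)
  have "G \<mu> (real (Suc n) * h) z - z = G \<mu> (real n * h) (G \<mu> h z - z) + (G \<mu> (real n * h) z - z)"
    using Suc.prems by (simp add: G_simps G_add[symmetric] algebra_simps)
  then have "norm (G \<mu> (real (Suc n) * h) z - z) \<le> norm (G \<mu> h z - z) + real n * norm (G \<mu> h z - z)"
    using Suc G_contraction[of "real n * h" \<mu> "G \<mu> h z - z"]
    by (smt (verit) mult_nonneg_nonneg norm_triangle_ineq of_nat_0_le_iff)
  then show ?case by (simp add: algebra_simps)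
qed (simp add: G_0)

text \<open>The difference \<open>z\<close> of two solutions has zero derivative at time
  \<open>0\<close>. Dividing \<open>t0\<close> into \<open>Suc n\<close> equal steps bounds
  \<open>G \<mu> t0 z - z\<close> by \<open>t0\<close> times a difference quotient that tends to
  zero, so \<open>z\<close> is fixed and therefore zero.\<close>

lemma R_generator_unique:
  assumes u: "inner u e = 0"
    and lim: "((\<lambda>d. (1 / d) *\<^sub>R (G \<mu> d u - u)) \<longlongrightarrow> - P0 x) (at_right 0)"
  shows "u = R \<mu> x"
proof -
  define z where "z = u - R \<mu> x"
  have "((\<lambda>d. (1 / d) *\<^sub>R (G \<mu> d u - u) - (1 / d) *\<^sub>R (G \<mu> d (R \<mu> x) - R \<mu> x)) \<longlongrightarrow> - P0 x - - P0 x) (at_right 0)"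
    by (intro tendsto_diff lim R_generator)
  moreover have "\<forall>\<^sub>F d in at_right 0. (1 / d) *\<^sub>R (G \<mu> d u - u) - (1 / d) *\<^sub>R (G \<mu> d (R \<mu> x) - R \<mu> x)
      = (1 / d) *\<^sub>R (G \<mu> d z - z)"
    unfolding eventually_at_right_field
    by (rule exI[of _ 1]) (simp add: z_def G_simps scaleR_diff_right[symmetric])
  ultimately have "((\<lambda>d. (1 / d) *\<^sub>R (G \<mu> d z - z)) \<longlongrightarrow> 0) (at_right 0)"
    using Lim_transform_eventually by fastforce
  moreover have "filterlim (\<lambda>n. t0 / real (Suc n)) (at_right 0) sequentially"
    unfolding filterlim_at using t0 tendsto_mult_right_zero[OF LIMSEQ_Suc[OF lim_1_over_n], of t0]
    by (auto simp: divide_inverse)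
  ultimately have "(\<lambda>n. (1 / (t0 / real (Suc n))) *\<^sub>R (G \<mu> (t0 / real (Suc n)) z - z)) \<longlonglongrightarrow> 0"
    by (rule filterlim_compose)
  then have "(\<lambda>n. t0 * norm ((1 / (t0 / real (Suc n))) *\<^sub>R (G \<mu> (t0 / real (Suc n)) z - z))) \<longlonglongrightarrow> 0"
    by (intro tendsto_mult_right_zero tendsto_norm_zero)
  moreover have "norm (G \<mu> t0 z - z) \<le> t0 * norm ((1 / (t0 / real (Suc n))) *\<^sub>R (G \<mu> (t0 / real (Suc n)) z - z))" for n
    using G_diff_le[of "t0 / real (Suc n)" \<mu> "Suc n" z] t0 by simp
  ultimately have "norm (G \<mu> t0 z - z) \<le> 0"
    by (intro LIMSEQ_le_const) auto
  then have "z = 0"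
    using u R_e by (intro G_fixed_zero[of z \<mu>]) (auto simp: z_def inner_diff_left)
  then show ?thesis by (simp add: z_def)
qed

text \<open>Contractivity makes the generator dissipative: each difference quotient at
  \<open>R \<mu> x\<close>, paired with \<open>R \<mu> x\<close>, is nonpositive, and the quotients
  tend to \<open>- P0 x\<close>.\<close>

lemma R_nonneg: "0 \<le> inner (R \<mu> x) (P0 x)"
proof -
  have lim: "((\<lambda>d. inner ((1 / d) *\<^sub>R (G \<mu> d (R \<mu> x) - R \<mu> x)) (R \<mu> x)) \<longlongrightarrow> inner (- P0 x) (R \<mu> x)) (at_right 0)"
    by (intro tendsto_intros R_generator)
  have "inner ((1 / d) *\<^sub>R (G \<mu> d u - u)) u \<le> 0" if "0 < d" for d u
  proof -
    have "inner (G \<mu> d u) u \<le> norm (G \<mu> d u) * norm u" by (rule norm_cauchy_schwarz)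
    also have "\<dots> \<le> norm u * norm u" using that by (intro mult_right_mono G_contraction) auto
    also have "\<dots> = inner u u" by (simp add: norm_eq_sqrt_inner)
    finally show ?thesis using that by (simp add: inner_diff_left divide_nonpos_pos)
  qed
  then have "\<forall>\<^sub>F d in at_right 0. inner ((1 / d) *\<^sub>R (G \<mu> d (R \<mu> x) - R \<mu> x)) (R \<mu> x) \<le> 0"
    unfolding eventually_at_right_field by (auto intro!: exI[of _ 1])
  from tendsto_upperbound[OF lim this] show ?thesis by (simp add: inner_commute)
qed

section \<open>The solution operator for large \<mu>\<close>

lemma e_Fix: "e \<in> Fix"
  by (simp add: Fix_def U_fix_e)

lemma P0_Fix: "x \<in> Fix \<Longrightarrow> P0 x \<in> Fix"
  by (auto simp: Fix_def P0_U[symmetric])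

lemma R_Fix: "x \<in> Fix \<Longrightarrow> R \<mu> x \<in> Fix"
  by (auto simp: Fix_def R_U[symmetric])

text \<open>\<open>T t\<close> maps \<open>Fix\<close> into itself, so on a fixed vector the twist
  by \<open>U (\<mu> * t)\<close> acts as the identity and the two fixed-point equations
  coincide.\<close>

lemma R_Fix_eq:
  assumes x: "x \<in> Fix"
  shows "R \<mu> x = R 0 x"
proof (rule R_unique[symmetric])
  have G_Fix: "G \<mu> t y = G 0 t y" if "y \<in> Fix" "0 \<le> t" for t y
    using that TU[of t "\<mu> * t" y] by (simp add: G_def Fix_def U_0)
  have "I \<mu> t0 (P0 x) = I 0 t0 (P0 x)"
    unfolding I_def using G_Fix[OF P0_Fix[OF x]] by (intro integral_cong) auto
  moreover have "G \<mu> t0 (R 0 x) = G 0 t0 (R 0 x)"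
    using G_Fix[OF R_Fix[OF x]] t0 by simp
  ultimately show "R 0 x = I \<mu> t0 (P0 x) + G \<mu> t0 (R 0 x)" using R_eq[of 0 x] by simp
qed (rule R_e)

lemma R_bounded_linear: "bounded_linear (R \<mu>)"
  using R_norm R_linear
  by (auto intro!: bounded_linear_intro[where K="t0 / (1 - \<theta>)"] simp: linear_add linear_scale mult.commute)

lemma R_cobound_orthogonal_Fix:
  assumes "y \<in> closure (span cobound)" "x \<in> Fix"
  shows "inner (R \<mu> y) x = 0"
proof -
  have "inner (R \<mu> (U s w - w)) x = 0" for s w
    using assms(2) by (simp add: linear_diff[OF R_linear] R_U inner_diff_left U_adjoint Fix_def)
  then have "span cobound \<subseteq> {y. inner (R \<mu> y) x = 0}"
    by (intro span_minimal)
       (auto simp: cobound_def subspace_def inner_add_left linear_0[OF R_linear] linear_add[OF R_linear] linear_scale[OF R_linear])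
  then have "closure (span cobound) \<subseteq> {y. inner (R \<mu> y) x = 0}"
    by (intro closure_minimal closed_Collect_eq continuous_intros linear_continuous_on R_bounded_linear)
  with assms(1) show ?thesis by auto
qed

text \<open>With \<open>\<delta> = s / \<mu>\<close>, one has \<open>G \<mu> \<delta> = U s \<circ> T \<delta>\<close>, so that \<open>U s\<close> almost leaves the solution \<open>R \<mu> g\<close> invariant.\<close>

lemma R_cobound_bound:
  assumes s: "0 \<le> s" and \<mu>: "0 < \<mu>"
  shows "norm (R \<mu> (U s g - g)) \<le> t0 / (1 - \<theta>) * norm (g - T (s / \<mu>) g) + s / \<mu> * norm g"
proof -
  define d where "d = s / \<mu>"
  have d: "0 \<le> d" "\<mu> * d = s" using s \<mu> by (simp_all add: d_def)
  define u where "u = R \<mu> g"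
  have "R \<mu> (U s g - g) = U s u - u" by (simp add: u_def linear_diff[OF R_linear] R_U)
  also have "\<dots> = U s (u - T d u) - I \<mu> d (P0 g)"
    by (simp add: u_def linear_diff[OF U_linear] R_resolvent[OF d(1), symmetric] G_def d)
  also have "norm \<dots> \<le> norm (u - T d u) + norm (I \<mu> d (P0 g))"
    by (metis U_norm norm_triangle_ineq4)
  also have "u - T d u = R \<mu> (g - T d g)" by (simp add: u_def R_T d)
  also have "norm (R \<mu> (g - T d g)) \<le> t0 / (1 - \<theta>) * norm (g - T d g)" by (rule R_norm)
  also have "norm (I \<mu> d (P0 g)) \<le> d * norm g"
    using I_norm[OF d(1), of \<mu> "P0 g"] mult_left_mono[OF norm_P0 d(1), of g] by linarith
  finally show ?thesis by (simp add: d_def)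
qed

lemma R_cobound_tendsto:
  assumes s: "0 \<le> s"
  shows "((\<lambda>\<mu>. R \<mu> (U s g - g)) \<longlongrightarrow> 0) at_top"
proof (rule Lim_null_comparison)
  show "\<forall>\<^sub>F \<mu> in at_top. norm (R \<mu> (U s g - g)) \<le> t0 / (1 - \<theta>) * norm (g - T (s / \<mu>) g) + s / \<mu> * norm g"
    using eventually_gt_at_top[of 0] by eventually_elim (rule R_cobound_bound[OF s])
  have "continuous (at 0 within {0..}) (\<lambda>t. T t g)"
    using G_cont[of "{0..}" 0 g] by (simp add: G_zero_T continuous_on_eq_continuous_within)
  then have T: "((\<lambda>t. T t g) \<longlongrightarrow> g) (at 0 within {0..})"
    by (simp add: continuous_within T_0)
  have lim0: "((\<lambda>\<mu>. s / \<mu>) \<longlongrightarrow> 0) at_top"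
    by (rule tendsto_divide_0[OF tendsto_const]) (rule filterlim_at_top_imp_at_infinity[OF filterlim_ident])
  have "((\<lambda>\<mu>. T (s / \<mu>) g) \<longlongrightarrow> g) at_top"
  proof (cases "s = 0")
    case False
    have "\<forall>\<^sub>F \<mu> in at_top. s / \<mu> \<in> {0..} \<and> s / \<mu> \<noteq> 0"
      using eventually_gt_at_top[of 0] by eventually_elim (use s False in auto)
    then have "filterlim (\<lambda>\<mu>. s / \<mu>) (at 0 within {0..}) at_top"
      unfolding filterlim_at using lim0 by simp
    from filterlim_compose[OF T this] show ?thesis .
  qed (simp add: T_0)
  then have "((\<lambda>\<mu>. t0 / (1 - \<theta>) * norm (g - T (s / \<mu>) g) + s / \<mu> * norm g)
      \<longlongrightarrow> t0 / (1 - \<theta>) * norm (g - g) + 0 * norm g) at_top"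
    by (intro tendsto_intros lim0)
  then show "((\<lambda>\<mu>. t0 / (1 - \<theta>) * norm (g - T (s / \<mu>) g) + s / \<mu> * norm g) \<longlongrightarrow> 0) at_top" by simp
qed

text \<open>Having limit zero is a linear condition, so the span is covered by the single
  coboundaries; the bound of \<open>R \<mu>\<close>, uniform in \<mu>, extends this to the
  closure.\<close>

lemma R_closure_cobound_tendsto:
  assumes y: "y \<in> closure (span cobound)"
  shows "((\<lambda>\<mu>. R \<mu> y) \<longlongrightarrow> 0) at_top"
proof -
  let ?Z = "{y. ((\<lambda>\<mu>. R \<mu> y) \<longlongrightarrow> 0) at_top}"
  have "U s g - g \<in> ?Z" for s g
  proof (cases "0 \<le> s")
    case False
    \<comment> \<open>For negative \<open>s\<close> the coboundary is minus the coboundary of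
      \<open>U s g\<close> for the positive time \<open>- s\<close>.\<close>
    have "R \<mu> (U s g - g) = - R \<mu> (U (- s) (U s g) - U s g)" for \<mu>
      by (simp add: U_inverse linear_diff[OF R_linear])
    then show ?thesis using tendsto_minus[OF R_cobound_tendsto[of "- s" "U s g"]] False by simp
  qed (use R_cobound_tendsto in simp)
  then have span: "span cobound \<subseteq> ?Z"
    by (intro span_minimal)
       (auto simp: cobound_def subspace_def linear_0[OF R_linear] linear_add[OF R_linear]
         linear_scale[OF R_linear] intro!: tendsto_add_zero tendsto_scaleR[OF tendsto_const, where b=0, simplified])
  define C where "C = t0 / (1 - \<theta>)"
  have C: "0 < C" using t0 \<theta> by (simp add: C_def)
  show ?thesis
  proof (rule tendstoI)
    fix r :: real assume "0 < r"
    then have "0 < r / 2 / C" using C by simp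
    then obtain z where z: "z \<in> span cobound" "dist z y < r / 2 / C"
      using y closure_approachable by blast
    have "\<forall>\<^sub>F \<mu> in at_top. dist (R \<mu> z) 0 < r / 2"
      using span z(1) \<open>0 < r\<close> tendstoD[of "\<lambda>\<mu>. R \<mu> z" 0 at_top "r / 2"] by auto
    then show "\<forall>\<^sub>F \<mu> in at_top. dist (R \<mu> y) 0 < r"
    proof eventually_elim
      fix \<mu> assume "dist (R \<mu> z) 0 < r / 2"
      moreover have "norm (R \<mu> (y - z)) < r / 2"
        using R_norm[of \<mu> "y - z"] z(2) C
        by (fold C_def) (simp add: dist_norm norm_minus_commute field_simps)
      ultimately show "dist (R \<mu> y) 0 < r"
        using norm_triangle_ineq[of "R \<mu> z" "R \<mu> (y - z)"] by (simp add: linear_diff[OF R_linear])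
    qed
  qed
qed

theorem R_limit:
  assumes y: "y \<in> Fix" and z: "z \<in> closure (span cobound)"
  shows "((\<lambda>\<mu>. inner (R \<mu> (y + z)) (P0 (y + z))) \<longlongrightarrow> inner (R 0 y) (P0 y)) at_top"
    and "inner (R 0 y) (P0 y) \<le> inner (R 0 (y + z)) (P0 (y + z))"
proof -
  have Pz: "P0 z = z"
    using Fix_orthogonal_cobound[OF e_Fix z] by (simp add: P0_id inner_commute)
  have eq: "inner (R \<mu> (y + z)) (P0 (y + z)) = inner (R 0 y) (P0 y) + inner (R \<mu> z) z" for \<mu>
    using Fix_orthogonal_cobound[OF R_Fix[OF y] z] R_cobound_orthogonal_Fix[OF z P0_Fix[OF y]] R_Fix_eq[OF y, of \<mu>]
    by (simp add: linear_add[OF R_linear] linear_add[OF P0_linear] Pz inner_add_left inner_add_right)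
  have "((\<lambda>\<mu>. inner (R 0 y) (P0 y) + inner (R \<mu> z) z) \<longlongrightarrow> inner (R 0 y) (P0 y) + inner 0 z) at_top"
    by (intro tendsto_intros R_closure_cobound_tendsto z)
  then show "((\<lambda>\<mu>. inner (R \<mu> (y + z)) (P0 (y + z))) \<longlongrightarrow> inner (R 0 y) (P0 y)) at_top"
    by (simp add: eq)
  show "inner (R 0 y) (P0 y) \<le> inner (R 0 (y + z)) (P0 (y + z))"
    using R_nonneg[of 0 z] by (simp add: eq Pz)
qed

end

instance l2 :: (euclidean_space) banach ..

subsection \<open>Mehler operators\<close>

definition one_l2 :: "'a::euclidean_space l2" where "one_l2 = cls (\<lambda>x. 1)"

definition cos_l2 :: "'a::euclidean_space \<Rightarrow> 'a l2" where "cos_l2 \<xi> = cls (\<lambda>x. cos (\<xi> \<bullet> x))"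

definition sin_l2 :: "'a::euclidean_space \<Rightarrow> 'a l2" where "sin_l2 \<xi> = cls (\<lambda>x. sin (\<xi> \<bullet> x))"

lemma L2_borel: "f \<in> L2 gauss \<Longrightarrow> f \<in> borel_measurable borel"
  using L2_measurable[of f gauss] by simp

lemma one_L2: "(\<lambda>x. 1) \<in> L2 gauss"
  by (simp add: L2_const)

lemma cos_L2: "(\<lambda>x. cos (\<xi> \<bullet> x)) \<in> L2 gauss"
  by (rule L2_bounded[where B=1]) (auto intro!: borel_measurable_continuous_onI continuous_intros)

lemma sin_L2: "(\<lambda>x. sin (\<xi> \<bullet> x)) \<in> L2 gauss"
  by (rule L2_bounded[where B=1]) (auto intro!: borel_measurable_continuous_onI continuous_intros)

lemma cf_cos_sin:
  fixes M :: "'a::euclidean_space measure"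
  assumes "finite_measure M" "sets M = sets borel"
  shows "cf M \<xi> = Complex (\<integral>x. cos (\<xi> \<bullet> x) \<partial>M) (\<integral>x. sin (\<xi> \<bullet> x) \<partial>M)"
proof -
  note [measurable_cong] = assms(2)
  have int: "integrable M (\<lambda>x. iexp (\<xi> \<bullet> x))"
    by (rule integrable_iexp[OF assms(1)]) measurable
  have "Re (cf M \<xi>) = (\<integral>x. cos (\<xi> \<bullet> x) \<partial>M)" "Im (cf M \<xi>) = (\<integral>x. sin (\<xi> \<bullet> x) \<partial>M)"
    unfolding cf_def using integral_Re[OF int] integral_Im[OF int]
    by (simp_all add: cis_conv_exp[symmetric])
  then show ?thesis by (simp add: complex_eq_iff)
qed

lemma integral_gauss_cos: "(\<integral>x. cos (\<xi> \<bullet> x) \<partial>gauss) = exp (- (\<xi> \<bullet> \<xi>) / 2)"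
  and integral_gauss_sin: "(\<integral>x. sin (\<xi> \<bullet> x) \<partial>gauss) = 0"
  using cf_cos_sin[OF finite_measure_gauss sets_gauss, of \<xi>] cf_gauss[of \<xi>]
  by (auto simp: complex_eq_iff)

text \<open>If \<open>f\<close> is orthogonal to all of these functions, its positive and negative
  parts are densities of finite measures with the same characteristic function, hence equal almost
  everywhere.\<close>

lemma trig_dense:
  "closure (span (range cos_l2 \<union> range sin_l2)) = (UNIV :: 'a::euclidean_space l2 set)"
proof (rule dense_subspaceI)
  fix m :: "'a l2"
  assume orth: "\<And>b. b \<in> range cos_l2 \<union> range sin_l2 \<Longrightarrow> inner m b = 0"
  obtain f where f: "f \<in> L2 gauss" "m = cls f" by (rule cls_cases)
  have [measurable]: "f \<in> borel_measurable gauss" by (rule L2_measurable[OF f(1)])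
  have intf: "integrable gauss f" by (rule L2_integrable[OF finite_measure_gauss f(1)])
  define fp fm where "fp x = max 0 (f x)" and "fm x = max 0 (- f x)" for x
  have [measurable]: "fp \<in> borel_measurable gauss" "fm \<in> borel_measurable gauss"
    unfolding fp_def fm_def by measurable
  have pm: "fp x - fm x = f x" "0 \<le> fp x" "0 \<le> fm x" for x by (auto simp: fp_def fm_def)
  have int: "integrable gauss fp" "integrable gauss fm"
    unfolding fp_def fm_def using intf by auto
  let ?M = "density gauss (\<lambda>x. ennreal (fp x))" and ?N = "density gauss (\<lambda>x. ennreal (fm x))"
  have fin: "finite_measure ?M" "finite_measure ?N"
    using int pm by (auto intro!: finite_measureI simp: emeasure_density nn_integral_eq_integral)
  have "cf ?M \<xi> = cf ?N \<xi>" for \<xi>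
  proof -
    have b: "integrable gauss (\<lambda>x. g x * cos (\<xi> \<bullet> x))" "integrable gauss (\<lambda>x. g x * sin (\<xi> \<bullet> x))"
      if "integrable gauss g" for g
      using that by (auto intro!: Bochner_Integration.integrable_bound[OF that] borel_measurable_times
          borel_measurable_continuous_onI continuous_intros simp: abs_mult mult_left_le)
    have "(\<integral>x. f x * cos (\<xi> \<bullet> x) \<partial>gauss) = 0" "(\<integral>x. f x * sin (\<xi> \<bullet> x) \<partial>gauss) = 0"
      using orth[of "cos_l2 \<xi>"] orth[of "sin_l2 \<xi>"]
      by (simp_all add: cos_l2_def sin_l2_def f cls_inner cos_L2 sin_L2)
    then have "(\<integral>x. fp x * cos (\<xi> \<bullet> x) \<partial>gauss) = (\<integral>x. fm x * cos (\<xi> \<bullet> x) \<partial>gauss)"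
      "(\<integral>x. fp x * sin (\<xi> \<bullet> x) \<partial>gauss) = (\<integral>x. fm x * sin (\<xi> \<bullet> x) \<partial>gauss)"
      using Bochner_Integration.integral_diff[OF b(1)[OF int(1)] b(1)[OF int(2)]]
        Bochner_Integration.integral_diff[OF b(2)[OF int(1)] b(2)[OF int(2)]]
      by (simp_all add: left_diff_distrib[symmetric] pm)
    then show ?thesis
      by (simp add: cf_cos_sin[OF fin(1)] cf_cos_sin[OF fin(2)] integral_density pm)
  qed
  from measure_eqI_cf[OF fin _ _ this] have "?M = ?N" by simp
  then have "AE x in gauss. ennreal (fp x) = ennreal (fm x)"
    by (intro iffD1[OF sigma_finite_measure.density_unique_iff])
       (auto intro: prob_space_imp_sigma_finite prob_space_gauss)
  then have "AE x in gauss. f x = 0"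
    by eventually_elim (metis diff_self ennreal_inj pm)
  then show "m = 0" using f by (simp add: cls_eq_iff L2_zero flip: cls_zero)
qed

text \<open>\<open>gauss_noise K \<nu>\<close> says that \<open>\<nu>\<close> is the centred Gaussian with covariance \<open>I - K K\<^sup>*\<close>, so that \<open>K x + y\<close>
  is standard Gaussian when \<open>x\<close> is and \<open>y\<close> has law \<open>\<nu>\<close>.\<close>

definition gauss_noise :: "('a::euclidean_space \<Rightarrow> 'a) \<Rightarrow> 'a measure \<Rightarrow> bool" where
  "gauss_noise K \<nu> \<longleftrightarrow> linear K \<and> prob_space \<nu> \<and> sets \<nu> = sets borel \<and>
     (\<forall>\<xi>. cf \<nu> \<xi> = of_real (exp (- (\<xi> \<bullet> \<xi> - adjoint K \<xi> \<bullet> adjoint K \<xi>) / 2)))"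

definition mehler :: "('a::euclidean_space \<Rightarrow> 'a) \<Rightarrow> 'a measure \<Rightarrow> ('a \<Rightarrow> real) \<Rightarrow> 'a \<Rightarrow> real" where
  "mehler K \<nu> f x = (\<integral>y. f (K x + y) \<partial>\<nu>)"

definition mehler_l2 :: "('a::euclidean_space \<Rightarrow> 'a) \<Rightarrow> 'a measure \<Rightarrow> 'a l2 \<Rightarrow> 'a l2" where
  "mehler_l2 K \<nu> x = cls (mehler K \<nu> (rpr x))"

lemma borel_measurable_linear: "linear K \<Longrightarrow> K \<in> borel_measurable borel"
  for K :: "'a::euclidean_space \<Rightarrow> 'b::euclidean_space"
  by (intro borel_measurable_continuous_onI linear_continuous_on) (simp add: linear_conv_bounded_linear)

context
  fixes K :: "'a::euclidean_space \<Rightarrow> 'a" and \<nu> :: "'a measure"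
  assumes noise: "gauss_noise K \<nu>"
begin

lemma noise_linear: "linear K"
  and noise_prob: "prob_space \<nu>"
  and noise_sets: "sets \<nu> = sets borel"
  and noise_cf: "cf \<nu> \<xi> = of_real (exp (- (\<xi> \<bullet> \<xi> - adjoint K \<xi> \<bullet> adjoint K \<xi>) / 2))"
  using noise by (auto simp: gauss_noise_def)

lemma noise_measurable [measurable]: "K \<in> borel_measurable borel"
  by (rule borel_measurable_linear[OF noise_linear])

lemma noise_convolution: "distr (gauss \<Otimes>\<^sub>M \<nu>) borel (\<lambda>(x, y). K x + y) = gauss"
proof -
  note [measurable_cong] = noise_sets
  interpret N: prob_space \<nu> by (rule noise_prob)
  interpret G: prob_space "gauss :: 'a measure" by (rule prob_space_gauss)
  interpret P: pair_prob_space "gauss :: 'a measure" \<nu> ..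
  show ?thesis
  proof (rule measure_eqI_cf)
    show "finite_measure (distr (gauss \<Otimes>\<^sub>M \<nu>) borel (\<lambda>(x, y). K x + y))"
      by (rule P.finite_measure_distr) measurable
    fix \<xi>
    have "cf (distr (gauss \<Otimes>\<^sub>M \<nu>) borel (\<lambda>(x, y). K x + y)) \<xi>
        = (CLINT z|gauss \<Otimes>\<^sub>M \<nu>. iexp (\<xi> \<bullet> (case z of (x, y) \<Rightarrow> K x + y)))"
      by (rule cf_distr) measurable
    also have "\<dots> = (CLINT z|gauss \<Otimes>\<^sub>M \<nu>. (\<lambda>(x, y). iexp (adjoint K \<xi> \<bullet> x) * iexp (\<xi> \<bullet> y)) z)"
      by (intro Bochner_Integration.integral_cong refl)
         (auto simp: inner_add_right adjoint_works[OF noise_linear] inner_commute[of \<xi> "K _"]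
           inner_commute[of "adjoint K \<xi>"] distrib_left exp_add split: prod.split)
    also have "\<dots> = (CLINT x|gauss. CLINT y|\<nu>. iexp (adjoint K \<xi> \<bullet> x) * iexp (\<xi> \<bullet> y))"
    proof -
      have "integrable (gauss \<Otimes>\<^sub>M \<nu>) (\<lambda>(x, y). iexp (adjoint K \<xi> \<bullet> x) * iexp (\<xi> \<bullet> y))"
        by (rule P.integrable_const_bound[where B=1]) (auto simp: norm_mult)
      from P.integral_fst'[OF this] show ?thesis by simp
    qed
    also have "\<dots> = cf gauss (adjoint K \<xi>) * cf \<nu> \<xi>"
      by (simp add: cf_def)
    also have "\<dots> = cf gauss \<xi>"
      by (simp add: cf_gauss noise_cf exp_add[symmetric] field_simps flip: of_real_mult)
    finally show "cf (distr (gauss \<Otimes>\<^sub>M \<nu>) borel (\<lambda>(x, y). K x + y)) \<xi> = cf gauss \<xi>" .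
  qed simp_all
qed

lemma mehler_measurable:
  assumes [measurable]: "f \<in> borel_measurable borel"
  shows "mehler K \<nu> f \<in> borel_measurable borel"
proof -
  note [measurable_cong] = noise_sets
  interpret N: prob_space \<nu> by (rule noise_prob)
  show ?thesis unfolding mehler_def by measurable
qed

lemma nn_integral_noise:
  assumes [measurable]: "f \<in> borel_measurable borel"
  shows "(\<integral>\<^sup>+x. \<integral>\<^sup>+y. f (K x + y) \<partial>\<nu> \<partial>gauss) = (\<integral>\<^sup>+x. f x \<partial>gauss)"
proof -
  note [measurable_cong] = noise_sets
  interpret N: prob_space \<nu> by (rule noise_prob)
  have "(\<integral>\<^sup>+x. f x \<partial>gauss) = (\<integral>\<^sup>+x. f x \<partial>distr (gauss \<Otimes>\<^sub>M \<nu>) borel (\<lambda>(x, y). K x + y))"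
    by (simp add: noise_convolution)
  also have "\<dots> = (\<integral>\<^sup>+z. f (case z of (x, y) \<Rightarrow> K x + y) \<partial>(gauss \<Otimes>\<^sub>M \<nu>))"
    by (rule nn_integral_distr) measurable
  also have "\<dots> = (\<integral>\<^sup>+x. \<integral>\<^sup>+y. f (K x + y) \<partial>\<nu> \<partial>gauss)"
    by (subst N.nn_integral_fst[symmetric]) (auto simp: split_beta')
  finally show ?thesis ..
qed

text \<open>Integrating the indicator of a null set over start and noise gives zero by
  \<open>nn_integral_noise\<close>. This makes \<open>mehler\<close> compatible with
  almost-everywhere equality.\<close>

lemma AE_noise:
  assumes "AE x in gauss. P x"
  shows "AE x in gauss. AE y in \<nu>. P (K x + y)"
proof -
  note [measurable_cong] = noise_sets
  interpret N: prob_space \<nu> by (rule noise_prob)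
  obtain A where A: "A \<in> null_sets gauss" "{x. \<not> P x} \<subseteq> A"
    using assms by (auto simp: eventually_ae_filter)
  then have [measurable]: "A \<in> sets borel" by auto
  have "(\<integral>\<^sup>+x. \<integral>\<^sup>+y. indicator A (K x + y) \<partial>\<nu> \<partial>gauss) = 0"
    using A(1) by (subst nn_integral_noise) (auto simp: null_sets_def)
  then have "AE x in gauss. (\<integral>\<^sup>+y. indicator A (K x + y) \<partial>\<nu>) = 0"
    by (subst (asm) nn_integral_0_iff_AE) measurable
  then show ?thesis
  proof eventually_elim
    fix x assume "(\<integral>\<^sup>+y. indicator A (K x + y) \<partial>\<nu>) = 0"
    then have "AE y in \<nu>. indicator A (K x + y) = (0::ennreal)"
      by (subst (asm) nn_integral_0_iff_AE) measurable
    then show "AE y in \<nu>. P (K x + y)"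
      by eventually_elim (use A(2) in \<open>auto split: split_indicator_asm\<close>)
  qed
qed

lemma mehler_cong_AE:
  assumes [measurable]: "f \<in> borel_measurable borel" "g \<in> borel_measurable borel"
    and "AE x in gauss. f x = g x"
  shows "AE x in gauss. mehler K \<nu> f x = mehler K \<nu> g x"
proof -
  note [measurable_cong] = noise_sets
  show ?thesis using AE_noise[OF assms(3)]
    unfolding mehler_def by eventually_elim (intro integral_cong_AE; measurable)
qed

text \<open>Jensen's inequality for the square, obtained from the nonnegative variance of
  \<open>f (K x + y)\<close> under the noise.\<close>

lemma mehler_square_le:
  assumes [measurable]: "f \<in> borel_measurable borel"
  shows "ennreal ((mehler K \<nu> f x)\<^sup>2) \<le> (\<integral>\<^sup>+y. ennreal ((f (K x + y))\<^sup>2) \<partial>\<nu>)"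
proof (cases "(\<integral>\<^sup>+y. ennreal ((f (K x + y))\<^sup>2) \<partial>\<nu>) = \<infinity>")
  case False
  note [measurable_cong] = noise_sets
  interpret N: prob_space \<nu> by (rule noise_prob)
  have i2: "integrable \<nu> (\<lambda>y. (f (K x + y))\<^sup>2)"
    using False by (intro integrableI_bounded) (auto simp: less_top)
  then have L2: "(\<lambda>y. f (K x + y)) \<in> L2 \<nu>" by (simp add: L2_def)
  then have i1: "integrable \<nu> (\<lambda>y. f (K x + y))"
    by (rule L2_integrable[OF N.finite_measure_axioms])
  define m where "m = mehler K \<nu> f x"
  have "0 \<le> (\<integral>y. (f (K x + y) - m)\<^sup>2 \<partial>\<nu>)" by simp
  also have "\<dots> = (\<integral>y. (f (K x + y))\<^sup>2 - 2 * m * f (K x + y) + m\<^sup>2 \<partial>\<nu>)"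
    by (simp add: power2_diff algebra_simps)
  also have "\<dots> = (\<integral>y. (f (K x + y))\<^sup>2 \<partial>\<nu>) - 2 * m * m + m\<^sup>2"
    using i1 i2 by (simp add: N.prob_space mehler_def[symmetric] m_def[symmetric])
  finally have "m\<^sup>2 \<le> (\<integral>y. (f (K x + y))\<^sup>2 \<partial>\<nu>)" by (simp add: power2_eq_square)
  then show ?thesis
    using i2 by (simp add: nn_integral_eq_integral m_def[symmetric] ennreal_leI)
qed simp

lemma mehler_L2:
  assumes f: "f \<in> L2 gauss"
  shows "mehler K \<nu> f \<in> L2 gauss" "norm (cls (mehler K \<nu> f)) \<le> norm (cls f)"
proof -
  have [measurable]: "f \<in> borel_measurable borel" using L2_measurable[OF f] by simp
  have "(\<integral>\<^sup>+x. ennreal ((mehler K \<nu> f x)\<^sup>2) \<partial>gauss) \<le> (\<integral>\<^sup>+x. \<integral>\<^sup>+y. ennreal ((f (K x + y))\<^sup>2) \<partial>\<nu> \<partial>gauss)"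
    by (intro nn_integral_mono mehler_square_le) measurable
  also have "\<dots> = ennreal ((norm (cls f))\<^sup>2)"
    using nn_integral_noise[of "\<lambda>z. ennreal ((f z)\<^sup>2)"] by (simp add: nn_integral_norm_cls f)
  finally have le: "(\<integral>\<^sup>+x. ennreal ((mehler K \<nu> f x)\<^sup>2) \<partial>gauss) \<le> ennreal ((norm (cls f))\<^sup>2)" .
  show "mehler K \<nu> f \<in> L2 gauss" "norm (cls (mehler K \<nu> f)) \<le> norm (cls f)"
    using norm_cls_le_sqrtI[OF _ norm_ge_zero le] mehler_measurable[of f] by auto
qed

lemma mehler_l2_cls:
  assumes f: "f \<in> L2 gauss"
  shows "mehler_l2 K \<nu> (cls f) = cls (mehler K \<nu> f)"
  unfolding mehler_l2_def
  using mehler_cong_AE[OF L2_borel L2_borel rpr_cls[OF f], OF rpr_L2 f]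
  by (subst cls_eq_iff) (auto intro: mehler_L2 rpr_L2 f)

lemma mehler_l2_norm: "norm (mehler_l2 K \<nu> x) \<le> norm x"
  using mehler_L2(2)[OF rpr_L2, of x] by (simp add: mehler_l2_def)

lemma AE_integrable_noise:
  assumes f: "f \<in> L2 gauss"
  shows "AE x in gauss. integrable \<nu> (\<lambda>y. f (K x + y))"
proof -
  note [measurable_cong] = noise_sets
  interpret N: prob_space \<nu> by (rule noise_prob)
  have [measurable]: "f \<in> borel_measurable borel" using L2_measurable[OF f] by simp
  have "(\<integral>\<^sup>+x. \<integral>\<^sup>+y. ennreal (norm (f (K x + y))) \<partial>\<nu> \<partial>gauss) = (\<integral>\<^sup>+x. ennreal (norm (f x)) \<partial>gauss)"
    by (rule nn_integral_noise) measurable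
  also have "\<dots> \<noteq> \<infinity>"
    using L2_integrable[OF finite_measure_gauss f] by (simp add: integrable_iff_bounded less_top)
  finally have "AE x in gauss. (\<integral>\<^sup>+y. ennreal (norm (f (K x + y))) \<partial>\<nu>) \<noteq> \<infinity>"
    by (intro nn_integral_PInf_AE) measurable
  then show ?thesis
    by eventually_elim (rule integrableI_bounded, measurable, simp add: less_top)
qed

lemma mehler_l2_linear: "linear (mehler_l2 K \<nu>)"
proof (rule linearI)
  show "mehler_l2 K \<nu> (x + y) = mehler_l2 K \<nu> x + mehler_l2 K \<nu> y" for x y
  proof -
    obtain f where f: "f \<in> L2 gauss" "x = cls f" by (rule cls_cases)
    obtain g where g: "g \<in> L2 gauss" "y = cls g" by (rule cls_cases)
    have "AE x in gauss. mehler K \<nu> (\<lambda>x. f x + g x) x = mehler K \<nu> f x + mehler K \<nu> g x"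
      using AE_integrable_noise[OF f(1)] AE_integrable_noise[OF g(1)]
      by eventually_elim (simp add: mehler_def)
    then show ?thesis
      using f g by (simp add: cls_add mehler_l2_cls L2_add mehler_L2 cls_eq_iff)
  qed
  show "mehler_l2 K \<nu> (c *\<^sub>R x) = c *\<^sub>R mehler_l2 K \<nu> x" for c x
  proof -
    obtain f where f: "f \<in> L2 gauss" "x = cls f" by (rule cls_cases)
    then show ?thesis
      by (simp add: cls_scale mehler_l2_cls L2_scale mehler_L2) (simp add: mehler_def[abs_def])
  qed
qed

lemma mehler_l2_bounded_linear: "bounded_linear (mehler_l2 K \<nu>)"
  by (rule bounded_linear_intro[where K=1])
     (simp_all add: linear_add[OF mehler_l2_linear] linear_scale[OF mehler_l2_linear] mehler_l2_norm)

lemma noise_cos_sin: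
  "(\<integral>y. cos (\<xi> \<bullet> y) \<partial>\<nu>) = exp (- (\<xi> \<bullet> \<xi> - adjoint K \<xi> \<bullet> adjoint K \<xi>) / 2)"
  "(\<integral>y. sin (\<xi> \<bullet> y) \<partial>\<nu>) = 0"
  using cf_cos_sin[OF prob_space.axioms(1)[OF noise_prob] noise_sets, of \<xi>] noise_cf[of \<xi>]
  by (auto simp: complex_eq_iff)

lemma mehler_trig:
  "mehler K \<nu> (\<lambda>x. cos (\<xi> \<bullet> x)) x = exp (- (\<xi> \<bullet> \<xi> - adjoint K \<xi> \<bullet> adjoint K \<xi>) / 2) * cos (adjoint K \<xi> \<bullet> x)"
  "mehler K \<nu> (\<lambda>x. sin (\<xi> \<bullet> x)) x = exp (- (\<xi> \<bullet> \<xi> - adjoint K \<xi> \<bullet> adjoint K \<xi>) / 2) * sin (adjoint K \<xi> \<bullet> x)"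
proof -
  note [measurable_cong] = noise_sets
  interpret N: prob_space \<nu> by (rule noise_prob)
  have Kx: "\<xi> \<bullet> K x = adjoint K \<xi> \<bullet> x" by (simp add: adjoint_works[OF noise_linear] inner_commute)
  have ints: "integrable \<nu> (\<lambda>y. cos (\<xi> \<bullet> y))" "integrable \<nu> (\<lambda>y. sin (\<xi> \<bullet> y))"
    by (auto intro!: N.integrable_const_bound[where B=1] borel_measurable_continuous_onI continuous_intros
       simp: measurable_cong_sets[OF noise_sets refl])
  show "mehler K \<nu> (\<lambda>x. cos (\<xi> \<bullet> x)) x = exp (- (\<xi> \<bullet> \<xi> - adjoint K \<xi> \<bullet> adjoint K \<xi>) / 2) * cos (adjoint K \<xi> \<bullet> x)"
    "mehler K \<nu> (\<lambda>x. sin (\<xi> \<bullet> x)) x = exp (- (\<xi> \<bullet> \<xi> - adjoint K \<xi> \<bullet> adjoint K \<xi>) / 2) * sin (adjoint K \<xi> \<bullet> x)"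
    unfolding mehler_def inner_add_right Kx cos_add sin_add using ints
    by (simp_all add: noise_cos_sin)
qed

lemma mehler_l2_trig:
  "mehler_l2 K \<nu> (cos_l2 \<xi>) = exp (- (\<xi> \<bullet> \<xi> - adjoint K \<xi> \<bullet> adjoint K \<xi>) / 2) *\<^sub>R cos_l2 (adjoint K \<xi>)"
  "mehler_l2 K \<nu> (sin_l2 \<xi>) = exp (- (\<xi> \<bullet> \<xi> - adjoint K \<xi> \<bullet> adjoint K \<xi>) / 2) *\<^sub>R sin_l2 (adjoint K \<xi>)"
  by (simp_all add: cos_l2_def sin_l2_def mehler_l2_cls cos_L2 sin_L2 cls_scale mehler_trig[abs_def] del: mult_exp_exp)

end

declare noise_measurable [measurable del]

lemma trig_dense_induct:
  fixes P :: "'a::euclidean_space l2 \<Rightarrow> bool"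
  assumes sub: "subspace {x. P x}" and closed: "closed {x. P x}"
    and trig: "\<And>\<xi>. P (cos_l2 \<xi>)" "\<And>\<xi>. P (sin_l2 \<xi>)"
  shows "P x"
proof -
  have "closure (span (range cos_l2 \<union> range sin_l2)) \<subseteq> {x. P x}"
    using trig by (intro closure_minimal span_minimal sub closed) auto
  then show ?thesis by (auto simp: trig_dense)
qed

lemma bounded_linear_eq_on_trig:
  fixes A B :: "'a::euclidean_space l2 \<Rightarrow> 'b::real_normed_vector"
  assumes A: "bounded_linear A" and B: "bounded_linear B"
    and "\<And>\<xi>. A (cos_l2 \<xi>) = B (cos_l2 \<xi>)" "\<And>\<xi>. A (sin_l2 \<xi>) = B (sin_l2 \<xi>)"
  shows "A x = B x"
proof (rule trig_dense_induct[where P="\<lambda>x. A x = B x"])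
  interpret A: bounded_linear A by fact
  interpret B: bounded_linear B by fact
  show "subspace {x. A x = B x}"
    by (auto simp: subspace_def A.add B.add A.scaleR B.scaleR A.zero B.zero)
  show "closed {x. A x = B x}"
    by (intro closed_Collect_eq linear_continuous_on A B)
qed (use assms in auto)

lemma adjoint_compose_linear:
  fixes K1 K2 :: "'a::euclidean_space \<Rightarrow> 'a"
  assumes "linear K1" "linear K2"
  shows "adjoint (\<lambda>x. K2 (K1 x)) \<xi> = adjoint K1 (adjoint K2 \<xi>)"
proof -
  have "adjoint (\<lambda>x. K2 (K1 x)) = (\<lambda>\<xi>. adjoint K1 (adjoint K2 \<xi>))"
    by (rule adjoint_unique) (simp add: adjoint_works assms)
  then show ?thesis by simp
qed

text \<open>On trigonometric functions the exponents telescope, so it suffices that \<nu>3 has the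
  right covariance; it is not exhibited as a convolution. The operators multiply in the order
  opposite to the maps.\<close>

lemma mehler_l2_compose:
  assumes n1: "gauss_noise K1 \<nu>1" and n2: "gauss_noise K2 \<nu>2" and n3: "gauss_noise (\<lambda>x. K2 (K1 x)) \<nu>3"
  shows "mehler_l2 K1 \<nu>1 (mehler_l2 K2 \<nu>2 x) = mehler_l2 (\<lambda>x. K2 (K1 x)) \<nu>3 x"
proof (rule bounded_linear_eq_on_trig[where A="\<lambda>x. mehler_l2 K1 \<nu>1 (mehler_l2 K2 \<nu>2 x)"])
  show "bounded_linear (\<lambda>x. mehler_l2 K1 \<nu>1 (mehler_l2 K2 \<nu>2 x))"
    by (rule bounded_linear_compose[OF mehler_l2_bounded_linear[OF n1] mehler_l2_bounded_linear[OF n2]])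
  show "bounded_linear (mehler_l2 (\<lambda>x. K2 (K1 x)) \<nu>3)"
    by (rule mehler_l2_bounded_linear[OF n3])
  note lin = noise_linear[OF n1] noise_linear[OF n2]
  show "mehler_l2 K1 \<nu>1 (mehler_l2 K2 \<nu>2 (cos_l2 \<xi>)) = mehler_l2 (\<lambda>x. K2 (K1 x)) \<nu>3 (cos_l2 \<xi>)" for \<xi>
    by (simp add: mehler_l2_trig[OF n1] mehler_l2_trig[OF n2] mehler_l2_trig[OF n3]
        linear_scale[OF mehler_l2_linear[OF n1]] adjoint_compose_linear[OF lin] exp_add[symmetric] field_simps)
  show "mehler_l2 K1 \<nu>1 (mehler_l2 K2 \<nu>2 (sin_l2 \<xi>)) = mehler_l2 (\<lambda>x. K2 (K1 x)) \<nu>3 (sin_l2 \<xi>)" for \<xi>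
    by (simp add: mehler_l2_trig[OF n1] mehler_l2_trig[OF n2] mehler_l2_trig[OF n3]
        linear_scale[OF mehler_l2_linear[OF n1]] adjoint_compose_linear[OF lin] exp_add[symmetric] field_simps)
qed


text \<open>The product formulas give integrals at the frequencies \<open>\<xi> - \<eta>\<close> and
  \<open>\<xi> + \<eta>\<close>. Up to the weights the Gram kernels are \<open>cosh\<close> and
  \<open>sinh\<close>, whose power series have nonnegative coefficients; the decay estimate rests on
  this.\<close>

lemma inner_trig:
  fixes \<xi> \<eta> :: "'a::euclidean_space"
  defines "w \<equiv> exp (- (\<xi> \<bullet> \<xi>) / 2) * exp (- (\<eta> \<bullet> \<eta>) / 2)"
  shows "inner (cos_l2 \<xi>) (cos_l2 \<eta>) = w * cosh (\<xi> \<bullet> \<eta>)"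
    "inner (sin_l2 \<xi>) (sin_l2 \<eta>) = w * sinh (\<xi> \<bullet> \<eta>)"
    "inner (cos_l2 \<xi>) (sin_l2 \<eta>) = 0"
proof -
  have m: "integrable gauss (\<lambda>x. cos (\<zeta> \<bullet> x))" "integrable gauss (\<lambda>x. sin (\<zeta> \<bullet> x))" for \<zeta> :: 'a
    by (rule L2_integrable[OF finite_measure_gauss cos_L2] L2_integrable[OF finite_measure_gauss sin_L2])+
  have e: "exp (- ((\<xi> - \<eta>) \<bullet> (\<xi> - \<eta>)) / 2) = w * exp (\<xi> \<bullet> \<eta>)"
    "exp (- ((\<xi> + \<eta>) \<bullet> (\<xi> + \<eta>)) / 2) = w * exp (- (\<xi> \<bullet> \<eta>))"
    by (simp_all add: w_def exp_add[symmetric] inner_diff_left inner_diff_right inner_add_left inner_add_right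
        inner_commute field_simps)
  have p: "cos (\<xi> \<bullet> x) * cos (\<eta> \<bullet> x) = (cos ((\<xi> - \<eta>) \<bullet> x) + cos ((\<xi> + \<eta>) \<bullet> x)) / 2"
    "sin (\<xi> \<bullet> x) * sin (\<eta> \<bullet> x) = (cos ((\<xi> - \<eta>) \<bullet> x) - cos ((\<xi> + \<eta>) \<bullet> x)) / 2"
    "cos (\<xi> \<bullet> x) * sin (\<eta> \<bullet> x) = (sin ((\<xi> + \<eta>) \<bullet> x) - sin ((\<xi> - \<eta>) \<bullet> x)) / 2" for x
    by (simp_all only: cos_times_cos sin_times_sin cos_times_sin inner_diff_left inner_add_left)
  have add: "(\<integral>x. (f x + g x) / 2 \<partial>gauss) = ((\<integral>x. f x \<partial>gauss) + (\<integral>x. g x \<partial>gauss)) / 2"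
    and diff: "(\<integral>x. (f x - g x) / 2 \<partial>gauss) = ((\<integral>x. f x \<partial>gauss) - (\<integral>x. g x \<partial>gauss)) / 2"
    if "integrable gauss f" "integrable gauss g" for f g :: "'a \<Rightarrow> real"
    using that by simp_all
  show "inner (cos_l2 \<xi>) (cos_l2 \<eta>) = w * cosh (\<xi> \<bullet> \<eta>)"
    unfolding cos_l2_def cls_inner[OF cos_L2 cos_L2] p add[OF m(1) m(1)] integral_gauss_cos e
    by (simp add: cosh_def distrib_left)
  show "inner (sin_l2 \<xi>) (sin_l2 \<eta>) = w * sinh (\<xi> \<bullet> \<eta>)"
    unfolding sin_l2_def cls_inner[OF sin_L2 sin_L2] p diff[OF m(1) m(1)] integral_gauss_cos e
    by (simp add: sinh_def right_diff_distrib)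
  show "inner (cos_l2 \<xi>) (sin_l2 \<eta>) = 0"
    unfolding cos_l2_def sin_l2_def cls_inner[OF cos_L2 sin_L2] p diff[OF m(2) m(2)] integral_gauss_sin
    by simp
qed

text \<open>A map into a Hilbert space is continuous when its Gram kernel is, since the squared
  distance of two values is a combination of kernel values.\<close>

lemma
  shows continuous_cos_l2: "continuous_on UNIV (cos_l2 :: 'a::euclidean_space \<Rightarrow> 'a l2)"
    and continuous_sin_l2: "continuous_on UNIV (sin_l2 :: 'a \<Rightarrow> 'a l2)"
proof -
  let ?w = "\<lambda>\<xi> \<eta>::'a. exp (- (\<xi> \<bullet> \<xi>) / 2) * exp (- (\<eta> \<bullet> \<eta>) / 2)"
  have gen: "continuous_on UNIV f" if G: "\<And>\<xi> \<eta>. inner (f \<xi>) (f \<eta>) = ?w \<xi> \<eta> * h (\<xi> \<bullet> \<eta>)" and h: "continuous_on UNIV h"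
    for f :: "'a \<Rightarrow> 'a l2" and h
  proof (intro continuous_at_imp_continuous_on ballI)
    fix \<eta> :: 'a
    have hc: "isCont h x" for x using h by (simp add: continuous_on_eq_continuous_at)
    have "((\<lambda>\<xi>. (norm (f \<xi> - f \<eta>))\<^sup>2) \<longlongrightarrow>
        ?w \<eta> \<eta> * h (\<eta> \<bullet> \<eta>) + ?w \<eta> \<eta> * h (\<eta> \<bullet> \<eta>) - 2 * (?w \<eta> \<eta> * h (\<eta> \<bullet> \<eta>))) (at \<eta>)"
    proof -
      have "(norm (f \<xi> - f \<eta>))\<^sup>2 = ?w \<xi> \<xi> * h (\<xi> \<bullet> \<xi>) + ?w \<eta> \<eta> * h (\<eta> \<bullet> \<eta>) - 2 * (?w \<xi> \<eta> * h (\<xi> \<bullet> \<eta>))" for \<xi>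
        unfolding power2_norm_eq_inner
        by (simp add: inner_diff_left inner_diff_right G inner_commute algebra_simps)
      moreover have "((\<lambda>\<xi>. h (\<xi> \<bullet> \<xi>)) \<longlongrightarrow> h (\<eta> \<bullet> \<eta>)) (at \<eta>)" "((\<lambda>\<xi>. h (\<xi> \<bullet> \<eta>)) \<longlongrightarrow> h (\<eta> \<bullet> \<eta>)) (at \<eta>)"
        by (rule isCont_tendsto_compose[OF hc], rule tendsto_intros, rule tendsto_ident_at, simp add: tendsto_ident_at)+
      moreover have "((\<lambda>\<xi>. exp (- (\<xi> \<bullet> \<xi>) / 2)) \<longlongrightarrow> exp (- (\<eta> \<bullet> \<eta>) / 2)) (at \<eta>)"
        by (auto intro!: tendsto_eq_intros)
      ultimately show ?thesis by (simp only:) (intro tendsto_add tendsto_diff tendsto_mult tendsto_const)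
    qed
    then have "((\<lambda>\<xi>. sqrt ((norm (f \<xi> - f \<eta>))\<^sup>2)) \<longlongrightarrow> sqrt 0) (at \<eta>)"
      by (intro tendsto_real_sqrt) simp
    then show "isCont f \<eta>"
      by (simp add: isCont_def LIM_zero_iff tendsto_norm_zero_iff)
  qed
  have "continuous_on UNIV (cosh :: real \<Rightarrow> real)" "continuous_on UNIV (sinh :: real \<Rightarrow> real)"
    unfolding cosh_def sinh_def by (intro continuous_intros)+
  from gen[OF inner_trig(1) this(1)] gen[OF inner_trig(2) this(2)]
  show "continuous_on UNIV (cos_l2 :: 'a \<Rightarrow> _)" "continuous_on UNIV (sin_l2 :: 'a \<Rightarrow> _)" by auto
qed

text \<open>For trigonometric functions the image is explicit. Contractivity makes limits in
  \<open>x\<close> uniform in \<open>t\<close>, so the vectors with a continuous orbit form a closed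
  subspace.\<close>

lemma mehler_l2_continuous:
  fixes K :: "real \<Rightarrow> 'a::euclidean_space \<Rightarrow> 'a"
  assumes n: "\<And>t. t \<in> T \<Longrightarrow> gauss_noise (K t) (\<nu> t)"
    and K: "\<And>\<xi>. continuous_on T (\<lambda>t. adjoint (K t) \<xi>)"
  shows "continuous_on T (\<lambda>t. mehler_l2 (K t) (\<nu> t) x)"
proof (rule trig_dense_induct[where P="\<lambda>x. continuous_on T (\<lambda>t. mehler_l2 (K t) (\<nu> t) x)"])
  show "subspace {x. continuous_on T (\<lambda>t. mehler_l2 (K t) (\<nu> t) x)}"
  proof (rule subspaceI)
    show "0 \<in> {x. continuous_on T (\<lambda>t. mehler_l2 (K t) (\<nu> t) x)}"
      using continuous_on_cong[of T T "\<lambda>t. mehler_l2 (K t) (\<nu> t) 0" "\<lambda>_. 0"]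
      by (simp add: linear_0[OF mehler_l2_linear[OF n]])
    fix x y assume "x \<in> {x. continuous_on T (\<lambda>t. mehler_l2 (K t) (\<nu> t) x)}"
      "y \<in> {x. continuous_on T (\<lambda>t. mehler_l2 (K t) (\<nu> t) x)}"
    then have "continuous_on T (\<lambda>t. mehler_l2 (K t) (\<nu> t) x + mehler_l2 (K t) (\<nu> t) y)"
      by (auto intro!: continuous_intros)
    then show "x + y \<in> {x. continuous_on T (\<lambda>t. mehler_l2 (K t) (\<nu> t) x)}"
      using continuous_on_cong[of T T "\<lambda>t. mehler_l2 (K t) (\<nu> t) (x + y)"]
      by (simp add: linear_add[OF mehler_l2_linear[OF n]])
  next
    fix c x assume "x \<in> {x. continuous_on T (\<lambda>t. mehler_l2 (K t) (\<nu> t) x)}"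
    then have "continuous_on T (\<lambda>t. c *\<^sub>R mehler_l2 (K t) (\<nu> t) x)"
      by (auto intro!: continuous_intros)
    then show "c *\<^sub>R x \<in> {x. continuous_on T (\<lambda>t. mehler_l2 (K t) (\<nu> t) x)}"
      using continuous_on_cong[of T T "\<lambda>t. mehler_l2 (K t) (\<nu> t) (c *\<^sub>R x)"]
      by (simp add: linear_scale[OF mehler_l2_linear[OF n]])
  qed
  show "closed {x. continuous_on T (\<lambda>t. mehler_l2 (K t) (\<nu> t) x)}"
    unfolding closed_sequential_limits
  proof (intro allI impI, elim conjE, simp only: mem_Collect_eq)
    fix X and x :: "'a l2"
    assume X: "\<forall>n. continuous_on T (\<lambda>t. mehler_l2 (K t) (\<nu> t) (X n))" "X \<longlonglongrightarrow> x"
    have "uniform_limit T (\<lambda>n t. mehler_l2 (K t) (\<nu> t) (X n)) (\<lambda>t. mehler_l2 (K t) (\<nu> t) x) sequentially"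
    proof (rule uniform_limitI)
      fix e :: real assume "0 < e"
      then have "\<forall>\<^sub>F n in sequentially. dist (X n) x < e" using X(2) by (simp add: tendstoD)
      then show "\<forall>\<^sub>F n in sequentially. \<forall>t\<in>T. dist (mehler_l2 (K t) (\<nu> t) (X n)) (mehler_l2 (K t) (\<nu> t) x) < e"
      proof eventually_elim
        fix m assume "dist (X m) x < e"
        then show "\<forall>t\<in>T. dist (mehler_l2 (K t) (\<nu> t) (X m)) (mehler_l2 (K t) (\<nu> t) x) < e"
          using mehler_l2_norm[OF n, of _ "X m - x"]
          by (auto simp: dist_norm linear_diff[OF mehler_l2_linear[OF n]] intro: le_less_trans)
      qed
    qed
    then show "continuous_on T (\<lambda>t. mehler_l2 (K t) (\<nu> t) x)"
      using X(1) by (intro uniform_limit_theorem[OF _ _ sequentially_bot]) auto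
  qed
  have w: "continuous_on T (\<lambda>t. exp (- (\<xi> \<bullet> \<xi> - adjoint (K t) \<xi> \<bullet> adjoint (K t) \<xi>) / 2))" for \<xi>
    by (intro continuous_intros K) auto
  show "continuous_on T (\<lambda>t. mehler_l2 (K t) (\<nu> t) (cos_l2 \<xi>))" for \<xi>
    using continuous_on_scaleR[OF w continuous_on_compose2[OF continuous_cos_l2 K]]
      continuous_on_cong[of T T "\<lambda>t. mehler_l2 (K t) (\<nu> t) (cos_l2 \<xi>)"]
    by (simp add: mehler_l2_trig[OF n])
  show "continuous_on T (\<lambda>t. mehler_l2 (K t) (\<nu> t) (sin_l2 \<xi>))" for \<xi>
    using continuous_on_scaleR[OF w continuous_on_compose2[OF continuous_sin_l2 K]]
      continuous_on_cong[of T T "\<lambda>t. mehler_l2 (K t) (\<nu> t) (sin_l2 \<xi>)"]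
    by (simp add: mehler_l2_trig[OF n])
qed

section \<open>Hilbert--Schmidt decay of Mehler operators\<close>

lemma sum_swap3:
  "(\<Sum>j\<in>A. \<Sum>k\<in>B. \<Sum>b\<in>C. f j k b) = (\<Sum>b\<in>C. \<Sum>j\<in>A. \<Sum>k\<in>B. f j k b)"
proof -
  have "(\<Sum>j\<in>A. \<Sum>k\<in>B. \<Sum>b\<in>C. f j k b) = (\<Sum>j\<in>A. \<Sum>b\<in>C. \<Sum>k\<in>B. f j k b)"
    by (intro sum.cong refl sum.swap)
  also have "\<dots> = (\<Sum>b\<in>C. \<Sum>j\<in>A. \<Sum>k\<in>B. f j k b)" by (rule sum.swap)
  finally show ?thesis .
qed

text \<open>Entrywise powers of a Gram matrix are positive semidefinite: expanding one factor over
  \<open>Basis\<close> and absorbing the coordinates into \<open>c\<close> lowers the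
  exponent.\<close>

lemma gram_power_nonneg:
  fixes \<xi> :: "nat \<Rightarrow> 'a::euclidean_space"
  shows "0 \<le> (\<Sum>j<N. \<Sum>k<N. c j * c k * (\<xi> j \<bullet> \<xi> k) ^ m)"
proof (induction m arbitrary: c)
  case 0
  have "(\<Sum>j<N. \<Sum>k<N. c j * c k) = (\<Sum>j<N. c j)\<^sup>2"
    by (simp add: power2_eq_square sum_product)
  then show ?case by simp
next
  case (Suc m)
  have "(\<Sum>j<N. \<Sum>k<N. c j * c k * (\<xi> j \<bullet> \<xi> k) ^ Suc m)
      = (\<Sum>j<N. \<Sum>k<N. \<Sum>b\<in>Basis. (c j * (\<xi> j \<bullet> b)) * (c k * (\<xi> k \<bullet> b)) * (\<xi> j \<bullet> \<xi> k) ^ m)"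
  proof (intro sum.cong refl)
    fix j k
    have "c j * c k * (\<xi> j \<bullet> \<xi> k) ^ Suc m = c j * c k * (\<Sum>b\<in>Basis. (\<xi> j \<bullet> b) * (\<xi> k \<bullet> b)) * (\<xi> j \<bullet> \<xi> k) ^ m"
      by (simp add: euclidean_inner[of "\<xi> j" "\<xi> k", symmetric])
    then show "c j * c k * (\<xi> j \<bullet> \<xi> k) ^ Suc m
        = (\<Sum>b\<in>Basis. (c j * (\<xi> j \<bullet> b)) * (c k * (\<xi> k \<bullet> b)) * (\<xi> j \<bullet> \<xi> k) ^ m)"
      by (simp only: sum_distrib_left sum_distrib_right) (simp only: mult_ac)
  qed
  also have "\<dots> = (\<Sum>b\<in>Basis. \<Sum>j<N. \<Sum>k<N. (c j * (\<xi> j \<bullet> b)) * (c k * (\<xi> k \<bullet> b)) * (\<xi> j \<bullet> \<xi> k) ^ m)"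
    by (rule sum_swap3)
  also have "\<dots> \<ge> 0" by (intro sum_nonneg Suc.IH)
  finally show ?case .
qed

text \<open>Pairing \<open>u\<close> against the basis, the trace bounds the form because
  \<open>\<bar>u\<bar>\<^sup>2 (\<Sum>e. F e) - F u = 1/2 (\<Sum>e e'. F (u\<^sub>e e' - u\<^sub>e\<^sub>' e))\<close>.\<close>

lemma quadratic_form_le_trace:
  fixes B :: "'a::euclidean_space \<Rightarrow> 'a \<Rightarrow> real"
  assumes B: "bounded_bilinear B" and sym: "\<And>u v. B u v = B v u" and nn: "\<And>u. 0 \<le> B u u"
  shows "B u u \<le> (u \<bullet> u) * (\<Sum>e\<in>Basis. B e e)"
proof -
  interpret B: bounded_bilinear B by fact
  let ?u = "\<lambda>e. u \<bullet> e"
  have Buu: "B u u = (\<Sum>e\<in>Basis. \<Sum>e'\<in>Basis. ?u e * ?u e' * B e e')"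
  proof -
    have "B u u = B (\<Sum>e\<in>Basis. ?u e *\<^sub>R e) (\<Sum>e\<in>Basis. ?u e *\<^sub>R e)"
      by (simp add: euclidean_representation)
    then show ?thesis
      by (simp add: B.sum_left B.sum_right B.scaleR_left B.scaleR_right sum_distrib_left mult_ac sym
          del: euclidean_representation)
  qed
  have tr: "(u \<bullet> u) * (\<Sum>e\<in>Basis. B e e) = (\<Sum>e\<in>Basis. \<Sum>e'\<in>Basis. ?u e * ?u e * B e' e')"
    by (subst euclidean_inner) (simp add: sum_product)
  then have tr': "(u \<bullet> u) * (\<Sum>e\<in>Basis. B e e) = (\<Sum>e\<in>Basis. \<Sum>e'\<in>Basis. ?u e' * ?u e' * B e e)"
    by (subst sum.swap)
  have "0 \<le> (\<Sum>e\<in>Basis. \<Sum>e'\<in>Basis. B (?u e *\<^sub>R e' - ?u e' *\<^sub>R e) (?u e *\<^sub>R e' - ?u e' *\<^sub>R e))"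
    by (intro sum_nonneg nn)
  also have "\<dots> = (\<Sum>e\<in>Basis. \<Sum>e'\<in>Basis. ?u e * ?u e * B e' e' + ?u e' * ?u e' * B e e - 2 * (?u e * ?u e' * B e e'))"
  proof (intro sum.cong refl)
    fix e e'
    show "B (?u e *\<^sub>R e' - ?u e' *\<^sub>R e) (?u e *\<^sub>R e' - ?u e' *\<^sub>R e)
        = ?u e * ?u e * B e' e' + ?u e' * ?u e' * B e e - 2 * (?u e * ?u e' * B e e')"
      using sym[of e' e] by (simp add: B.diff_left B.diff_right B.scaleR_left B.scaleR_right algebra_simps)
  qed
  also have "\<dots> = 2 * ((u \<bullet> u) * (\<Sum>e\<in>Basis. B e e)) - 2 * B u u"
    using tr tr' by (simp add: Buu sum.distrib sum_subtractf sum_distrib_left)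
  finally show ?thesis by simp
qed

text \<open>The constant is the squared Hilbert--Schmidt norm of \<open>K\<close>, whose
  \<open>m\<close>-th power bounds the squared norm of the adjoint on \<open>m\<close>-th tensor
  powers. In the induction one factor is expanded over \<open>Basis\<close> and the adjoint is moved
  onto \<open>b\<close>; the remaining form \<open>B\<close> is positive, and its value at
  \<open>K b\<close> is at most \<open>K b \<bullet> K b\<close> times its trace.\<close>

lemma gram_power_adjoint_le:
  fixes \<xi> :: "nat \<Rightarrow> 'a::euclidean_space" and K :: "'a \<Rightarrow> 'a"
  assumes K: "linear K"
  shows "(\<Sum>j<N. \<Sum>k<N. c j * c k * (adjoint K (\<xi> j) \<bullet> adjoint K (\<xi> k)) ^ m)
       \<le> (\<Sum>b\<in>Basis. K b \<bullet> K b) ^ m * (\<Sum>j<N. \<Sum>k<N. c j * c k * (\<xi> j \<bullet> \<xi> k) ^ m)"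
proof (induction m arbitrary: c)
  case (Suc m)
  let ?\<tau> = "\<Sum>b\<in>Basis. K b \<bullet> K b"
  let ?\<eta> = "\<lambda>j. adjoint K (\<xi> j)"
  define B where "B u v = (\<Sum>j<N. \<Sum>k<N. (c j * (\<xi> j \<bullet> u)) * (c k * (\<xi> k \<bullet> v)) * (\<xi> j \<bullet> \<xi> k) ^ m)" for u v
  have tau: "0 \<le> ?\<tau>" by (intro sum_nonneg) simp
  have split: "(\<Sum>j<N. \<Sum>k<N. c j * c k * (\<zeta> j \<bullet> \<zeta> k) ^ Suc m)
      = (\<Sum>b\<in>Basis. \<Sum>j<N. \<Sum>k<N. (c j * (\<zeta> j \<bullet> b)) * (c k * (\<zeta> k \<bullet> b)) * (\<zeta> j \<bullet> \<zeta> k) ^ m)" for \<zeta> :: "nat \<Rightarrow> 'a"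
  proof -
    have "c j * c k * (\<zeta> j \<bullet> \<zeta> k) ^ Suc m
        = (\<Sum>b\<in>Basis. (c j * (\<zeta> j \<bullet> b)) * (c k * (\<zeta> k \<bullet> b)) * (\<zeta> j \<bullet> \<zeta> k) ^ m)" for j k
    proof -
      have "c j * c k * (\<zeta> j \<bullet> \<zeta> k) ^ Suc m = c j * c k * (\<Sum>b\<in>Basis. (\<zeta> j \<bullet> b) * (\<zeta> k \<bullet> b)) * (\<zeta> j \<bullet> \<zeta> k) ^ m"
        by (simp add: euclidean_inner[of "\<zeta> j" "\<zeta> k", symmetric])
      then show ?thesis by (simp only: sum_distrib_left sum_distrib_right) (simp only: mult_ac)
    qed
    then show ?thesis
      by (subst sum_swap3[symmetric]) (simp only:)
  qed
  have Bbil: "bounded_bilinear B"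
    unfolding bilinear_conv_bounded_bilinear[symmetric] bilinear_def B_def
    by (intro conjI allI linearI)
       (simp_all add: inner_add_right sum.distrib[symmetric] sum_distrib_left algebra_simps)
  have Bsym: "B u v = B v u" for u v
    unfolding B_def by (subst sum.swap) (simp add: inner_commute mult_ac)
  have Bnn: "0 \<le> B u u" for u
    unfolding B_def by (rule gram_power_nonneg)
  have "(\<Sum>j<N. \<Sum>k<N. c j * c k * (?\<eta> j \<bullet> ?\<eta> k) ^ Suc m)
      = (\<Sum>b\<in>Basis. \<Sum>j<N. \<Sum>k<N. (c j * (\<xi> j \<bullet> K b)) * (c k * (\<xi> k \<bullet> K b)) * (?\<eta> j \<bullet> ?\<eta> k) ^ m)"
    unfolding split by (simp add: adjoint_works[OF K] inner_commute)
  also have "\<dots> \<le> (\<Sum>b\<in>Basis. ?\<tau> ^ m * B (K b) (K b))"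
    unfolding B_def by (intro sum_mono Suc.IH)
  also have "\<dots> \<le> (\<Sum>b\<in>Basis. ?\<tau> ^ m * ((K b \<bullet> K b) * (\<Sum>e\<in>Basis. B e e)))"
    using tau by (intro sum_mono mult_left_mono quadratic_form_le_trace Bbil Bsym Bnn) auto
  also have "\<dots> = ?\<tau> ^ Suc m * (\<Sum>e\<in>Basis. B e e)"
    by (simp add: sum_distrib_left[symmetric] sum_distrib_right[symmetric] mult_ac)
  also have "(\<Sum>e\<in>Basis. B e e) = (\<Sum>j<N. \<Sum>k<N. c j * c k * (\<xi> j \<bullet> \<xi> k) ^ Suc m)"
    unfolding split B_def ..
  finally show ?case .
qed simp

text \<open>The bound for powers, applied termwise. The term of exponent zero, the contribution of
  the constants, does not contract and is subtracted; every other term contracts by \<tau> or better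
  because \<tau> is at most one.\<close>

lemma gram_series_le:
  fixes \<xi> :: "nat \<Rightarrow> 'a::euclidean_space" and K :: "'a \<Rightarrow> 'a"
  assumes K: "linear K" and \<tau>: "\<tau> = (\<Sum>b\<in>Basis. K b \<bullet> K b)" "\<tau> \<le> 1"
    and h: "\<And>x. (\<lambda>n. w n * x ^ n) sums h x" and w: "\<And>n. (0::real) \<le> w n"
  shows "(\<Sum>j<N. \<Sum>k<N. c j * c k * h (adjoint K (\<xi> j) \<bullet> adjoint K (\<xi> k))) - w 0 * (\<Sum>j<N. c j)\<^sup>2
      \<le> \<tau> * ((\<Sum>j<N. \<Sum>k<N. c j * c k * h (\<xi> j \<bullet> \<xi> k)) - w 0 * (\<Sum>j<N. c j)\<^sup>2)"
proof -
  let ?\<eta> = "\<lambda>j. adjoint K (\<xi> j)"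
  have tau0: "0 \<le> \<tau>" unfolding \<tau> by (intro sum_nonneg) simp
  have ser: "(\<lambda>n. w n * (\<Sum>j<N. \<Sum>k<N. c j * c k * (\<zeta> j \<bullet> \<zeta> k) ^ n)) sums (\<Sum>j<N. \<Sum>k<N. c j * c k * h (\<zeta> j \<bullet> \<zeta> k))"
    for \<zeta> :: "nat \<Rightarrow> 'a"
  proof -
    have "(\<lambda>n. \<Sum>j<N. \<Sum>k<N. c j * c k * (w n * (\<zeta> j \<bullet> \<zeta> k) ^ n)) sums (\<Sum>j<N. \<Sum>k<N. c j * c k * h (\<zeta> j \<bullet> \<zeta> k))"
      by (intro sums_sum sums_mult h)
    then show ?thesis by (simp add: sum_distrib_left mult_ac)
  qed
  have sq: "(\<Sum>j<N. \<Sum>k<N. c j * c k) = (\<Sum>j<N. c j)\<^sup>2"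
    by (simp add: power2_eq_square sum_product)
  have shift: "(\<lambda>n. f (Suc n)) sums (s - f 0)" if "f sums s" for f :: "nat \<Rightarrow> real" and s
    using that by (simp add: sums_Suc_iff)
  let ?Z = "\<lambda>n. w (Suc n) * (\<Sum>j<N. \<Sum>k<N. c j * c k * (?\<eta> j \<bullet> ?\<eta> k) ^ Suc n)"
  let ?Y = "\<lambda>n. w (Suc n) * (\<Sum>j<N. \<Sum>k<N. c j * c k * (\<xi> j \<bullet> \<xi> k) ^ Suc n)"
  have Z: "?Z sums ((\<Sum>j<N. \<Sum>k<N. c j * c k * h (?\<eta> j \<bullet> ?\<eta> k)) - w 0 * (\<Sum>j<N. c j)\<^sup>2)"
    and Y: "?Y sums ((\<Sum>j<N. \<Sum>k<N. c j * c k * h (\<xi> j \<bullet> \<xi> k)) - w 0 * (\<Sum>j<N. c j)\<^sup>2)"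
    using shift[OF ser[of ?\<eta>]] shift[OF ser[of \<xi>]] by (simp_all only: power_0 mult_1_right sq)
  show ?thesis
  proof (rule sums_le[OF _ Z sums_mult[OF Y]])
    fix n
    have p: "\<tau> ^ Suc n \<le> \<tau>" using tau0 \<tau>(2) by (simp add: mult_left_le power_le_one)
    have "(\<Sum>j<N. \<Sum>k<N. c j * c k * (?\<eta> j \<bullet> ?\<eta> k) ^ Suc n)
        \<le> \<tau> ^ Suc n * (\<Sum>j<N. \<Sum>k<N. c j * c k * (\<xi> j \<bullet> \<xi> k) ^ Suc n)"
      unfolding \<tau>(1) by (rule gram_power_adjoint_le[OF K])
    also have "\<dots> \<le> \<tau> * (\<Sum>j<N. \<Sum>k<N. c j * c k * (\<xi> j \<bullet> \<xi> k) ^ Suc n)"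
      by (intro mult_right_mono p gram_power_nonneg)
    finally have "?Z n \<le> w (Suc n) * (\<tau> * (\<Sum>j<N. \<Sum>k<N. c j * c k * (\<xi> j \<bullet> \<xi> k) ^ Suc n))"
      by (rule mult_left_mono[OF _ w])
    then show "?Z n \<le> \<tau> * ?Y n" by (simp only: mult.left_commute[of \<tau>])
  qed
qed

lemma cosh_power_series: "(\<lambda>n. (if even n then 1 / fact n else 0) * x ^ n) sums cosh (x::real)"
  using cosh_converges[of x] by (rule sums_cong[THEN iffD1, rotated]) (auto simp: divide_inverse)

lemma sinh_power_series: "(\<lambda>n. (if even n then 0 else 1 / fact n) * x ^ n) sums sinh (x::real)"
  using sinh_converges[of x] by (rule sums_cong[THEN iffD1, rotated]) (auto simp: divide_inverse)

text \<open>Cosines and sines share one list of frequencies, padded with zero coefficients, so that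
  the norm of the sum splits into one \<open>cosh\<close> and one \<open>sinh\<close> form.\<close>

lemma trig_span_form:
  assumes "x \<in> span (range cos_l2 \<union> range sin_l2)"
  obtains N :: nat and a b \<xi> where "x = (\<Sum>j<N. a j *\<^sub>R cos_l2 (\<xi> j) + b j *\<^sub>R sin_l2 (\<xi> j))"
proof -
  let ?P = "\<lambda>x. \<exists>(N::nat) a b \<xi>. x = (\<Sum>j<N. a j *\<^sub>R cos_l2 (\<xi> j) + b j *\<^sub>R sin_l2 (\<xi> j))"
  have "?P x"
    using assms
  proof (induction rule: span_induct_alt)
    case base
    have "0 = (\<Sum>j<(0::nat). 0 *\<^sub>R cos_l2 (0::'a) + 0 *\<^sub>R sin_l2 0)" by simp
    then show ?case by fast
  next
    case (step c z y)
    then obtain N :: nat and a b \<xi> where y: "y = (\<Sum>j<N. a j *\<^sub>R cos_l2 (\<xi> j) + b j *\<^sub>R sin_l2 (\<xi> j))" by blast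
    have keep: "(\<Sum>j<N. (a(N := r)) j *\<^sub>R cos_l2 ((\<xi>(N := \<eta>)) j) + (b(N := s)) j *\<^sub>R sin_l2 ((\<xi>(N := \<eta>)) j)) = y" for r s \<eta>
      unfolding y by (intro sum.cong) auto
    consider \<eta> where "z = cos_l2 \<eta>" | \<eta> where "z = sin_l2 \<eta>" using step by blast
    then show ?case
    proof cases
      case (1 \<eta>)
      have "c *\<^sub>R z + y = (\<Sum>j<Suc N. (a(N := c)) j *\<^sub>R cos_l2 ((\<xi>(N := \<eta>)) j) + (b(N := 0)) j *\<^sub>R sin_l2 ((\<xi>(N := \<eta>)) j))"
        by (subst sum.lessThan_Suc, subst keep) (simp add: 1)
      then show ?thesis by blast
    next
      case (2 \<eta>)
      have "c *\<^sub>R z + y = (\<Sum>j<Suc N. (a(N := 0)) j *\<^sub>R cos_l2 ((\<xi>(N := \<eta>)) j) + (b(N := c)) j *\<^sub>R sin_l2 ((\<xi>(N := \<eta>)) j))"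
        by (subst sum.lessThan_Suc, subst keep) (simp add: 2)
      then show ?thesis by blast
    qed
  qed
  then show ?thesis using that by blast
qed

lemma norm_trig_sum:
  fixes \<xi> :: "nat \<Rightarrow> 'a::euclidean_space"
  defines "g \<equiv> \<lambda>j. exp (- (\<xi> j \<bullet> \<xi> j) / 2)"
  shows "(norm (\<Sum>j<N. a j *\<^sub>R cos_l2 (\<xi> j) + b j *\<^sub>R sin_l2 (\<xi> j)))\<^sup>2
     = (\<Sum>j<N. \<Sum>k<N. (a j * g j) * (a k * g k) * cosh (\<xi> j \<bullet> \<xi> k))
     + (\<Sum>j<N. \<Sum>k<N. (b j * g j) * (b k * g k) * sinh (\<xi> j \<bullet> \<xi> k))"
proof -
  have "inner (a j *\<^sub>R cos_l2 (\<xi> j) + b j *\<^sub>R sin_l2 (\<xi> j)) (a k *\<^sub>R cos_l2 (\<xi> k) + b k *\<^sub>R sin_l2 (\<xi> k))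
     = (a j * g j) * (a k * g k) * cosh (\<xi> j \<bullet> \<xi> k) + (b j * g j) * (b k * g k) * sinh (\<xi> j \<bullet> \<xi> k)" for j k
    using inner_trig(3)[of "\<xi> j" "\<xi> k"] inner_trig(3)[of "\<xi> k" "\<xi> j"]
    by (simp add: inner_add_left inner_add_right inner_trig(1,2) inner_commute[of "sin_l2 _" "cos_l2 _"] g_def)
  then show ?thesis
    unfolding power2_norm_eq_inner inner_sum_left inner_sum_right
    by (simp only: sum.distrib) (intro arg_cong2[where f="(+)"] sum.swap)
qed

lemma one_l2_cos: "one_l2 = cos_l2 0"
  by (simp add: one_l2_def cos_l2_def)

lemma inner_trig_one:
  "inner (cos_l2 \<xi>) one_l2 = exp (- (\<xi> \<bullet> \<xi>) / 2)" "inner (sin_l2 \<xi>) one_l2 = 0"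
  using inner_trig(1)[of \<xi> 0] inner_trig(3)[of 0 \<xi>] by (simp_all add: one_l2_cos inner_commute)

lemma norm_one_l2: "norm one_l2 = 1"
  using inner_trig(1)[of "0::'a" 0] by (simp add: norm_eq_1 one_l2_cos)

text \<open>Subtracting \<open>(inner x one_l2)\<^sup>2\<close> on both sides removes the mean,
  which is the zeroth term of the \<open>cosh\<close> series; the \<open>sinh\<close> series has no
  such term. What remains contracts with the squared Hilbert--Schmidt norm of
  \<open>K\<close>.\<close>

lemma mehler_l2_decay:
  fixes x :: "'a::euclidean_space l2"
  assumes n: "gauss_noise K \<nu>" and \<tau>: "\<tau> = (\<Sum>b\<in>Basis. K b \<bullet> K b)" "\<tau> \<le> 1"
  shows "(norm (mehler_l2 K \<nu> x))\<^sup>2 - (inner x one_l2)\<^sup>2 \<le> \<tau> * ((norm x)\<^sup>2 - (inner x one_l2)\<^sup>2)"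
proof -
  have "span (range cos_l2 \<union> range sin_l2)
      \<subseteq> {x. (norm (mehler_l2 K \<nu> x))\<^sup>2 - (inner x one_l2)\<^sup>2 \<le> \<tau> * ((norm x)\<^sup>2 - (inner x one_l2)\<^sup>2)}"
  proof (intro subsetI CollectI)
    fix x assume "x \<in> span (range cos_l2 \<union> range (sin_l2 :: 'a \<Rightarrow> _))"
    then obtain N :: nat and a b and \<xi> :: "nat \<Rightarrow> 'a" where x: "x = (\<Sum>j<N. a j *\<^sub>R cos_l2 (\<xi> j) + b j *\<^sub>R sin_l2 (\<xi> j))"
      by (rule trig_span_form)
    let ?\<eta> = "\<lambda>j. adjoint K (\<xi> j)"
    define g where "g j = exp (- (\<xi> j \<bullet> \<xi> j) / 2)" for j
    define w where "w j = exp (- (\<xi> j \<bullet> \<xi> j - ?\<eta> j \<bullet> ?\<eta> j) / 2)" for j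
    \<comment> \<open>The Mehler factor turns the Gaussian weight of the new frequency into that of
      the old one, so \<open>x\<close> and its image have the same coefficients and differ only in
      the Gram matrix.\<close>
    have wg: "w j * exp (- (?\<eta> j \<bullet> ?\<eta> j) / 2) = g j" for j
      by (simp add: w_def g_def exp_add[symmetric] field_simps)
    have Mx: "mehler_l2 K \<nu> x = (\<Sum>j<N. (a j * w j) *\<^sub>R cos_l2 (?\<eta> j) + (b j * w j) *\<^sub>R sin_l2 (?\<eta> j))"
      unfolding x by (simp add: linear_sum[OF mehler_l2_linear[OF n]] linear_add[OF mehler_l2_linear[OF n]]
          linear_scale[OF mehler_l2_linear[OF n]] mehler_l2_trig[OF n] w_def)
    have nM: "(norm (mehler_l2 K \<nu> x))\<^sup>2 = (\<Sum>j<N. \<Sum>k<N. (a j * g j) * (a k * g k) * cosh (?\<eta> j \<bullet> ?\<eta> k))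
        + (\<Sum>j<N. \<Sum>k<N. (b j * g j) * (b k * g k) * sinh (?\<eta> j \<bullet> ?\<eta> k))"
      unfolding Mx norm_trig_sum by (simp only: mult.assoc wg)
    have nx: "(norm x)\<^sup>2 = (\<Sum>j<N. \<Sum>k<N. (a j * g j) * (a k * g k) * cosh (\<xi> j \<bullet> \<xi> k))
        + (\<Sum>j<N. \<Sum>k<N. (b j * g j) * (b k * g k) * sinh (\<xi> j \<bullet> \<xi> k))"
      unfolding x norm_trig_sum by (simp only: g_def)
    have ix: "inner x one_l2 = (\<Sum>j<N. a j * g j)"
      unfolding x by (simp add: inner_sum_left inner_add_left inner_trig_one g_def)
    have "(\<Sum>j<N. \<Sum>k<N. (a j * g j) * (a k * g k) * cosh (?\<eta> j \<bullet> ?\<eta> k)) - (inner x one_l2)\<^sup>2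
        \<le> \<tau> * ((\<Sum>j<N. \<Sum>k<N. (a j * g j) * (a k * g k) * cosh (\<xi> j \<bullet> \<xi> k)) - (inner x one_l2)\<^sup>2)"
      using gram_series_le[OF noise_linear[OF n] \<tau> cosh_power_series, where c="\<lambda>j. a j * g j" and N=N and \<xi>=\<xi>] by (simp add: ix)
    moreover have "(\<Sum>j<N. \<Sum>k<N. (b j * g j) * (b k * g k) * sinh (?\<eta> j \<bullet> ?\<eta> k))
        \<le> \<tau> * (\<Sum>j<N. \<Sum>k<N. (b j * g j) * (b k * g k) * sinh (\<xi> j \<bullet> \<xi> k))"
      using gram_series_le[OF noise_linear[OF n] \<tau> sinh_power_series, where c="\<lambda>j. b j * g j" and N=N and \<xi>=\<xi>] by simp
    ultimately show "(norm (mehler_l2 K \<nu> x))\<^sup>2 - (inner x one_l2)\<^sup>2 \<le> \<tau> * ((norm x)\<^sup>2 - (inner x one_l2)\<^sup>2)"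
      unfolding nM nx by (simp add: algebra_simps)
  qed
  then have "closure (span (range cos_l2 \<union> range sin_l2))
      \<subseteq> {x. (norm (mehler_l2 K \<nu> x))\<^sup>2 - (inner x one_l2)\<^sup>2 \<le> \<tau> * ((norm x)\<^sup>2 - (inner x one_l2)\<^sup>2)}"
    by (intro closure_minimal closed_Collect_le continuous_intros linear_continuous_on mehler_l2_bounded_linear n)
  then show ?thesis by (auto simp: trig_dense)
qed

subsection \<open>The law of a linear stochastic differential equation\<close>

lemma sum_integral_partition:
  fixes \<phi> :: "real \<Rightarrow> 'a::banach"
  assumes "continuous_on {0..real n * h} \<phi>" "0 \<le> h" "m \<le> n"
  shows "(\<Sum>j<m. integral {real j * h..real (Suc j) * h} \<phi>) = integral {0..real m * h} \<phi>"
  using assms(3)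
proof (induction m)
  case (Suc m)
  have le: "real m * h \<le> real (Suc m) * h" "real (Suc m) * h \<le> real n * h" "0 \<le> real m * h"
    using assms(2) Suc.prems by (auto intro!: mult_right_mono)
  have "\<phi> integrable_on {0..real (Suc m) * h}"
    by (rule integrable_continuous_real, rule continuous_on_subset[OF assms(1)]) (use le in auto)
  from Henstock_Kurzweil_Integration.integral_combine[OF le(3,1) this] Suc show ?case by simp
qed simp

text \<open>Here \<open>c = 0\<close> and \<open>c = 1\<close> select the left and the right end point as evaluation point.\<close>

lemma riemann_stieltjes_tendsto:
  fixes G w :: "real \<Rightarrow> 'a::euclidean_space"
  assumes t: "0 < t" and c: "c \<le> (1::nat)"
    and G: "\<And>s. s \<in> {0..t} \<Longrightarrow> (G has_vector_derivative G' s) (at s within {0..t})"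
    and G': "continuous_on {0..t} G'" and w: "continuous_on {0..t} w"
  shows "(\<lambda>n. \<Sum>j<Suc n. (G (real (Suc j) * (t / real (Suc n))) - G (real j * (t / real (Suc n))))
            \<bullet> w (real (j + c) * (t / real (Suc n))))
     \<longlonglongrightarrow> integral {0..t} (\<lambda>s. G' s \<bullet> w s)"
proof (rule LIMSEQ_I)
  fix r :: real assume r: "0 < r"
  obtain C where C: "0 < C" "\<And>s. s \<in> {0..t} \<Longrightarrow> norm (G' s) \<le> C"
    using compact_imp_bounded[OF compact_continuous_image[OF G' compact_Icc]]
    unfolding bounded_pos by auto
  \<comment> \<open>The errors on the \<open>Suc n\<close> subintervals are at most
    \<open>C * e * h\<close> each and add up to \<open>C * e * t\<close>, which is half of
    \<open>r\<close>.\<close>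
  define e where "e = r / (2 * C * t)"
  have e: "0 < e" using r C t by (simp add: e_def)
  obtain d where d: "0 < d" "\<And>x y. x \<in> {0..t} \<Longrightarrow> y \<in> {0..t} \<Longrightarrow> dist y x < d \<Longrightarrow> dist (w y) (w x) < e"
    using compact_uniformly_continuous[OF w compact_Icc] e unfolding uniformly_continuous_on_def by metis
  obtain N where N: "t / d < real N" using reals_Archimedean2 by blast
  have "norm ((\<Sum>j<Suc n. (G (real (Suc j) * (t / real (Suc n))) - G (real j * (t / real (Suc n))))
            \<bullet> w (real (j + c) * (t / real (Suc n)))) - integral {0..t} (\<lambda>s. G' s \<bullet> w s)) < r"
    if n: "n \<ge> N" for n
  proof -
    define h where "h = t / real (Suc n)"
    have h: "0 < h" "h < d" "real (Suc n) * h = t"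
    proof -
      show "0 < h" "real (Suc n) * h = t" using t by (simp_all add: h_def)
      have "t / d < real (Suc n)" using N n by linarith
      then show "h < d" using d(1) by (simp add: h_def field_simps)
    qed
    let ?D = "\<lambda>j. (G (real (Suc j) * h) - G (real j * h)) \<bullet> w (real (j + c) * h)"
    let ?I = "\<lambda>j. integral {real j * h..real (Suc j) * h} (\<lambda>s. G' s \<bullet> w s)"
    have cont: "continuous_on {0..t} (\<lambda>s. G' s \<bullet> w s)" by (intro continuous_intros G' w)
    have I: "integral {0..t} (\<lambda>s. G' s \<bullet> w s) = (\<Sum>j<Suc n. ?I j)"
      using sum_integral_partition[of "Suc n" h "\<lambda>s. G' s \<bullet> w s" "Suc n"] cont h by simp
    have bnd: "norm (?D j - ?I j) \<le> C * e * h" if j: "j < Suc n" for j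
    proof -
      let ?a = "real j * h" and ?b = "real (Suc j) * h" and ?\<tau> = "real (j + c) * h"
      have "real (Suc j) * h \<le> real (Suc n) * h" using j h(1) by (intro mult_right_mono) auto
      then have ab: "0 \<le> ?a" "?a \<le> ?b" "?b \<le> t" "?b - ?a = h" using h by (auto simp: algebra_simps)
      have tau: "?\<tau> \<in> {?a..?b}" using c h(1) by (auto intro!: mult_right_mono)
      have sub: "{?a..?b} \<subseteq> {0..t}" using ab by auto
      have "((\<lambda>s. G' s \<bullet> w ?\<tau>) has_integral (G ?b \<bullet> w ?\<tau> - G ?a \<bullet> w ?\<tau>)) {?a..?b}"
      proof (rule fundamental_theorem_of_calculus[OF ab(2)])
        fix s assume s: "s \<in> {?a..?b}"
        have "(G has_vector_derivative G' s) (at s within {?a..?b})"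
          using has_vector_derivative_within_subset[OF G sub] s sub by blast
        from bounded_linear.has_vector_derivative[OF bounded_linear_inner_left this]
        show "((\<lambda>s. G s \<bullet> w ?\<tau>) has_vector_derivative G' s \<bullet> w ?\<tau>) (at s within {?a..?b})" .
      qed
      then have D: "?D j = integral {?a..?b} (\<lambda>s. G' s \<bullet> w ?\<tau>)"
        by (simp add: inner_diff_left integral_unique)
      have c1: "continuous_on {?a..?b} (\<lambda>s. G' s \<bullet> w ?\<tau>)" "continuous_on {?a..?b} (\<lambda>s. G' s \<bullet> w s)"
        by (intro continuous_intros continuous_on_subset[OF G' sub] continuous_on_subset[OF w sub])+
      have "?D j - ?I j = integral {?a..?b} (\<lambda>s. G' s \<bullet> w ?\<tau> - G' s \<bullet> w s)"
        unfolding D using c1 by (intro integral_diff[symmetric] integrable_continuous_real)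
      also have "norm \<dots> \<le> (C * e) * (?b - ?a)"
      proof (rule integral_bound[OF ab(2)])
        show "continuous_on {?a..?b} (\<lambda>s. G' s \<bullet> w ?\<tau> - G' s \<bullet> w s)" by (intro continuous_intros c1)
        fix s assume s: "s \<in> {?a..?b}"
        have "norm (G' s \<bullet> w ?\<tau> - G' s \<bullet> w s) \<le> norm (G' s) * norm (w ?\<tau> - w s)"
          by (simp add: inner_diff_right[symmetric] Cauchy_Schwarz_ineq2)
        also have "\<dots> \<le> C * e"
        proof (rule mult_mono)
          show "norm (G' s) \<le> C" using C s sub by blast
          have "dist ?\<tau> s < d" using s tau ab(4) h(2) by (auto simp: dist_real_def)
          then show "norm (w ?\<tau> - w s) \<le> e" using d(2)[of s ?\<tau>] s tau sub by (auto simp: dist_norm)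
        qed (use C in auto)
        finally show "norm (G' s \<bullet> w ?\<tau> - G' s \<bullet> w s) \<le> C * e" .
      qed
      finally show ?thesis by (simp only: ab(4))
    qed
    have "norm ((\<Sum>j<Suc n. ?D j) - (\<Sum>j<Suc n. ?I j)) \<le> (\<Sum>j<Suc n. norm (?D j - ?I j))"
      unfolding sum_subtractf[symmetric] by (rule norm_sum)
    also have "\<dots> \<le> (\<Sum>j<Suc n. C * e * h)" by (intro sum_mono bnd) auto
    also have "\<dots> = C * e * t" using h(3) by (simp add: algebra_simps flip: h(3))
    also have "\<dots> = r / 2" using C t by (simp add: e_def)
    also have "\<dots> < r" using r by simp
    finally show ?thesis unfolding I h_def .
  qed
  then show "\<exists>no. \<forall>n\<ge>no. norm ((\<Sum>j<Suc n. (G (real (Suc j) * (t / real (Suc n))) - G (real j * (t / real (Suc n))))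
            \<bullet> w (real (j + c) * (t / real (Suc n)))) - integral {0..t} (\<lambda>s. G' s \<bullet> w s)) < r" by blast
qed

lemma cf_gaussian_scalar:
  fixes \<eta> :: "real^'n"
  assumes "0 < h"
  shows "cf (gaussian_measure (h *\<^sub>R mat 1)) \<eta> = of_real (exp (- (h * (\<eta> \<bullet> \<eta>)) / 2))"
proof -
  let ?L = "sqrt h *\<^sub>R (mat 1 :: real^'n^'n)"
  have L: "?L *v x = sqrt h *\<^sub>R x" for x
    by (simp add: scaleR_matrix_vector_assoc[symmetric])
  have inv: "?L ** ((1 / sqrt h) *\<^sub>R mat 1) = mat 1" "((1 / sqrt h) *\<^sub>R mat 1) ** ?L = mat 1"
    using assms by (simp_all add: matrix_eq matrix_vector_mul_assoc[symmetric] scaleR_matrix_vector_assoc[symmetric]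
        matrix_vector_mult_scaleR)
  have sq: "?L ** transpose ?L = h *\<^sub>R mat 1"
  proof -
    have "transpose ?L = ?L" by (simp add: transpose_def mat_def vec_eq_iff)
    then show ?thesis using assms
      by (simp add: matrix_eq matrix_vector_mul_assoc[symmetric] scaleR_matrix_vector_assoc[symmetric]
        matrix_vector_mult_scaleR)
  qed
  have "cf (gaussian_measure (h *\<^sub>R mat 1)) \<eta> = cf (distr gauss borel ((*v) ?L)) \<eta>"
  proof -
    have "invertible ?L" unfolding invertible_def using inv by blast
    from gaussian_measure_matrix[OF this] show ?thesis by (simp only: sq)
  qed
  also have "\<dots> = (CLINT x|gauss. iexp (\<eta> \<bullet> (?L *v x)))"
    by (rule cf_distr) measurable
  also have "\<dots> = cf gauss (sqrt h *\<^sub>R \<eta>)"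
    by (simp add: cf_def L)
  finally show ?thesis using assms by (simp add: cf_gauss)
qed

lemma brownian_increment_sum_cf:
  fixes W :: "real \<Rightarrow> 'w \<Rightarrow> real^'n" and \<eta> :: "nat \<Rightarrow> real^'n"
  assumes W: "standard_brownian_motion P W" and h: "0 < h"
  shows "(CLINT \<omega>|P. iexp (\<Sum>j<n. \<eta> j \<bullet> (W (real (Suc j) * h) \<omega> - W (real j * h) \<omega>)))
     = of_real (exp (- (\<Sum>j<n. h * (\<eta> j \<bullet> \<eta> j)) / 2))"
proof -
  interpret P: prob_space P using W by (simp add: standard_brownian_motion_def)
  have [measurable]: "W (real j * h) \<in> borel_measurable P" for j
    using W h by (simp add: standard_brownian_motion_def)
  let ?X = "\<lambda>j \<omega>. W (real (Suc j) * h) \<omega> - W (real j * h) \<omega>"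
  have Xm [measurable]: "?X j \<in> borel_measurable P" for j
    by (intro borel_measurable_diff) measurable
  have "P.indep_vars (\<lambda>_. borel) ?X {..<n}"
  proof -
    have "\<forall>(n::nat) \<tau>. 0 \<le> \<tau> 0 \<and> (\<forall>i<n. \<tau> i < \<tau> (Suc i)) \<longrightarrow>
        P.indep_vars (\<lambda>_. borel) (\<lambda>i \<omega>. W (\<tau> (Suc i)) \<omega> - W (\<tau> i) \<omega>) {..<n}"
      using W by (simp add: standard_brownian_motion_def)
    from this[rule_format, of "\<lambda>j. real j * h" n] h show ?thesis by (simp add: algebra_simps)
  qed
  then have ind: "P.indep_vars (\<lambda>_. borel) (\<lambda>j \<omega>. iexp (\<eta> j \<bullet> ?X j \<omega>)) {..<n}"
    by (rule P.indep_vars_compose2) measurable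
  have fac: "(CLINT \<omega>|P. iexp (\<eta> j \<bullet> ?X j \<omega>)) = of_real (exp (- (h * (\<eta> j \<bullet> \<eta> j)) / 2))" for j
  proof -
    have "\<forall>s t. 0 \<le> s \<and> s < t \<longrightarrow> distr P borel (\<lambda>\<omega>. W t \<omega> - W s \<omega>) = gaussian_measure ((t - s) *\<^sub>R mat 1)"
      using W by (simp add: standard_brownian_motion_def)
    from this[rule_format, of "real j * h" "real (Suc j) * h"] h
    have "distr P borel (?X j) = gaussian_measure (h *\<^sub>R mat 1)" by (simp add: algebra_simps)
    then show ?thesis
      using cf_distr[OF Xm, of j "\<eta> j"] cf_gaussian_scalar[OF h, of "\<eta> j"] by simp
  qed
  have "(CLINT \<omega>|P. iexp (\<Sum>j<n. \<eta> j \<bullet> ?X j \<omega>)) = (CLINT \<omega>|P. (\<Prod>j<n. iexp (\<eta> j \<bullet> ?X j \<omega>)))"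
    by (simp add: exp_sum[symmetric] sum_distrib_left)
  also have "\<dots> = (\<Prod>j<n. CLINT \<omega>|P. iexp (\<eta> j \<bullet> ?X j \<omega>))"
  proof (rule P.indep_vars_lebesgue_integral[OF _ ind])
    fix j show "integrable P (\<lambda>\<omega>. iexp (\<eta> j \<bullet> ?X j \<omega>))"
      by (rule integrable_iexp[OF P.finite_measure_axioms]) measurable
  qed simp
  also have "\<dots> = of_real (exp (- (\<Sum>j<n. h * (\<eta> j \<bullet> \<eta> j)) / 2))"
    unfolding fac by (simp add: exp_sum[symmetric] sum_negf sum_divide_distrib flip: of_real_prod)
  finally show ?thesis .
qed

text \<open>Pairing with the backward flow \<open>g\<close> removes the drift, and integration by
  parts makes \<open>\<xi> \<bullet> Y t \<omega> - \<xi> \<bullet> flow L t x\<close> a limit of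
  sums of independent Gaussian increments. The hypothesis \<open>diss\<close> balances damping and
  noise; it turns the limiting variance into the loss of squared length along the adjoint
  flow.\<close>

lemma linear_sde_cf:
  fixes W :: "real \<Rightarrow> 'w \<Rightarrow> real^'n" and Y :: "real \<Rightarrow> 'w \<Rightarrow> 'e::euclidean_space"
  assumes W: "standard_brownian_motion P W"
    and Y: "additive_sde_solution P W L \<sigma> x Y"
    and L: "linear L" and L': "linear L'" and adj: "\<And>y z. L y \<bullet> z = y \<bullet> L' z" and \<sigma>: "linear \<sigma>"
    and diss: "\<And>z. 2 * (L' z \<bullet> z) = - (adjoint \<sigma> z \<bullet> adjoint \<sigma> z)"
    and t: "0 \<le> t"
  shows "cf (distr P borel (Y t)) \<xi>
     = iexp (\<xi> \<bullet> flow L t x) * of_real (exp (- (\<xi> \<bullet> \<xi> - flow L' t \<xi> \<bullet> flow L' t \<xi>) / 2))"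
proof -
  interpret P: prob_space P using W by (simp add: standard_brownian_motion_def)
  have Ym [measurable]: "Y t \<in> borel_measurable P"
    using Y t by (simp add: additive_sde_solution_def)
  have good: "AE \<omega> in P. continuous_on {0..} (\<lambda>t. Y t \<omega>) \<and> continuous_on {0..} (\<lambda>t. W t \<omega>) \<and> W 0 \<omega> = 0 \<and>
      (\<forall>t\<ge>0. Y t \<omega> = x + integral {0..t} (\<lambda>s. L (Y s \<omega>)) + \<sigma> (W t \<omega>))"
  proof -
    have "AE \<omega> in P. W 0 \<omega> = 0 \<and> continuous_on {0..} (\<lambda>t. W t \<omega>)"
      using W by (simp add: standard_brownian_motion_def)
    moreover have "AE \<omega> in P. continuous_on {0..} (\<lambda>t. Y t \<omega>) \<and>
        (\<forall>t\<ge>0. Y t \<omega> = x + integral {0..t} (\<lambda>s. L (Y s \<omega>)) + \<sigma> (W t \<omega>))"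
      using Y by (simp add: additive_sde_solution_def)
    ultimately show ?thesis by eventually_elim auto
  qed
  have bl: "bounded_linear L" "bounded_linear L'" "bounded_linear \<sigma>" "bounded_linear (adjoint \<sigma>)"
    using L L' \<sigma> adjoint_linear[OF \<sigma>] by (simp_all add: linear_conv_bounded_linear)
  show ?thesis
  proof (cases "t = 0")
    case True
    have "cf (distr P borel (Y t)) \<xi> = (CLINT \<omega>|P. iexp (\<xi> \<bullet> Y t \<omega>))" by (rule cf_distr[OF Ym])
    also have "\<dots> = (CLINT \<omega>|P. iexp (\<xi> \<bullet> x))"
    proof (rule integral_cong_AE)
      show "AE \<omega> in P. iexp (\<xi> \<bullet> Y t \<omega>) = iexp (\<xi> \<bullet> x)"
        using good by eventually_elim (simp add: True linear_0[OF \<sigma>])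
    qed measurable
    finally show ?thesis using True by (simp add: P.prob_space)
  next
    case False
    with t have t0: "0 < t" by simp
    define g where "g s = flow L' (t - s) \<xi>" for s
    have g': "(g has_vector_derivative - L' (g s)) (at s within T)" for s T
    proof -
      have "((\<lambda>s. t - s) has_real_derivative -1) (at s within T)" by (auto intro!: derivative_eq_intros)
      from flow_has_vector_derivative_comp[OF L' this, of \<xi>] show ?thesis by (simp add: g_def[abs_def])
    qed
    have gc: "continuous_on T g" for T
      unfolding g_def by (intro continuous_intros)
    have L'gc: "continuous_on T (\<lambda>s. - L' (g s))" for T
      by (intro continuous_intros bounded_linear.continuous_on[OF bl(2)] gc)
    let ?h = "\<lambda>n. t / real (Suc n)"
    \<comment> \<open>\<open>g\<close> is taken at the right end points because summation by parts
      leaves \<open>w\<close> at the left ones. Hence \<open>c = 0\<close> in the pathwise limit and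
      \<open>c = 1\<close> in the limit of the variance.\<close>
    define \<eta> where "\<eta> n j = adjoint \<sigma> (g (real (Suc j) * ?h n))" for n j
    define Sn where "Sn n \<omega> = (\<Sum>j<Suc n. \<eta> n j \<bullet> (W (real (Suc j) * ?h n) \<omega> - W (real j * ?h n) \<omega>))" for n \<omega>
    have Wm [measurable]: "W (real j * ?h n) \<in> borel_measurable P" for j n
      using W t by (simp add: standard_brownian_motion_def)
    have Sm [measurable]: "Sn n \<in> borel_measurable P" for n
      unfolding Sn_def by measurable
    have path: "AE \<omega> in P. (\<lambda>n. Sn n \<omega>) \<longlonglongrightarrow> \<xi> \<bullet> Y t \<omega> - \<xi> \<bullet> flow L t x"
      using good
    proof eventually_elim
      fix \<omega> assume "continuous_on {0..} (\<lambda>t. Y t \<omega>) \<and> continuous_on {0..} (\<lambda>t. W t \<omega>) \<and> W 0 \<omega> = 0 \<and>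
        (\<forall>t\<ge>0. Y t \<omega> = x + integral {0..t} (\<lambda>s. L (Y s \<omega>)) + \<sigma> (W t \<omega>))"
      then have Yc: "continuous_on {0..t} (\<lambda>t. Y t \<omega>)" and Wc: "continuous_on {0..t} (\<lambda>t. W t \<omega>)"
        and W0: "W 0 \<omega> = 0" and Yeq: "\<And>s. 0 \<le> s \<Longrightarrow> Y s \<omega> = x + integral {0..s} (\<lambda>s. L (Y s \<omega>)) + \<sigma> (W s \<omega>)"
        by (auto intro: continuous_on_subset)
      define w where "w s = \<sigma> (W s \<omega>)" for s
      have wc: "continuous_on {0..t} w" unfolding w_def by (intro bounded_linear.continuous_on[OF bl(3)] Wc)
      have w0: "w 0 = 0" by (simp add: w_def W0 linear_0[OF \<sigma>])
      \<comment> \<open>\<open>Z\<close> is the solution without its noise term, hence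
        differentiable; in the derivative of \<open>g s \<bullet> Z s\<close> the drift cancels up
        to the contribution of \<open>w\<close>.\<close>
      define Z where "Z s = x + integral {0..s} (\<lambda>s. L (Y s \<omega>))" for s
      have YZ: "Y s \<omega> = Z s + w s" if "0 \<le> s" for s using Yeq[OF that] by (simp add: Z_def w_def)
      have Z': "(Z has_vector_derivative L (Y s \<omega>)) (at s within {0..t})" if "s \<in> {0..t}" for s
        unfolding Z_def
        using integral_has_vector_derivative[OF bounded_linear.continuous_on[OF bl(1) Yc] that]
        by (auto intro!: derivative_eq_intros)
      have "((\<lambda>s. g s \<bullet> Z s) has_vector_derivative - (- L' (g s) \<bullet> w s)) (at s within {0..t})"
        if s: "s \<in> {0..t}" for s
      proof -
        have "((\<lambda>s. g s \<bullet> Z s) has_vector_derivative g s \<bullet> L (Y s \<omega>) + - L' (g s) \<bullet> Z s) (at s within {0..t})"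
          by (rule bounded_bilinear.has_vector_derivative[OF bounded_bilinear_inner g' Z'[OF s]])
        moreover have "g s \<bullet> L (Y s \<omega>) = L' (g s) \<bullet> Y s \<omega>"
          using adj[of "Y s \<omega>" "g s"] by (simp add: inner_commute)
        ultimately show ?thesis using s YZ[of s] by (simp add: inner_add_right)
      qed
      then have has: "((\<lambda>s. - (- L' (g s) \<bullet> w s)) has_integral g t \<bullet> Z t - g 0 \<bullet> Z 0) {0..t}"
        by (intro fundamental_theorem_of_calculus t)
      have H: "integral {0..t} (\<lambda>s. - L' (g s) \<bullet> w s) = - (g t \<bullet> Z t - g 0 \<bullet> Z 0)"
      proof -
        have "- integral {0..t} (\<lambda>s. - L' (g s) \<bullet> w s) = g t \<bullet> Z t - g 0 \<bullet> Z 0"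
          using integral_unique[OF has] unfolding integral_neg .
        then show ?thesis by linarith
      qed
      have RS: "(\<lambda>n. \<Sum>j<Suc n. (g (real (Suc j) * ?h n) - g (real j * ?h n)) \<bullet> w (real (j + 0) * ?h n))
          \<longlonglongrightarrow> integral {0..t} (\<lambda>s. - L' (g s) \<bullet> w s)"
        by (rule riemann_stieltjes_tendsto[OF t0 _ g' L'gc wc]) auto
      have parts: "Sn n \<omega> = g t \<bullet> w t - (\<Sum>j<Suc n. (g (real (Suc j) * ?h n) - g (real j * ?h n)) \<bullet> w (real (j + 0) * ?h n))" for n
      proof -
        have "\<eta> n j \<bullet> (W (real (Suc j) * ?h n) \<omega> - W (real j * ?h n) \<omega>)
            = (g (real (Suc j) * ?h n) \<bullet> w (real (Suc j) * ?h n) - g (real j * ?h n) \<bullet> w (real j * ?h n))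
              - (g (real (Suc j) * ?h n) - g (real j * ?h n)) \<bullet> w (real (j + 0) * ?h n)" for j
        proof -
          have "adjoint \<sigma> y \<bullet> v = y \<bullet> \<sigma> v" for y v
            by (simp add: adjoint_works[OF \<sigma>] inner_commute)
          then show ?thesis
            unfolding \<eta>_def w_def by (simp only: linear_diff[OF \<sigma>] inner_diff_left inner_diff_right add_0_right)
        qed
        then have "Sn n \<omega> = (\<Sum>j<Suc n. g (real (Suc j) * ?h n) \<bullet> w (real (Suc j) * ?h n) - g (real j * ?h n) \<bullet> w (real j * ?h n))
            - (\<Sum>j<Suc n. (g (real (Suc j) * ?h n) - g (real j * ?h n)) \<bullet> w (real (j + 0) * ?h n))"
          unfolding Sn_def by (simp only: sum_subtractf)
        also have "(\<Sum>j<Suc n. g (real (Suc j) * ?h n) \<bullet> w (real (Suc j) * ?h n) - g (real j * ?h n) \<bullet> w (real j * ?h n))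
            = g t \<bullet> w t"
          using sum_lessThan_telescope[of "\<lambda>j. g (real j * ?h n) \<bullet> w (real j * ?h n)" "Suc n"] w0 by simp
        finally show ?thesis .
      qed
      have "(\<lambda>n. Sn n \<omega>) \<longlonglongrightarrow> g t \<bullet> w t - integral {0..t} (\<lambda>s. - L' (g s) \<bullet> w s)"
        unfolding parts by (intro tendsto_diff tendsto_const RS)
      also have "g t \<bullet> w t - integral {0..t} (\<lambda>s. - L' (g s) \<bullet> w s) = \<xi> \<bullet> Y t \<omega> - \<xi> \<bullet> flow L t x"
        using flow_adjoint[OF L L' adj, of t x \<xi>]
        by (simp only: H) (simp add: g_def Z_def YZ[OF t] inner_add_right inner_commute)
      finally show "(\<lambda>n. Sn n \<omega>) \<longlonglongrightarrow> \<xi> \<bullet> Y t \<omega> - \<xi> \<bullet> flow L t x" .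
    qed
    have "(\<lambda>n. CLINT \<omega>|P. iexp (Sn n \<omega>)) \<longlonglongrightarrow> (CLINT \<omega>|P. iexp (\<xi> \<bullet> Y t \<omega> - \<xi> \<bullet> flow L t x))"
    proof (rule integral_dominated_convergence[where w="\<lambda>_. 1"])
      show "AE \<omega> in P. (\<lambda>n. iexp (Sn n \<omega>)) \<longlonglongrightarrow> iexp (\<xi> \<bullet> Y t \<omega> - \<xi> \<bullet> flow L t x)"
        using path by eventually_elim (intro tendsto_intros)
      show "(\<lambda>\<omega>. iexp (\<xi> \<bullet> Y t \<omega> - \<xi> \<bullet> flow L t x)) \<in> borel_measurable P" by measurable
      show "(\<lambda>\<omega>. iexp (Sn n \<omega>)) \<in> borel_measurable P" for n by measurable
    qed auto
    moreover have "(\<lambda>n. CLINT \<omega>|P. iexp (Sn n \<omega>)) \<longlonglongrightarrow> of_real (exp (- (\<xi> \<bullet> \<xi> - flow L' t \<xi> \<bullet> flow L' t \<xi>) / 2))"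
    proof -
      let ?q = "\<lambda>s. adjoint \<sigma> (g s) \<bullet> adjoint \<sigma> (g s)"
      have qc: "continuous_on {0..t} ?q"
        by (intro continuous_intros bounded_linear.continuous_on[OF bl(4)] gc)
      \<comment> \<open>\<open>g\<close> solves the backward equation, so by \<open>diss\<close> its
        squared length grows at exactly the rate of the variance.\<close>
      have "((\<lambda>s. g s \<bullet> g s) has_vector_derivative ?q s) (at s within {0..t})" for s
      proof -
        have "((\<lambda>s. g s \<bullet> g s) has_vector_derivative g s \<bullet> (- L' (g s)) + (- L' (g s)) \<bullet> g s) (at s within {0..t})"
          by (rule bounded_bilinear.has_vector_derivative[OF bounded_bilinear_inner g' g'])
        moreover have "g s \<bullet> (- L' (g s)) + (- L' (g s)) \<bullet> g s = ?q s"
          using diss[of "g s"] by (simp add: inner_commute)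
        ultimately show ?thesis by simp
      qed
      then have "(?q has_integral g t \<bullet> g t - g 0 \<bullet> g 0) {0..t}"
        by (intro fundamental_theorem_of_calculus t)
      then have q: "integral {0..t} (\<lambda>s. 1 \<bullet> ?q s) = \<xi> \<bullet> \<xi> - flow L' t \<xi> \<bullet> flow L' t \<xi>"
        by (simp add: g_def integral_unique)
      have "(\<lambda>n. \<Sum>j<Suc n. (real (Suc j) * ?h n - real j * ?h n) \<bullet> ?q (real (j + 1) * ?h n))
          \<longlonglongrightarrow> integral {0..t} (\<lambda>s. 1 \<bullet> ?q s)"
        by (rule riemann_stieltjes_tendsto[OF t0 _ _ _ qc]) (auto intro!: derivative_eq_intros)
      also have "(\<lambda>n. \<Sum>j<Suc n. (real (Suc j) * ?h n - real j * ?h n) \<bullet> ?q (real (j + 1) * ?h n))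
          = (\<lambda>n. \<Sum>j<Suc n. ?h n * (\<eta> n j \<bullet> \<eta> n j))"
      proof (intro ext sum.cong refl)
        fix n j
        have "real (Suc j) * ?h n - real j * ?h n = ?h n" by (simp add: algebra_simps flip: add_divide_distrib)
        then show "(real (Suc j) * ?h n - real j * ?h n) \<bullet> ?q (real (j + 1) * ?h n) = ?h n * (\<eta> n j \<bullet> \<eta> n j)"
          by (simp only: \<eta>_def inner_real_def Suc_eq_plus1)
      qed
      finally have "(\<lambda>n. \<Sum>j<Suc n. ?h n * (\<eta> n j \<bullet> \<eta> n j)) \<longlonglongrightarrow> \<xi> \<bullet> \<xi> - flow L' t \<xi> \<bullet> flow L' t \<xi>"
        unfolding q .
      then have "(\<lambda>n. complex_of_real (exp (- (\<Sum>j<Suc n. ?h n * (\<eta> n j \<bullet> \<eta> n j)) / 2)))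
          \<longlonglongrightarrow> complex_of_real (exp (- (\<xi> \<bullet> \<xi> - flow L' t \<xi> \<bullet> flow L' t \<xi>) / 2))"
        by (intro tendsto_of_real tendsto_exp tendsto_divide tendsto_minus tendsto_const) auto
      moreover have "(CLINT \<omega>|P. iexp (Sn n \<omega>)) = of_real (exp (- (\<Sum>j<Suc n. ?h n * (\<eta> n j \<bullet> \<eta> n j)) / 2))" for n
        unfolding Sn_def by (rule brownian_increment_sum_cf[OF W]) (use t0 in simp)
      ultimately show ?thesis by simp
    qed
    ultimately have eq: "(CLINT \<omega>|P. iexp (\<xi> \<bullet> Y t \<omega> - \<xi> \<bullet> flow L t x))
        = of_real (exp (- (\<xi> \<bullet> \<xi> - flow L' t \<xi> \<bullet> flow L' t \<xi>) / 2))"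
      by (rule LIMSEQ_unique)
    have "cf (distr P borel (Y t)) \<xi> = (CLINT \<omega>|P. iexp (\<xi> \<bullet> Y t \<omega>))" by (rule cf_distr[OF Ym])
    also have "\<dots> = (CLINT \<omega>|P. iexp (\<xi> \<bullet> flow L t x) * iexp (\<xi> \<bullet> Y t \<omega> - \<xi> \<bullet> flow L t x))"
      by (simp add: exp_add[symmetric] algebra_simps)
    also have "\<dots> = iexp (\<xi> \<bullet> flow L t x) * (CLINT \<omega>|P. iexp (\<xi> \<bullet> Y t \<omega> - \<xi> \<bullet> flow L t x))" by simp
    finally show ?thesis unfolding eq .
  qed
qed

subsection \<open>Square roots of positive definite matrices\<close>

lemma sym_pos_def_bounds:
  fixes S :: "real^'n^'n"
  assumes "sym_pos_def S"
  obtains m where "0 < m" "\<And>x. m * (x \<bullet> x) \<le> x \<bullet> (S *v x)"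
proof -
  have "continuous_on (sphere 0 1) (\<lambda>x::real^'n. x \<bullet> (S *v x))"
    by (intro continuous_intros linear_continuous_on matrix_vector_mul_bounded_linear)
  then obtain x0 :: "real^'n" where x0: "x0 \<in> sphere 0 1" "\<And>y. y \<in> sphere 0 1 \<Longrightarrow> x0 \<bullet> (S *v x0) \<le> y \<bullet> (S *v y)"
    using continuous_attains_inf[of "sphere 0 1 :: (real^'n) set" "\<lambda>x. x \<bullet> (S *v x)"] by auto
  define m where "m = x0 \<bullet> (S *v x0)"
  have "0 < m" using x0(1) assms unfolding m_def sym_pos_def_def by (metis dist_0_norm mem_sphere norm_zero zero_neq_one)
  moreover have "m * (x \<bullet> x) \<le> x \<bullet> (S *v x)" for x
  proof (cases "x = 0")
    case False
    have "m \<le> (x /\<^sub>R norm x) \<bullet> (S *v (x /\<^sub>R norm x))"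
      unfolding m_def using False by (intro x0(2)) simp
    also have "\<dots> = (x \<bullet> (S *v x)) / (x \<bullet> x)"
      by (simp add: matrix_vector_mult_scaleR power2_norm_eq_inner[symmetric] power2_eq_square divide_inverse)
    finally show ?thesis using False by (simp add: pos_le_divide_eq)
  qed simp
  ultimately show ?thesis by (rule that)
qed

definition self_adjoint :: "'a::euclidean_space endo \<Rightarrow> bool" where
  "self_adjoint Z \<longleftrightarrow> (\<forall>x y. endo_apply Z x \<bullet> y = x \<bullet> endo_apply Z y)"

lemma norm_endo_apply: "norm (endo_apply Z x) \<le> norm Z * norm x"
  by transfer (rule norm_blinfun)

lemma norm_endo_bound: "0 \<le> b \<Longrightarrow> (\<And>x. norm (endo_apply Z x) \<le> b * norm x) \<Longrightarrow> norm Z \<le> b"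
  by transfer (rule norm_blinfun_bound)

lemma endo_eqI: "(\<And>x. endo_apply A x = endo_apply B x) \<Longrightarrow> A = B"
  by transfer (rule blinfun_eqI)

lemma endo_apply_linear:
  "endo_apply (A + B) x = endo_apply A x + endo_apply B x"
  "endo_apply (A - B) x = endo_apply A x - endo_apply B x"
  "endo_apply (c *\<^sub>R A) x = c *\<^sub>R endo_apply A x"
  by (transfer, simp add: blinfun.add_left blinfun.diff_left blinfun.scaleR_left)+

text \<open>If \<open>A = 1 - Y\<close> with \<open>\<parallel>Y\<parallel> < 1\<close>, then \<open>1 - Z\<close> is a square root of \<open>A\<close> for the fixed point \<open>Z\<close> of
  \<open>Z \<mapsto> (Y + Z\<^sup>2) / 2\<close>. Staying in the bicommutant gives uniqueness later on.\<close>

lemma endo_sqrt_near_one: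
  fixes Y :: "'a::euclidean_space endo"
  assumes Y: "norm Y \<le> q" "q < 1" and sa: "self_adjoint Y"
  obtains Z where "norm Z \<le> q" "self_adjoint Z" "(1 - Z) * (1 - Z) = 1 - Y"
    "\<And>C. C * Y = Y * C \<Longrightarrow> C * Z = Z * C"
proof -
  have q0: "0 \<le> q" using Y(1) norm_ge_zero order_trans by blast
  define T where "T = cball 0 q \<inter> {Z. self_adjoint Z} \<inter> {Z. \<forall>C. C * Y = Y * C \<longrightarrow> C * Z = Z * C}"
  define F where "F Z = (1/2) *\<^sub>R (Y + Z * Z)" for Z
  have cont: "continuous_on UNIV (\<lambda>Z. endo_apply Z x)" for x :: 'a
    by (intro linear_continuous_on bounded_bilinear.bounded_linear_left[OF bounded_bilinear_endo_apply])
  have "closed T"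
  proof -
    have "{Z::'a endo. self_adjoint Z} = (\<Inter>x. \<Inter>y. {Z. endo_apply Z x \<bullet> y = x \<bullet> endo_apply Z y})"
      by (auto simp: self_adjoint_def)
    moreover have "{Z. \<forall>C. C * Y = Y * C \<longrightarrow> C * Z = Z * C} = (\<Inter>C\<in>{C. C * Y = Y * C}. {Z. C * Z = Z * C})"
      by auto
    ultimately show ?thesis unfolding T_def
      by (simp only:) (intro closed_Int closed_cball closed_INT ballI closed_Collect_eq continuous_intros cont)
  qed
  moreover have "0 \<in> T" using q0 by (simp add: T_def self_adjoint_def) (transfer, simp)
  moreover have "F ` T \<subseteq> T"
  proof (rule image_subsetI)
    fix Z assume Z: "Z \<in> T"
    then have nz: "norm Z \<le> q" by (simp add: T_def)
    have "norm (F Z) \<le> (1/2) * (norm Y + norm Z * norm Z)"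
      unfolding F_def using norm_triangle_ineq[of Y "Z * Z"] norm_mult_ineq[of Z Z] by simp
    also have "\<dots> \<le> (1/2) * (q + q * 1)"
      using Y nz q0 by (intro mult_left_mono add_mono mult_mono) auto
    finally have "norm (F Z) \<le> q" by simp
    moreover have "self_adjoint (F Z)"
    proof -
      have saZ: "endo_apply Z x \<bullet> y = x \<bullet> endo_apply Z y" for x y
        using Z by (auto simp: T_def self_adjoint_def)
      have saY: "endo_apply Y x \<bullet> y = x \<bullet> endo_apply Y y" for x y
        using sa by (auto simp: self_adjoint_def)
      show ?thesis
        by (simp add: self_adjoint_def F_def endo_apply_linear endo_apply_times inner_add_left inner_add_right saY saZ)
    qed
    moreover have "C * F Z = F Z * C" if "C * Y = Y * C" for C
    proof -
      have "C * Z = Z * C" using Z that by (auto simp: T_def)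
      then have "C * (Z * Z) = (Z * Z) * C" by (metis mult.assoc)
      then show ?thesis using that by (simp add: F_def distrib_left distrib_right)
    qed
    ultimately show "F Z \<in> T" by (simp add: T_def)
  qed
  moreover have "dist (F Z) (F Z') \<le> q * dist Z Z'" if "Z \<in> T" "Z' \<in> T" for Z Z'
  proof -
    have "F Z - F Z' = (1/2) *\<^sub>R (Z * (Z - Z') + (Z - Z') * Z')"
      by (simp add: F_def scaleR_diff_right[symmetric] right_diff_distrib left_diff_distrib)
    also have "norm \<dots> \<le> (1/2) * (norm Z * norm (Z - Z') + norm (Z - Z') * norm Z')"
      using norm_triangle_ineq[of "Z * (Z - Z')" "(Z - Z') * Z'"] norm_mult_ineq[of Z "Z - Z'"] norm_mult_ineq[of "Z - Z'" Z']
      by simp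
    also have "\<dots> \<le> (1/2) * (q * norm (Z - Z') + norm (Z - Z') * q)"
      using that by (intro mult_left_mono add_mono mult_mono) (auto simp: T_def q0)
    finally show ?thesis by (simp add: dist_norm mult.commute)
  qed
  ultimately have "\<exists>!Z\<in>T. F Z = Z"
    using q0 Y(2) by (intro Banach_fix[where c=q]) (auto simp: complete_eq_closed)
  then obtain Z where Z: "Z \<in> T" "F Z = Z" by blast
  have "Y + Z * Z = Z + Z"
  proof -
    have "2 *\<^sub>R F Z = Y + Z * Z" by (simp add: F_def)
    then show ?thesis using Z(2) by (simp add: scaleR_2)
  qed
  then have "(1 - Z) * (1 - Z) = 1 - Y"
  proof -
    assume "Y + Z * Z = Z + Z"
    then have "Y = Z + Z - Z * Z" by (metis add_diff_cancel_right')
    then show ?thesis by (simp add: left_diff_distrib right_diff_distrib)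
  qed
  moreover have "C * Z = Z * C" if "C * Y = Y * C" for C
    using Z(1) that unfolding T_def by auto
  moreover have "norm Z \<le> q" "self_adjoint Z" using Z(1) unfolding T_def by auto
  ultimately show ?thesis using that by blast
qed

lemma endo_of_matrix_times:
  fixes A B :: "real^'n^'n"
  shows "endo_of ((*v) (A ** B)) = endo_of ((*v) A) * endo_of ((*v) B)"
  by (rule endo_eqI) (simp add: endo_apply_endo_of endo_apply_times matrix_vector_mul_assoc)

text \<open>After division by a large \<open>c\<close> the matrix is at distance less than one from
  the identity, where the fixed-point construction of the root applies; scaling by
  \<open>sqrt c\<close> returns a root of \<open>S\<close>.\<close>

lemma sym_pos_def_sqrt_exists:
  fixes S :: "real^'n^'n"
  assumes S: "sym_pos_def S"
  obtains R where "sym_pos_def R" "R ** R = S" "\<And>C. C ** S = S ** C \<Longrightarrow> C ** R = R ** C"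
proof -
  obtain m where m: "0 < m" "\<And>x. m * (x \<bullet> x) \<le> x \<bullet> (S *v x)" using sym_pos_def_bounds[OF S] by blast
  define A where "A = endo_of ((*v) S)"
  have Ax: "endo_apply A x = S *v x" for x by (simp add: A_def endo_apply_endo_of)
  have sym: "(S *v x) \<bullet> y = x \<bullet> (S *v y)" for x y
    using S by (metis dot_lmul_matrix sym_pos_def_def transpose_matrix_vector)
  \<comment> \<open>The quotient yields \<open>(norm A)\<^sup>2 \<le> m * c\<close>, so in the
    squared norm of \<open>Y\<close> the quadratic term costs at most half of the linear gain and
    \<open>1 - m / c\<close> remains; the extra \<open>m\<close> ensures
    \<open>m \<le> c\<close>.\<close>
  define c where "c = (norm A)\<^sup>2 / m + m"
  have c: "0 < c" "(norm A)\<^sup>2 \<le> m * c"  proof -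
    have "0 \<le> (norm A)\<^sup>2 / m" using m(1) by simp
    then show "0 < c" unfolding c_def using m(1) by linarith
    have "m * c = (norm A)\<^sup>2 + m * m" using m(1) by (simp add: c_def distrib_left)
    then show "(norm A)\<^sup>2 \<le> m * c" by simp
  qed
  have mc: "m \<le> c" by (simp add: c_def m(1) less_imp_le)
  define Y where "Y = 1 - (1 / c) *\<^sub>R A"
  define q where "q = sqrt (1 - m / c)"
  have q: "0 \<le> q" "q < 1" "q\<^sup>2 = 1 - m / c" using m(1) c mc by (simp_all add: q_def)
  have "norm Y \<le> q"
  proof (rule norm_endo_bound[OF q(1)])
    fix x
    have "(norm (endo_apply Y x))\<^sup>2 = x \<bullet> x - 2 / c * (x \<bullet> (S *v x)) + (norm (endo_apply A x))\<^sup>2 / c\<^sup>2"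
      unfolding power2_norm_eq_inner Y_def
      by (simp add: endo_apply_linear endo_apply_one Ax inner_diff_left inner_diff_right sym power2_eq_square
          inner_commute[of "S *v x" x] algebra_simps)
    also have "\<dots> \<le> x \<bullet> x - 2 / c * (m * (x \<bullet> x)) + (m * c) * (x \<bullet> x) / c\<^sup>2"
    proof (intro add_mono diff_mono order_refl mult_left_mono m(2) divide_right_mono)
      have "(norm (endo_apply A x))\<^sup>2 \<le> (norm A)\<^sup>2 * (norm x)\<^sup>2"
        using power_mono[OF norm_endo_apply norm_ge_zero, of A x 2] by (simp add: power_mult_distrib)
      also have "\<dots> \<le> (m * c) * (x \<bullet> x)"
        unfolding power2_norm_eq_inner[of x] by (intro mult_right_mono c(2)) simp
      finally show "(norm (endo_apply A x))\<^sup>2 \<le> (m * c) * (x \<bullet> x)" .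
    qed (use c in auto)
    also have "\<dots> = (q * norm x)\<^sup>2"
      using c(1) unfolding power_mult_distrib q(3) power2_norm_eq_inner by (simp add: power2_eq_square field_simps)
    finally have "(norm (endo_apply Y x))\<^sup>2 \<le> (q * norm x)\<^sup>2" .
    from power2_le_imp_le[OF this] show "norm (endo_apply Y x) \<le> q * norm x"
      using q(1) by simp
  qed
  moreover have "self_adjoint Y"
    by (simp add: self_adjoint_def Y_def endo_apply_linear endo_apply_one Ax inner_diff_left inner_diff_right sym)
  ultimately obtain Z where Z: "norm Z \<le> q" "self_adjoint Z" "(1 - Z) * (1 - Z) = 1 - Y"
    "\<And>C. C * Y = Y * C \<Longrightarrow> C * Z = Z * C"
    using endo_sqrt_near_one[OF _ q(2)] by blast
  define B where "B = sqrt c *\<^sub>R (1 - Z)"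
  define R where "R = matrix (endo_apply B)"
  have linB: "linear (endo_apply B)"
    by (rule bounded_linear.linear[OF bounded_bilinear.bounded_linear_right[OF bounded_bilinear_endo_apply]])
  have Rx: "R *v x = endo_apply B x" for x by (simp add: R_def matrix_works linB)
  have BB: "B * B = A" using c(1) by (simp add: B_def Z(3) Y_def)
  have BR: "B = endo_of ((*v) R)" by (rule endo_eqI) (simp add: endo_apply_endo_of Rx)
  have "sym_pos_def R"
    unfolding sym_pos_def_def
  proof (intro conjI allI impI)
    have "(R *v x) \<bullet> y = x \<bullet> (R *v y)" for x y
      using Z(2) by (simp add: Rx B_def endo_apply_linear endo_apply_one self_adjoint_def inner_diff_left inner_diff_right)
    then have "adjoint ((*v) R) = (*v) R" by (intro adjoint_unique) auto
    then show "transpose R = R" by (metis adjoint_matrix matrix_of_matrix_vector_mul)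
    fix x :: "real^'n" assume "x \<noteq> 0"
    have "x \<bullet> endo_apply Z x \<le> norm x * (q * norm x)"
      using norm_cauchy_schwarz[of x "endo_apply Z x"] norm_endo_apply[of Z x] Z(1)
      by (meson mult_left_mono mult_right_mono norm_ge_zero order_trans)
    also have "\<dots> = q * (x \<bullet> x)" by (simp add: power2_norm_eq_inner[symmetric] power2_eq_square)
    also have "\<dots> < x \<bullet> x" using q(2) \<open>x \<noteq> 0\<close> by simp
    finally show "0 < x \<bullet> (R *v x)" using c(1)
      by (simp add: Rx B_def endo_apply_linear endo_apply_one inner_diff_right)
  qed
  moreover have "R ** R = S"
    by (simp add: matrix_eq matrix_vector_mul_assoc[symmetric] Rx endo_apply_times[symmetric] BB Ax)
  moreover have "C ** R = R ** C" if "C ** S = S ** C" for C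
  proof -
    let ?C = "endo_of ((*v) C)"
    have "?C * A = A * ?C" unfolding A_def endo_of_matrix_times[symmetric] that ..
    then have "?C * Y = Y * ?C" by (simp add: Y_def right_diff_distrib left_diff_distrib)
    from Z(4)[OF this] have "?C * B = B * ?C" by (simp add: B_def right_diff_distrib left_diff_distrib)
    then have "endo_apply (?C * B) x = endo_apply (B * ?C) x" for x by simp
    then show ?thesis
      by (simp add: matrix_eq matrix_vector_mul_assoc[symmetric] Rx endo_apply_times endo_apply_endo_of)
  qed
  ultimately show ?thesis by (rule that)
qed

text \<open>\<open>matrix_sqrt\<close> is a definite description over all semidefinite roots, so
  uniqueness among these is needed. Any such root commutes with its square, hence with the root
  \<open>T\<close> of the existence lemma.\<close>

lemma matrix_sqrt_eqI:
  fixes R :: "real^'n^'n"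
  assumes R: "sym_pos_def R"
  shows "matrix_sqrt (R ** R) = R"
proof -
  have psd: "sym_pos_semidef R"
    using R unfolding sym_pos_def_def sym_pos_semidef_def by (metis inner_zero_left less_imp_le order_refl)
  have Rinj: "x = 0" if "R *v x = 0" for x
    using R that by (force simp: sym_pos_def_def)
  have sym: "(R *v x) \<bullet> y = x \<bullet> (R *v y)" for x y
    using R by (metis dot_lmul_matrix sym_pos_def_def transpose_matrix_vector)
  have "sym_pos_def (R ** R)"
    unfolding sym_pos_def_def
  proof (intro conjI allI impI)
    show "transpose (R ** R) = R ** R" using R by (simp add: matrix_transpose_mul sym_pos_def_def)
    fix x :: "real^'n" assume "x \<noteq> 0"
    then have "0 < (R *v x) \<bullet> (R *v x)" using Rinj by auto
    then show "0 < x \<bullet> (R ** R *v x)" by (simp add: sym matrix_vector_mul_assoc[symmetric])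
  qed
  then obtain T where T: "sym_pos_def T" "T ** T = R ** R" "\<And>C. C ** (R ** R) = (R ** R) ** C \<Longrightarrow> C ** T = T ** C"
    by (rule sym_pos_def_sqrt_exists) blast
  have eqT: "Q = T" if Q: "sym_pos_semidef Q" "Q ** Q = R ** R" for Q
  proof -
    have "Q ** (R ** R) = (R ** R) ** Q" by (simp flip: Q(2) add: matrix_mul_assoc)
    from T(3)[OF this] have QT: "Q ** T = T ** Q" .
    have "Q *v x = T *v x" for x
    proof -
      let ?y = "Q *v x - T *v x"
      \<comment> \<open>The product of the sum and the difference of \<open>Q\<close> and
        \<open>T\<close> vanishes by commutation. Both quadratic forms at \<open>?y\<close> are
        nonnegative with sum zero, and definiteness of \<open>T\<close> gives
        \<open>?y = 0\<close>.\<close>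
      have "Q *v ?y + T *v ?y = 0"
        by (simp add: matrix_vector_mult_diff_distrib matrix_vector_mul_assoc Q(2) T(2) QT)
      then have "?y \<bullet> (Q *v ?y) + ?y \<bullet> (T *v ?y) = 0" by (metis inner_add_right inner_zero_right)
      moreover have "0 \<le> ?y \<bullet> (Q *v ?y)" using Q(1) by (simp add: sym_pos_semidef_def)
      ultimately have "?y \<bullet> (T *v ?y) \<le> 0" by simp
      then have "?y = 0" using T(1) unfolding sym_pos_def_def by (meson not_le)
      then show ?thesis by simp
    qed
    then show ?thesis by (simp add: matrix_eq)
  qed
  show ?thesis unfolding matrix_sqrt_def
    by (rule the_equality) (use psd eqT[OF psd] eqT in auto)
qed

subsection \<open>Smooth compactly supported functions\<close>

text \<open>Polynomial factors in \<open>1 / t\<close> make the family closed under differentiation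
  while it stays flat at the origin.\<close>

definition flat_exp :: "real poly \<Rightarrow> real \<Rightarrow> real" where
  "flat_exp p t = (if 0 < t then poly p (1 / t) * exp (- (1 / t)) else 0)"

lemma poly_div_exp_tendsto_0: "((\<lambda>y::real. poly p y / exp y) \<longlongrightarrow> 0) at_top"
proof -
  have "((\<lambda>y. \<Sum>i\<le>degree p. coeff p i * (y ^ i / exp y)) \<longlongrightarrow> (\<Sum>i\<le>degree p. coeff p i * 0)) at_top"
    by (intro tendsto_intros tendsto_power_div_exp_0)
  then show ?thesis by (simp add: poly_altdef sum_divide_distrib)
qed

lemma flat_exp_has_derivative:
  "(flat_exp p has_real_derivative flat_exp ([:0, 0, 1:] * (p - pderiv p)) t) (at t)"
proof -
  consider "0 < t" | "t < 0" | "t = 0" by linarith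
  then show ?thesis
  proof cases
    case 1
    have "((\<lambda>t. poly p (1 / t) * exp (- (1 / t))) has_real_derivative
        poly ([:0, 0, 1:] * (p - pderiv p)) (1 / t) * exp (- (1 / t))) (at t)"
      using 1 by (auto intro!: derivative_eq_intros DERIV_chain2[OF poly_DERIV] simp: power2_eq_square field_simps)
    then have "(flat_exp p has_real_derivative poly ([:0, 0, 1:] * (p - pderiv p)) (1 / t) * exp (- (1 / t))) (at t)"
      by (rule has_field_derivative_transform_within_open[where S="{0<..}"]) (use 1 in \<open>auto simp: flat_exp_def\<close>)
    then show ?thesis using 1 by (simp add: flat_exp_def)
  next
    case 2
    have "((\<lambda>_. 0) has_real_derivative 0) (at t)" by simp
    then have "(flat_exp p has_real_derivative 0) (at t)"
      by (rule has_field_derivative_transform_within_open[where S="{..<0}"]) (use 2 in \<open>auto simp: flat_exp_def\<close>)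
    then show ?thesis using 2 by (simp add: flat_exp_def)
  next
    case 3
    \<comment> \<open>From the right the quotient is \<open>poly (pCons 0 p) y / exp y\<close> at
      \<open>y = 1 / h\<close>; the shift of the polynomial absorbs the division by
      \<open>h\<close>.\<close>
    have right: "((\<lambda>h. flat_exp p h / h) \<longlongrightarrow> 0) (at_right 0)"
    proof (rule Lim_transform_eventually)
      have "filterlim (\<lambda>h::real. 1 / h) at_top (at_right 0)"
        using filterlim_inverse_at_top_right by (simp add: divide_inverse)
      from filterlim_compose[OF poly_div_exp_tendsto_0 this]
      show "((\<lambda>h. poly (pCons 0 p) (1 / h) / exp (1 / h)) \<longlongrightarrow> 0) (at_right 0)" .
      show "\<forall>\<^sub>F h in at_right 0. poly (pCons 0 p) (1 / h) / exp (1 / h) = flat_exp p h / h"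
        unfolding eventually_at_right_field by (rule exI[of _ 1]) (simp add: flat_exp_def exp_minus divide_inverse)
    qed
    have left: "((\<lambda>h. flat_exp p h / h) \<longlongrightarrow> 0) (at_left 0)"
    proof (rule Lim_transform_eventually[OF tendsto_const])
      show "\<forall>\<^sub>F h in at_left 0. 0 = flat_exp p h / h"
        unfolding eventually_at_left_field by (rule exI[of _ "-1"]) (simp add: flat_exp_def)
    qed
    have "((\<lambda>h. (flat_exp p (0 + h) - flat_exp p 0) / h) \<longlongrightarrow> 0) (at 0)"
      using left right by (simp add: filterlim_split_at flat_exp_def)
    then show ?thesis using 3 by (simp add: DERIV_def flat_exp_def)
  qed
qed

text \<open>\<open>flat_exp (flat_poly n)\<close> is the \<open>n\<close>-th derivative of
  \<open>flat_exp 1\<close>.\<close>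

fun flat_poly :: "nat \<Rightarrow> real poly" where
  "flat_poly 0 = 1"
| "flat_poly (Suc n) = [:0, 0, 1:] * (flat_poly n - pderiv (flat_poly n))"

section \<open>Gradients and the smoothness classes \<open>Ck\<close>\<close>

lemma grad_eqI: "GDERIV f x :> D \<Longrightarrow> grad f x = D"
  unfolding grad_def
proof (rule the_equality)
  fix D' assume "GDERIV f x :> D" "GDERIV f x :> D'"
  then have "inner D = inner D'"
    unfolding gderiv_def by (metis has_derivative_unique inner_commute ext)
  then have "(D - D') \<bullet> (D - D') = 0" by (metis inner_diff_left right_minus_eq)
  then show "D' = D" by simp
qed

lemma grad_GDERIV:
  fixes f :: "'a::euclidean_space \<Rightarrow> real"
  assumes "f differentiable (at x)"
  shows "GDERIV f x :> grad f x"
proof -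
  obtain f' where f': "(f has_derivative f') (at x)" using assms by (auto simp: differentiable_def)
  have lin: "linear f'" using f' has_derivative_linear by blast
  have "f' h = h \<bullet> (\<Sum>b\<in>Basis. f' b *\<^sub>R b)" for h
  proof -
    have "f' h = f' (\<Sum>b\<in>Basis. (h \<bullet> b) *\<^sub>R b)" by (simp add: euclidean_representation)
    also have "\<dots> = (\<Sum>b\<in>Basis. (h \<bullet> b) * f' b)" by (simp add: linear_sum[OF lin] linear_scale[OF lin])
    finally show ?thesis by (simp add: inner_sum_right mult.commute)
  qed
  then have "f' = (\<lambda>h. h \<bullet> (\<Sum>b\<in>Basis. f' b *\<^sub>R b))" by blast
  then have "GDERIV f x :> (\<Sum>b\<in>Basis. f' b *\<^sub>R b)"
    using f' by (simp add: gderiv_def)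
  then show ?thesis using grad_eqI by metis
qed

lemma GDERIV_differentiable: "GDERIV f x :> D \<Longrightarrow> f differentiable (at x)"
  unfolding gderiv_def differentiable_def by blast

lemma Ck_SucI:
  assumes "\<And>x. GDERIV f x :> g x" "\<And>i. Ck k (\<lambda>x. g x $ i)"
  shows "Ck (Suc k) f"
proof -
  have "grad f = g" using grad_eqI[OF assms(1)] by blast
  moreover have "f differentiable (at x)" for x by (rule GDERIV_differentiable[OF assms(1)])
  ultimately show ?thesis using assms(2) by simp
qed

lemma Ck_SucD:
  assumes "Ck (Suc k) f"
  shows "GDERIV f x :> grad f x" "Ck k (\<lambda>x. grad f x $ i)"
  using assms grad_GDERIV by auto

declare Ck.simps(2) [simp del]

lemma Ck_continuous: "Ck k f \<Longrightarrow> continuous_on UNIV f"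
proof (cases k)
  case (Suc n)
  assume "Ck k f"
  then show ?thesis
    by (auto simp: Suc Ck.simps(2) intro!: continuous_at_imp_continuous_on differentiable_imp_continuous_within)
qed simp

lemma Ck_Suc: "Ck (Suc k) f \<Longrightarrow> Ck k f"
proof (induction k arbitrary: f)
  case 0
  then show ?case using Ck_continuous by auto
next
  case (Suc k)
  show ?case by (rule Ck_SucI[OF Ck_SucD(1)[OF Suc.prems] Suc.IH[OF Ck_SucD(2)[OF Suc.prems]]])
qed

lemma Ck_const: "Ck k (\<lambda>x. c)"
proof (induction k arbitrary: c)
  case (Suc k)
  show ?case by (rule Ck_SucI[where g="\<lambda>x. 0", OF GDERIV_const]) (simp add: Suc)
qed simp

lemma Ck_add: "Ck k f \<Longrightarrow> Ck k g \<Longrightarrow> Ck k (\<lambda>x. f x + g x)"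
proof (induction k arbitrary: f g)
  case (Suc k)
  show ?case
    by (rule Ck_SucI[OF GDERIV_add[OF Ck_SucD(1)[OF Suc.prems(1)] Ck_SucD(1)[OF Suc.prems(2)]]])
       (use Suc.IH[OF Ck_SucD(2)[OF Suc.prems(1)] Ck_SucD(2)[OF Suc.prems(2)]] in simp)
qed (auto intro: continuous_intros)

lemma Ck_mult: "Ck k f \<Longrightarrow> Ck k g \<Longrightarrow> Ck k (\<lambda>x. f x * g x)"
proof (induction k arbitrary: f g)
  case (Suc k)
  show ?case
  proof (rule Ck_SucI[OF GDERIV_mult[OF Ck_SucD(1)[OF Suc.prems(1)] Ck_SucD(1)[OF Suc.prems(2)]]])
    fix i
    have "Ck k (\<lambda>x. f x * (grad g x $ i) + g x * (grad f x $ i))"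
      by (rule Ck_add[OF Suc.IH[OF Ck_Suc[OF Suc.prems(1)] Ck_SucD(2)[OF Suc.prems(2)]]
            Suc.IH[OF Ck_Suc[OF Suc.prems(2)] Ck_SucD(2)[OF Suc.prems(1)]]])
    then show "Ck k (\<lambda>x. (f x *\<^sub>R grad g x + g x *\<^sub>R grad f x) $ i)" by simp
  qed
qed (auto intro: continuous_intros)

lemma Ck_scale: "Ck k f \<Longrightarrow> Ck k (\<lambda>x. c * f x)"
  using Ck_mult[OF Ck_const[of k c]] .

lemma Ck_sum: "finite I \<Longrightarrow> (\<And>i. i \<in> I \<Longrightarrow> Ck k (f i)) \<Longrightarrow> Ck k (\<lambda>x. \<Sum>i\<in>I. f i x)"
  by (induction I rule: finite_induct) (auto intro: Ck_const Ck_add)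

lemma Ck_prod: "finite I \<Longrightarrow> (\<And>i. i \<in> I \<Longrightarrow> Ck k (f i)) \<Longrightarrow> Ck k (\<lambda>x. \<Prod>i\<in>I. f i x)"
  by (induction I rule: finite_induct) (auto intro: Ck_const Ck_mult)

lemma GDERIV_compose_linear:
  fixes L :: "'a::euclidean_space \<Rightarrow> 'b::euclidean_space"
  assumes "linear L" "GDERIV f (L x) :> D"
  shows "GDERIV (\<lambda>x. f (L x)) x :> adjoint L D"
proof -
  have "((\<lambda>x. f (L x)) has_derivative (\<lambda>h. L h \<bullet> D)) (at x)"
    using assms has_derivative_compose[of L L x UNIV f "\<lambda>h. h \<bullet> D"] bounded_linear_imp_has_derivative[of L]
    by (simp add: gderiv_def linear_conv_bounded_linear)
  then show ?thesis by (simp add: gderiv_def adjoint_works[OF assms(1)])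
qed

lemma Ck_compose_linear:
  fixes L :: "real^'n \<Rightarrow> real^'n"
  assumes L: "linear L"
  shows "Ck k f \<Longrightarrow> Ck k (\<lambda>x. f (L x))"
proof (induction k arbitrary: f)
  case 0
  have "continuous_on UNIV L" using L by (simp add: linear_continuous_on linear_conv_bounded_linear)
  with 0 show ?case by (auto intro: continuous_on_compose2)
next
  case (Suc k)
  show ?case
  proof (rule Ck_SucI[OF GDERIV_compose_linear[OF L Ck_SucD(1)[OF Suc.prems]]])
    fix i
    have "adjoint L D $ i = (\<Sum>j\<in>UNIV. (L (axis i 1) $ j) * (D $ j))" for D
    proof -
      have "adjoint L D $ i = axis i 1 \<bullet> adjoint L D" by (simp add: inner_axis' )
      also have "\<dots> = L (axis i 1) \<bullet> D" by (simp add: adjoint_works[OF L])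
      finally show ?thesis by (simp add: inner_vec_def)
    qed
    then show "Ck k (\<lambda>x. adjoint L (grad f (L x)) $ i)"
      by (simp only:) (intro Ck_sum Ck_scale Suc.IH Ck_SucD(2)[OF Suc.prems] finite)
  qed
qed

text \<open>The hypothesis speaks of a whole sequence of successive derivatives so that the
  induction on \<open>k\<close> may pass from \<open>\<psi> n\<close> to
  \<open>\<psi> (Suc n)\<close>.\<close>

lemma Ck_coordinate:
  fixes \<psi> :: "nat \<Rightarrow> real \<Rightarrow> real"
  assumes \<psi>: "\<And>n t. (\<psi> n has_real_derivative \<psi> (Suc n) t) (at t)"
  shows "Ck k (\<lambda>x::real^'n. \<psi> n (a * (x $ i) + b))"
proof (induction k arbitrary: n)
  have der: "((\<lambda>x::real^'n. \<psi> n (a * (x $ i) + b)) has_derivative (\<lambda>h. \<psi> (Suc n) (a * (x $ i) + b) * (a * (h $ i)))) (at x)" for n x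
  proof -
    have "((\<lambda>x::real^'n. a * (x $ i) + b) has_derivative (\<lambda>h. a * (h $ i))) (at x)"
      by (auto intro!: derivative_eq_intros bounded_linear.has_derivative[OF bounded_linear_vec_nth])
    from has_derivative_compose[OF this \<psi>[unfolded has_field_derivative_def]] show ?thesis .
  qed
  {
    case 0
    show ?case
      using der by (auto intro!: continuous_at_imp_continuous_on has_derivative_continuous)
  next
    case (Suc k)
    show ?case
    proof (rule Ck_SucI)
      show "GDERIV (\<lambda>x::real^'n. \<psi> n (a * (x $ i) + b)) x :> axis i (a * \<psi> (Suc n) (a * (x $ i) + b))" for x
        using der[of n x] by (simp add: gderiv_def inner_axis mult_ac)
      fix j
      show "Ck k (\<lambda>x::real^'n. axis i (a * \<psi> (Suc n) (a * (x $ i) + b)) $ j)"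
        by (cases "j = i") (simp_all add: axis_def Ck_const Ck_scale Suc)
    qed
  }
qed

section \<open>Test functions and their density\<close>

lemma Cc_iff: "u \<in> Cc_infinity \<longleftrightarrow> (\<forall>k. Ck k u) \<and> bounded {x. u x \<noteq> 0}"
  by (simp add: Cc_infinity_def)

lemma Cc_continuous: "u \<in> Cc_infinity \<Longrightarrow> continuous_on UNIV u"
  using Ck_continuous by (auto simp: Cc_iff)

lemma Cc_zero: "(\<lambda>x. 0) \<in> Cc_infinity"
  by (simp add: Cc_iff Ck_const)

lemma Cc_add:
  assumes "u \<in> Cc_infinity" "v \<in> Cc_infinity"
  shows "(\<lambda>x. u x + v x) \<in> Cc_infinity"
proof -
  have "bounded ({x. u x \<noteq> 0} \<union> {x. v x \<noteq> 0})" using assms by (simp add: Cc_iff)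
  then have "bounded {x. u x + v x \<noteq> 0}" by (rule bounded_subset) auto
  with assms show ?thesis by (simp add: Cc_iff Ck_add)
qed

lemma Cc_scale:
  assumes "u \<in> Cc_infinity"
  shows "(\<lambda>x. c * u x) \<in> Cc_infinity"
proof -
  have "bounded {x. u x \<noteq> 0}" using assms by (simp add: Cc_iff)
  then have "bounded {x. c * u x \<noteq> 0}" by (rule bounded_subset) auto
  with assms show ?thesis by (simp add: Cc_iff Ck_scale)
qed

lemma Cc_sum: "finite I \<Longrightarrow> (\<And>i. i \<in> I \<Longrightarrow> f i \<in> Cc_infinity) \<Longrightarrow> (\<lambda>x. \<Sum>i\<in>I. f i x) \<in> Cc_infinity"
  by (induction I rule: finite_induct) (auto intro: Cc_zero Cc_add)

lemma Cc_compose_linear: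
  fixes L L' :: "real^'n \<Rightarrow> real^'n"
  assumes u: "u \<in> Cc_infinity" and L: "linear L" and L': "linear L'" and inv: "\<And>x. L' (L x) = x"
  shows "(\<lambda>x. u (L x)) \<in> Cc_infinity"
proof -
  have "bounded {x. u x \<noteq> 0}"
    using u by (simp add: Cc_iff)
  then have "bounded (L' ` {x. u x \<noteq> 0})"
    using L' by (intro bounded_linear_image) (simp_all add: linear_conv_bounded_linear)
  moreover have "{x. u (L x) \<noteq> 0} \<subseteq> L' ` {x. u x \<noteq> 0}"
  proof
    fix x assume "x \<in> {x. u (L x) \<noteq> 0}"
    then show "x \<in> L' ` {x. u x \<noteq> 0}" using inv[of x] by (intro image_eqI[of _ _ "L x"]) auto
  qed
  ultimately have "bounded {x. u (L x) \<noteq> 0}" by (rule bounded_subset)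
  with u show ?thesis by (simp add: Cc_iff Ck_compose_linear[OF L])
qed

lemma Cc_GDERIV: "u \<in> Cc_infinity \<Longrightarrow> GDERIV u x :> grad u x"
  and Cc_grad_continuous: "u \<in> Cc_infinity \<Longrightarrow> continuous_on UNIV (\<lambda>x. grad u x)"
proof -
  assume u: "u \<in> Cc_infinity"
  then have 2: "Ck (Suc 0) u" by (simp only: Cc_iff)
  show "GDERIV u x :> grad u x" by (rule Ck_SucD(1)[OF 2])
  have "continuous_on UNIV (\<lambda>x. \<chi> i. grad u x $ i)"
    using Ck_SucD(2)[OF 2] by (intro continuous_on_vec_lambda) auto
  then show "continuous_on UNIV (\<lambda>x. grad u x)" by simp
qed

lemma Cc_grad_outside:
  assumes u: "u \<in> Cc_infinity" and x: "x \<notin> closure {x. u x \<noteq> 0}"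
  shows "grad u x = 0"
proof (rule grad_eqI)
  have "((\<lambda>x. 0) has_derivative (\<lambda>h. 0)) (at x)" by simp
  then have "(u has_derivative (\<lambda>h. 0)) (at x)"
    by (rule has_derivative_transform_within_open[where s="- closure {x. u x \<noteq> 0}"])
       (use x closure_subset[of "{x. u x \<noteq> 0}"] in auto)
  then show "GDERIV u x :> 0" by (simp add: gderiv_def)
qed

text \<open>Smooth, and positive exactly on the open box with corners \<open>a\<close> and
  \<open>b\<close>; the factor \<open>Suc n\<close> steepens the edges so that the limit is the
  indicator.\<close>

definition box_bump :: "real^'n \<Rightarrow> real^'n \<Rightarrow> nat \<Rightarrow> real^'n \<Rightarrow> real" where
  "box_bump a b n x = (\<Prod>i\<in>UNIV. flat_exp 1 (real (Suc n) * (x $ i - a $ i)) * flat_exp 1 (real (Suc n) * (b $ i - x $ i)))"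

lemma flat_exp_1_bounds: "0 \<le> flat_exp 1 t" "flat_exp 1 t \<le> 1"
  by (simp_all add: flat_exp_def)

lemma box_bump_Cc:
  fixes a b :: "real^'n"
  shows "box_bump a b n \<in> Cc_infinity"
proof -
  have fl: "Ck k (\<lambda>x::real^'n. flat_exp 1 (c * (x $ i) + d))" for k c i d
    using Ck_coordinate[of "\<lambda>n. flat_exp (flat_poly n)" k 0 c i d] flat_exp_has_derivative by simp
  have "Ck k (\<lambda>x::real^'n. flat_exp 1 (real (Suc n) * (x $ i - a $ i)) * flat_exp 1 (real (Suc n) * (b $ i - x $ i)))" for k i
    using Ck_mult[OF fl[of k "real (Suc n)" i "- real (Suc n) * a $ i"] fl[of k "- real (Suc n)" i "real (Suc n) * b $ i"]]
    by (simp add: algebra_simps)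
  then have "Ck k (box_bump a b n)" for k
    unfolding box_bump_def by (intro Ck_prod) auto
  moreover have "{x. box_bump a b n x \<noteq> 0} \<subseteq> cbox a b"
  proof
    fix x assume "x \<in> {x. box_bump a b n x \<noteq> 0}"
    then have *: "flat_exp 1 (real (Suc n) * (x $ i - a $ i)) \<noteq> 0" "flat_exp 1 (real (Suc n) * (b $ i - x $ i)) \<noteq> 0" for i
      by (auto simp: box_bump_def)
    have "a $ i < x $ i" for i
      using *(1)[of i] by (rule contrapos_np) (simp add: flat_exp_def zero_less_mult_iff)
    moreover have "x $ i < b $ i" for i
      using *(2)[of i] by (rule contrapos_np) (simp add: flat_exp_def zero_less_mult_iff)
    ultimately show "x \<in> cbox a b" by (auto simp: mem_box_cart less_imp_le)
  qed
  then have "bounded {x. box_bump a b n x \<noteq> 0}" using bounded_subset bounded_cbox by blast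
  ultimately show ?thesis by (simp add: Cc_iff)
qed

lemma box_bump_bounds: "0 \<le> box_bump a b n x" "box_bump a b n x \<le> 1"
  unfolding box_bump_def using flat_exp_1_bounds
  by (auto intro!: prod_nonneg prod_le_1 mult_nonneg_nonneg mult_le_one)

lemma box_bump_tendsto: "(\<lambda>n. box_bump a b n x) \<longlonglongrightarrow> indicator (box a b) x"
proof -
  have fl: "(\<lambda>n. flat_exp 1 (real (Suc n) * t)) \<longlonglongrightarrow> (if 0 < t then 1 else 0)" for t
  proof (cases "0 < t")
    case True
    have "(\<lambda>n. exp (- (1 / real (Suc n) * (1 / t)))) \<longlonglongrightarrow> exp (- (0 * (1 / t)))"
      by (intro tendsto_intros LIMSEQ_Suc lim_1_over_n)
    with True show ?thesis by (simp add: flat_exp_def)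
  qed (auto simp: flat_exp_def zero_less_mult_iff)
  have "(\<lambda>n. box_bump a b n x) \<longlonglongrightarrow> (\<Prod>i\<in>UNIV. (if 0 < x $ i - a $ i then 1 else 0) * (if 0 < b $ i - x $ i then 1 else 0))"
    unfolding box_bump_def by (intro tendsto_prod tendsto_mult fl)
  also have "(\<Prod>i\<in>UNIV. (if 0 < x $ i - a $ i then 1 else 0) * (if 0 < b $ i - x $ i then 1 else 0)) = (indicator (box a b) x :: real)"
  proof (cases "x \<in> box a b")
    case True
    then show ?thesis by (auto simp: mem_box_cart intro!: prod.neutral)
  next
    case False
    then obtain i where "\<not> (a $ i < x $ i \<and> x $ i < b $ i)" by (auto simp: mem_box_cart)
    then have ex: "\<exists>i\<in>UNIV. (if 0 < x $ i - a $ i then 1 else 0) * (if 0 < b $ i - x $ i then 1 else (0::real)) = 0"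
      by (intro bexI[of _ i]) auto
    have "indicator (box a b) x = (0::real)" using False by simp
    from trans[OF prod_zero[OF finite ex] this[symmetric]] show ?thesis .
  qed
  finally show ?thesis .
qed

lemma Cc_bounded:
  assumes "u \<in> Cc_infinity"
  obtains B where "\<And>x. \<bar>u x\<bar> \<le> B"
proof -
  have "compact (u ` closure {x. u x \<noteq> 0})"
    using assms Cc_continuous[OF assms]
    by (intro compact_continuous_image) (auto simp: Cc_infinity_def intro: continuous_on_subset)
  then have "bounded (u ` closure {x. u x \<noteq> 0})" by (rule compact_imp_bounded)
  then obtain B where B: "\<And>y. y \<in> u ` closure {x. u x \<noteq> 0} \<Longrightarrow> norm y \<le> B"
    unfolding bounded_iff by auto
  have "\<bar>u x\<bar> \<le> max B 0" for x
  proof (cases "u x = 0")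
    case False
    then have "x \<in> closure {x. u x \<noteq> 0}" using closure_subset[of "{x. u x \<noteq> 0}"] by auto
    then show ?thesis using B[of "u x"] by auto
  qed simp
  then show ?thesis by (rule that)
qed

lemma Cc_L2: "u \<in> Cc_infinity \<Longrightarrow> u \<in> L2 gauss"
  using Cc_bounded[of u] L2_bounded[OF finite_measure_gauss, of u] borel_measurable_continuous_onI[OF Cc_continuous[of u]]
  by (metis measurable_cong_sets sets_gauss)

text \<open>Orthogonality passes from bumps to indicators of boxes. The positive and negative parts
  of \<open>f\<close> then give equal mass to every box, and boxes generate the Borel sets.\<close>

lemma Cc_dense: "closure (cls ` Cc_infinity) = (UNIV :: (real^'n) l2 set)"
proof -
  have sub: "subspace (cls ` (Cc_infinity :: (real^'n \<Rightarrow> real) set))"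
  proof (rule subspaceI)
    show "0 \<in> cls ` (Cc_infinity :: (real^'n \<Rightarrow> real) set)" using Cc_zero cls_zero by (metis image_eqI)
    fix x y assume "x \<in> cls ` (Cc_infinity :: (real^'n \<Rightarrow> real) set)" "y \<in> cls ` (Cc_infinity :: (real^'n \<Rightarrow> real) set)"
    then show "x + y \<in> cls ` Cc_infinity" by (auto simp: cls_add Cc_L2 intro: Cc_add)
  next
    fix c x assume "x \<in> cls ` (Cc_infinity :: (real^'n \<Rightarrow> real) set)"
    then show "c *\<^sub>R x \<in> cls ` Cc_infinity" by (auto simp: cls_scale Cc_L2 intro: Cc_scale)
  qed
  have "closure (span (cls ` (Cc_infinity :: (real^'n \<Rightarrow> real) set))) = UNIV"
  proof (rule dense_subspaceI)
    fix m :: "(real^'n) l2"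
    assume orth: "\<And>b. b \<in> cls ` Cc_infinity \<Longrightarrow> inner m b = 0"
    obtain f where f: "f \<in> L2 gauss" "m = cls f" by (rule cls_cases)
    have [measurable]: "f \<in> borel_measurable borel" by (rule L2_borel[OF f(1)])
    have intf: "integrable gauss f" by (rule L2_integrable[OF finite_measure_gauss f(1)])
    have box0: "(\<integral>x. f x * indicator (box a b) x \<partial>gauss) = 0" for a b
    proof (rule LIMSEQ_unique)
      show "(\<lambda>n. \<integral>x. f x * box_bump a b n x \<partial>gauss) \<longlonglongrightarrow> (\<integral>x. f x * indicator (box a b) x \<partial>gauss)"
      proof (rule integral_dominated_convergence[where w="\<lambda>x. \<bar>f x\<bar>"])
        show "(\<lambda>x. f x * box_bump a b n x) \<in> borel_measurable gauss" for n
          using borel_measurable_continuous_onI[OF Cc_continuous[OF box_bump_Cc[of a b n]]] by measurable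
        show "AE x in gauss. norm (f x * box_bump a b n x) \<le> \<bar>f x\<bar>" for n
          using box_bump_bounds[of a b n] by (auto simp: abs_mult intro!: mult_left_le)
        show "AE x in gauss. (\<lambda>n. f x * box_bump a b n x) \<longlonglongrightarrow> f x * indicator (box a b) x"
          by (intro AE_I2 tendsto_mult tendsto_const box_bump_tendsto)
      qed (use intf in auto)
      have "(\<integral>x. f x * box_bump a b n x \<partial>gauss) = 0" for n
        using orth[OF imageI[OF box_bump_Cc]] cls_inner[OF f(1) Cc_L2[OF box_bump_Cc]] by (simp add: f(2))
      then show "(\<lambda>n. \<integral>x. f x * box_bump a b n x \<partial>gauss) \<longlonglongrightarrow> 0" by simp
    qed
    define fp fm where "fp x = max 0 (f x)" and "fm x = max 0 (- f x)" for x
    have [measurable]: "fp \<in> borel_measurable borel" "fm \<in> borel_measurable borel"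
      unfolding fp_def fm_def by measurable
    have pm: "fp x - fm x = f x" "0 \<le> fp x" "0 \<le> fm x" for x by (auto simp: fp_def fm_def)
    have int: "integrable gauss fp" "integrable gauss fm"
      unfolding fp_def fm_def using intf by auto
    let ?M = "density gauss (\<lambda>x. ennreal (fp x))" and ?N = "density gauss (\<lambda>x. ennreal (fm x))"
    have em: "emeasure (density gauss (\<lambda>x. ennreal (g x))) (box a b) = ennreal (\<integral>x. g x * indicator (box a b) x \<partial>gauss)"
      if g: "integrable gauss g" "\<And>x. 0 \<le> g x" and [measurable]: "g \<in> borel_measurable borel" for g :: "real^'n \<Rightarrow> real" and a b
    proof -
      have "emeasure (density gauss (\<lambda>x. ennreal (g x))) (box a b) = (\<integral>\<^sup>+x. ennreal (g x * indicator (box a b) x) \<partial>gauss)"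
        by (subst emeasure_density) (auto intro!: nn_integral_cong simp: indicator_def)
      also have "\<dots> = ennreal (\<integral>x. g x * indicator (box a b) x \<partial>gauss)"
        using g by (intro nn_integral_eq_integral integrable_mult_indicator[OF _ g(1), of "box a b", simplified real_scaleR_def, simplified mult.commute[of "indicator _ _"]])
          auto
      finally show ?thesis .
    qed
    have intb: "integrable gauss (\<lambda>x. g x * indicator (box a b) x)" if "integrable gauss g" for g :: "real^'n \<Rightarrow> real" and a b
      using integrable_mult_indicator[OF _ that, of "box a b"] by (simp add: mult.commute)
    have eqb: "emeasure ?M (box a b) = emeasure ?N (box a b)" for a b
    proof -
      have "(\<integral>x. fp x * indicator (box a b) x \<partial>gauss) - (\<integral>x. fm x * indicator (box a b) x \<partial>gauss)
          = (\<integral>x. f x * indicator (box a b) x \<partial>gauss)"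
        using Bochner_Integration.integral_diff[OF intb[OF int(1)] intb[OF int(2)], of a b a b]
        by (simp add: left_diff_distrib[symmetric] pm)
      then show ?thesis using em[OF int(1)] em[OF int(2)] pm by (simp add: box0)
    qed
    have "?M = ?N"
    proof (rule measure_eqI_generator_eq)
      let ?E = "range (\<lambda>(a, b). box a b::(real^'n) set)"
      show "Int_stable ?E" by (auto simp: Int_stable_def box_Int_box)
      show "?E \<subseteq> Pow UNIV" "sets ?M = sigma_sets UNIV ?E" "sets ?N = sigma_sets UNIV ?E"
        by (simp_all add: borel_eq_box)
      let ?A = "\<lambda>n::nat. box (- (real n *\<^sub>R One)) (real n *\<^sub>R One) :: (real^'n) set"
      show "range ?A \<subseteq> ?E" "(\<Union>i. ?A i) = UNIV" unfolding UN_box_eq_UNIV by auto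
      show "emeasure ?M (?A i) \<noteq> \<infinity>" for i using em[OF int(1)] pm by simp
      show "emeasure ?M X = emeasure ?N X" if "X \<in> ?E" for X using that eqb by auto
    qed
    then have "AE x in gauss. ennreal (fp x) = ennreal (fm x)"
      by (intro iffD1[OF sigma_finite_measure.density_unique_iff])
         (auto intro: prob_space_imp_sigma_finite prob_space_gauss)
    then have "AE x in gauss. f x = 0"
      by eventually_elim (metis diff_self ennreal_inj pm)
    then show "m = 0" using f by (simp add: cls_eq_iff L2_zero flip: cls_zero)
  qed
  moreover have "span (cls ` Cc_infinity) = cls ` (Cc_infinity :: (real^'n \<Rightarrow> real) set)"
    by (rule span_eq_iff[THEN iffD2, OF sub])
  ultimately show ?thesis by simp
qed

subsection \<open>Rotation groups and the kernel of their generator\<close>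

text \<open>Composition with a flow, written as a Mehler operator with the point mass at zero as
  noise, so that for skew \<open>C\<close> linearity, contractivity and composition are
  inherited.\<close>

definition rot :: "('a::euclidean_space \<Rightarrow> 'a) \<Rightarrow> real \<Rightarrow> 'a l2 \<Rightarrow> 'a l2" where
  "rot C s = mehler_l2 (flow C s) (return borel 0)"

definition skew :: "('a::euclidean_space \<Rightarrow> 'a) \<Rightarrow> bool" where
  "skew C \<longleftrightarrow> linear C \<and> (\<forall>x y. C x \<bullet> y = - (x \<bullet> C y))"

context
  fixes C :: "'a::euclidean_space \<Rightarrow> 'a"
  assumes skew: "skew C"
begin

lemma skew_linear: "linear C"
  using skew by (simp add: skew_def)

lemma flow_skew_adjoint: "flow C s x \<bullet> y = x \<bullet> flow C (- s) y"
proof -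
  have "flow C s x \<bullet> y = x \<bullet> flow (\<lambda>x. - C x) s y"
    using skew by (intro flow_adjoint) (auto simp: skew_def linear_compose_neg)
  then show ?thesis by (simp add: flow_negate[OF skew_linear])
qed

lemma adjoint_flow_skew: "adjoint (flow C s) = flow C (- s)"
  by (rule adjoint_unique) (simp add: flow_skew_adjoint)

lemma flow_skew_inner: "flow C s x \<bullet> flow C s y = x \<bullet> y"
  by (simp add: flow_skew_adjoint)

lemma gauss_noise_rot: "gauss_noise (flow C s) (return borel 0)"
proof -
  have "cf (return borel 0) \<xi> = 1" for \<xi> :: 'a
    unfolding cf_def by (subst integral_return) auto
  then show ?thesis
    by (simp add: gauss_noise_def linear_flow prob_space_return adjoint_flow_skew flow_skew_inner)
qed

lemma mehler_rot:
  assumes "f \<in> borel_measurable borel"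
  shows "mehler (flow C s) (return borel 0) f = (\<lambda>x. f (flow C s x))"
proof
  fix x
  have [measurable]: "f \<in> borel_measurable borel" by fact
  show "mehler (flow C s) (return borel 0) f x = f (flow C s x)"
    unfolding mehler_def by (subst integral_return) auto
qed

lemma rot_cls:
  assumes "f \<in> L2 gauss"
  shows "rot C s (cls f) = cls (\<lambda>x. f (flow C s x))" "(\<lambda>x. f (flow C s x)) \<in> L2 gauss"
  using mehler_l2_cls[OF gauss_noise_rot assms, of s] mehler_L2(1)[OF gauss_noise_rot assms, of s]
  by (simp_all add: rot_def mehler_rot L2_borel[OF assms])

lemma rot_linear: "linear (rot C s)"
  unfolding rot_def by (rule mehler_l2_linear[OF gauss_noise_rot])

lemma rot_0: "rot C 0 x = x"
  by (rule cls_cases[of x]) (simp add: rot_cls)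

lemma rot_add: "rot C (s + t) x = rot C s (rot C t x)"
proof (rule cls_cases[of x])
  fix f assume f: "f \<in> L2 gauss" "x = cls f"
  have "rot C s (rot C t x) = cls (\<lambda>x. f (flow C t (flow C s x)))"
    by (simp add: f rot_cls)
  then show ?thesis by (simp add: f rot_cls flow_add add.commute[of s])
qed

lemma norm_rot: "norm (rot C s x) = norm x"
proof (rule antisym)
  show le: "norm (rot C s x) \<le> norm x" for s x
    unfolding rot_def by (rule mehler_l2_norm[OF gauss_noise_rot])
  have "norm (rot C (- s) (rot C s x)) \<le> norm (rot C s x)" by (rule le)
  then show "norm x \<le> norm (rot C s x)" by (simp add: rot_add[symmetric] rot_0)
qed

lemma rot_inner: "inner (rot C s x) (rot C s y) = inner x y"
proof -
  have pol: "inner u v = ((norm (u + v))\<^sup>2 - (norm (u - v))\<^sup>2) / 4" for u v :: "'a l2"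
    unfolding power2_norm_eq_inner
    by (simp add: inner_add_left inner_add_right inner_diff_left inner_diff_right inner_commute)
  show ?thesis
    unfolding pol[of "rot C s x"] pol[of x]
    by (simp add: linear_add[OF rot_linear, symmetric] linear_diff[OF rot_linear, symmetric] norm_rot)
qed

lemma unitary_group_rot: "unitary_group (rot C)"
  by (intro unitary_group.intro rot_linear rot_inner rot_0 rot_add)

lemma rot_one: "rot C s one_l2 = one_l2"
  by (simp add: one_l2_def rot_cls one_L2)

end

section \<open>The first-order operator as generator of the rotation group\<close>

lemma L2_tendsto_cls:
  assumes "\<And>n. u n \<in> L2 gauss" "g \<in> L2 gauss"
  shows "L2_tendsto gauss u g F \<longleftrightarrow> ((\<lambda>n. cls (u n)) \<longlongrightarrow> cls g) F"
proof -
  have "L2_norm gauss (\<lambda>x. u n x - g x) = norm (cls (u n) - cls g)" for n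
    using assms by (simp add: L2_norm_def L2_inner_def norm_eq_sqrt_inner cls_diff cls_inner L2_diff)
  then show ?thesis
    using assms by (simp add: L2_tendsto_def tendsto_norm_zero_iff LIM_zero_iff)
qed

context
  fixes C :: "real^'n \<Rightarrow> real^'n"
  assumes skew: "skew C"
begin

lemma Cc_flow:
  assumes "u \<in> Cc_infinity"
  shows "(\<lambda>x. u (flow C s x)) \<in> Cc_infinity"
  by (rule Cc_compose_linear[OF assms linear_flow linear_flow[of C "- s"]]) simp

lemma first_order_continuous:
  assumes "u \<in> Cc_infinity"
  shows "continuous_on UNIV (first_order_op C u)"
  unfolding first_order_op_def
  using skew_linear[OF skew]
  by (intro continuous_intros Cc_grad_continuous assms linear_continuous_on) (simp add: linear_conv_bounded_linear)

lemma first_order_bounded: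
  assumes u: "u \<in> Cc_infinity"
  obtains B where "\<And>x. \<bar>first_order_op C u x\<bar> \<le> B"
proof -
  have "compact (first_order_op C u ` closure {x. u x \<noteq> 0})"
    using u first_order_continuous[OF u]
    by (intro compact_continuous_image) (auto simp: Cc_infinity_def intro: continuous_on_subset)
  then have "bounded (first_order_op C u ` closure {x. u x \<noteq> 0})" by (rule compact_imp_bounded)
  then obtain B where B: "\<And>y. y \<in> first_order_op C u ` closure {x. u x \<noteq> 0} \<Longrightarrow> norm y \<le> B"
    unfolding bounded_iff by auto
  have "\<bar>first_order_op C u x\<bar> \<le> max B 0" for x
  proof (cases "x \<in> closure {x. u x \<noteq> 0}")
    case True
    then show ?thesis using B[of "first_order_op C u x"] by auto
  qed (simp add: first_order_op_def Cc_grad_outside[OF u])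
  then show ?thesis by (rule that)
qed

lemma first_order_L2: "u \<in> Cc_infinity \<Longrightarrow> first_order_op C u \<in> L2 gauss"
  using first_order_bounded[of u] L2_bounded[OF finite_measure_gauss, of "first_order_op C u"]
    borel_measurable_continuous_onI[OF first_order_continuous[of u]]
  by (metis measurable_cong_sets sets_gauss)

lemma Cc_flow_derivative:
  assumes u: "u \<in> Cc_infinity"
  shows "((\<lambda>s. u (flow C s x)) has_real_derivative first_order_op C u (flow C s x)) (at s)"
proof -
  have "((\<lambda>s. flow C s x) has_derivative (\<lambda>h. h *\<^sub>R C (flow C s x))) (at s)"
    using flow_has_vector_derivative[OF skew_linear[OF skew]] by (simp add: has_vector_derivative_def)
  from has_derivative_compose[OF this Cc_GDERIV[OF u, unfolded gderiv_def]]
  show ?thesis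
    by (simp add: has_field_derivative_def first_order_op_def mult_commute_abs)
qed

text \<open>Pointwise convergence is the derivative along the flow; the mean value theorem bounds
  all quotients by a bound of \<open>first_order_op C u\<close>, so dominated convergence gives the
  limit in norm.\<close>

lemma rot_difference_quotient:
  assumes u: "u \<in> Cc_infinity" and s: "0 < s"
  shows "(\<lambda>n. (real (Suc n) / s) *\<^sub>R (rot C (s / real (Suc n)) (cls u) - cls u)) \<longlonglongrightarrow> cls (first_order_op C u)"
proof -
  let ?h = "\<lambda>n. s / real (Suc n)"
  let ?q = "\<lambda>n x. (real (Suc n) / s) * (u (flow C (?h n) x) - u x)"
  have qL2: "?q n \<in> L2 gauss" for n
    by (intro L2_scale L2_diff Cc_L2 Cc_flow u)
  have dL2: "(\<lambda>x. ?q n x - first_order_op C u x) \<in> L2 gauss" for n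
    by (intro L2_diff qL2 first_order_L2 u)
  have q: "(real (Suc n) / s) *\<^sub>R (rot C (?h n) (cls u) - cls u) = cls (?q n)" for n
    using rot_cls[OF skew Cc_L2[OF u]] by (simp only: cls_diff cls_scale L2_diff Cc_L2[OF u])
  obtain B where B: "\<And>x. \<bar>first_order_op C u x\<bar> \<le> B" by (rule first_order_bounded[OF u]) blast
  have qB: "\<bar>?q n x\<bar> \<le> B" for n x
  proof -
    have "0 < ?h n" using s by simp
    then obtain z where "u (flow C (?h n) x) - u (flow C 0 x) = (?h n - 0) * first_order_op C u (flow C z x)"
      using MVT2[of 0 "?h n" "\<lambda>s. u (flow C s x)" "\<lambda>s. first_order_op C u (flow C s x)"] Cc_flow_derivative[OF u]
      by blast
    then have "?q n x = first_order_op C u (flow C z x)" using s by simp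
    then show ?thesis using B by simp
  qed
  have lim: "(\<lambda>n. ?q n x) \<longlonglongrightarrow> first_order_op C u x" for x
  proof -
    have "((\<lambda>h. (u (flow C (0 + h) x) - u (flow C 0 x)) / h) \<longlongrightarrow> first_order_op C u (flow C 0 x)) (at 0)"
      using Cc_flow_derivative[OF u, of x 0] by (simp add: DERIV_def)
    moreover have "filterlim ?h (at 0) sequentially"
      unfolding filterlim_at using s tendsto_mult_right_zero[OF LIMSEQ_Suc[OF lim_1_over_n], of s]
      by (auto simp: divide_inverse)
    ultimately have "(\<lambda>n. (u (flow C (0 + ?h n) x) - u (flow C 0 x)) / ?h n) \<longlonglongrightarrow> first_order_op C u (flow C 0 x)"
      by (rule filterlim_compose)
    then show ?thesis by (simp add: mult.commute)
  qed
  have "(\<lambda>n. \<integral>x. (?q n x - first_order_op C u x)\<^sup>2 \<partial>gauss) \<longlonglongrightarrow> (\<integral>x. 0 \<partial>(gauss :: (real^'n) measure))"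
  proof (rule integral_dominated_convergence[where w="\<lambda>_. (2 * B)\<^sup>2"])
    show "(\<lambda>x. (?q n x - first_order_op C u x)\<^sup>2) \<in> borel_measurable gauss" for n
      using L2_measurable[OF dL2[of n]] by measurable
    show "AE x in gauss. (\<lambda>n. (?q n x - first_order_op C u x)\<^sup>2) \<longlonglongrightarrow> 0"
    proof (rule AE_I2)
      fix x
      have "(\<lambda>n. (?q n x - first_order_op C u x)\<^sup>2) \<longlonglongrightarrow> (first_order_op C u x - first_order_op C u x)\<^sup>2"
        by (intro tendsto_intros lim)
      then show "(\<lambda>n. (?q n x - first_order_op C u x)\<^sup>2) \<longlonglongrightarrow> 0" by simp
    qed
    show "AE x in gauss. norm ((?q n x - first_order_op C u x)\<^sup>2) \<le> (2 * B)\<^sup>2" for n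
    proof (rule AE_I2)
      fix x
      have "\<bar>?q n x - first_order_op C u x\<bar> \<le> \<bar>?q n x\<bar> + \<bar>first_order_op C u x\<bar>" by (rule abs_triangle_ineq4)
      also have "\<dots> \<le> B + B" by (rule add_mono[OF qB B])
      finally have "\<bar>?q n x - first_order_op C u x\<bar> \<le> 2 * B" by simp
      then have "\<bar>?q n x - first_order_op C u x\<bar>\<^sup>2 \<le> (2 * B)\<^sup>2" by (rule power_mono) simp
      then show "norm ((?q n x - first_order_op C u x)\<^sup>2) \<le> (2 * B)\<^sup>2" by simp
    qed
  qed (simp_all add: finite_measure.integrable_const)
  moreover have "(norm (cls (?q n) - cls (first_order_op C u)))\<^sup>2 = (\<integral>x. (?q n x - first_order_op C u x)\<^sup>2 \<partial>gauss)" for n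
    by (subst cls_diff[OF qL2 first_order_L2[OF u]]) (rule cls_norm[OF dL2])
  ultimately have "(\<lambda>n. (norm (cls (?q n) - cls (first_order_op C u)))\<^sup>2) \<longlonglongrightarrow> 0"
    by (simp only: Bochner_Integration.integral_zero)
  then have "(\<lambda>n. sqrt ((norm (cls (?q n) - cls (first_order_op C u)))\<^sup>2)) \<longlonglongrightarrow> sqrt 0"
    by (rule tendsto_real_sqrt)
  then show ?thesis unfolding q by (simp add: tendsto_norm_zero_iff LIM_zero_iff)
qed

lemma rot_diff_le: "norm (rot C (real n * h) x - x) \<le> real n * norm (rot C h x - x)"
proof (induction n)
  case (Suc n)
  have "rot C (real (Suc n) * h) x - x = rot C (real n * h) (rot C h x - x) + (rot C (real n * h) x - x)"
    by (simp add: linear_diff[OF rot_linear[OF skew]] rot_add[OF skew, symmetric] algebra_simps)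
  then have "norm (rot C (real (Suc n) * h) x - x) \<le> norm (rot C h x - x) + real n * norm (rot C h x - x)"
    using Suc norm_triangle_ineq[of "rot C (real n * h) (rot C h x - x)"] norm_rot[OF skew, of "real n * h" "rot C h x - x"]
    by (smt (verit))
  then show ?case by (simp add: algebra_simps)
qed (simp add: rot_0[OF skew])

text \<open>The time \<open>s\<close> is split into \<open>Suc n\<close> equal steps and
  \<open>n\<close> tends to infinity. The bound survives limits of \<open>u\<close> together with
  its derivative, which makes every element of the closure's kernel invariant.\<close>

lemma rot_diff_le_generator:
  assumes u: "u \<in> Cc_infinity" and s: "0 < s"
  shows "norm (rot C s (cls u) - cls u) \<le> s * norm (cls (first_order_op C u))"
proof (rule LIMSEQ_le_const)
  show "(\<lambda>n. s * norm ((real (Suc n) / s) *\<^sub>R (rot C (s / real (Suc n)) (cls u) - cls u))) \<longlonglongrightarrow> s * norm (cls (first_order_op C u))"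
    by (intro tendsto_intros rot_difference_quotient assms)
  have "norm (rot C s (cls u) - cls u) \<le> s * norm ((real (Suc n) / s) *\<^sub>R (rot C (s / real (Suc n)) (cls u) - cls u))" for n
    using rot_diff_le[of "Suc n" "s / real (Suc n)" "cls u"] s by simp
  then show "\<exists>N. \<forall>n\<ge>N. norm (rot C s (cls u) - cls u) \<le> s * norm ((real (Suc n) / s) *\<^sub>R (rot C (s / real (Suc n)) (cls u) - cls u))"
    by blast
qed

text \<open>Both sides are limits of the same difference quotients, because the rotations commute
  with each other.\<close>

lemma first_order_rot:
  assumes u: "u \<in> Cc_infinity"
  shows "cls (first_order_op C (\<lambda>x. u (flow C s x))) = rot C s (cls (first_order_op C u))"
proof (rule LIMSEQ_unique)
  show "(\<lambda>n. (real (Suc n) / 1) *\<^sub>R (rot C (1 / real (Suc n)) (cls (\<lambda>x. u (flow C s x))) - cls (\<lambda>x. u (flow C s x))))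
      \<longlonglongrightarrow> cls (first_order_op C (\<lambda>x. u (flow C s x)))"
    by (rule rot_difference_quotient[OF Cc_flow[OF u]]) simp
  have "(real (Suc n) / 1) *\<^sub>R (rot C (1 / real (Suc n)) (cls (\<lambda>x. u (flow C s x))) - cls (\<lambda>x. u (flow C s x)))
      = rot C s ((real (Suc n) / 1) *\<^sub>R (rot C (1 / real (Suc n)) (cls u) - cls u))" for n
    using rot_cls(1)[OF skew Cc_L2[OF u], of s]
    by (simp add: linear_diff[OF rot_linear[OF skew]] linear_scale[OF rot_linear[OF skew]]
        rot_add[OF skew, symmetric] add.commute flip: rot_cls(1)[OF skew Cc_L2[OF u], of s])
  moreover have "(\<lambda>n. rot C s ((real (Suc n) / 1) *\<^sub>R (rot C (1 / real (Suc n)) (cls u) - cls u)))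
      \<longlonglongrightarrow> rot C s (cls (first_order_op C u))"
    using rot_difference_quotient[OF u, of 1] unitary_group.isCont_U[OF unitary_group_rot[OF skew]]
    by (intro isCont_tendsto_compose[where g="rot C s"]) auto
  ultimately show "(\<lambda>n. (real (Suc n) / 1) *\<^sub>R (rot C (1 / real (Suc n)) (cls (\<lambda>x. u (flow C s x))) - cls (\<lambda>x. u (flow C s x))))
      \<longlonglongrightarrow> rot C s (cls (first_order_op C u))" by simp
qed

lemma first_order_sum:
  assumes "finite I" "\<And>i. i \<in> I \<Longrightarrow> f i \<in> Cc_infinity"
  shows "first_order_op C (\<lambda>x. c * (\<Sum>i\<in>I. f i x)) = (\<lambda>x. c * (\<Sum>i\<in>I. first_order_op C (f i) x))"
proof
  fix x
  have "GDERIV (\<lambda>x. \<Sum>i\<in>I. f i x) x :> (\<Sum>i\<in>I. grad (f i) x)"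
    using assms
  proof (induction I rule: finite_induct)
    case (insert i I)
    have "GDERIV (\<lambda>x. f i x + (\<Sum>i\<in>I. f i x)) x :> grad (f i) x + (\<Sum>i\<in>I. grad (f i) x)"
      by (rule GDERIV_add) (use insert in \<open>auto intro: Cc_GDERIV\<close>)
    with insert(1,2) show ?case by simp
  qed (simp add: GDERIV_const)
  from GDERIV_mult[OF GDERIV_const[of c] this]
  have "grad (\<lambda>x. c * (\<Sum>i\<in>I. f i x)) x = c *\<^sub>R (\<Sum>i\<in>I. grad (f i) x)"
    by (intro grad_eqI) simp
  then show "first_order_op C (\<lambda>x. c * (\<Sum>i\<in>I. f i x)) x = c * (\<Sum>i\<in>I. first_order_op C (f i) x)"
    by (simp add: first_order_op_def inner_sum_right)
qed

interpretation U: unitary_group "rot C" by (rule unitary_group_rot[OF skew])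

text \<open>Averaging an approximation along the flow keeps it close to an invariant vector, while the
  generator of the average is a telescoping difference quotient.\<close>

lemma Fix_approximation:
  assumes x: "x \<in> U.Fix" and e: "0 < e"
  obtains v where "v \<in> Cc_infinity" "norm (cls v - x) < e" "norm (cls (first_order_op C v)) < e"
proof -
  have "x \<in> closure (cls ` Cc_infinity)" by (simp add: Cc_dense)
  then obtain g where g: "g \<in> Cc_infinity" "dist (cls g) x < e"
    using e by (auto simp: closure_approachable)
  let ?D = "cls (first_order_op C g)"
  let ?q = "\<lambda>n. (real (Suc n) / 1) *\<^sub>R (rot C (1 / real (Suc n)) (cls g) - cls g)"
  obtain m where m: "norm (?q m - ?D) < e / 2"
    using LIMSEQ_D[OF rot_difference_quotient[OF g(1), of 1], of "e / 2"] e by auto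
  define h where "h = 1 / real (Suc m)"
  have h: "0 < h" by (simp add: h_def)
  define q where "q = (1 / h) *\<^sub>R (rot C h (cls g) - cls g)"
  have q: "norm (q - ?D) < e / 2" using m by (simp add: q_def h_def)
  \<comment> \<open>Large enough for the telescoped boundary term, of norm at most
    \<open>2 * norm (cls g) / (real N * h)\<close>, to fall below half of \<open>e\<close>.\<close>
  obtain N0 :: nat where N0: "4 * norm (cls g) / (h * e) < real N0" using reals_Archimedean2 by blast
  define N where "N = Suc N0"
  have N: "0 < N" "2 * norm (cls g) / (real N * h) < e / 2"
  proof -
    have "4 * norm (cls g) / (h * e) < real N" using N0 by (simp add: N_def)
    then have "4 * norm (cls g) < real N * (h * e)" using h e by (simp add: pos_divide_less_eq)
    then have "2 * norm (cls g) < e / 2 * (real N * h)" by (simp add: algebra_simps)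
    moreover have "0 < real N * h" using h by (simp add: N_def)
    ultimately show "2 * norm (cls g) / (real N * h) < e / 2" by (simp only: pos_divide_less_eq)
    show "0 < N" by (simp add: N_def)
  qed
  let ?R = "\<lambda>i::nat. rot C (real i * h)"
  define v where "v = (\<lambda>x. (1 / real N) * (\<Sum>i<N. g (flow C (real i * h) x)))"
  have v: "v \<in> Cc_infinity" unfolding v_def by (intro Cc_scale Cc_sum Cc_flow g) auto
  have clsv: "cls v = (1 / real N) *\<^sub>R (\<Sum>i<N. ?R i (cls g))"
  proof -
    have S: "(\<lambda>x. \<Sum>i<N. g (flow C (real i * h) x)) \<in> L2 gauss \<and>
        cls (\<lambda>x. \<Sum>i<N. g (flow C (real i * h) x)) = (\<Sum>i<N. cls (\<lambda>x. g (flow C (real i * h) x)))"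
      by (rule cls_sum) (auto intro: rot_cls[OF skew Cc_L2[OF g(1)]])
    show ?thesis
      unfolding v_def cls_scale[OF conjunct1[OF S], symmetric] conjunct2[OF S]
      by (simp add: rot_cls[OF skew Cc_L2[OF g(1)]])
  qed
  have avg: "norm ((1 / real N) *\<^sub>R (\<Sum>i<N. ?R i y)) \<le> norm y" for y
  proof -
    have "norm (\<Sum>i<N. ?R i y) \<le> (\<Sum>i<N. norm y)"
      by (rule order_trans[OF norm_sum]) (simp add: norm_rot[OF skew])
    then show ?thesis using N(1) by (simp add: field_simps)
  qed
  have "cls v - x = (1 / real N) *\<^sub>R (\<Sum>i<N. ?R i (cls g - x))"
  proof -
    have "(\<Sum>i<N. ?R i x) = real N *\<^sub>R x" using x by (simp add: U.Fix_def sum_constant_scaleR)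
    then show ?thesis using N(1)
      by (simp add: clsv linear_diff[OF rot_linear[OF skew]] sum_subtractf scaleR_diff_right)
  qed
  then have 1: "norm (cls v - x) < e" using avg[of "cls g - x"] g(2) by (simp add: dist_norm)
  have "cls (first_order_op C v) = (1 / real N) *\<^sub>R (\<Sum>i<N. ?R i ?D)"
  proof -
    have D: "first_order_op C v = (\<lambda>x. (1 / real N) * (\<Sum>i<N. first_order_op C (\<lambda>x. g (flow C (real i * h) x)) x))"
      unfolding v_def by (rule first_order_sum) (auto intro: Cc_flow g)
    have S: "(\<lambda>x. \<Sum>i<N. first_order_op C (\<lambda>x. g (flow C (real i * h) x)) x) \<in> L2 gauss \<and>
        cls (\<lambda>x. \<Sum>i<N. first_order_op C (\<lambda>x. g (flow C (real i * h) x)) x)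
          = (\<Sum>i<N. cls (first_order_op C (\<lambda>x. g (flow C (real i * h) x))))"
      by (rule cls_sum) (auto intro: first_order_L2 Cc_flow g)
    show ?thesis
      unfolding D cls_scale[OF conjunct1[OF S], symmetric] conjunct2[OF S] first_order_rot[OF g(1)] ..
  qed
  \<comment> \<open>The derivative is replaced by the quotient \<open>q\<close>, whose average
    telescopes; the error is an average of rotated copies of \<open>q - ?D\<close> and no larger in
    norm.\<close>
  also have "\<dots> = (1 / real N) *\<^sub>R (\<Sum>i<N. ?R i q) - (1 / real N) *\<^sub>R (\<Sum>i<N. ?R i (q - ?D))"
    by (simp add: linear_diff[OF rot_linear[OF skew]] sum_subtractf scaleR_diff_right)
  also have "(\<Sum>i<N. ?R i q) = (1 / h) *\<^sub>R (?R N (cls g) - cls g)"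
  proof -
    have "?R i q = (1 / h) *\<^sub>R (?R (Suc i) (cls g) - ?R i (cls g))" for i
      by (simp add: q_def linear_diff[OF rot_linear[OF skew]] linear_scale[OF rot_linear[OF skew]]
          rot_add[OF skew, symmetric] algebra_simps)
    then have "(\<Sum>i<N. ?R i q) = (1 / h) *\<^sub>R (\<Sum>i<N. ?R (Suc i) (cls g) - ?R i (cls g))"
      by (simp only: scaleR_sum_right)
    also have "(\<Sum>i<N. ?R (Suc i) (cls g) - ?R i (cls g)) = ?R N (cls g) - ?R 0 (cls g)"
      by (rule sum_lessThan_telescope)
    finally show ?thesis by (simp add: rot_0[OF skew])
  qed
  also have "norm ((1 / real N) *\<^sub>R (1 / h) *\<^sub>R (?R N (cls g) - cls g) - (1 / real N) *\<^sub>R (\<Sum>i<N. ?R i (q - ?D)))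
      \<le> 2 * norm (cls g) / (real N * h) + norm (q - ?D)"
  proof -
    have "norm ((1 / real N) *\<^sub>R (1 / h) *\<^sub>R (?R N (cls g) - cls g)) \<le> 2 * norm (cls g) / (real N * h)"
    proof -
      have "norm (?R N (cls g) - cls g) \<le> 2 * norm (cls g)"
        using norm_triangle_ineq4[of "?R N (cls g)" "cls g"] by (simp add: norm_rot[OF skew])
      moreover have "norm ((1 / real N) *\<^sub>R (1 / h) *\<^sub>R y) = norm y / (real N * h)" for y :: "(real^'n) l2"
        using N(1) h by simp
      ultimately show ?thesis using h by (simp only:) (intro divide_right_mono, auto)
    qed
    then show ?thesis using avg[of "q - ?D"] norm_triangle_ineq4 by (smt (verit))
  qed
  also have "\<dots> < e" using N(2) q by simp
  finally show ?thesis using that[OF v 1] by blast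
qed

text \<open>A limit of test functions with vanishing derivatives is invariant by
  \<open>rot_diff_le_generator\<close>; conversely \<open>Fix_approximation\<close> gives, for an
  invariant class, test functions with small derivative.\<close>

theorem closure_kernel_gauss:
  assumes f: "f \<in> L2 gauss"
  shows "f \<in> closure_kernel gauss (first_order_op C) \<longleftrightarrow> cls f \<in> U.Fix"
proof
  assume "f \<in> closure_kernel gauss (first_order_op C)"
  then obtain u where u: "\<And>n. u n \<in> Cc_infinity" "L2_tendsto gauss u f sequentially"
    "L2_tendsto gauss (\<lambda>n. first_order_op C (u n)) (\<lambda>x. 0) sequentially"
    by (auto simp: closure_kernel_def closure_maps_def)
  have lim: "(\<lambda>n. cls (u n)) \<longlonglongrightarrow> cls f" "(\<lambda>n. cls (first_order_op C (u n))) \<longlonglongrightarrow> 0"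
    using u L2_tendsto_cls[of u f] L2_tendsto_cls[of "\<lambda>n. first_order_op C (u n)" "\<lambda>x. 0"] f
    by (simp_all add: Cc_L2 first_order_L2 L2_zero cls_zero)
  have pos: "rot C s (cls f) = cls f" if s: "0 < s" for s
  proof -
    have "(\<lambda>n. rot C s (cls (u n)) - cls (u n)) \<longlonglongrightarrow> rot C s (cls f) - cls f"
      by (intro tendsto_diff lim isCont_tendsto_compose[OF U.isCont_U])
    then have "(\<lambda>n. norm (rot C s (cls (u n)) - cls (u n))) \<longlonglongrightarrow> norm (rot C s (cls f) - cls f)"
      by (rule tendsto_norm)
    moreover have "(\<lambda>n. s * norm (cls (first_order_op C (u n)))) \<longlonglongrightarrow> s * norm (0 :: (real^'n) l2)"
      by (intro tendsto_intros lim)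
    ultimately have "norm (rot C s (cls f) - cls f) \<le> s * norm (0 :: (real^'n) l2)"
      by (rule LIMSEQ_le) (use rot_diff_le_generator[OF u(1) s] in blast)
    then show ?thesis by simp
  qed
  have "rot C s (cls f) = cls f" for s
  proof -
    consider "0 < s" | "s = 0" | "0 < - s" by linarith
    then show ?thesis
    proof cases
      case 3
      have "rot C s (rot C (- s) (cls f)) = cls f" by (rule U.U_inverse)
      then show ?thesis by (simp add: pos[OF 3])
    qed (simp_all add: pos U.U_0)
  qed
  then show "cls f \<in> U.Fix" by (simp add: U.Fix_def)
next
  assume fix_f: "cls f \<in> U.Fix"
  have "\<exists>v\<in>Cc_infinity. norm (cls v - cls f) < 1 / real (Suc n) \<and> norm (cls (first_order_op C v)) < 1 / real (Suc n)" for n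
    using Fix_approximation[OF fix_f, of "1 / real (Suc n)"] by (metis of_nat_0_less_iff zero_less_Suc zero_less_divide_1_iff)
  then obtain u where u: "\<And>n. u n \<in> Cc_infinity" "\<And>n. norm (cls (u n) - cls f) < 1 / real (Suc n)"
    "\<And>n. norm (cls (first_order_op C (u n))) < 1 / real (Suc n)" by metis
  have to0: "(\<lambda>n. 1 / real (Suc n)) \<longlonglongrightarrow> 0" by (rule LIMSEQ_Suc[OF lim_1_over_n])
  have "(\<lambda>n. cls (u n) - cls f) \<longlonglongrightarrow> 0"
    by (rule Lim_null_comparison[OF _ to0]) (intro always_eventually allI less_imp_le u)
  then have "(\<lambda>n. cls (u n)) \<longlonglongrightarrow> cls f" by (simp add: LIM_zero_iff)
  then have "L2_tendsto gauss u f sequentially" by (subst L2_tendsto_cls) (auto simp: Cc_L2 u f)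
  moreover have "(\<lambda>n. cls (first_order_op C (u n))) \<longlonglongrightarrow> 0"
    by (rule Lim_null_comparison[OF _ to0]) (intro always_eventually allI less_imp_le u)
  then have "L2_tendsto gauss (\<lambda>n. first_order_op C (u n)) (\<lambda>x. 0) sequentially"
    by (subst L2_tendsto_cls) (auto simp: first_order_L2 u L2_zero cls_zero)
  ultimately show "f \<in> closure_kernel gauss (first_order_op C)"
    using u(1) by (auto simp: closure_kernel_def closure_maps_def)
qed

end

subsection \<open>Linear images of the standard Gaussian\<close>

lemma measurable_gauss [simp]: "f \<in> gauss \<rightarrow>\<^sub>M N \<longleftrightarrow> f \<in> borel \<rightarrow>\<^sub>M N"
  by (simp add: measurable_cong_sets[OF sets_gauss refl])

text \<open>The image of a solution solves the other equation. Uniqueness is available for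
  nonnegative times; negative times follow by negating both generators.\<close>

lemma flow_intertwine:
  fixes M :: "'a::euclidean_space \<Rightarrow> 'b::euclidean_space"
  assumes L: "linear L" and L': "linear L'" and M: "linear M" and comm: "\<And>x. M (L x) = L' (M x)"
  shows "M (flow L t x) = flow L' t (M x)"
proof -
  have pos: "M (flow L t x) = flow L' t (M x)" if "0 \<le> t" "linear L" "linear L'" "\<And>x. M (L x) = L' (M x)"
    for t x and L L'
  proof -
    have "M (flow L t x) = flow L' t (M (flow L 0 x))"
    proof (rule flow_unique[OF that(3,1)])
      fix s assume "s \<in> {0..t}"
      have "bounded_linear M" using M by (simp add: linear_conv_bounded_linear)
      from bounded_linear.has_vector_derivative[OF this flow_has_vector_derivative[OF that(2)]]
      show "((\<lambda>t. M (flow L t x)) has_vector_derivative L' (M (flow L s x))) (at s within {0..t})"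
        by (simp add: that(4))
    qed
    then show ?thesis by simp
  qed
  show ?thesis
  proof (cases "0 \<le> t")
    case False
    have "M (flow (\<lambda>x. - L x) (- t) x) = flow (\<lambda>x. - L' x) (- t) (M x)"
      using False by (intro pos) (auto simp: linear_compose_neg L L' comm linear_neg[OF M])
    then show ?thesis by (simp add: flow_negate[OF L, symmetric] flow_negate[OF L', symmetric])
  qed (use pos L L' comm in auto)
qed

lemma cf_distr_linear_gauss:
  fixes T :: "'a::euclidean_space \<Rightarrow> 'b::euclidean_space"
  assumes T: "linear T"
  shows "cf (distr gauss borel T) \<xi> = of_real (exp (- (adjoint T \<xi> \<bullet> adjoint T \<xi>) / 2))"
proof -
  have "cf (distr gauss borel T) \<xi> = (CLINT x|gauss. iexp (\<xi> \<bullet> T x))"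
    by (rule cf_distr) (use borel_measurable_linear[OF T] in simp)
  also have "\<dots> = cf gauss (adjoint T \<xi>)"
    by (simp add: cf_def adjoint_works[OF T] inner_commute[of \<xi>] inner_commute[of "adjoint T \<xi>"])
  finally show ?thesis by (simp add: cf_gauss)
qed

lemma prob_space_distr_linear_gauss: "linear T \<Longrightarrow> prob_space (distr gauss borel T)"
  for T :: "'a::euclidean_space \<Rightarrow> 'b::euclidean_space"
  by (rule prob_space.prob_space_distr[OF prob_space_gauss]) (use borel_measurable_linear in simp)

lemma cf_pair:
  fixes M :: "'a::euclidean_space measure" and N :: "'b::euclidean_space measure"
  assumes M: "prob_space M" "sets M = sets borel" and N: "prob_space N" "sets N = sets borel"
  shows "cf (M \<Otimes>\<^sub>M N) (a, b) = cf M a * cf N b"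
proof -
  note [measurable_cong] = M(2) N(2)
  interpret M: prob_space M by fact
  interpret N: prob_space N by fact
  interpret P: pair_prob_space M N ..
  have "integrable (M \<Otimes>\<^sub>M N) (\<lambda>(x, y). iexp (a \<bullet> x) * iexp (b \<bullet> y))"
    by (rule P.integrable_const_bound[where B=1]) (auto simp: norm_mult)
  from P.integral_fst'[OF this]
  have "(CLINT z|M \<Otimes>\<^sub>M N. (case z of (x, y) \<Rightarrow> iexp (a \<bullet> x) * iexp (b \<bullet> y))) = cf M a * cf N b"
    by (simp add: cf_def)
  moreover have "iexp ((a, b) \<bullet> z) = (case z of (x, y) \<Rightarrow> iexp (a \<bullet> x) * iexp (b \<bullet> y))" for z
    by (cases z) (simp add: exp_add distrib_left)
  ultimately show ?thesis by (simp add: cf_def)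
qed

lemma pair_distr_linear_gauss:
  fixes T1 :: "'a::euclidean_space \<Rightarrow> 'a" and T2 :: "'b::euclidean_space \<Rightarrow> 'b"
  assumes T: "linear T1" "linear T2"
  shows "distr gauss borel T1 \<Otimes>\<^sub>M distr gauss borel T2 = distr gauss borel (\<lambda>(x, y). (T1 x, T2 y))"
proof (rule measure_eqI_cf)
  let ?M = "distr gauss borel T1" and ?N = "distr gauss borel T2"
  note p = prob_space_distr_linear_gauss[OF T(1)] prob_space_distr_linear_gauss[OF T(2)]
  interpret M: prob_space ?M by (rule p)
  interpret N: prob_space ?N by (rule p)
  interpret P: pair_prob_space ?M ?N ..
  have lin: "linear (\<lambda>(x, y). (T1 x, T2 y))"
    by (rule linearI) (auto simp: linear_add[OF T(1)] linear_add[OF T(2)] linear_scale[OF T(1)] linear_scale[OF T(2)])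
  show "finite_measure (?M \<Otimes>\<^sub>M ?N)" by (rule P.finite_measure_axioms)
  show "sets (?M \<Otimes>\<^sub>M ?N) = sets borel"
  proof -
    have "sets (?M \<Otimes>\<^sub>M ?N) = sets (borel \<Otimes>\<^sub>M borel)" by (rule sets_pair_measure_cong) simp_all
    then show ?thesis by (simp only: borel_prod)
  qed
  show "finite_measure (distr gauss borel (\<lambda>(x, y). (T1 x, T2 y)))"
    using prob_space_distr_linear_gauss[OF lin] by (simp add: prob_space_def)
  fix \<xi> :: "'a \<times> 'b"
  obtain a b where \<xi>: "\<xi> = (a, b)" by (cases \<xi>)
  have adj: "adjoint (\<lambda>(x, y). (T1 x, T2 y)) = (\<lambda>(a, b). (adjoint T1 a, adjoint T2 b))"
    by (rule adjoint_unique) (auto simp: adjoint_works[OF T(1)] adjoint_works[OF T(2)])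
  show "cf (?M \<Otimes>\<^sub>M ?N) \<xi> = cf (distr gauss borel (\<lambda>(x, y). (T1 x, T2 y))) \<xi>"
    unfolding \<xi> using p
    by (subst cf_pair) (simp_all add: cf_distr_linear_gauss T lin adj exp_add[symmetric] add_divide_distrib flip: of_real_mult)
qed simp

lemma distr_gauss_fst: "distr gauss borel (fst :: 'a::euclidean_space \<times> 'b::euclidean_space \<Rightarrow> 'a) = gauss"
proof (rule measure_eqI_cf)
  have lin: "linear (fst :: 'a \<times> 'b \<Rightarrow> 'a)" by (rule linearI) auto
  show "finite_measure (distr gauss borel (fst :: 'a \<times> 'b \<Rightarrow> 'a))"
    using prob_space_distr_linear_gauss[OF lin] by (simp add: prob_space_def)
  have "adjoint (fst :: 'a \<times> 'b \<Rightarrow> 'a) = (\<lambda>a. (a, 0))"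
    by (rule adjoint_unique) auto
  then show "cf (distr gauss borel (fst :: 'a \<times> 'b \<Rightarrow> 'a)) \<xi> = cf gauss \<xi>" for \<xi>
    by (simp add: cf_distr_linear_gauss lin cf_gauss)
qed simp_all

context
  fixes T T' :: "'a::euclidean_space \<Rightarrow> 'a" and m :: "'a measure"
  assumes T: "linear T" and T': "linear T'" and inv: "\<And>x. T (T' x) = x"
    and m: "m = distr gauss borel T"
begin

lemma image_measurable_iff: "f \<in> borel_measurable m \<longleftrightarrow> (\<lambda>x. f (T x)) \<in> borel_measurable borel"
  for f :: "'a \<Rightarrow> real"
proof
  have [measurable]: "T \<in> borel_measurable borel" "T' \<in> borel_measurable borel"
    using T T' by (simp_all add: borel_measurable_linear)
  show "(\<lambda>x. f (T x)) \<in> borel_measurable borel" if "f \<in> borel_measurable m"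
  proof -
    have [measurable]: "f \<in> borel_measurable borel" using that by (simp add: m)
    show ?thesis by measurable
  qed
  show "f \<in> borel_measurable m" if "(\<lambda>x. f (T x)) \<in> borel_measurable borel"
  proof -
    have "(\<lambda>x. f (T (T' x))) \<in> borel_measurable borel"
      by (rule measurable_compose[OF _ that]) measurable
    then show ?thesis by (simp add: inv m)
  qed
qed

lemma image_T_measurable: "T \<in> gauss \<rightarrow>\<^sub>M borel"
  using borel_measurable_linear[OF T] by simp

lemma image_L2_iff: "f \<in> L2 m \<longleftrightarrow> (\<lambda>x. f (T x)) \<in> L2 gauss"
proof (cases "f \<in> borel_measurable m")
  case True
  then have "(\<lambda>x. (f x)\<^sup>2) \<in> borel_measurable borel" by (simp add: m)
  from integrable_distr_eq[OF image_T_measurable this]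
  have "integrable m (\<lambda>x. (f x)\<^sup>2) \<longleftrightarrow> integrable gauss (\<lambda>x. (f (T x))\<^sup>2)" by (simp only: m)
  moreover have "(\<lambda>x. f (T x)) \<in> borel_measurable gauss" using True image_measurable_iff[of f] by simp
  ultimately show ?thesis using True by (simp only: L2_def mem_Collect_eq)
next
  case False
  moreover from this have "(\<lambda>x. f (T x)) \<notin> borel_measurable gauss" using image_measurable_iff[of f] by simp
  ultimately show ?thesis by (simp only: L2_def mem_Collect_eq simp_thms)
qed

lemma image_integral: "f \<in> L2 m \<Longrightarrow> (\<integral>x. f x \<partial>m) = inner (cls (\<lambda>x. f (T x))) one_l2"
  unfolding one_l2_def using L2_measurable[of f m] image_L2_iff[of f]
  by (simp add: cls_inner one_L2 m integral_distr[OF image_T_measurable])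

lemma image_inner:
  "f \<in> L2 m \<Longrightarrow> g \<in> L2 m \<Longrightarrow> L2_inner m f g = inner (cls (\<lambda>x. f (T x))) (cls (\<lambda>x. g (T x)))"
  using L2_measurable[of f m] L2_measurable[of g m] image_L2_iff[of f] image_L2_iff[of g]
  by (simp add: cls_inner L2_inner_def m integral_distr[OF image_T_measurable])

lemma image_tendsto_iff:
  "L2_tendsto m u g F \<longleftrightarrow>
    (g \<in> L2 m \<and> (\<forall>\<^sub>F n in F. u n \<in> L2 m) \<and> ((\<lambda>n. cls (\<lambda>x. u n (T x))) \<longlongrightarrow> cls (\<lambda>x. g (T x))) F)"
proof -
  have "((\<lambda>n. L2_norm m (\<lambda>x. u n x - g x)) \<longlongrightarrow> 0) F
      \<longleftrightarrow> ((\<lambda>n. cls (\<lambda>x. u n (T x))) \<longlongrightarrow> cls (\<lambda>x. g (T x))) F"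
    if g: "g \<in> L2 m" and u: "\<forall>\<^sub>F n in F. u n \<in> L2 m"
  proof -
    have "\<forall>\<^sub>F n in F. L2_norm m (\<lambda>x. u n x - g x) = norm (cls (\<lambda>x. u n (T x)) - cls (\<lambda>x. g (T x)))"
      using u
    proof eventually_elim
      fix n assume un: "u n \<in> L2 m"
      show "L2_norm m (\<lambda>x. u n x - g x) = norm (cls (\<lambda>x. u n (T x)) - cls (\<lambda>x. g (T x)))"
        using un g image_L2_iff[of "u n"] image_L2_iff[of g]
        by (simp add: L2_norm_def norm_eq_sqrt_inner image_inner L2_diff cls_diff)
    qed
    then show ?thesis by (subst tendsto_cong) (auto simp: tendsto_norm_zero_iff LIM_zero_iff)
  qed
  then show ?thesis by (auto simp: L2_tendsto_def)
qed

end

lemma first_order_op_compose: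
  fixes T :: "real^'n \<Rightarrow> real^'n"
  assumes T: "linear T" and u: "u \<in> Cc_infinity" and AT: "\<And>x. T (A x) = b (T x)"
  shows "first_order_op A (\<lambda>x. u (T x)) x = first_order_op b u (T x)"
proof -
  have "grad (\<lambda>x. u (T x)) x = adjoint T (grad u (T x))"
    by (rule grad_eqI[OF GDERIV_compose_linear[OF T Cc_GDERIV[OF u]]])
  then show ?thesis by (simp add: first_order_op_def adjoint_works[OF T] AT)
qed

text \<open>Composition with \<open>T\<close> and with its inverse exchanges the test functions, and
  the chain rule carries the operator of \<open>b\<close> to that of \<open>A\<close>; approximating
  sequences therefore correspond.\<close>

lemma closure_kernel_image:
  fixes T T' :: "real^'n \<Rightarrow> real^'n"
  assumes T: "linear T" and T': "linear T'" and inv: "\<And>x. T (T' x) = x" "\<And>x. T' (T x) = x"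
    and m: "m = distr gauss borel T" and A: "skew A" and AT: "\<And>x. T (A x) = b (T x)"
  shows "f \<in> closure_kernel m (first_order_op b) \<longleftrightarrow> (\<lambda>x. f (T x)) \<in> closure_kernel gauss (first_order_op A)"
proof -
  note tend = image_tendsto_iff[OF T T' inv(1) m]
  note L2 = image_L2_iff[OF T T' inv(1) m]
  have gtend: "L2_tendsto gauss (u :: nat \<Rightarrow> real^'n \<Rightarrow> real) g sequentially \<longleftrightarrow>
    (g \<in> L2 gauss \<and> (\<forall>\<^sub>F n in sequentially. u n \<in> L2 gauss) \<and> ((\<lambda>n. cls (u n)) \<longlongrightarrow> cls g) sequentially)" for u g
  proof -
    have "linear (\<lambda>x::real^'n. x)" by (rule linear_ident)
    moreover have "gauss = distr gauss borel (\<lambda>x::real^'n. x)" by (simp add: distr_id2)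
    ultimately show ?thesis using image_tendsto_iff[of "\<lambda>x. x" "\<lambda>x. x" gauss u g sequentially] by simp
  qed
  have D: "first_order_op A (\<lambda>x. u (T x)) = (\<lambda>x. first_order_op b u (T x))" if "u \<in> Cc_infinity" for u
    using first_order_op_compose[where A=A and b=b, OF T that AT] by blast
  have key: "(L2_tendsto m u f sequentially \<and> L2_tendsto m (\<lambda>n. first_order_op b (u n)) (\<lambda>x. 0) sequentially) \<longleftrightarrow>
      (L2_tendsto gauss (\<lambda>n x. u n (T x)) (\<lambda>x. f (T x)) sequentially \<and>
       L2_tendsto gauss (\<lambda>n. first_order_op A (\<lambda>x. u n (T x))) (\<lambda>x. 0) sequentially)"
    if "\<forall>n. u n \<in> Cc_infinity" for u :: "nat \<Rightarrow> real^'n \<Rightarrow> real"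
    using that by (simp add: tend gtend L2 D)
  show ?thesis
    unfolding closure_kernel_def closure_maps_def mem_Collect_eq
  proof
    assume "\<exists>u. (\<forall>n. u n \<in> Cc_infinity) \<and> L2_tendsto m u f sequentially \<and>
      L2_tendsto m (\<lambda>n. first_order_op b (u n)) (\<lambda>x. 0) sequentially"
    then obtain u where u: "\<forall>n. u n \<in> Cc_infinity" "L2_tendsto m u f sequentially"
      "L2_tendsto m (\<lambda>n. first_order_op b (u n)) (\<lambda>x. 0) sequentially" by blast
    have "\<forall>n. (\<lambda>x. u n (T x)) \<in> Cc_infinity" using u(1) Cc_compose_linear[OF _ T T' inv(2)] by blast
    with key[OF u(1)] u(2,3) show "\<exists>u. (\<forall>n. u n \<in> Cc_infinity) \<and> L2_tendsto gauss u (\<lambda>x. f (T x)) sequentially \<and>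
      L2_tendsto gauss (\<lambda>n. first_order_op A (u n)) (\<lambda>x. 0) sequentially"
      by (intro exI[of _ "\<lambda>n x. u n (T x)"] conjI) simp_all
  next
    assume "\<exists>u. (\<forall>n. u n \<in> Cc_infinity) \<and> L2_tendsto gauss u (\<lambda>x. f (T x)) sequentially \<and>
      L2_tendsto gauss (\<lambda>n. first_order_op A (u n)) (\<lambda>x. 0) sequentially"
    then obtain u where u: "\<forall>n. u n \<in> Cc_infinity" "L2_tendsto gauss u (\<lambda>x. f (T x)) sequentially"
      "L2_tendsto gauss (\<lambda>n. first_order_op A (u n)) (\<lambda>x. 0) sequentially" by blast
    have v: "\<forall>n. (\<lambda>x. u n (T' x)) \<in> Cc_infinity" using u(1) Cc_compose_linear[OF _ T' T inv(1)] by blast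
    have "L2_tendsto m (\<lambda>n x. u n (T' x)) f sequentially \<and>
      L2_tendsto m (\<lambda>n. first_order_op b (\<lambda>x. u n (T' x))) (\<lambda>x. 0) sequentially"
      unfolding key[OF v] inv using u(2,3) by simp
    with v show "\<exists>u. (\<forall>n. u n \<in> Cc_infinity) \<and> L2_tendsto m u f sequentially \<and>
      L2_tendsto m (\<lambda>n. first_order_op b (u n)) (\<lambda>x. 0) sequentially"
      by (intro exI[of _ "\<lambda>n x. u n (T' x)"] conjI) simp_all
  qed
qed

subsection \<open>Functions of the position only\<close>

definition lift_fst :: "'a::euclidean_space l2 \<Rightarrow> ('a \<times> 'a) l2" where
  "lift_fst x = cls (\<lambda>z. rpr x (fst z))"

lemma fst_L2:
  fixes f :: "'a::euclidean_space \<Rightarrow> real"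
  assumes f: "f \<in> L2 gauss"
  shows "(\<lambda>z::'a \<times> 'a. f (fst z)) \<in> L2 gauss"
    "norm (cls (\<lambda>z::'a \<times> 'a. f (fst z))) = norm (cls f)"
proof -
  have fm [measurable]: "f \<in> borel_measurable borel" by (rule L2_borel[OF f])
  have fst [measurable]: "fst \<in> (gauss :: ('a \<times> 'a) measure) \<rightarrow>\<^sub>M borel"
    by (simp add: borel_measurable_continuous_onI continuous_on_fst)
  have sq: "(\<lambda>x. (f x)\<^sup>2) \<in> borel_measurable borel" by measurable
  have "integrable (distr gauss borel (fst :: 'a \<times> 'a \<Rightarrow> 'a)) (\<lambda>x. (f x)\<^sup>2)"
    using L2_integrable_square[OF f] by (simp add: distr_gauss_fst)
  then have "integrable (gauss :: ('a \<times> 'a) measure) (\<lambda>z. (f (fst z))\<^sup>2)"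
    by (subst (asm) integrable_distr_eq[OF fst sq])
  moreover have "(\<lambda>z::'a \<times> 'a. f (fst z)) \<in> borel_measurable gauss" by measurable
  ultimately show L: "(\<lambda>z::'a \<times> 'a. f (fst z)) \<in> L2 gauss" by (simp add: L2_def)
  have "(\<integral>z. (f (fst z))\<^sup>2 \<partial>(gauss :: ('a \<times> 'a) measure)) = (\<integral>x. (f x)\<^sup>2 \<partial>distr gauss borel (fst :: 'a \<times> 'a \<Rightarrow> 'a))"
    by (rule integral_distr[OF fst sq, symmetric])
  then have "(norm (cls (\<lambda>z::'a \<times> 'a. f (fst z))))\<^sup>2 = (norm (cls f))\<^sup>2"
    by (simp add: cls_norm L f distr_gauss_fst)
  then show "norm (cls (\<lambda>z::'a \<times> 'a. f (fst z))) = norm (cls f)" by (simp add: power2_eq_iff_nonneg)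
qed

lemma lift_fst_cls:
  assumes f: "f \<in> L2 gauss"
  shows "lift_fst (cls f) = cls (\<lambda>z. f (fst z))"
proof -
  have d: "(\<lambda>x. rpr (cls f) x - f x) \<in> L2 gauss" by (intro L2_diff rpr_L2 f)
  have "norm (cls (\<lambda>z::'a \<times> 'a. rpr (cls f) (fst z)) - cls (\<lambda>z. f (fst z))) = norm (cls (\<lambda>z::'a \<times> 'a. rpr (cls f) (fst z) - f (fst z)))"
    by (subst cls_diff[OF fst_L2(1)[OF rpr_L2] fst_L2(1)[OF f]]) (rule refl)
  also have "\<dots> = norm (cls (\<lambda>x. rpr (cls f) x - f x))" by (rule fst_L2(2)[OF d])
  also have "\<dots> = 0" by (simp add: cls_diff[symmetric] rpr_L2 f)
  finally show ?thesis by (simp add: lift_fst_def)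
qed

lemma lift_fst_bounded_linear: "bounded_linear (lift_fst :: 'a::euclidean_space l2 \<Rightarrow> _)"
proof (rule bounded_linear_intro[where K=1])
  show "lift_fst (x + y) = lift_fst x + lift_fst y" for x y :: "'a l2"
    by (rule cls_cases[of x], rule cls_cases[of y]) (simp add: cls_add lift_fst_cls L2_add fst_L2)
  show "lift_fst (c *\<^sub>R x) = c *\<^sub>R lift_fst x" for c and x :: "'a l2"
    by (rule cls_cases[of x]) (simp add: cls_scale lift_fst_cls L2_scale fst_L2)
  show "norm (lift_fst x) \<le> norm x * 1" for x :: "'a l2"
    by (rule cls_cases[of x]) (simp add: lift_fst_cls fst_L2)
qed

lemma lift_fst_rot:
  fixes C :: "'a::euclidean_space \<Rightarrow> 'a"
  assumes C: "skew C"
  defines "C2 \<equiv> (\<lambda>(q, p). (C q, C p))"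
  shows "skew C2" "rot C2 s (lift_fst x) = lift_fst (rot C s x)"
proof -
  have lin: "linear C" using C by (simp add: skew_def)
  show sk: "skew C2"
    using C unfolding skew_def C2_def
    by (auto intro!: linearI simp: linear_add[OF lin] linear_scale[OF lin])
  have "linear (fst :: 'a \<times> 'a \<Rightarrow> 'a)" by (rule linearI) auto
  with sk lin have fl: "fst (flow C2 s z) = flow C s (fst z)" for z
    by (intro flow_intertwine) (auto simp: skew_def C2_def split: prod.split)
  show "rot C2 s (lift_fst x) = lift_fst (rot C s x)"
    by (rule cls_cases[of x]) (simp add: lift_fst_cls rot_cls[OF C] rot_cls[OF sk] fst_L2 fl)
qed

text \<open>\<open>lift_fst\<close> intertwines the two rotation groups, so it respects invariance
  and maps coboundaries to coboundaries; continuity covers the closure.\<close>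

lemma lift_fst_Fix:
  fixes C :: "'a::euclidean_space \<Rightarrow> 'a"
  assumes C: "skew C"
  defines "C2 \<equiv> (\<lambda>(q, p). (C q, C p))"
  shows "x \<in> unitary_group.Fix (rot C) \<Longrightarrow> lift_fst x \<in> unitary_group.Fix (rot C2)"
    and "x \<in> closure (span (unitary_group.cobound (rot C))) \<Longrightarrow>
           lift_fst x \<in> closure (span (unitary_group.cobound (rot C2)))"
proof -
  note r = lift_fst_rot[OF C, folded C2_def]
  interpret V: unitary_group "rot C" by (rule unitary_group_rot[OF C])
  interpret E: unitary_group "rot C2" by (rule unitary_group_rot[OF r(1)])
  interpret l: bounded_linear "lift_fst :: 'a l2 \<Rightarrow> _" by (rule lift_fst_bounded_linear)
  show "lift_fst x \<in> E.Fix" if "x \<in> V.Fix"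
    using that by (auto simp: V.Fix_def E.Fix_def r(2))
  have "lift_fst ` V.cobound \<subseteq> E.cobound"
  proof
    fix y assume "y \<in> lift_fst ` V.cobound"
    then obtain s w where "y = lift_fst (rot C s w - w)" by (auto simp: V.cobound_def)
    then have "y = rot C2 s (lift_fst w) - lift_fst w" by (simp add: l.diff r(2))
    then show "y \<in> E.cobound" by (auto simp: E.cobound_def)
  qed
  then have "span V.cobound \<subseteq> {x. lift_fst x \<in> span E.cobound}"
    by (intro span_minimal) (auto simp: subspace_def l.add l.scaleR l.zero intro: span_base span_add span_scale span_zero)
  then have "lift_fst ` span V.cobound \<subseteq> closure (span E.cobound)"
    using closure_subset by blast
  moreover have "lift_fst ` closure (span V.cobound) \<subseteq> closure (span E.cobound)"
    by (rule image_closure_subset[OF linear_continuous_on[OF lift_fst_bounded_linear] closed_closure]) fact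
  ultimately show "lift_fst x \<in> closure (span E.cobound)" if "x \<in> closure (span V.cobound)" using that by blast
qed

lemma lift_fst_inner_one:
  fixes x :: "'a::euclidean_space l2"
  shows "inner (lift_fst x) one_l2 = inner x one_l2"
proof (rule bounded_linear_eq_on_trig[where A="\<lambda>x::'a l2. inner (lift_fst x) one_l2" and B="\<lambda>x. inner x one_l2"])
  show "bounded_linear (\<lambda>x::'a l2. inner (lift_fst x) one_l2)"
    by (rule bounded_linear_compose[OF bounded_linear_inner_left lift_fst_bounded_linear])
  show "bounded_linear (\<lambda>x::'a l2. inner x one_l2)" by (rule bounded_linear_inner_left)
  fix \<xi> :: 'a
  have "lift_fst (cos_l2 \<xi>) = cos_l2 (\<xi>, 0)" "lift_fst (sin_l2 \<xi>) = sin_l2 (\<xi>, 0)"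
    by (simp_all add: cos_l2_def sin_l2_def lift_fst_cls cos_L2 sin_L2 inner_prod_def)
  then show "inner (lift_fst (cos_l2 \<xi>)) one_l2 = inner (cos_l2 \<xi>) one_l2"
    "inner (lift_fst (sin_l2 \<xi>)) one_l2 = inner (sin_l2 \<xi>) one_l2"
    by (simp_all add: inner_trig_one)
qed

subsection \<open>Ornstein--Uhlenbeck semigroups twisted by a rotation\<close>

text \<open>By uniqueness: the product on the right solves the equation of the sum, since
  \<open>flow L s\<close> commutes with \<open>C\<close>.\<close>

lemma flow_add_commuting:
  fixes L C :: "'a::euclidean_space \<Rightarrow> 'a"
  assumes L: "linear L" and C: "linear C" and comm: "\<And>x. C (L x) = L (C x)" and t: "0 \<le> t"
  shows "flow (\<lambda>x. L x + \<mu> *\<^sub>R C x) t x = flow L t (flow C (\<mu> * t) x)"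
proof -
  have lin: "linear (\<lambda>x. L x + \<mu> *\<^sub>R C x)"
    by (intro linear_compose_add linear_compose_scale_right L C)
  have "flow L t (flow C (\<mu> * t) x) = flow (\<lambda>x. L x + \<mu> *\<^sub>R C x) t (flow L 0 (flow C (\<mu> * 0) x))"
  proof (rule flow_unique[OF lin t])
    fix s assume "s \<in> {0..t}"
    have "((\<lambda>t. flow C (\<mu> * t) x) has_vector_derivative \<mu> *\<^sub>R C (flow C (\<mu> * s) x)) (at s within {0..t})"
      by (rule flow_has_vector_derivative_comp[OF C]) (auto intro!: derivative_eq_intros)
    from bounded_bilinear_flow_step[OF L DERIV_ident this]
    have "((\<lambda>t. flow L t (flow C (\<mu> * t) x)) has_vector_derivative
      flow L s (L (flow C (\<mu> * s) x)) + flow L s (\<mu> *\<^sub>R C (flow C (\<mu> * s) x))) (at s within {0..t})"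
      by simp
    moreover have "flow L s (C y) = C (flow L s y)" for y
      by (rule flow_intertwine[OF L L C comm, symmetric])
    ultimately show "((\<lambda>t. flow L t (flow C (\<mu> * t) x)) has_vector_derivative
      L (flow L s (flow C (\<mu> * s) x)) + \<mu> *\<^sub>R C (flow L s (flow C (\<mu> * s) x))) (at s within {0..t})"
      by (simp add: flow_generator_commute[OF L] linear_scale[OF linear_flow])
  qed
  then show ?thesis by simp
qed

lemma adjoint_flow: "linear L \<Longrightarrow> adjoint (flow L t) = flow (adjoint L) t"
  for L :: "'a::euclidean_space \<Rightarrow> 'a"
  by (rule adjoint_unique) (simp add: flow_adjoint adjoint_linear adjoint_works)

text \<open>A preliminary rotation leaves the product of \<open>K\<close> with its adjoint
  unchanged, so the same noise law fits. This is why \<nu> can be chosen independent of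
  \<mu>.\<close>

lemma gauss_noise_flow_skew:
  assumes n: "gauss_noise K \<nu>" and C: "skew C"
  shows "gauss_noise (\<lambda>x. K (flow C s x)) \<nu>"
proof -
  have "adjoint (\<lambda>x. K (flow C s x)) \<xi> = flow C (- s) (adjoint K \<xi>)" for \<xi>
    using adjoint_compose_linear[OF linear_flow noise_linear[OF n]] by (simp add: adjoint_flow_skew[OF C])
  then show ?thesis
    using n linear_compose[OF linear_flow[of C s] noise_linear[OF n]]
    by (simp add: gauss_noise_def flow_skew_inner[OF C] o_def)
qed

text \<open>Only the law at the single time \<open>t\<close> enters, and the characteristic function
  determines it, so every solution process gives the same semigroup.\<close>

lemma expectation_linear_sde:
  fixes L :: "'a::euclidean_space \<Rightarrow> 'a" and \<sigma> :: "real^'n \<Rightarrow> 'a"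
  assumes W: "standard_brownian_motion P W" and Y: "additive_sde_solution P W L \<sigma> x Y"
    and L: "linear L" and \<sigma>: "linear \<sigma>"
    and diss: "\<And>z. 2 * (adjoint L z \<bullet> z) = - (adjoint \<sigma> z \<bullet> adjoint \<sigma> z)"
    and t: "0 \<le> t" and n: "gauss_noise (flow L t) \<nu>" and \<phi>: "\<phi> \<in> borel_measurable borel"
  shows "(\<integral>\<omega>. \<phi> (Y t \<omega>) \<partial>P) = mehler (flow L t) \<nu> \<phi> x"
proof -
  interpret P: prob_space P using W by (simp add: standard_brownian_motion_def)
  interpret N: prob_space \<nu> by (rule noise_prob[OF n])
  note [measurable_cong] = noise_sets[OF n]
  have [measurable]: "Y t \<in> borel_measurable P" using Y t by (simp add: additive_sde_solution_def)
  have "distr P borel (Y t) = distr \<nu> borel (\<lambda>y. flow L t x + y)"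
  proof (rule measure_eqI_cf)
    show "finite_measure (distr P borel (Y t))" by (rule P.finite_measure_distr) measurable
    show "finite_measure (distr \<nu> borel (\<lambda>y. flow L t x + y))" by (rule N.finite_measure_distr) measurable
    fix \<xi> :: 'a
    have "cf (distr \<nu> borel (\<lambda>y. flow L t x + y)) \<xi> = (CLINT y|\<nu>. iexp (\<xi> \<bullet> (flow L t x + y)))"
      by (rule cf_distr) measurable
    also have "\<dots> = iexp (\<xi> \<bullet> flow L t x) * cf \<nu> \<xi>"
      by (simp add: cf_def inner_add_right distrib_left exp_add)
    finally show "cf (distr P borel (Y t)) \<xi> = cf (distr \<nu> borel (\<lambda>y. flow L t x + y)) \<xi>"
      using linear_sde_cf[OF W Y L adjoint_linear[OF L] _ \<sigma> diss t, of \<xi>] noise_cf[OF n, of \<xi>]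
      by (simp add: adjoint_works[OF L] adjoint_flow[OF L])
  qed simp_all
  then have "(\<integral>z. \<phi> z \<partial>distr P borel (Y t)) = (\<integral>z. \<phi> z \<partial>distr \<nu> borel (\<lambda>y. flow L t x + y))" by simp
  then show ?thesis
    using \<phi> by (simp add: mehler_def integral_distr)
qed

lemma additive_sde_solution_linear_image:
  fixes b :: "'a::euclidean_space \<Rightarrow> 'a" and \<Phi> :: "'a \<Rightarrow> 'c::euclidean_space"
  assumes X: "additive_sde_solution P W b \<sigma> x X" and \<Phi>: "linear \<Phi>" and b: "continuous_on UNIV b"
    and b': "\<And>y. \<Phi> (b y) = b' (\<Phi> y)" and \<sigma>': "\<And>w. \<Phi> (\<sigma> w) = \<sigma>' w"
  shows "additive_sde_solution P W b' \<sigma>' (\<Phi> x) (\<lambda>t \<omega>. \<Phi> (X t \<omega>))"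
proof -
  have bl: "bounded_linear \<Phi>" using \<Phi> by (simp add: linear_conv_bounded_linear)
  note [measurable] = borel_measurable_linear[OF \<Phi>]
  have m: "X t \<in> borel_measurable P" if "0 \<le> t" for t using X that by (simp add: additive_sde_solution_def)
  have "AE \<omega> in P. continuous_on {0..} (\<lambda>t. X t \<omega>) \<and>
      (\<forall>t\<ge>0. X t \<omega> = x + integral {0..t} (\<lambda>s. b (X s \<omega>)) + \<sigma> (W t \<omega>))"
    using X by (simp add: additive_sde_solution_def)
  then have "AE \<omega> in P. continuous_on {0..} (\<lambda>t. \<Phi> (X t \<omega>)) \<and>
      (\<forall>t\<ge>0. \<Phi> (X t \<omega>) = \<Phi> x + integral {0..t} (\<lambda>s. b' (\<Phi> (X s \<omega>))) + \<sigma>' (W t \<omega>))"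
  proof eventually_elim
    fix \<omega>
    assume *: "continuous_on {0..} (\<lambda>t. X t \<omega>) \<and>
      (\<forall>t\<ge>0. X t \<omega> = x + integral {0..t} (\<lambda>s. b (X s \<omega>)) + \<sigma> (W t \<omega>))"
    have "\<Phi> (X t \<omega>) = \<Phi> x + integral {0..t} (\<lambda>s. b' (\<Phi> (X s \<omega>))) + \<sigma>' (W t \<omega>)" if t: "0 \<le> t" for t
    proof -
      have "continuous_on {0..t} (\<lambda>s. b (X s \<omega>))"
        using * by (intro continuous_on_compose2[OF b, of "{0..t}" "\<lambda>s. X s \<omega>"]) (auto intro: continuous_on_subset)
      then have "(\<lambda>s. b (X s \<omega>)) integrable_on {0..t}" by (rule integrable_continuous_real)
      from integral_linear[OF this bl]
      have "\<Phi> (integral {0..t} (\<lambda>s. b (X s \<omega>))) = integral {0..t} (\<lambda>s. b' (\<Phi> (X s \<omega>)))"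
        by (simp add: o_def b')
      moreover have "X t \<omega> = x + integral {0..t} (\<lambda>s. b (X s \<omega>)) + \<sigma> (W t \<omega>)" using * t by blast
      ultimately show ?thesis by (simp add: linear_add[OF \<Phi>] \<sigma>')
    qed
    moreover have "continuous_on {0..} (\<lambda>t. \<Phi> (X t \<omega>))"
      using * linear_continuous_on[OF bl, of UNIV] by (auto intro: continuous_on_compose2)
    ultimately show "continuous_on {0..} (\<lambda>t. \<Phi> (X t \<omega>)) \<and>
      (\<forall>t\<ge>0. \<Phi> (X t \<omega>) = \<Phi> x + integral {0..t} (\<lambda>s. b' (\<Phi> (X s \<omega>))) + \<sigma>' (W t \<omega>))" by blast
  qed
  moreover have "(\<lambda>\<omega>. \<Phi> (X t \<omega>)) \<in> borel_measurable P" if "0 \<le> t" for t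
    using m[OF that] by measurable
  ultimately show ?thesis by (simp add: additive_sde_solution_def)
qed

text \<open>The solution started at zero is pure noise; its law supplies the measure required by
  Mehler's formula, so no degenerate Gaussian has to be constructed by hand.\<close>

lemma gauss_noise_linear_sde:
  fixes L :: "'a::euclidean_space \<Rightarrow> 'a" and \<sigma> :: "real^'n \<Rightarrow> 'a"
  assumes W: "standard_brownian_motion P W" and Y: "additive_sde_solution P W L \<sigma> 0 Y"
    and L: "linear L" and \<sigma>: "linear \<sigma>"
    and diss: "\<And>z. 2 * (adjoint L z \<bullet> z) = - (adjoint \<sigma> z \<bullet> adjoint \<sigma> z)"
    and t: "0 \<le> t"
  shows "gauss_noise (flow L t) (distr P borel (Y t))"
proof -
  interpret P: prob_space P using W by (simp add: standard_brownian_motion_def)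
  have "Y t \<in> borel_measurable P" using Y t by (simp add: additive_sde_solution_def)
  then have "prob_space (distr P borel (Y t))" by (rule P.prob_space_distr)
  then show ?thesis
    using linear_sde_cf[OF W Y L adjoint_linear[OF L] _ \<sigma> diss t]
    by (simp add: gauss_noise_def linear_flow linear_0[OF linear_flow] adjoint_works[OF L] adjoint_flow[OF L])
qed

lemma mehler_l2_inner_one:
  fixes x :: "'a::euclidean_space l2"
  assumes n: "gauss_noise K \<nu>"
  shows "inner (mehler_l2 K \<nu> x) one_l2 = inner x one_l2"
proof (rule bounded_linear_eq_on_trig[where A="\<lambda>x. inner (mehler_l2 K \<nu> x) one_l2" and B="\<lambda>x. inner x one_l2"])
  show "bounded_linear (\<lambda>x. inner (mehler_l2 K \<nu> x) one_l2)"
    by (rule bounded_linear_compose[OF bounded_linear_inner_left mehler_l2_bounded_linear[OF n]])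
  show "bounded_linear (\<lambda>x::'a l2. inner x one_l2)" by (rule bounded_linear_inner_left)
  fix \<xi> :: 'a
  have "exp (- (\<xi> \<bullet> \<xi> - adjoint K \<xi> \<bullet> adjoint K \<xi>) / 2) * exp (- (adjoint K \<xi> \<bullet> adjoint K \<xi>) / 2) = exp (- (\<xi> \<bullet> \<xi>) / 2)"
    unfolding mult_exp_exp by (rule arg_cong[where f=exp]) (simp add: field_simps)
  then show "inner (mehler_l2 K \<nu> (cos_l2 \<xi>)) one_l2 = inner (cos_l2 \<xi>) one_l2"
    by (simp only: mehler_l2_trig(1)[OF n] inner_trig_one inner_scaleR_left)
  show "inner (mehler_l2 K \<nu> (sin_l2 \<xi>)) one_l2 = inner (sin_l2 \<xi>) one_l2"
    by (simp only: mehler_l2_trig(2)[OF n] inner_trig_one inner_scaleR_left mult_zero_right)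
qed

locale twisted_ou =
  fixes L C :: "'a::euclidean_space \<Rightarrow> 'a" and \<nu> :: "real \<Rightarrow> 'a measure" and t0 :: real
  assumes L: "linear L" and C: "skew C" and comm: "C (L x) = L (C x)"
    and noise: "0 \<le> t \<Longrightarrow> gauss_noise (flow L t) (\<nu> t)"
    and t0: "0 < t0" and trace: "(\<Sum>b\<in>Basis. flow L t0 b \<bullet> flow L t0 b) < 1"
begin

lemma noise_twisted: "0 \<le> t \<Longrightarrow> gauss_noise (\<lambda>x. flow L t (flow C s x)) (\<nu> t)"
  by (rule gauss_noise_flow_skew[OF noise C])

lemma flow_commute: "flow L t (flow C s x) = flow C s (flow L t x)"
  using flow_intertwine[OF skew_linear[OF C] skew_linear[OF C] linear_flow, of L t s x]
    flow_intertwine[OF L L skew_linear[OF C] comm, symmetric] by simp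

lemma rot_mehler: "0 \<le> t \<Longrightarrow> rot C s (mehler_l2 (flow L t) (\<nu> t) x) = mehler_l2 (\<lambda>x. flow L t (flow C s x)) (\<nu> t) x"
  unfolding rot_def by (rule mehler_l2_compose[OF gauss_noise_rot[OF C] noise noise_twisted])

lemma mehler_rot_commute:
  assumes "0 \<le> t"
  shows "mehler_l2 (flow L t) (\<nu> t) (rot C s x) = rot C s (mehler_l2 (flow L t) (\<nu> t) x)"
proof -
  have "gauss_noise (\<lambda>x. flow C s (flow L t x)) (\<nu> t)" using noise_twisted[OF assms] by (simp add: flow_commute)
  from mehler_l2_compose[OF noise[OF assms] gauss_noise_rot[OF C] this]
  show ?thesis unfolding rot_mehler[OF assms] by (simp add: rot_def flow_commute)
qed

sublocale twisted_semigroup "rot C" "\<lambda>t. mehler_l2 (flow L t) (\<nu> t)" one_l2 t0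
  "sqrt (\<Sum>b\<in>Basis. flow L t0 b \<bullet> flow L t0 b)"
proof (intro twisted_semigroup.intro unitary_group_rot[OF C] twisted_semigroup_axioms.intro)
  let ?\<tau> = "\<Sum>b\<in>Basis. flow L t0 b \<bullet> flow L t0 b"
  show "linear (mehler_l2 (flow L t) (\<nu> t))" if "0 \<le> t" for t by (rule mehler_l2_linear[OF noise[OF that]])
  show "norm (mehler_l2 (flow L t) (\<nu> t) x) \<le> norm x" if "0 \<le> t" for t x by (rule mehler_l2_norm[OF noise[OF that]])
  have bl: "bounded_linear (mehler_l2 (flow L t) (\<nu> t))" if "0 \<le> t" for t
    by (rule mehler_l2_bounded_linear[OF noise[OF that]])
  show "mehler_l2 (flow L 0) (\<nu> 0) x = x" for x
  proof (rule bounded_linear_eq_on_trig)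
    show "bounded_linear (mehler_l2 (flow L 0) (\<nu> 0))" by (rule bl) simp
    show "bounded_linear (\<lambda>x::'a l2. x)" by (rule bounded_linear_ident)
    have "flow L 0 = (\<lambda>x. x)" by auto
    moreover have "adjoint (\<lambda>x::'a. x) = (\<lambda>x. x)" by (rule adjoint_unique) simp
    ultimately show "mehler_l2 (flow L 0) (\<nu> 0) (cos_l2 \<xi>) = cos_l2 \<xi>" "mehler_l2 (flow L 0) (\<nu> 0) (sin_l2 \<xi>) = sin_l2 \<xi>" for \<xi>
      using mehler_l2_trig[OF noise[of 0], of \<xi>] by simp_all
  qed
  show "mehler_l2 (flow L (s + t)) (\<nu> (s + t)) x = mehler_l2 (flow L s) (\<nu> s) (mehler_l2 (flow L t) (\<nu> t) x)"
    if "0 \<le> s" "0 \<le> t" for s t x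
  proof -
    have eq: "(\<lambda>x. flow L t (flow L s x)) = flow L (s + t)" by (simp add: flow_add[symmetric] add.commute fun_eq_iff)
    have "gauss_noise (\<lambda>x. flow L t (flow L s x)) (\<nu> (s + t))" unfolding eq using that by (intro noise) simp
    from mehler_l2_compose[OF noise[OF that(1)] noise[OF that(2)] this] show ?thesis by (simp add: eq)
  qed
  show "mehler_l2 (flow L t) (\<nu> t) (rot C s x) = rot C s (mehler_l2 (flow L t) (\<nu> t) x)" if "0 \<le> t" for t s x
    by (rule mehler_rot_commute[OF that])
  show "continuous_on {0..} (\<lambda>t. rot C (\<mu> * t) (mehler_l2 (flow L t) (\<nu> t) x))" for \<mu> x
  proof -
    \<comment> \<open>The twisted operators are Mehler operators of the combined flow, so continuity
      holds although \<open>t\<close> also moves the rotation.\<close>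
    have "continuous_on {0..} (\<lambda>t. mehler_l2 (\<lambda>x. flow L t (flow C (\<mu> * t) x)) (\<nu> t) x)"
    proof (rule mehler_l2_continuous)
      show "continuous_on {0..} (\<lambda>t. adjoint (\<lambda>x. flow L t (flow C (\<mu> * t) x)) \<xi>)" for \<xi>
        by (simp add: adjoint_compose_linear linear_flow adjoint_flow_skew[OF C] adjoint_flow[OF L])
          (intro continuous_intros)
    qed (simp add: noise_twisted)
    then show ?thesis by (rule continuous_on_cong[THEN iffD1, rotated -1]) (auto simp: rot_mehler)
  qed
  show "inner (mehler_l2 (flow L t) (\<nu> t) x) one_l2 = inner x one_l2" if "0 \<le> t" for t x
    by (rule mehler_l2_inner_one[OF noise[OF that]])
  show "mehler_l2 (flow L t) (\<nu> t) one_l2 = one_l2" if "0 \<le> t" for t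
    unfolding one_l2_cos using mehler_l2_trig(1)[OF noise[OF that], of 0] linear_0[OF adjoint_linear[OF linear_flow], of L t] by simp
  show "inner (rot C s x) one_l2 = inner x one_l2" for s x
    using rot_inner[OF C, of s x one_l2] by (simp add: rot_one[OF C])
  show "norm one_l2 = 1" by (rule norm_one_l2)
  show "0 < t0" by (rule t0)
  show "0 \<le> sqrt ?\<tau>" by (simp add: sum_nonneg)
  show "sqrt ?\<tau> < 1" using trace by simp
  show "norm (mehler_l2 (flow L t0) (\<nu> t0) x) \<le> sqrt ?\<tau> * norm x" if "inner x one_l2 = 0" for x
  proof -
    have "(norm (mehler_l2 (flow L t0) (\<nu> t0) x))\<^sup>2 \<le> ?\<tau> * (norm x)\<^sup>2"
      using mehler_l2_decay[OF noise refl, of t0 x] t0 trace that by simp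
    then have "sqrt ((norm (mehler_l2 (flow L t0) (\<nu> t0) x))\<^sup>2) \<le> sqrt (?\<tau> * (norm x)\<^sup>2)"
      by (rule real_sqrt_le_mono)
    then show ?thesis by (simp add: real_sqrt_mult)
  qed
qed

lemma G_mehler:
  assumes t: "0 \<le> t"
  shows "gauss_noise (flow (\<lambda>x. L x + \<mu> *\<^sub>R C x) t) (\<nu> t)"
    "G \<mu> t x = mehler_l2 (flow (\<lambda>x. L x + \<mu> *\<^sub>R C x) t) (\<nu> t) x"
proof -
  have eq: "flow (\<lambda>x. L x + \<mu> *\<^sub>R C x) t = (\<lambda>x. flow L t (flow C (\<mu> * t) x))"
    by (rule ext) (rule flow_add_commuting[OF L skew_linear[OF C] comm t])
  show "gauss_noise (flow (\<lambda>x. L x + \<mu> *\<^sub>R C x) t) (\<nu> t)"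
    unfolding eq by (rule noise_twisted[OF t])
  show "G \<mu> t x = mehler_l2 (flow (\<lambda>x. L x + \<mu> *\<^sub>R C x) t) (\<nu> t) x"
    unfolding eq G_def by (rule rot_mehler[OF t])
qed

end

subsection \<open>Exponential decay of the damped oscillator\<close>

text \<open>A modified energy: the cross term \<open>\<epsilon> * (q s \<bullet> p s)\<close>
  transfers the damping of \<open>p\<close> to \<open>q\<close>. The choice of \<epsilon> secures
  \<open>\<epsilon> \<le> 1\<close>, which puts \<open>H\<close> between \<open>N / 2\<close> and
  \<open>3 / 2 * N\<close>, as well as
  \<open>\<epsilon> * (3 + \<gamma>\<^sup>2) \<le> 4 * \<gamma>\<close>, which gives
  \<open>H' s \<le> - (\<epsilon> / 2) * N s\<close>. The factor 3 is the ratio of the two bounds on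
  \<open>H\<close>.\<close>

lemma oscillator_decay:
  fixes q p :: "real \<Rightarrow> 'a::real_inner"
  assumes \<gamma>: "0 < \<gamma>" and \<epsilon>: "\<epsilon> = 4 * \<gamma> / (4 + \<gamma>\<^sup>2)" and t: "0 \<le> t"
    and q: "\<And>s. (q has_vector_derivative p s) (at s)"
    and p: "\<And>s. (p has_vector_derivative (- q s - \<gamma> *\<^sub>R p s)) (at s)"
  shows "q t \<bullet> q t + p t \<bullet> p t \<le> 3 * exp (- (\<epsilon> / 3) * t) * (q 0 \<bullet> q 0 + p 0 \<bullet> p 0)"
proof -
  define N where "N s = q s \<bullet> q s + p s \<bullet> p s" for s
  define H where "H s = N s + \<epsilon> * (q s \<bullet> p s)" for s
  have pos: "0 < 4 + \<gamma>\<^sup>2" by (smt (verit) zero_le_power2)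
  have "(\<gamma> - 2)\<^sup>2 \<ge> 0" by simp
  then have "4 * \<gamma> \<le> 4 + \<gamma>\<^sup>2" by (simp add: power2_eq_square algebra_simps)
  then have \<epsilon>1: "0 < \<epsilon>" "\<epsilon> \<le> 1"
    using pos \<gamma> by (simp_all add: \<epsilon> pos_divide_le_eq)
  have "\<epsilon> * (3 + \<gamma>\<^sup>2) \<le> \<epsilon> * (4 + \<gamma>\<^sup>2)" using \<epsilon>1(1) by (intro mult_left_mono) auto
  also have "\<dots> = 4 * \<gamma>" using pos by (simp add: \<epsilon>)
  finally have \<epsilon>2: "\<epsilon> * (3 + \<gamma>\<^sup>2) \<le> 4 * \<gamma>" .
  have cross: "\<bar>q s \<bullet> p s\<bar> \<le> N s / 2" for s
    using inner_ge_zero[of "q s - p s"] inner_ge_zero[of "q s + p s"]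
    by (simp add: N_def inner_diff_left inner_diff_right inner_add_left inner_add_right inner_commute[of "p s" "q s"])
  have N0: "0 \<le> N s" for s by (simp add: N_def)
  have eq: "\<bar>\<epsilon> * (q s \<bullet> p s)\<bar> \<le> N s / 2" for s
    using mult_mono[of \<epsilon> 1 "\<bar>q s \<bullet> p s\<bar>" "N s / 2"] \<epsilon>1 cross[of s] by (simp add: abs_mult)
  have H: "N s / 2 \<le> H s" "H s \<le> 3 / 2 * N s" for s using eq[of s] unfolding H_def by linarith+
  have ip: "((\<lambda>s. f s \<bullet> g s) has_real_derivative (f s \<bullet> g' + f' \<bullet> g s)) (at s)"
    if "(f has_vector_derivative f') (at s)" "(g has_vector_derivative g') (at s)" for f g :: "real \<Rightarrow> 'a" and f' g' s
    using bounded_bilinear.has_vector_derivative[OF bounded_bilinear_inner that]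
    by (simp add: has_real_derivative_iff_has_vector_derivative)
  define H' where "H' s = 2 * (q s \<bullet> p s) + 2 * (p s \<bullet> (- q s - \<gamma> *\<^sub>R p s)) + \<epsilon> * (q s \<bullet> (- q s - \<gamma> *\<^sub>R p s) + p s \<bullet> p s)" for s
  have dH: "(H has_real_derivative H' s) (at s)" for s
    unfolding H_def N_def H'_def
    by (rule derivative_eq_intros ip[OF q q] ip[OF p p] ip[OF q p] refl)+ (simp add: inner_commute)
  have H': "H' s \<le> - (\<epsilon> / 3) * H s" for s
  proof -
    have "0 \<le> (q s + \<gamma> *\<^sub>R p s) \<bullet> (q s + \<gamma> *\<^sub>R p s)" by simp
    then have "- (\<gamma> * (q s \<bullet> p s)) \<le> (q s \<bullet> q s) / 2 + \<gamma>\<^sup>2 * (p s \<bullet> p s) / 2"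
      by (simp add: inner_add_left inner_add_right inner_commute[of "p s" "q s"] power2_eq_square algebra_simps)
    from mult_left_mono[OF this, of \<epsilon>]
    have a: "- (\<epsilon> * \<gamma> * (q s \<bullet> p s)) \<le> \<epsilon> * (q s \<bullet> q s) / 2 + \<epsilon> * \<gamma>\<^sup>2 * (p s \<bullet> p s) / 2"
      using \<epsilon>1 by (simp add: algebra_simps)
    have b: "\<epsilon> * (3 + \<gamma>\<^sup>2) * (p s \<bullet> p s) \<le> 4 * \<gamma> * (p s \<bullet> p s)"
      by (rule mult_right_mono[OF \<epsilon>2]) simp
    have "H' s \<le> - (\<epsilon> / 2) * N s"
      using a b unfolding H'_def N_def by (simp add: inner_diff_right inner_commute[of "p s" "q s"] algebra_simps)
    also have "\<dots> \<le> - (\<epsilon> / 3) * H s"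
      using mult_left_mono[OF H(2)[of s], of \<epsilon>] \<epsilon>1 by (simp add: field_simps)
    finally show ?thesis .
  qed
  have le: "exp (\<epsilon> / 3 * s) * (H' s + \<epsilon> / 3 * H s) \<le> 0" for s
    by (rule mult_nonneg_nonpos) (use H'[of s] in auto)
  have "((\<lambda>s. exp (\<epsilon> / 3 * s) * H s) has_real_derivative exp (\<epsilon> / 3 * s) * (H' s + \<epsilon> / 3 * H s)) (at s)" for s
    by (auto intro!: derivative_eq_intros dH simp: algebra_simps)
  with le have nonpos: "\<exists>y. ((\<lambda>s. exp (\<epsilon> / 3 * s) * H s) has_real_derivative y) (at s) \<and> y \<le> 0" for s
    by blast
  have "exp (\<epsilon> / 3 * t) * H t \<le> exp (\<epsilon> / 3 * 0) * H 0"
    by (rule DERIV_nonpos_imp_nonincreasing[OF t]) (use nonpos in blast)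
  then have "H t \<le> exp (- (\<epsilon> / 3) * t) * H 0"
    by (simp add: exp_minus field_simps)
  also have "\<dots> \<le> exp (- (\<epsilon> / 3) * t) * (3 / 2 * N 0)" by (intro mult_left_mono H) simp
  finally show ?thesis using H(1)[of t] by (simp add: N_def algebra_simps)
qed

definition oscillator :: "real \<Rightarrow> 'a::real_vector \<times> 'a \<Rightarrow> 'a \<times> 'a" where
  "oscillator \<gamma> = (\<lambda>(q, p). (p, - q - \<gamma> *\<^sub>R p))"

lemma linear_oscillator: "linear (oscillator \<gamma>)"
  by (rule linearI) (auto simp: oscillator_def algebra_simps)

text \<open>The decay is summed over the basis, so the squared Hilbert--Schmidt norm of the flow
  tends to zero and any late time serves.\<close>

lemma oscillator_trace:
  assumes \<gamma>: "0 < \<gamma>"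
  obtains t0 where "0 < t0"
    "(\<Sum>b\<in>Basis. flow (oscillator \<gamma>) t0 b \<bullet> flow (oscillator \<gamma>) t0 (b :: 'a::euclidean_space \<times> 'a)) < 1"
proof -
  define \<epsilon> where "\<epsilon> = 4 * \<gamma> / (4 + \<gamma>\<^sup>2)"
  have \<epsilon>0: "0 < \<epsilon>" using \<gamma> by (simp add: \<epsilon>_def add_pos_nonneg)
  let ?F = "flow (oscillator \<gamma>) :: real \<Rightarrow> 'a \<times> 'a \<Rightarrow> 'a \<times> 'a"
  have le: "?F t z \<bullet> ?F t z \<le> 3 * exp (- (\<epsilon> / 3) * t) * (z \<bullet> z)" if t: "0 \<le> t" for t z
  proof -
    have d: "((\<lambda>s. ?F s z) has_vector_derivative oscillator \<gamma> (?F s z)) (at s)" for s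
      by (rule flow_has_vector_derivative[OF linear_oscillator])
    have q: "((\<lambda>s. fst (?F s z)) has_vector_derivative snd (?F s z)) (at s)" for s
      using bounded_linear.has_vector_derivative[OF bounded_linear_fst d[of s]]
      by (simp add: oscillator_def case_prod_beta)
    have p: "((\<lambda>s. snd (?F s z)) has_vector_derivative (- fst (?F s z) - \<gamma> *\<^sub>R snd (?F s z))) (at s)" for s
      using bounded_linear.has_vector_derivative[OF bounded_linear_snd d[of s]]
      by (simp add: oscillator_def case_prod_beta)
    show ?thesis
      using oscillator_decay[OF \<gamma> \<epsilon>_def t q p] by (simp add: inner_prod_def)
  qed
  define D where "D = (\<Sum>b\<in>(Basis :: ('a \<times> 'a) set). b \<bullet> b)"
  have "((\<lambda>t. 3 * exp (- (\<epsilon> / 3) * t) * D) \<longlongrightarrow> 0) at_top" using \<epsilon>0 by real_asymp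
  then have "\<forall>\<^sub>F t in at_top. 3 * exp (- (\<epsilon> / 3) * t) * D < 1" by (rule order_tendstoD) simp
  then have "\<forall>\<^sub>F t in at_top. 0 < t \<and> 3 * exp (- (\<epsilon> / 3) * t) * D < 1"
    using eventually_gt_at_top[of "0::real"] by eventually_elim auto
  then obtain t0 where t0: "0 < t0" "3 * exp (- (\<epsilon> / 3) * t0) * D < 1"
    using eventually_happens[of _ "at_top :: real filter"] by auto
  have "(\<Sum>b\<in>Basis. ?F t0 b \<bullet> ?F t0 b) \<le> (\<Sum>b\<in>(Basis :: ('a \<times> 'a) set). 3 * exp (- (\<epsilon> / 3) * t0) * (b \<bullet> b))"
    by (rule sum_mono, rule le) (use t0(1) in simp)
  also have "\<dots> < 1" using t0(2) by (simp add: D_def sum_distrib_left mult_ac)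
  finally show ?thesis using that t0(1) by blast
qed

subsection \<open>The asymptotic variance in normalised coordinates\<close>

text \<open>\<open>\<Psi>\<close> passes from normalised to physical coordinates,
  \<open>\<Phi>\<close> goes back, and \<open>T\<close> is the position part of
  \<open>\<Psi>\<close>. The process enters only through \<open>law\<close>.\<close>

locale kinetic_ou = twisted_ou L C \<nu> t0
  for L C :: "'q::euclidean_space \<times> 'q \<Rightarrow> 'q \<times> 'q" and \<nu> t0 +
  fixes \<Phi> \<Psi> :: "'q \<times> 'q \<Rightarrow> 'q \<times> 'q" and T T' :: "'q \<Rightarrow> 'q" and \<pi> \<kappa> :: "'q measure"
    and P :: "'w measure" and X :: "real \<Rightarrow> 'q \<times> 'q \<Rightarrow> real \<Rightarrow> 'w \<Rightarrow> 'q \<times> 'q"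
  assumes \<Phi>: "linear \<Phi>" and \<Psi>: "linear \<Psi>" and \<Psi>\<Phi>: "\<Psi> (\<Phi> z) = z" and \<Phi>\<Psi>: "\<Phi> (\<Psi> z) = z"
    and pair: "\<pi> \<Otimes>\<^sub>M \<kappa> = distr gauss borel \<Psi>"
    and T: "linear T" and T': "linear T'" and TT': "T (T' q) = q" and \<pi>: "\<pi> = distr gauss borel T"
    and fst_\<Psi>: "fst (\<Psi> z) = T (fst z)"
    and law: "0 \<le> t \<Longrightarrow> \<phi> \<in> borel_measurable borel \<Longrightarrow> (\<integral>\<omega>. \<phi> (X \<mu> z t \<omega>) \<partial>P)
      = mehler (flow (\<lambda>x. L x + \<mu> *\<^sub>R C x) t) (\<nu> t) (\<lambda>x. \<phi> (\<Psi> x)) (\<Phi> z)"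
begin

lemmas pair_image = image_L2_iff[OF \<Psi> \<Phi> \<Psi>\<Phi> pair] image_integral[OF \<Psi> \<Phi> \<Psi>\<Phi> pair]
  image_inner[OF \<Psi> \<Phi> \<Psi>\<Phi> pair] image_tendsto_iff[OF \<Psi> \<Phi> \<Psi>\<Phi> pair]

text \<open>On a concrete function \<open>u\<close> the Markov semigroup is a pointwise Mehler
  average, so after pulling back by \<open>\<Psi>\<close> the defining limit becomes the derivative
  of \<open>G\<close> at time zero on classes.\<close>

lemma generator_maps_iff:
  "generator_maps (\<pi> \<Otimes>\<^sub>M \<kappa>) (markov_semigroup P (X \<mu>)) u \<psi> \<longleftrightarrow>
    u \<in> L2 (\<pi> \<Otimes>\<^sub>M \<kappa>) \<and> \<psi> \<in> L2 (\<pi> \<Otimes>\<^sub>M \<kappa>) \<and>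
    ((\<lambda>t. (1 / t) *\<^sub>R (G \<mu> t (cls (\<lambda>x. u (\<Psi> x))) - cls (\<lambda>x. u (\<Psi> x)))) \<longlongrightarrow> cls (\<lambda>x. \<psi> (\<Psi> x))) (at_right 0)"
proof (cases "u \<in> L2 (\<pi> \<Otimes>\<^sub>M \<kappa>)")
  case True
  let ?u = "\<lambda>x. u (\<Psi> x)"
  have u: "?u \<in> L2 gauss" using True by (simp add: pair_image(1))
  have um: "u \<in> borel_measurable borel" using L2_measurable[OF True] by (simp add: pair)
  let ?D = "\<lambda>t x. (markov_semigroup P (X \<mu>) t u x - u x) / t"
  have D: "(\<lambda>x. ?D t (\<Psi> x)) \<in> L2 gauss \<and> cls (\<lambda>x. ?D t (\<Psi> x)) = (1 / t) *\<^sub>R (G \<mu> t (cls ?u) - cls ?u)"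
    if t: "0 < t" for t
  proof -
    let ?F = "flow (\<lambda>x. L x + \<mu> *\<^sub>R C x) t"
    from t have t': "0 \<le> t" by simp
    note n = G_mehler(1)[OF t', of \<mu>]
    have m: "mehler ?F (\<nu> t) ?u \<in> L2 gauss" by (rule mehler_L2(1)[OF n u])
    have eq: "(\<lambda>x. ?D t (\<Psi> x)) = (\<lambda>x. (1 / t) * (mehler ?F (\<nu> t) ?u x - ?u x))"
      by (simp add: markov_semigroup_def law[OF t' um] \<Phi>\<Psi>)
    note d = L2_diff[OF m u]
    show ?thesis
      unfolding eq G_mehler(2)[OF t'] mehler_l2_cls[OF n u] cls_scale[OF d] cls_diff[OF m u]
      by (intro conjI refl L2_scale[OF d])
  qed
  have pos: "\<forall>\<^sub>F t in at_right 0. (0::real) < t" by (rule eventually_at_right_less)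
  then have ev: "\<forall>\<^sub>F t in at_right 0. ?D t \<in> L2 (\<pi> \<Otimes>\<^sub>M \<kappa>)"
    by eventually_elim (use D in \<open>simp add: pair_image(1)\<close>)
  have "\<forall>\<^sub>F t in at_right 0. cls (\<lambda>x. ?D t (\<Psi> x)) = (1 / t) *\<^sub>R (G \<mu> t (cls ?u) - cls ?u)"
    using pos by eventually_elim (use D in blast)
  from tendsto_cong[OF this] show ?thesis
    using True ev by (simp add: generator_maps_def pair_image(4))
qed (simp add: generator_maps_def)

lemma asymptotic_variance_eq:
  assumes f: "f \<in> L2 \<pi>"
  defines "x \<equiv> lift_fst (cls (\<lambda>q. f (T q)))"
  shows "asymptotic_variance \<pi> \<kappa> (markov_semigroup P (X \<mu>)) f = inner (R \<mu> x) (P0 x)"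
proof -
  have fT: "(\<lambda>q. f (T q)) \<in> L2 gauss" using f image_L2_iff[OF T T' TT' \<pi>] by simp
  let ?c = "\<integral>q. f q \<partial>\<pi>"
  have c: "?c = inner x one_l2"
    using image_integral[OF T T' TT' \<pi> f] by (simp add: x_def lift_fst_inner_one)
  have cen: "(case \<Psi> z of (q, p) \<Rightarrow> centred \<pi> f q) = f (T (fst z)) - ?c * 1" for z
    by (cases "\<Psi> z") (simp add: centred_def fst_\<Psi>[symmetric])
  have fst: "(\<lambda>z::'q \<times> 'q. f (T (fst z))) \<in> L2 gauss" by (rule fst_L2(1)[OF fT])
  have one: "(\<lambda>z::'q \<times> 'q. ?c * 1) \<in> L2 gauss" by (intro L2_scale one_L2)
  have fin: "(\<lambda>(q, p). centred \<pi> f q) \<in> L2 (\<pi> \<Otimes>\<^sub>M \<kappa>)" "(\<lambda>(q, p). - centred \<pi> f q) \<in> L2 (\<pi> \<Otimes>\<^sub>M \<kappa>)"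
    and cls: "cls (\<lambda>z. case \<Psi> z of (q, p) \<Rightarrow> centred \<pi> f q) = P0 x"
      "cls (\<lambda>z. case \<Psi> z of (q, p) \<Rightarrow> - centred \<pi> f q) = - P0 x"
  proof -
    have L: "(\<lambda>z::'q \<times> 'q. f (T (fst z)) - ?c * 1) \<in> L2 gauss" by (rule L2_diff[OF fst one])
    have neg: "(\<lambda>z. case \<Psi> z of (q, p) \<Rightarrow> - centred \<pi> f q) = (\<lambda>z. - (f (T (fst z)) - ?c * 1))"
      unfolding cen[symmetric] by (auto split: prod.split)
    show "(\<lambda>(q, p). centred \<pi> f q) \<in> L2 (\<pi> \<Otimes>\<^sub>M \<kappa>)" unfolding pair_image(1) cen by (rule L)
    show "(\<lambda>(q, p). - centred \<pi> f q) \<in> L2 (\<pi> \<Otimes>\<^sub>M \<kappa>)"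
      unfolding pair_image(1) neg using L2_scale[OF L, of "-1"] by simp
    have "cls (\<lambda>z::'q \<times> 'q. f (T (fst z)) - ?c * 1) = cls (\<lambda>z. f (T (fst z))) - cls (\<lambda>z. ?c * 1)"
      by (rule cls_diff[OF fst one, symmetric])
    also have "cls (\<lambda>z::'q \<times> 'q. ?c * 1) = ?c *\<^sub>R one_l2"
      unfolding one_l2_def by (rule cls_scale[OF one_L2, symmetric])
    also have "cls (\<lambda>z::'q \<times> 'q. f (T (fst z))) = x"
      unfolding x_def by (rule lift_fst_cls[OF fT, symmetric])
    finally have eq: "cls (\<lambda>z::'q \<times> 'q. f (T (fst z)) - ?c * 1) = P0 x"
      by (simp only: P0_def c)
    then show "cls (\<lambda>z. case \<Psi> z of (q, p) \<Rightarrow> centred \<pi> f q) = P0 x" unfolding cen .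
    show "cls (\<lambda>z. case \<Psi> z of (q, p) \<Rightarrow> - centred \<pi> f q) = - P0 x"
      unfolding neg eq[symmetric] cls_minus[OF L] ..
  qed
  show ?thesis
    unfolding asymptotic_variance_def
  proof (rule the_equality)
    \<comment> \<open>Existence: a representative of the abstract solution, read in physical
      coordinates. Uniqueness of the value follows because the class of any solution is
      \<open>R \<mu> x\<close>.\<close>
    let ?u = "\<lambda>z. rpr (R \<mu> x) (\<Phi> z)"
    have u: "?u \<in> L2 (\<pi> \<Otimes>\<^sub>M \<kappa>)" by (simp add: pair_image(1) \<Phi>\<Psi> rpr_L2)
    have "poisson_solution \<pi> \<kappa> (markov_semigroup P (X \<mu>)) f ?u"
      using u fin(2) R_generator[of \<mu> x]
      by (simp add: poisson_solution_def generator_maps_iff cls \<Phi>\<Psi> cls_rpr pair_image(2) R_e)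
    moreover have "inner (R \<mu> x) (P0 x) = L2_inner (\<pi> \<Otimes>\<^sub>M \<kappa>) ?u (\<lambda>(q, p). centred \<pi> f q)"
      using u fin(1) by (simp add: pair_image(3) cls \<Phi>\<Psi> cls_rpr)
    ultimately show "\<exists>u. poisson_solution \<pi> \<kappa> (markov_semigroup P (X \<mu>)) f u \<and>
      inner (R \<mu> x) (P0 x) = L2_inner (\<pi> \<Otimes>\<^sub>M \<kappa>) u (\<lambda>(q, p). centred \<pi> f q)" by blast
  next
    fix v assume "\<exists>u. poisson_solution \<pi> \<kappa> (markov_semigroup P (X \<mu>)) f u \<and>
      v = L2_inner (\<pi> \<Otimes>\<^sub>M \<kappa>) u (\<lambda>(q, p). centred \<pi> f q)"
    then obtain u where u: "poisson_solution \<pi> \<kappa> (markov_semigroup P (X \<mu>)) f u"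
      and v: "v = L2_inner (\<pi> \<Otimes>\<^sub>M \<kappa>) u (\<lambda>(q, p). centred \<pi> f q)" by blast
    have uL: "u \<in> L2 (\<pi> \<Otimes>\<^sub>M \<kappa>)" using u by (simp add: poisson_solution_def generator_maps_def)
    have "cls (\<lambda>z. u (\<Psi> z)) = R \<mu> x"
      using u by (intro R_generator_unique)
        (simp_all add: poisson_solution_def generator_maps_iff cls pair_image(2)[OF uL])
    then show "v = inner (R \<mu> x) (P0 x)"
      unfolding v pair_image(3)[OF uL fin(1)] by (simp add: cls)
  qed
qed

end

subsection \<open>Projection onto the kernel of the first-order operator\<close>

text \<open>The choice in \<open>L2_projection\<close> needs a witness: the Hilbert space projection
  onto the closed subspace of invariant classes, turned back into a function. The residual is
  orthogonal to that subspace and so lies in the closed span of the coboundaries.\<close>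

lemma projection_closure_kernel:
  fixes T T' :: "real^'n \<Rightarrow> real^'n"
  assumes T: "linear T" "linear T'" "\<And>x. T (T' x) = x" "\<And>x. T' (T x) = x"
    and m: "m = distr gauss borel T" and A: "skew A" and AT: "\<And>x. T (A x) = b (T x)" and f: "f \<in> L2 m"
  defines "g \<equiv> L2_projection m (closure_kernel m (first_order_op b)) f"
  shows "g \<in> L2 m" "cls (\<lambda>x. g (T x)) \<in> unitary_group.Fix (rot A)"
    "cls (\<lambda>x. f (T x)) - cls (\<lambda>x. g (T x)) \<in> closure (span (unitary_group.cobound (rot A)))"
proof -
  interpret U: unitary_group "rot A" by (rule unitary_group_rot[OF A])
  let ?K = "closure_kernel m (first_order_op b)"
  note L2 = image_L2_iff[OF T(1,2,3) m]
  have K: "k \<in> ?K \<longleftrightarrow> k \<in> L2 m \<and> cls (\<lambda>x. k (T x)) \<in> U.Fix" for k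
  proof -
    have "k \<in> L2 m" if "k \<in> ?K" using that by (auto simp: closure_kernel_def closure_maps_def L2_tendsto_def)
    then show ?thesis
      using closure_kernel_image[OF T m A AT] closure_kernel_gauss[OF A, of "\<lambda>x. k (T x)"] L2[of k] by blast
  qed
  have rprK: "(\<lambda>x. rpr y (T' x)) \<in> ?K" "cls (\<lambda>x. rpr y (T' (T x))) = y" if "y \<in> U.Fix" for y
    using that by (simp_all add: K L2 T(4) rpr_L2 cls_rpr)
  have inn: "L2_inner m (\<lambda>x. f x - h x) k = inner (cls (\<lambda>x. f (T x)) - cls (\<lambda>x. h (T x))) (cls (\<lambda>x. k (T x)))"
    if "h \<in> L2 m" "k \<in> L2 m" for h k
    using image_inner[OF T(1,2,3) m L2_diff[OF f that(1)] that(2)] that f by (simp add: cls_diff L2)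
  obtain p where p: "p \<in> U.Fix" "\<And>k. k \<in> U.Fix \<Longrightarrow> inner (cls (\<lambda>x. f (T x)) - p) k = 0"
    using closed_subspace_projection[OF U.subspace_Fix U.closed_Fix] by blast
  have "\<exists>g. g \<in> ?K \<and> (\<forall>h\<in>?K. L2_inner m (\<lambda>x. f x - g x) h = 0)"
    using rprK[OF p(1)] p(2) by (intro exI[of _ "\<lambda>x. rpr p (T' x)"]) (auto simp: inn K)
  from someI_ex[OF this] have g: "g \<in> ?K" "\<And>h. h \<in> ?K \<Longrightarrow> L2_inner m (\<lambda>x. f x - g x) h = 0"
    by (auto simp: g_def L2_projection_def)
  from g(1) show gL: "g \<in> L2 m" and "cls (\<lambda>x. g (T x)) \<in> U.Fix" by (auto simp: K)
  show "cls (\<lambda>x. f (T x)) - cls (\<lambda>x. g (T x)) \<in> closure (span U.cobound)"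
  proof (rule U.orthogonal_Fix_cobound)
    fix y assume y: "y \<in> U.Fix"
    have "(\<lambda>x. rpr y (T' x)) \<in> L2 m" using rprK(1)[OF y] by (simp add: K)
    from inn[OF gL this] g(2)[OF rprK(1)[OF y]] rprK(2)[OF y]
    show "inner (cls (\<lambda>x. f (T x)) - cls (\<lambda>x. g (T x))) y = 0" by simp
  qed
qed

lemma skew_uminus: "skew A \<Longrightarrow> skew (\<lambda>x. - A x)"
  by (auto simp: skew_def linear_compose_neg)

text \<open>Negating the generator only reverses time. This is needed because the drift carries
  \<open>J\<^sub>1\<close> with a minus sign while the operator defining the projection does
  not.\<close>

lemma rot_uminus:
  assumes "skew A"
  shows "unitary_group.Fix (rot (\<lambda>x. - A x)) = unitary_group.Fix (rot A)"
    "unitary_group.cobound (rot (\<lambda>x. - A x)) = unitary_group.cobound (rot A)"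
proof -
  interpret A: unitary_group "rot A" by (rule unitary_group_rot[OF assms])
  interpret B: unitary_group "rot (\<lambda>x. - A x)" by (rule unitary_group_rot[OF skew_uminus[OF assms]])
  have *: "rot (\<lambda>x. - A x) s = rot A (- s)" for s
  proof -
    have "flow (\<lambda>x. - A x) s = flow A (- s)"
      by (rule ext) (rule flow_negate[OF skew_linear[OF assms], symmetric])
    then show ?thesis unfolding rot_def by simp
  qed
  show "B.Fix = A.Fix" unfolding A.Fix_def B.Fix_def * by (metis minus_minus)
  show "B.cobound = A.cobound" unfolding A.cobound_def B.cobound_def * by (metis minus_minus)
qed

theorem corollary5:
  fixes S M \<Gamma> J\<^sub>1 J\<^sub>2 :: "real^'d^'d"
    and \<gamma> :: real
    and V :: "real^'d \<Rightarrow> real"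
    and P :: "'w measure"
    and W :: "real \<Rightarrow> 'w \<Rightarrow> real^'d"
    and X :: "real \<Rightarrow> (real^'d) \<times> (real^'d) \<Rightarrow> real \<Rightarrow> 'w \<Rightarrow> (real^'d) \<times> (real^'d)"
    and \<pi> \<kappa> :: "(real^'d) measure"
    and \<sigma>2 :: "real \<Rightarrow> (real^'d \<Rightarrow> real) \<Rightarrow> real"
    and Proj :: "(real^'d \<Rightarrow> real) \<Rightarrow> real^'d \<Rightarrow> real"
    and f :: "real^'d \<Rightarrow> real"
  assumes S: "sym_pos_def S"
    and J1: "skew_symmetric J\<^sub>1"
    and J2: "skew_symmetric J\<^sub>2"
    and V: "V = (\<lambda>q. 1 / 2 * (q \<bullet> (S *v q)))"
    and M: "M = S"
    and \<Gamma>: "\<Gamma> = \<gamma> *\<^sub>R S"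
    and \<gamma>: "\<gamma> > sqrt 2"
    and SJS: "S ** J\<^sub>1 ** S = J\<^sub>2"
    and W: "standard_brownian_motion P W"
    and X: "\<And>\<mu> x. additive_sde_solution P W
              (langevin_drift M \<Gamma> J\<^sub>1 J\<^sub>2 V \<mu>) (langevin_noise \<Gamma>) x (X \<mu> x)"
    and \<pi>: "\<pi> = gaussian_measure (matrix_inv S)"
    and \<kappa>: "\<kappa> = gaussian_measure M"
    and \<sigma>2: "\<sigma>2 = (\<lambda>\<mu>. asymptotic_variance \<pi> \<kappa> (markov_semigroup P (X \<mu>)))"
    and Proj: "Proj = L2_projection \<pi>
              (closure_kernel \<pi> (first_order_op (\<lambda>q. J\<^sub>1 *v (S *v q))))"
    and f: "f \<in> L2 \<pi>"
  shows "((\<lambda>\<mu>. \<sigma>2 \<mu> f) \<longlongrightarrow> \<sigma>2 0 (Proj f)) at_top \<and> \<sigma>2 0 (Proj f) \<le> \<sigma>2 0 f"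
proof -
  have \<gamma>0: "0 < \<gamma>" using \<gamma> real_sqrt_gt_zero[of 2] by linarith
  obtain Q where Q: "sym_pos_def Q" "Q ** Q = S" using sym_pos_def_sqrt_exists[OF S] by metis
  have Qt: "transpose Q = Q" using Q(1) by (simp add: sym_pos_def_def)
  have "inj ((*v) Q)"
  proof (rule injI)
    fix x y assume "Q *v x = Q *v y"
    then have "(x - y) \<bullet> (Q *v (x - y)) = 0" by (simp add: matrix_vector_mult_diff_distrib)
    then have "x - y = 0" using Q(1) unfolding sym_pos_def_def by (metis less_irrefl)
    then show "x = y" by simp
  qed
  then have "invertible Q"
    by (simp add: invertible_left_inverse matrix_left_invertible_injective)
  then obtain K where K: "Q ** K = mat 1" "K ** Q = mat 1" by (auto simp: invertible_def)
  have invQ: "invertible Q" "invertible K" using K by (auto simp: invertible_def)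
  have Rt: "transpose K = K"
  proof -
    have "transpose K = transpose K ** (Q ** K)" by (simp add: K)
    also have "\<dots> = transpose (Q ** K) ** K"
      by (simp add: matrix_transpose_mul Qt matrix_mul_assoc)
    finally show ?thesis by (simp add: K transpose_mat)
  qed
  have QR [simp]: "Q *v (K *v x) = x" "K *v (Q *v x) = x" for x
    by (simp_all add: matrix_vector_mul_assoc K)
  have Sv: "S *v x = Q *v (Q *v x)" for x by (simp add: Q(2)[symmetric] matrix_vector_mul_assoc)
  have invS: "matrix_inv S = K ** K"
  proof (rule matrix_inv_eqI)
    have "Q ** Q ** (K ** K) = Q ** (Q ** K) ** K" by (simp only: matrix_mul_assoc)
    then show "S ** (K ** K) = mat 1" by (simp add: Q(2) K)
    have "K ** K ** (Q ** Q) = K ** (K ** Q) ** Q" by (simp only: matrix_mul_assoc)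
    then show "K ** K ** S = mat 1" by (simp add: Q(2) K)
  qed
  have \<pi>K: "\<pi> = distr gauss borel ((*v) K)"
    using gaussian_measure_matrix[OF invQ(2)] by (simp add: \<pi> invS Rt)
  have \<kappa>Q: "\<kappa> = distr gauss borel ((*v) Q)"
    using gaussian_measure_matrix[OF invQ(1)] by (simp add: \<kappa> M Qt Q(2))
  \<comment> \<open>In the coordinate \<open>Q *v q\<close> the vector field
    \<open>J\<^sub>1 *v (S *v q)\<close> becomes \<open>A\<close>, which is skew because
    \<open>Q\<close> is symmetric.\<close>
  define A where "A x = Q *v (J\<^sub>1 *v (Q *v x))" for x
  have A: "skew A"
    unfolding skew_def
  proof (intro conjI allI)
    show "linear A" unfolding A_def
      by (rule linearI) (simp_all add: matrix_vector_right_distrib matrix_vector_mult_scaleR)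
    have Qi: "(Q *v x) \<bullet> y = x \<bullet> (Q *v y)" for x y by (metis Qt dot_lmul_matrix vector_transpose_matrix)
    have Ji: "(J\<^sub>1 *v x) \<bullet> y = - (x \<bullet> (J\<^sub>1 *v y))" for x y
    proof -
      have "(J\<^sub>1 *v x) \<bullet> y = x \<bullet> (transpose J\<^sub>1 *v y)" by (metis dot_lmul_matrix inner_commute transpose_matrix_vector)
      moreover have "(- J\<^sub>1) *v y = - (J\<^sub>1 *v y)"
        by (simp add: vec_eq_iff matrix_vector_mult_def sum_negf)
      ultimately show ?thesis using J1 by (simp only: skew_symmetric_def inner_minus_right)
    qed
    show "A x \<bullet> y = - (x \<bullet> A y)" for x y by (simp add: A_def Qi Ji)
  qed
  note linA = skew_linear[OF A]
  define \<Phi> where "\<Phi> = (\<lambda>(q::real^'d, p::real^'d). (Q *v q, K *v p))"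
  define \<Psi> where "\<Psi> = (\<lambda>(q::real^'d, p::real^'d). (K *v q, Q *v p))"
  define C where "C = (\<lambda>(q, p). (- A q, - A p))"
  have C: "skew C" unfolding C_def by (rule lift_fst_rot(1)[OF skew_uminus[OF A]])
  define D where "D \<mu> x = oscillator \<gamma> x + \<mu> *\<^sub>R C x" for \<mu> x
  \<comment> \<open>The inverse of \<open>Q\<close> cancels the matrix in \<open>matrix_sqrt (2
    *\<^sub>R \<Gamma>) = sqrt (2 * \<gamma>) *\<^sub>R Q\<close>, so the noise becomes isotropic in
    the momenta.\<close>
  define \<sigma> where "\<sigma> w = (0::real^'d, sqrt (2 * \<gamma>) *\<^sub>R w)" for w :: "real^'d"
  have lin: "linear \<Phi>" "linear \<Psi>" "linear \<sigma>"
    by (auto intro!: linearI simp: \<Phi>_def \<Psi>_def \<sigma>_def matrix_vector_right_distrib matrix_vector_mult_scaleR scaleR_add_right)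
  have linD: "linear (D \<mu>)" for \<mu>
    unfolding D_def by (intro linear_compose_add linear_compose_scale_right linear_oscillator skew_linear[OF C])
  have adj\<sigma>: "adjoint \<sigma> = (\<lambda>(a, b). sqrt (2 * \<gamma>) *\<^sub>R b)"
    by (rule adjoint_unique) (auto simp: \<sigma>_def)
  \<comment> \<open>The skew part does not dissipate, so damping and noise balance for every \<mu>,
    which makes the standard Gaussian invariant throughout.\<close>
  have diss: "2 * (adjoint (D \<mu>) z \<bullet> z) = - (adjoint \<sigma> z \<bullet> adjoint \<sigma> z)" for \<mu> z
  proof -
    have "C z \<bullet> z = 0" using C unfolding skew_def by (metis inner_commute eq_neg_iff_add_eq_0 add_eq_0_iff equation_minus_iff neg_equal_zero)
    then have "D \<mu> z \<bullet> z = oscillator \<gamma> z \<bullet> z" by (simp add: D_def inner_add_left)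
    moreover have "adjoint (D \<mu>) z \<bullet> z = D \<mu> z \<bullet> z"
      by (metis adjoint_works[OF linD] inner_commute)
    moreover obtain a b where z: "z = (a, b)" by (cases z)
    have "oscillator \<gamma> z \<bullet> z = - (\<gamma> * (b \<bullet> b))"
      by (simp add: z oscillator_def inner_diff_left inner_commute[of a b])
    moreover have "adjoint \<sigma> z \<bullet> adjoint \<sigma> z = 2 * \<gamma> * (b \<bullet> b)"
      using \<gamma>0 by (simp add: z adj\<sigma> mult.assoc[symmetric])
    ultimately show ?thesis by simp
  qed
  have gradV: "grad V q = S *v q" for q
  proof (rule grad_eqI)
    have St: "transpose S = S" using S by (simp add: sym_pos_def_def)
    have Si: "h \<bullet> (S *v q) = q \<bullet> (S *v h)" for h by (metis St dot_lmul_matrix vector_transpose_matrix inner_commute)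
    have "(V has_derivative (\<lambda>h. 1 / 2 * (q \<bullet> (S *v h) + h \<bullet> (S *v q)))) (at q)"
      unfolding V by (auto intro!: derivative_eq_intros bounded_linear_imp_has_derivative matrix_vector_mul_bounded_linear)
    then show "GDERIV V q :> S *v q" by (simp add: gderiv_def Si)
  qed
  have drift: "langevin_drift M \<Gamma> J\<^sub>1 J\<^sub>2 V \<mu> (q, p)
    = (K *v (K *v p) - \<mu> *\<^sub>R (J\<^sub>1 *v (S *v q)),
       - (S *v q) - \<mu> *\<^sub>R (S *v (J\<^sub>1 *v p)) - \<gamma> *\<^sub>R p)" for \<mu> q p
  proof -
    have "S *v (K *v (K *v p)) = p" by (simp add: Sv)
    moreover have "J\<^sub>2 *v (K *v (K *v p)) = S *v (J\<^sub>1 *v p)"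
      by (simp add: SJS[symmetric] matrix_vector_mul_assoc[symmetric] Sv)
    ultimately show ?thesis
      by (simp add: langevin_drift_def M \<Gamma> invS gradV matrix_vector_mul_assoc[symmetric] scaleR_matrix_vector_assoc[symmetric])
  qed
  have cont: "continuous_on UNIV (langevin_drift M \<Gamma> J\<^sub>1 J\<^sub>2 V \<mu>)" for \<mu>
  proof -
    have "langevin_drift M \<Gamma> J\<^sub>1 J\<^sub>2 V \<mu> = (\<lambda>z. (K *v (K *v snd z) - \<mu> *\<^sub>R (J\<^sub>1 *v (S *v fst z)),
      - (S *v fst z) - \<mu> *\<^sub>R (S *v (J\<^sub>1 *v snd z)) - \<gamma> *\<^sub>R snd z))"
      by (rule ext) (metis drift prod.collapse)
    then show ?thesis
      by (simp only:) (intro continuous_intros bounded_linear.continuous_on[OF matrix_vector_mul_bounded_linear])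
  qed
  have sqrt\<Gamma>: "matrix_sqrt (2 *\<^sub>R \<Gamma>) = sqrt (2 * \<gamma>) *\<^sub>R Q"
  proof -
    have "sym_pos_def (sqrt (2 * \<gamma>) *\<^sub>R Q)"
      using Q(1) \<gamma>0 by (simp add: sym_pos_def_def scaleR_matrix_vector_assoc[symmetric] transpose_scalar)
    moreover have "(sqrt (2 * \<gamma>) *\<^sub>R Q) ** (sqrt (2 * \<gamma>) *\<^sub>R Q) = 2 *\<^sub>R \<Gamma>"
      using \<gamma>0 by (simp add: matrix_eq \<Gamma> matrix_vector_mul_assoc[symmetric] scaleR_matrix_vector_assoc[symmetric]
          matrix_vector_mult_scaleR Sv)
    ultimately show ?thesis using matrix_sqrt_eqI by metis
  qed
  have sde: "additive_sde_solution P W (D \<mu>) \<sigma> (\<Phi> x) (\<lambda>t \<omega>. \<Phi> (X \<mu> x t \<omega>))" for \<mu> x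
  proof (rule additive_sde_solution_linear_image[OF X lin(1) cont])
    show "\<Phi> (langevin_drift M \<Gamma> J\<^sub>1 J\<^sub>2 V \<mu> y) = D \<mu> (\<Phi> y)" for y
      by (cases y) (simp add: drift \<Phi>_def D_def C_def oscillator_def A_def Sv
          matrix_vector_mult_diff_distrib matrix_vector_mult_scaleR linear_neg[OF matrix_vector_mul_linear])
    show "\<Phi> (langevin_noise \<Gamma> w) = \<sigma> w" for w
      by (simp add: langevin_noise_def sqrt\<Gamma> \<Phi>_def \<sigma>_def scaleR_matrix_vector_assoc[symmetric] matrix_vector_mult_scaleR)
  qed
  \<comment> \<open>The noise law is read off the process at \<mu> = 0 started at the origin and
    reused for all \<mu>.\<close>
  define \<nu> where "\<nu> t = distr P borel (\<lambda>\<omega>. \<Phi> (X 0 0 t \<omega>))" for t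
  have D0: "D 0 = oscillator \<gamma>" by (simp add: D_def fun_eq_iff)
  have noise: "gauss_noise (flow (oscillator \<gamma>) t) (\<nu> t)" if "0 \<le> t" for t
    using gauss_noise_linear_sde[OF W _ linD lin(3) diss that, of 0] sde[of 0 0]
    by (simp add: \<nu>_def D0 linear_0[OF lin(1)])
  obtain t0 where t0: "0 < t0"
    "(\<Sum>b\<in>Basis. flow (oscillator \<gamma>) t0 b \<bullet> flow (oscillator \<gamma>) t0 (b :: (real^'d) \<times> (real^'d))) < 1"
    by (rule oscillator_trace[OF \<gamma>0])
  have ou: "twisted_ou (oscillator \<gamma>) C \<nu> t0"
  proof (rule twisted_ou.intro)
    show "C (oscillator \<gamma> x) = oscillator \<gamma> (C x)" for x
    proof -
      obtain q p where x: "x = (q, p)" by (cases x)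
      have "A (- q - \<gamma> *\<^sub>R p) = - A q - \<gamma> *\<^sub>R A p"
        by (simp only: linear_diff[OF linA] linear_neg[OF linA] linear_scale[OF linA])
      then show ?thesis by (simp add: x C_def oscillator_def)
    qed
  qed (fact linear_oscillator C noise t0)+
  interpret kinetic_ou "oscillator \<gamma>" C \<nu> t0 \<Phi> \<Psi> "(*v) K" "(*v) Q" \<pi> \<kappa> P X
  proof (intro kinetic_ou.intro ou kinetic_ou_axioms.intro)
    show "\<pi> \<Otimes>\<^sub>M \<kappa> = distr gauss borel \<Psi>"
      unfolding \<pi>K \<kappa>Q \<Psi>_def by (rule pair_distr_linear_gauss) simp_all
    show "\<Psi> (\<Phi> z) = z" "\<Phi> (\<Psi> z) = z" "fst (\<Psi> z) = K *v fst z" for z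
      by (cases z; simp add: \<Phi>_def \<Psi>_def)+
    fix t :: real and \<phi> :: "(real^'d) \<times> (real^'d) \<Rightarrow> real" and \<mu> z
    assume t: "0 \<le> t" and [measurable]: "\<phi> \<in> borel_measurable borel"
    note [measurable] = borel_measurable_linear[OF lin(2)]
    have "gauss_noise (flow (D \<mu>) t) (\<nu> t)"
      using twisted_ou.G_mehler(1)[OF ou t] by (simp add: D_def[abs_def])
    from expectation_linear_sde[OF W sde linD lin(3) diss t this, of "\<lambda>x. \<phi> (\<Psi> x)"]
    have "(\<integral>\<omega>. \<phi> (\<Psi> (\<Phi> (X \<mu> z t \<omega>))) \<partial>P) = mehler (flow (D \<mu>) t) (\<nu> t) (\<lambda>x. \<phi> (\<Psi> x)) (\<Phi> z)"
      by simp
    moreover have "\<Psi> (\<Phi> y) = y" for y by (cases y) (simp add: \<Phi>_def \<Psi>_def)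
    ultimately show "(\<integral>\<omega>. \<phi> (X \<mu> z t \<omega>) \<partial>P)
      = mehler (flow (\<lambda>x. oscillator \<gamma> x + \<mu> *\<^sub>R C x) t) (\<nu> t) (\<lambda>x. \<phi> (\<Psi> x)) (\<Phi> z)"
      by (simp add: D_def[abs_def])
  qed (simp_all add: lin \<pi>K)
  have AT: "K *v A x = J\<^sub>1 *v (S *v (K *v x))" for x by (simp add: A_def Sv)
  have Klin: "linear ((*v) K)" "linear ((*v) Q)" by simp_all
  note g = projection_closure_kernel[where b="\<lambda>q. J\<^sub>1 *v (S *v q)", OF Klin QR(2,1) \<pi>K A AT f, folded Proj]
  define x where "x = cls (\<lambda>q. f (K *v q))"
  define y where "y = cls (\<lambda>q. Proj f (K *v q))"
  interpret l: bounded_linear "lift_fst :: (real^'d) l2 \<Rightarrow> _" by (rule lift_fst_bounded_linear)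
  note lf = lift_fst_Fix[OF skew_uminus[OF A], folded C_def, unfolded rot_uminus[OF A]]
  \<comment> \<open>\<open>y\<close> is the class of the projected observable and
    \<open>x - y\<close> its complement; lifting them to phase space supplies the two parts of the
    abstract decomposition.\<close>
  have "lift_fst y \<in> Fix" using g(2) by (intro lf(1)) (simp add: y_def)
  moreover have "lift_fst (x - y) \<in> closure (span cobound)" using g(3) by (intro lf(2)) (simp add: x_def y_def)
  ultimately have lim:
    "((\<lambda>\<mu>. inner (R \<mu> (lift_fst y + lift_fst (x - y))) (P0 (lift_fst y + lift_fst (x - y))))
        \<longlongrightarrow> inner (R 0 (lift_fst y)) (P0 (lift_fst y))) at_top"
    "inner (R 0 (lift_fst y)) (P0 (lift_fst y))
       \<le> inner (R 0 (lift_fst y + lift_fst (x - y))) (P0 (lift_fst y + lift_fst (x - y)))"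
    using R_limit by blast+
  have "lift_fst y + lift_fst (x - y) = lift_fst x" by (simp add: l.add[symmetric])
  moreover have "\<sigma>2 \<mu> f = inner (R \<mu> (lift_fst x)) (P0 (lift_fst x))" for \<mu>
    unfolding \<sigma>2 x_def by (rule asymptotic_variance_eq[OF f])
  moreover have "\<sigma>2 0 (Proj f) = inner (R 0 (lift_fst y)) (P0 (lift_fst y))"
    unfolding \<sigma>2 y_def by (rule asymptotic_variance_eq[OF g(1)])
  ultimately show ?thesis using lim by simp
qed

end
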